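(* Let $(\mathfrak{g},\mathfrak{k})$ be a Hermitian symmetric pair and let $M$ be a unitary module belonging to $\mathcal{O}$. Then there are isomorphisms of $\mathfrak{k}$-modules $$H_D^{\mathfrak{g},\mathfrak{k}}(M)\cong\ker D_{\mathfrak{g},\mathfrak{k}}(M)\cong H^{\cdot}(\mathfrak{p}^+,M)\otimes\mathbb{C}_{\rho-\rho_\mathfrak{k}}\cong H_{\cdot}(\mathfrak{p}^-,M)\otimes\mathbb{C}_{\rho-\rho_\mathfrak{k}},$$ where $H^{\cdot}(\mathfrak{p}^+,M)=\bigoplus_{k\ge0}H^k(\mathfrak{p}^+,M)$ and $H_{\cdot}(\mathfrak{p}^-,M)=\bigoplus_{k\ge0}H_k(\mathfrak{p}^-,M)$ are the nilpotent Lie algebra cohomology and homology with coefficients in $M$.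
   Context: Let $\mathfrak{g}$ be a finite-dimensional complex semisimple Lie algebra with Killing form $\langle\cdot,\cdot\rangle$ and Cartan involution $\theta$; $\mathfrak{g}_0$ is a $\theta$-stable real form with Cartan decomposition $\mathfrak{g}_0=\mathfrak{k}_0\oplus\mathfrak{p}_0$, and $\mathfrak{k}=(\mathfrak{k}_0)^{\mathbb{C}}$, $\mathfrak{p}=(\mathfrak{p}_0)^{\mathbb{C}}$. The pair $(\mathfrak{g},\mathfrak{k})$ is Hermitian symmetric: $\mathfrak{k}$ contains a Cartan subalgebra $\mathfrak{t}$ of $\mathfrak{g}$, and $\mathfrak{g}=\mathfrak{k}\oplus\mathfrak{p}^+\oplus\mathfrak{p}^-$ with $\mathfrak{p}=\mathfrak{p}^+\oplus\mathfrak{p}^-$, where $\mathfrak{p}^\pm$ are $\mathfrak{k}$-stable abelian subalgebras, maximal isotropic and dual to each other under the Killing form, and $\mathfrak{k}\oplus\mathfrak{p}^+$ is a parabolic subalgebra. Fix a positive system $\Delta^+$ of $\Delta(\mathfrak{g},\mathfrak{t})$ with Borel subalgebra $\mathfrak{b}=\mathfrak{t}\oplus\mathfrak{n}$, $\mathfrak{n}=\bigoplus_{\alpha\in\Delta^+}\mathfrak{g}_\alpha$, such that $\mathfrak{b}\subseteq\mathfrak{k}\oplus\mathfrak{p}^+$. $\rho$ and $\rho_\mathfrak{k}$ are the half-sums of $\Delta^+$ and $\Delta^+\cap\Delta(\mathfrak{k},\mathfrak{t})$; $\mathbb{C}_{\rho-\rho_\mathfrak{k}}$ is the one-dimensional $\mathfrak{k}$-module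 of weight $\rho-\rho_\mathfrak{k}$. Category $\mathcal{O}$: finitely generated $U(\mathfrak{g})$-modules which are weight modules for $\mathfrak{t}$ and locally $\mathfrak{n}$-finite. A module $(M,\pi)\in\mathcal{O}$ is unitary if it admits a Hermitian inner product with $\langle\pi(X)u,v\rangle+\langle u,\pi(X)v\rangle=0$ for all $u,v\in M$, $X\in\mathfrak{g}_0$. Spin module and Dirac operator: $\mathbf{C}(\mathfrak{p})$ is the quotient of $T(\mathfrak{p})$ by $X\otimes Y+Y\otimes X=\langle X,Y\rangle$; $S=\bigwedge\mathfrak{p}^-$ with Clifford action $\gamma$ in which $\mathfrak{p}^-$ acts by exterior multiplication and $\mathfrak{p}^+$ by contraction via $\langle\cdot,\cdot\rangle$. For $a,b\in\mathfrak{p}$, $R_{a,b}(v)=\langle b,v\rangle a-\langle a,v\rangle b$ span $\mathfrak{so}(\mathfrak{p})$ and $\varphi(R_{a,b})=\frac12[\gamma(a),\gamma(b)]$ defines an injective Lie algebra map $\mathfrak{so}(\mathfrak{p})\to\mathbf{C}(\mathfrak{p})$; $\mathfrak{k}$ acts on $S$ via $\mathfrak{k}\xrightarrow{\mathrm{ad}}\mathfrak{so}(\mathfrak{p})\xrightarrow{\varphi}\mathbf{C}(\mathfrak{p})\to\mathrm{End}(S)$ and on $M\otimes S$ diagonally. $D_{\mathfrak{g},\mathfrak{k}}(M)=\sum_j\pi(Z_j)\otimes\gamma(Z_j)$ on $M\otimes S$ for any orthonormal basis $\{Z_j\}$ of $\mathfrak{p}$, and $H_D^{\mathfrak{g},\mathfrak{k}}(M)=\ker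 D_{\mathfrak{g},\mathfrak{k}}(M)/(\mathrm{im}\,D_{\mathfrak{g},\mathfrak{k}}(M)\cap\ker D_{\mathfrak{g},\mathfrak{k}}(M))$. Cohomology and homology: $H^k(\mathfrak{p}^+,M)=\ker d^k/\mathrm{im}\,d^{k-1}$, where $d^k:\mathrm{Hom}(\bigwedge^k\mathfrak{p}^+,M)\to\mathrm{Hom}(\bigwedge^{k+1}\mathfrak{p}^+,M)$ is $d^k\omega(X_0\wedge\dots\wedge X_k)=\sum_{i=0}^k(-1)^iX_i\,\omega(X_0\wedge\dots\wedge\widehat{X_i}\wedge\dots\wedge X_k)$. $H_k(\mathfrak{p}^-,M)=\ker\partial^{k-1}/\mathrm{im}\,\partial^k$, where $\partial^k:M\otimes\bigwedge^{k+1}\mathfrak{p}^-\to M\otimes\bigwedge^k\mathfrak{p}^-$ is $\partial^k(v\otimes Y_1\wedge\dots\wedge Y_{k+1})=\sum_{i=1}^{k+1}(-1)^{i+1}Y_iv\otimes Y_1\wedge\dots\wedge\widehat{Y_i}\wedge\dots\wedge Y_{k+1}$. Both carry natural $\mathfrak{k}$-module structures since $d^k,\partial^k$ are $\mathfrak{k}$-equivariant. *)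

theory Defs
  imports Complex_Main "HOL-Library.Poly_Mapping" "HOL-Library.Function_Algebras"
begin

section \<open>Complex vector spaces\<close>

class complex_vector = ab_group_add +
  fixes scaleC :: "complex \<Rightarrow> 'a \<Rightarrow> 'a"  (infixr \<open>*\<^sub>C\<close> 75)
  assumes scaleC_add_right: "c *\<^sub>C (x + y) = c *\<^sub>C x + c *\<^sub>C y"
    and scaleC_add_left: "(c + d) *\<^sub>C x = c *\<^sub>C x + d *\<^sub>C x"
    and scaleC_scaleC: "c *\<^sub>C (d *\<^sub>C x) = (c * d) *\<^sub>C x"
    and scaleC_one: "1 *\<^sub>C x = x"

global_interpretation complex_vector: vector_space "scaleC :: complex \<Rightarrow> 'a \<Rightarrow> 'a::complex_vector"
  defines csubspace = complex_vector.subspace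
    and cspan = complex_vector.span
    and crepresentation = complex_vector.representation
    and cextend_basis = complex_vector.extend_basis
  by unfold_locales (simp_all add: scaleC_add_right scaleC_add_left scaleC_scaleC scaleC_one)

abbreviation clinear :: "('a::complex_vector \<Rightarrow> 'b::complex_vector) \<Rightarrow> bool"
  where "clinear \<equiv> Vector_Spaces.linear scaleC scaleC"

lemma clinear_iff:
  "clinear f \<longleftrightarrow> (\<forall>x y. f (x + y) = f x + f y) \<and> (\<forall>c x. f (c *\<^sub>C x) = c *\<^sub>C f x)"
  by (auto simp: Vector_Spaces.linear_iff complex_vector.vector_space_axioms)

instantiation complex :: complex_vector
begin
definition scaleC_complex :: "complex \<Rightarrow> complex \<Rightarrow> complex" where "scaleC_complex = (*)"
instance by standard (simp_all add: scaleC_complex_def algebra_simps)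
end

instantiation "fun" :: (type, complex_vector) complex_vector
begin
definition scaleC_fun :: "complex \<Rightarrow> ('a \<Rightarrow> 'b) \<Rightarrow> 'a \<Rightarrow> 'b"
  where "scaleC_fun c f = (\<lambda>x. c *\<^sub>C f x)"
instance
  by standard (simp_all add: scaleC_fun_def fun_eq_iff scaleC_add_right scaleC_add_left
      scaleC_scaleC scaleC_one)
end

instantiation poly_mapping :: (type, complex_vector) complex_vector
begin
definition scaleC_poly_mapping :: "complex \<Rightarrow> ('a \<Rightarrow>\<^sub>0 'b) \<Rightarrow> 'a \<Rightarrow>\<^sub>0 'b"
  where "scaleC_poly_mapping c = Poly_Mapping.map (scaleC c)"

lemma lookup_scaleC: "Poly_Mapping.lookup (c *\<^sub>C p) x = c *\<^sub>C Poly_Mapping.lookup p x" for p :: "'a \<Rightarrow>\<^sub>0 'b"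
  by (auto simp: scaleC_poly_mapping_def map.rep_eq when_def)

instance
  by standard (simp_all add: poly_mapping_eq_iff fun_eq_iff lookup_scaleC lookup_add
      scaleC_add_right scaleC_add_left scaleC_scaleC scaleC_one)
end

definition finite_dim :: "'a::complex_vector set \<Rightarrow> bool"
  where "finite_dim V \<longleftrightarrow> (\<exists>B. finite B \<and> cspan B = V)"

definition subspace_sum :: "'a::complex_vector set \<Rightarrow> 'a set \<Rightarrow> 'a set"
  where "subspace_sum U W = {u + w | u w. u \<in> U \<and> w \<in> W}"

(* The component in U of x \<in> U \<oplus> W. *)
definition component :: "'a::complex_vector set \<Rightarrow> 'a set \<Rightarrow> 'a \<Rightarrow> 'a"
  where "component U W x = (THE u. u \<in> U \<and> x - u \<in> W)"

definition ctrace :: "('a::complex_vector \<Rightarrow> 'a) \<Rightarrow> complex"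
  where "ctrace f = (\<Sum>b\<in>cextend_basis {}. crepresentation (cextend_basis {}) (f b) b)"


section \<open>Tensor products\<close>

text \<open>The tensor product and the exterior algebra are quotients of the free vector space
  \<^typ>\<open>'x \<Rightarrow>\<^sub>0 complex\<close> by the span of the usual relations.\<close>

definition linear_extension :: "('x \<Rightarrow> 'v::complex_vector) \<Rightarrow> ('x \<Rightarrow>\<^sub>0 complex) \<Rightarrow> 'v"
  where "linear_extension f p = (\<Sum>x\<in>Poly_Mapping.keys p. Poly_Mapping.lookup p x *\<^sub>C f x)"

definition tensor_relations :: "('a::complex_vector \<times> 'b::complex_vector \<Rightarrow>\<^sub>0 complex) set" where
  "tensor_relations =
    {Poly_Mapping.single (x + x', y) 1 - Poly_Mapping.single (x, y) 1 - Poly_Mapping.single (x', y) 1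
      | x x' y. True}
    \<union> {Poly_Mapping.single (x, y + y') 1 - Poly_Mapping.single (x, y) 1 - Poly_Mapping.single (x, y') 1
      | x y y'. True}
    \<union> {Poly_Mapping.single (c *\<^sub>C x, y) 1 - c *\<^sub>C Poly_Mapping.single (x, y) 1 | c x y. True}
    \<union> {Poly_Mapping.single (x, c *\<^sub>C y) 1 - c *\<^sub>C Poly_Mapping.single (x, y) 1 | c x y. True}"

definition tensor_eq ::
    "('a::complex_vector \<times> 'b::complex_vector \<Rightarrow>\<^sub>0 complex) \<Rightarrow> ('a \<times> 'b \<Rightarrow>\<^sub>0 complex) \<Rightarrow> bool"
  where "tensor_eq p q \<longleftrightarrow> p - q \<in> cspan tensor_relations"

lemma equivp_span_diff:
  fixes R :: "'a::complex_vector set"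
  shows "equivp (\<lambda>p q. p - q \<in> cspan R)"
proof (rule equivpI)
  show "reflp (\<lambda>p q. p - q \<in> cspan R)"
    by (simp add: reflp_def complex_vector.span_zero)
  have "q - p \<in> cspan R" if "p - q \<in> cspan R" for p q
    using complex_vector.span_neg[OF that] by simp
  then show "symp (\<lambda>p q. p - q \<in> cspan R)"
    by (simp add: symp_def)
  have "p - r \<in> cspan R" if "p - q \<in> cspan R" "q - r \<in> cspan R" for p q r
    using complex_vector.span_add[OF that] by simp
  then show "transp (\<lambda>p q. p - q \<in> cspan R)"
    unfolding transp_def by blast
qed

quotient_type (overloaded) ('a, 'b) tensor =
    "('a::complex_vector \<times> 'b::complex_vector) \<Rightarrow>\<^sub>0 complex" / tensor_eq
  using equivp_span_diff[of tensor_relations] by (simp add: tensor_eq_def[abs_def])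

lemma span_diff_congs:
  fixes R :: "'a::complex_vector set"
  shows "p - p' \<in> cspan R \<Longrightarrow> q - q' \<in> cspan R \<Longrightarrow> (p + q) - (p' + q') \<in> cspan R"
    and "p - p' \<in> cspan R \<Longrightarrow> q - q' \<in> cspan R \<Longrightarrow> (p - q) - (p' - q') \<in> cspan R"
    and "p - p' \<in> cspan R \<Longrightarrow> - p - (- p') \<in> cspan R"
    and "p - p' \<in> cspan R \<Longrightarrow> c *\<^sub>C p - c *\<^sub>C p' \<in> cspan R"
proof -
  assume p: "p - p' \<in> cspan R"
  show "(p + q) - (p' + q') \<in> cspan R" if "q - q' \<in> cspan R"
    using complex_vector.span_add[OF p that] by (simp add: algebra_simps)
  show "(p - q) - (p' - q') \<in> cspan R" if "q - q' \<in> cspan R"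
    using complex_vector.span_diff[OF p that] by (simp add: algebra_simps)
  show "- p - (- p') \<in> cspan R"
    using complex_vector.span_neg[OF p] by simp
  show "c *\<^sub>C p - c *\<^sub>C p' \<in> cspan R"
    using complex_vector.span_scale[OF p, of c] by (simp add: complex_vector.scale_right_diff_distrib)
qed

instantiation tensor :: (complex_vector, complex_vector) complex_vector
begin

lift_definition zero_tensor :: "('a, 'b) tensor" is 0 .
lift_definition plus_tensor :: "('a, 'b) tensor \<Rightarrow> ('a, 'b) tensor \<Rightarrow> ('a, 'b) tensor" is "(+)"
  unfolding tensor_eq_def by (rule span_diff_congs)
lift_definition minus_tensor :: "('a, 'b) tensor \<Rightarrow> ('a, 'b) tensor \<Rightarrow> ('a, 'b) tensor" is "(-)"
  unfolding tensor_eq_def by (rule span_diff_congs)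
lift_definition uminus_tensor :: "('a, 'b) tensor \<Rightarrow> ('a, 'b) tensor" is uminus
  unfolding tensor_eq_def by (rule span_diff_congs)
lift_definition scaleC_tensor :: "complex \<Rightarrow> ('a, 'b) tensor \<Rightarrow> ('a, 'b) tensor" is scaleC
  unfolding tensor_eq_def by (rule span_diff_congs)

instance
  by standard (transfer, simp add: tensor_eq_def complex_vector.span_zero algebra_simps
      scaleC_add_right scaleC_add_left scaleC_scaleC scaleC_one)+

end

lift_definition tens :: "'a::complex_vector \<Rightarrow> 'b::complex_vector \<Rightarrow> ('a, 'b) tensor"
    (infixr \<open>\<otimes>\<^sub>C\<close> 72)
  is "\<lambda>x y. Poly_Mapping.single (x, y) 1" .

definition tensor_lift ::
    "('a::complex_vector \<Rightarrow> 'b::complex_vector \<Rightarrow> 'v::complex_vector) \<Rightarrow> ('a, 'b) tensor \<Rightarrow> 'v"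
  where "tensor_lift f t = linear_extension (\<lambda>(x, y). f x y) (rep_tensor t)"

lemma linear_extension_superset:
  assumes "finite S" "Poly_Mapping.keys p \<subseteq> S"
  shows "linear_extension f p = (\<Sum>x\<in>S. Poly_Mapping.lookup p x *\<^sub>C f x)"
  unfolding linear_extension_def
  by (rule sum.mono_neutral_left) (use assms in \<open>auto simp: in_keys_iff\<close>)

lemma clinear_linear_extension: "clinear (linear_extension f)"
  unfolding clinear_iff
proof (intro conjI allI)
  fix p q :: "'a \<Rightarrow>\<^sub>0 complex" and c
  let ?S = "Poly_Mapping.keys p \<union> Poly_Mapping.keys q"
  have "linear_extension f (p + q) = (\<Sum>x\<in>?S. Poly_Mapping.lookup (p + q) x *\<^sub>C f x)"
    by (rule linear_extension_superset) (use Poly_Mapping.keys_add[of p q] in auto)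
  also have "\<dots> = (\<Sum>x\<in>?S. Poly_Mapping.lookup p x *\<^sub>C f x) + (\<Sum>x\<in>?S. Poly_Mapping.lookup q x *\<^sub>C f x)"
    by (simp add: lookup_add scaleC_add_left sum.distrib)
  also have "\<dots> = linear_extension f p + linear_extension f q"
    by (simp add: linear_extension_superset[of ?S])
  finally show "linear_extension f (p + q) = linear_extension f p + linear_extension f q" .
  have "linear_extension f (c *\<^sub>C p) = (\<Sum>x\<in>Poly_Mapping.keys p. Poly_Mapping.lookup (c *\<^sub>C p) x *\<^sub>C f x)"
    by (rule linear_extension_superset) (auto simp: in_keys_iff lookup_scaleC)
  also have "\<dots> = c *\<^sub>C linear_extension f p"
    by (simp add: lookup_scaleC scaleC_complex_def linear_extension_def
        complex_vector.scale_sum_right)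
  finally show "linear_extension f (c *\<^sub>C p) = c *\<^sub>C linear_extension f p" .
qed

lemma linear_extension_single [simp]: "linear_extension f (Poly_Mapping.single x 1) = f x"
  by (simp add: linear_extension_def)

lemma clinear_simps:
  assumes "clinear f"
  shows "f (x + y) = f x + f y" "f (x - y) = f x - f y" "f (c *\<^sub>C x) = c *\<^sub>C f x" "f 0 = 0"
proof -
  interpret Vector_Spaces.linear scaleC scaleC f by (fact assms)
  show "f (x + y) = f x + f y" "f (x - y) = f x - f y" "f (c *\<^sub>C x) = c *\<^sub>C f x" "f 0 = 0"
    by (simp_all add: add diff scale)
qed

lemma clinear_vanishes_on_span:
  assumes f: "clinear f" and R: "\<And>r. r \<in> R \<Longrightarrow> f r = 0" and p: "p \<in> cspan R"
  shows "f p = 0"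
  using p
proof (induction rule: complex_vector.span_induct_alt)
  case base
  show ?case by (rule clinear_simps(4)[OF f])
next
  case (step c x y)
  then show ?case by (simp add: clinear_simps[OF f] R)
qed

lemma tens_add_left: "(x + x') \<otimes>\<^sub>C y = x \<otimes>\<^sub>C y + x' \<otimes>\<^sub>C y"
  by transfer (simp add: tensor_eq_def tensor_relations_def diff_diff_eq[symmetric],
      rule complex_vector.span_base, blast)

lemma tens_add_right: "x \<otimes>\<^sub>C (y + y') = x \<otimes>\<^sub>C y + x \<otimes>\<^sub>C y'"
  by transfer (simp add: tensor_eq_def tensor_relations_def diff_diff_eq[symmetric],
      rule complex_vector.span_base, blast)

lemma tens_scale_left: "(c *\<^sub>C x) \<otimes>\<^sub>C y = c *\<^sub>C (x \<otimes>\<^sub>C y)"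
  by transfer (simp add: tensor_eq_def tensor_relations_def, rule complex_vector.span_base, blast)

lemma tens_scale_right: "x \<otimes>\<^sub>C (c *\<^sub>C y) = c *\<^sub>C (x \<otimes>\<^sub>C y)"
  by transfer (simp add: tensor_eq_def tensor_relations_def, rule complex_vector.span_base, blast)

definition cbilinear :: "('a::complex_vector \<Rightarrow> 'b::complex_vector \<Rightarrow> 'v::complex_vector) \<Rightarrow> bool"
  where "cbilinear f \<longleftrightarrow> (\<forall>x. clinear (f x)) \<and> (\<forall>y. clinear (\<lambda>x. f x y))"

lemma linear_extension_tensor_eq:
  assumes f: "cbilinear f" and eq: "tensor_eq p q"
  shows "linear_extension (\<lambda>(x, y). f x y) p = linear_extension (\<lambda>(x, y). f x y) q"
proof -
  have f1: "clinear (f x)" and f2: "clinear (\<lambda>x. f x y)" for x y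
    using f by (auto simp: cbilinear_def)
  note L = clinear_simps[OF clinear_linear_extension]
  have "linear_extension (\<lambda>(x, y). f x y) (p - q) = 0"
    using eq unfolding tensor_eq_def
    by (rule clinear_vanishes_on_span[OF clinear_linear_extension, rotated])
      (auto simp: tensor_relations_def L clinear_simps[OF f1] clinear_simps[OF f2])
  then show ?thesis by (simp add: L)
qed

lemma tensor_lift_abs:
  assumes "cbilinear f"
  shows "tensor_lift f (abs_tensor p) = linear_extension (\<lambda>(x, y). f x y) p"
  unfolding tensor_lift_def
  by (rule linear_extension_tensor_eq[OF assms])
    (rule Quotient3_rep_abs[OF Quotient3_tensor],
      simp add: tensor_eq_def complex_vector.span_zero)

text \<open>The universal property of the tensor product.\<close>

lemma
  assumes "cbilinear f"
  shows tensor_lift_tens: "tensor_lift f (x \<otimes>\<^sub>C y) = f x y"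
    and clinear_tensor_lift: "clinear (tensor_lift f)"
proof -
  show "tensor_lift f (x \<otimes>\<^sub>C y) = f x y"
    by (simp add: tens.abs_eq tensor_lift_abs[OF assms])
  have "tensor_lift f (s + t) = tensor_lift f s + tensor_lift f t" for s t
    by (induction s rule: tensor.abs_induct, induction t rule: tensor.abs_induct)
      (simp add: plus_tensor.abs_eq tensor_lift_abs[OF assms]
        clinear_simps[OF clinear_linear_extension])
  moreover have "tensor_lift f (c *\<^sub>C t) = c *\<^sub>C tensor_lift f t" for c t
    by (induction t rule: tensor.abs_induct)
      (simp add: scaleC_tensor.abs_eq tensor_lift_abs[OF assms]
        clinear_simps[OF clinear_linear_extension])
  ultimately show "clinear (tensor_lift f)"
    by (simp add: clinear_iff)
qed

definition tensor_map :: "('a::complex_vector \<Rightarrow> 'c::complex_vector) \<Rightarrow>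
    ('b::complex_vector \<Rightarrow> 'd::complex_vector) \<Rightarrow> ('a, 'b) tensor \<Rightarrow> ('c, 'd) tensor"
  where "tensor_map A B = tensor_lift (\<lambda>x y. A x \<otimes>\<^sub>C B y)"


section \<open>Exterior algebras\<close>

text \<open>The basis element of the free vector space indexed by a list stands for the product
  of its entries in the tensor algebra; the class of the list is their wedge product.\<close>

definition exterior_relations :: "('a::complex_vector list \<Rightarrow>\<^sub>0 complex) set" where
  "exterior_relations =
    {Poly_Mapping.single (xs @ [x + y] @ ys) 1 - Poly_Mapping.single (xs @ [x] @ ys) 1
       - Poly_Mapping.single (xs @ [y] @ ys) 1
      | xs x y ys. True}
    \<union> {Poly_Mapping.single (xs @ [c *\<^sub>C x] @ ys) 1 - c *\<^sub>C Poly_Mapping.single (xs @ [x] @ ys) 1 | xs c x ys. True}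
    \<union> {Poly_Mapping.single (xs @ [x, x] @ ys) 1 | xs x ys. True}"

definition exterior_eq ::
    "('a::complex_vector list \<Rightarrow>\<^sub>0 complex) \<Rightarrow> ('a list \<Rightarrow>\<^sub>0 complex) \<Rightarrow> bool"
  where "exterior_eq p q \<longleftrightarrow> p - q \<in> cspan exterior_relations"

quotient_type (overloaded) 'a exterior = "('a::complex_vector) list \<Rightarrow>\<^sub>0 complex" / exterior_eq
  using equivp_span_diff[of exterior_relations] by (simp add: exterior_eq_def[abs_def])

instantiation exterior :: (complex_vector) complex_vector
begin

lift_definition zero_exterior :: "'a exterior" is 0 .
lift_definition plus_exterior :: "'a exterior \<Rightarrow> 'a exterior \<Rightarrow> 'a exterior" is "(+)"
  unfolding exterior_eq_def by (rule span_diff_congs)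
lift_definition minus_exterior :: "'a exterior \<Rightarrow> 'a exterior \<Rightarrow> 'a exterior" is "(-)"
  unfolding exterior_eq_def by (rule span_diff_congs)
lift_definition uminus_exterior :: "'a exterior \<Rightarrow> 'a exterior" is uminus
  unfolding exterior_eq_def by (rule span_diff_congs)
lift_definition scaleC_exterior :: "complex \<Rightarrow> 'a exterior \<Rightarrow> 'a exterior" is scaleC
  unfolding exterior_eq_def by (rule span_diff_congs)

instance
  by standard (transfer, simp add: exterior_eq_def complex_vector.span_zero algebra_simps
      scaleC_add_right scaleC_add_left scaleC_scaleC scaleC_one)+

end

lift_definition wedge :: "'a::complex_vector list \<Rightarrow> 'a exterior" is "\<lambda>xs. Poly_Mapping.single xs 1" .

text \<open>For a subspace \<open>V\<close>, the exterior algebra of \<open>V\<close> and its homogeneous parts are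
  identified with their images in the exterior algebra of the ambient space.\<close>

definition ext_algebra :: "'a::complex_vector set \<Rightarrow> 'a exterior set"
  where "ext_algebra V = cspan {wedge xs | xs. xs \<in> lists V}"

definition ext_power :: "'a::complex_vector set \<Rightarrow> nat \<Rightarrow> 'a exterior set"
  where "ext_power V k = cspan {wedge xs | xs. xs \<in> lists V \<and> length xs = k}"

definition alternating_on ::
    "'a::complex_vector set \<Rightarrow> ('a list \<Rightarrow> 'v::complex_vector) \<Rightarrow> bool" where
  "alternating_on V f \<longleftrightarrow> (\<forall>xs\<in>lists V. \<forall>ys\<in>lists V. \<forall>x\<in>V. \<forall>y\<in>V. \<forall>c.
     f (xs @ [x + y] @ ys) = f (xs @ [x] @ ys) + f (xs @ [y] @ ys)
     \<and> f (xs @ [c *\<^sub>C x] @ ys) = c *\<^sub>C f (xs @ [x] @ ys)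
     \<and> f (xs @ [x, x] @ ys) = 0)"

(* The linear map on ext_algebra V that sends x1 \<and> ... \<and> xn to f [x1, ..., xn],
   for f alternating and multilinear on V. *)
definition ext_lift ::
    "'a::complex_vector set \<Rightarrow> ('a list \<Rightarrow> 'v::complex_vector) \<Rightarrow> 'a exterior \<Rightarrow> 'v"
  where "ext_lift V f w =
    linear_extension f (SOME p. Poly_Mapping.keys p \<subseteq> lists V \<and> abs_exterior p = w)"

lemma abs_exterior_eq_iff: "abs_exterior p = abs_exterior q \<longleftrightarrow> p - q \<in> cspan exterior_relations"
  by (simp add: exterior.abs_eq_iff exterior_eq_def)

lemma linear_extension_exterior_eq:
  fixes f :: "'a::complex_vector list \<Rightarrow> 'v::complex_vector"
  assumes V: "csubspace V" and f: "alternating_on V f"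
    and p: "Poly_Mapping.keys p \<subseteq> lists V" and q: "Poly_Mapping.keys q \<subseteq> lists V"
    and eq: "abs_exterior p = abs_exterior q"
  shows "linear_extension f p = linear_extension f q"
proof -
  interpret vector_space_pair "scaleC :: complex \<Rightarrow> 'a \<Rightarrow> 'a" "scaleC :: complex \<Rightarrow> 'a \<Rightarrow> 'a"
    by unfold_locales
  have "clinear (id :: 'a \<Rightarrow> 'a)" by (simp add: clinear_iff)
  from linear_exists_left_inverse_on[OF this V[unfolded csubspace_def]]
  obtain P :: "'a \<Rightarrow> 'a" where P: "range P \<subseteq> V" "clinear P" "\<forall>v\<in>V. P v = v"
    by auto
  define g where "g = (\<lambda>xs. f (map P xs))"
  have PV2: "P x \<in> V" for x
    using P(1) by blast
  have PV1: "map P xs \<in> lists V" for xs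
    by (simp add: in_lists_conv_set PV2)
  have F: "f (map P xs @ [P x + P y] @ map P ys) = f (map P xs @ [P x] @ map P ys) + f (map P xs @ [P y] @ map P ys)
      \<and> f (map P xs @ [c *\<^sub>C P x] @ map P ys) = c *\<^sub>C f (map P xs @ [P x] @ map P ys)
      \<and> f (map P xs @ [P x, P x] @ map P ys) = 0" for xs ys x y c
    using f PV1[of xs] PV1[of ys] PV2[of x] PV2[of y] unfolding alternating_on_def by blast
  have g_add: "g (xs @ [x + y] @ ys) = g (xs @ [x] @ ys) + g (xs @ [y] @ ys)" for xs x y ys
    using F[of xs x y ys] by (simp add: g_def clinear_simps[OF P(2)])
  have g_scale: "g (xs @ [c *\<^sub>C x] @ ys) = c *\<^sub>C g (xs @ [x] @ ys)" for xs c x ys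
    using F[of xs x x ys c] by (simp add: g_def clinear_simps[OF P(2)])
  have g_alt: "g (xs @ [x, x] @ ys) = 0" for xs x ys
    using F[of xs x x ys] by (simp add: g_def)
  note L = clinear_simps[OF clinear_linear_extension]
  have "linear_extension g (p - q) = 0"
    using eq[unfolded abs_exterior_eq_iff]
  proof (rule clinear_vanishes_on_span[OF clinear_linear_extension, rotated])
    fix r :: "'a list \<Rightarrow>\<^sub>0 complex"
    assume "r \<in> exterior_relations"
    then consider
      (add) xs x y ys where "r = Poly_Mapping.single (xs @ [x + y] @ ys) 1
        - Poly_Mapping.single (xs @ [x] @ ys) 1 - Poly_Mapping.single (xs @ [y] @ ys) 1"
      | (scale) xs c x ys where "r = Poly_Mapping.single (xs @ [c *\<^sub>C x] @ ys) 1
        - c *\<^sub>C Poly_Mapping.single (xs @ [x] @ ys) 1"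
      | (alt) xs x ys where "r = Poly_Mapping.single (xs @ [x, x] @ ys) 1"
      unfolding exterior_relations_def by blast
    then show "linear_extension g r = 0"
      by cases (simp_all only: L linear_extension_single g_add g_scale g_alt
          add_diff_cancel_left' diff_self)
  qed
  moreover have "linear_extension g r = linear_extension f r"
    if "Poly_Mapping.keys r \<subseteq> lists V" for r
    unfolding linear_extension_def
  proof (rule sum.cong)
    fix xs assume "xs \<in> Poly_Mapping.keys r"
    with that P(3) have "map P xs = xs" by (auto simp: in_lists_conv_set intro!: map_idI)
    then show "Poly_Mapping.lookup r xs *\<^sub>C g xs = Poly_Mapping.lookup r xs *\<^sub>C f xs" by (simp add: g_def)
  qed simp
  ultimately show ?thesis using p q by (simp add: L)
qed

lemma ext_lift_abs:
  assumes "csubspace V" "alternating_on V f" "Poly_Mapping.keys p \<subseteq> lists V"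
  shows "ext_lift V f (abs_exterior p) = linear_extension f p"
proof -
  let ?P = "\<lambda>q. Poly_Mapping.keys q \<subseteq> lists V \<and> abs_exterior q = abs_exterior p"
  have "?P (SOME q. ?P q)" by (rule someI[of ?P p]) (use assms in simp)
  then show ?thesis
    unfolding ext_lift_def using linear_extension_exterior_eq[OF assms(1,2) _ assms(3)] by blast
qed

lemma ext_algebra_eq: "ext_algebra V = abs_exterior ` {p. Poly_Mapping.keys p \<subseteq> lists V}"
proof
  have "csubspace (abs_exterior ` {p. Poly_Mapping.keys p \<subseteq> lists V})"
    unfolding complex_vector.subspace_def
  proof (intro conjI ballI allI)
    show "0 \<in> abs_exterior ` {p. Poly_Mapping.keys p \<subseteq> lists V}"
      by (rule image_eqI[of _ _ 0]) (auto simp: zero_exterior.abs_eq)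
  next
    fix x y
    assume "x \<in> abs_exterior ` {p. Poly_Mapping.keys p \<subseteq> lists V}"
      "y \<in> abs_exterior ` {p. Poly_Mapping.keys p \<subseteq> lists V}"
    then obtain p q where "x = abs_exterior p" "y = abs_exterior q"
      "Poly_Mapping.keys p \<subseteq> lists V" "Poly_Mapping.keys q \<subseteq> lists V" by auto
    then show "x + y \<in> abs_exterior ` {p. Poly_Mapping.keys p \<subseteq> lists V}"
      using Poly_Mapping.keys_add[of p q]
      by (intro image_eqI[of _ _ "p + q"]) (auto simp: plus_exterior.abs_eq)
  next
    fix c x
    assume "x \<in> abs_exterior ` {p. Poly_Mapping.keys p \<subseteq> lists V}"
    then obtain p where "x = abs_exterior p" "Poly_Mapping.keys p \<subseteq> lists V" by auto
    then show "c *\<^sub>C x \<in> abs_exterior ` {p. Poly_Mapping.keys p \<subseteq> lists V}"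
      by (intro image_eqI[of _ _ "c *\<^sub>C p"])
        (auto simp: scaleC_exterior.abs_eq in_keys_iff lookup_scaleC)
  qed
  then show "ext_algebra V \<subseteq> abs_exterior ` {p. Poly_Mapping.keys p \<subseteq> lists V}"
    unfolding ext_algebra_def
    by (intro complex_vector.span_minimal) (auto simp: wedge.abs_eq)
next
  have abs_lin: "clinear (abs_exterior :: ('a list \<Rightarrow>\<^sub>0 complex) \<Rightarrow> _)"
    by (simp add: clinear_iff plus_exterior.abs_eq scaleC_exterior.abs_eq)
  show "abs_exterior ` {p. Poly_Mapping.keys p \<subseteq> lists V} \<subseteq> ext_algebra V"
  proof clarify
    fix p :: "'a list \<Rightarrow>\<^sub>0 complex"
    assume p: "Poly_Mapping.keys p \<subseteq> lists V"
    interpret abs: Vector_Spaces.linear scaleC scaleC "abs_exterior :: ('a list \<Rightarrow>\<^sub>0 complex) \<Rightarrow> _"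
      by (rule abs_lin)
    have "p = (\<Sum>xs\<in>Poly_Mapping.keys p. Poly_Mapping.lookup p xs *\<^sub>C Poly_Mapping.single xs 1)"
    proof (rule poly_mapping_eqI)
      fix ys
      have "Poly_Mapping.lookup (\<Sum>xs\<in>Poly_Mapping.keys p. Poly_Mapping.lookup p xs *\<^sub>C Poly_Mapping.single xs 1) ys
          = (\<Sum>xs\<in>Poly_Mapping.keys p. if xs = ys then Poly_Mapping.lookup p ys else 0)"
        unfolding lookup_sum
        by (rule sum.cong) (auto simp: lookup_scaleC lookup_single when_def scaleC_complex_def)
      then show "Poly_Mapping.lookup p ys = Poly_Mapping.lookup
          (\<Sum>xs\<in>Poly_Mapping.keys p. Poly_Mapping.lookup p xs *\<^sub>C Poly_Mapping.single xs 1) ys"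
        by (simp add: in_keys_iff)
    qed
    then have "abs_exterior p =
        abs_exterior (\<Sum>xs\<in>Poly_Mapping.keys p. Poly_Mapping.lookup p xs *\<^sub>C Poly_Mapping.single xs 1)"
      by (rule arg_cong)
    also have "\<dots> = (\<Sum>xs\<in>Poly_Mapping.keys p. Poly_Mapping.lookup p xs *\<^sub>C wedge xs)"
      by (simp only: abs.sum abs.scale wedge.abs_eq)
    also have "\<dots> \<in> ext_algebra V"
      unfolding ext_algebra_def
      by (intro complex_vector.span_sum complex_vector.span_scale complex_vector.span_base)
        (use p in blast)
    finally show "abs_exterior p \<in> ext_algebra V" .
  qed
qed

text \<open>The universal property of the exterior algebra.\<close>

lemma
  assumes V: "csubspace V" and f: "alternating_on V f"
  shows ext_lift_wedge: "xs \<in> lists V \<Longrightarrow> ext_lift V f (wedge xs) = f xs"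
    and ext_lift_add: "v \<in> ext_algebra V \<Longrightarrow> w \<in> ext_algebra V \<Longrightarrow>
      ext_lift V f (v + w) = ext_lift V f v + ext_lift V f w"
    and ext_lift_scale: "w \<in> ext_algebra V \<Longrightarrow> ext_lift V f (c *\<^sub>C w) = c *\<^sub>C ext_lift V f w"
proof -
  note L = clinear_simps[OF clinear_linear_extension]
  show "ext_lift V f (wedge xs) = f xs" if "xs \<in> lists V"
    using that by (simp add: wedge.abs_eq ext_lift_abs[OF V f])
  show "ext_lift V f (v + w) = ext_lift V f v + ext_lift V f w"
    if "v \<in> ext_algebra V" "w \<in> ext_algebra V"
  proof -
    from that obtain p q where "v = abs_exterior p" "w = abs_exterior q"
      "Poly_Mapping.keys p \<subseteq> lists V" "Poly_Mapping.keys q \<subseteq> lists V"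
      by (auto simp: ext_algebra_eq)
    moreover from this have "Poly_Mapping.keys (p + q) \<subseteq> lists V"
      using Poly_Mapping.keys_add[of p q] by auto
    ultimately show ?thesis
      by (simp add: plus_exterior.abs_eq ext_lift_abs[OF V f] L)
  qed
  show "ext_lift V f (c *\<^sub>C w) = c *\<^sub>C ext_lift V f w" if "w \<in> ext_algebra V"
  proof -
    from that obtain p where "w = abs_exterior p" "Poly_Mapping.keys p \<subseteq> lists V"
      by (auto simp: ext_algebra_eq)
    moreover from this have "Poly_Mapping.keys (c *\<^sub>C p) \<subseteq> lists V"
      by (auto simp: in_keys_iff lookup_scaleC)
    ultimately show ?thesis
      by (simp add: scaleC_exterior.abs_eq ext_lift_abs[OF V f] L)
  qed
qed

(* The list xs with its i-th entry (counting from 0) left out. *)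
definition omit :: "nat \<Rightarrow> 'a list \<Rightarrow> 'a list"
  where "omit i xs = take i xs @ drop (Suc i) xs"

definition ext_mult :: "'a::complex_vector \<Rightarrow> 'a exterior \<Rightarrow> 'a exterior"
  where "ext_mult y = ext_lift UNIV (\<lambda>ys. wedge (y # ys))"


section \<open>Lie algebras\<close>

class complex_lie_algebra = complex_vector +
  fixes lie_bracket :: "'a \<Rightarrow> 'a \<Rightarrow> 'a"  (\<open>[_,/ _]\<^sub>L\<close>)
  assumes lie_bracket_add_left: "[x + y, z]\<^sub>L = [x, z]\<^sub>L + [y, z]\<^sub>L"
    and lie_bracket_add_right: "[x, y + z]\<^sub>L = [x, y]\<^sub>L + [x, z]\<^sub>L"
    and lie_bracket_scale_left: "[c *\<^sub>C x, y]\<^sub>L = c *\<^sub>C [x, y]\<^sub>L"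
    and lie_bracket_scale_right: "[x, c *\<^sub>C y]\<^sub>L = c *\<^sub>C [x, y]\<^sub>L"
    and lie_bracket_self: "[x, x]\<^sub>L = 0"
    and lie_bracket_jacobi: "[x, [y, z]\<^sub>L]\<^sub>L + [y, [z, x]\<^sub>L]\<^sub>L + [z, [x, y]\<^sub>L]\<^sub>L = 0"

definition lie_subalgebra :: "'g::complex_lie_algebra set \<Rightarrow> bool"
  where "lie_subalgebra h \<longleftrightarrow> csubspace h \<and> (\<forall>x\<in>h. \<forall>y\<in>h. [x, y]\<^sub>L \<in> h)"

definition lie_ideal :: "'g::complex_lie_algebra set \<Rightarrow> bool"
  where "lie_ideal I \<longleftrightarrow> csubspace I \<and> (\<forall>x. \<forall>y\<in>I. [x, y]\<^sub>L \<in> I)"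

definition abelian :: "'g::complex_lie_algebra set \<Rightarrow> bool"
  where "abelian h \<longleftrightarrow> (\<forall>x\<in>h. \<forall>y\<in>h. [x, y]\<^sub>L = 0)"

primrec derived_series :: "'g::complex_lie_algebra set \<Rightarrow> nat \<Rightarrow> 'g set" where
  "derived_series h 0 = h"
| "derived_series h (Suc n) =
    cspan {[x, y]\<^sub>L | x y. x \<in> derived_series h n \<and> y \<in> derived_series h n}"

definition solvable :: "'g::complex_lie_algebra set \<Rightarrow> bool"
  where "solvable h \<longleftrightarrow> (\<exists>n. derived_series h n = {0})"

definition killing :: "'g::complex_lie_algebra \<Rightarrow> 'g \<Rightarrow> complex"
  where "killing x y = ctrace (\<lambda>z. [x, [y, z]\<^sub>L]\<^sub>L)"

definition borel_subalgebra :: "'g::complex_lie_algebra set \<Rightarrow> bool"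
  where "borel_subalgebra b \<longleftrightarrow> lie_subalgebra b \<and> solvable b
    \<and> (\<forall>c. lie_subalgebra c \<and> solvable c \<and> b \<subseteq> c \<longrightarrow> c = b)"

definition parabolic_subalgebra :: "'g::complex_lie_algebra set \<Rightarrow> bool"
  where "parabolic_subalgebra q \<longleftrightarrow> lie_subalgebra q \<and> (\<exists>b. borel_subalgebra b \<and> b \<subseteq> q)"

(* The textbook definition of a Cartan subalgebra of a complex semisimple Lie algebra: maximal
   abelian, with diagonalizable adjoint action. *)
definition cartan_subalgebra :: "'g::complex_lie_algebra set \<Rightarrow> bool"
  where "cartan_subalgebra t \<longleftrightarrow> csubspace t \<and> abelian t
    \<and> (\<forall>x. (\<forall>h\<in>t. [h, x]\<^sub>L = 0) \<longrightarrow> x \<in> t)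
    \<and> (\<forall>h\<in>t. cspan {x. \<exists>c. [h, x]\<^sub>L = c *\<^sub>C x} = UNIV)"

(* Linear functionals on t, represented by functions that vanish outside t. *)
definition dual_space :: "'g::complex_vector set \<Rightarrow> ('g \<Rightarrow> complex) set"
  where "dual_space t = {\<alpha>. (\<forall>x\<in>t. \<forall>y\<in>t. \<alpha> (x + y) = \<alpha> x + \<alpha> y)
    \<and> (\<forall>c. \<forall>x\<in>t. \<alpha> (c *\<^sub>C x) = c * \<alpha> x) \<and> (\<forall>x. x \<notin> t \<longrightarrow> \<alpha> x = 0)}"

definition weight_space ::
    "('g \<Rightarrow> 'v \<Rightarrow> 'v::complex_vector) \<Rightarrow> 'g set \<Rightarrow> ('g \<Rightarrow> complex) \<Rightarrow> 'v set"
  where "weight_space \<pi> t \<mu> = {v. \<forall>h\<in>t. \<pi> h v = \<mu> h *\<^sub>C v}"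

(* \<Delta>(h, t) for a subalgebra h containing t. *)
definition roots :: "'g::complex_lie_algebra set \<Rightarrow> 'g set \<Rightarrow> ('g \<Rightarrow> complex) set"
  where "roots h t = {\<alpha> \<in> dual_space t. \<alpha> \<noteq> (\<lambda>_. 0) \<and> weight_space lie_bracket t \<alpha> \<inter> h \<noteq> {0}}"

(* The roots that are positive on some regular element at which all roots take real values. *)
definition positive_system :: "'g::complex_lie_algebra set \<Rightarrow> ('g \<Rightarrow> complex) set \<Rightarrow> bool"
  where "positive_system t P \<longleftrightarrow> (\<exists>h\<in>t. (\<forall>\<alpha>\<in>roots UNIV t. \<alpha> h \<in> \<real> \<and> \<alpha> h \<noteq> 0)
    \<and> P = {\<alpha> \<in> roots UNIV t. Re (\<alpha> h) > 0})"

definition half_sum :: "('g \<Rightarrow> complex) set \<Rightarrow> 'g \<Rightarrow> complex"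
  where "half_sum P = (\<lambda>h. (\<Sum>\<alpha>\<in>P. \<alpha> h) / 2)"

definition nilradical :: "'g::complex_lie_algebra set \<Rightarrow> ('g \<Rightarrow> complex) set \<Rightarrow> 'g set"
  where "nilradical t P = cspan (\<Union>\<alpha>\<in>P. weight_space lie_bracket t \<alpha>)"

definition lie_semisimple :: "'g::complex_lie_algebra itself \<Rightarrow> bool"
  where "lie_semisimple _ \<longleftrightarrow> finite_dim (UNIV :: 'g set)
    \<and> (\<forall>I::'g set. lie_ideal I \<and> solvable I \<longrightarrow> I = {0})"


section \<open>Hermitian symmetric pairs\<close>

definition real_form :: "'g::complex_lie_algebra set \<Rightarrow> bool"
  where "real_form g\<^sub>0 \<longleftrightarrow> 0 \<in> g\<^sub>0 \<and> (\<forall>x\<in>g\<^sub>0. \<forall>y\<in>g\<^sub>0. x + y \<in> g\<^sub>0)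
    \<and> (\<forall>r. \<forall>x\<in>g\<^sub>0. complex_of_real r *\<^sub>C x \<in> g\<^sub>0) \<and> (\<forall>x\<in>g\<^sub>0. \<forall>y\<in>g\<^sub>0. [x, y]\<^sub>L \<in> g\<^sub>0)
    \<and> (\<forall>z. \<exists>!(x, y). x \<in> g\<^sub>0 \<and> y \<in> g\<^sub>0 \<and> z = x + \<i> *\<^sub>C y)"

(* \<theta> is the complex linear extension to g of a Cartan involution of the real form; the Killing
   form of g is real on the real form. *)
definition cartan_involution :: "('g::complex_lie_algebra \<Rightarrow> 'g) \<Rightarrow> 'g set \<Rightarrow> bool"
  where "cartan_involution \<theta> g\<^sub>0 \<longleftrightarrow> clinear \<theta> \<and> (\<forall>x y. \<theta> [x, y]\<^sub>L = [\<theta> x, \<theta> y]\<^sub>L)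
    \<and> (\<forall>x. \<theta> (\<theta> x) = x) \<and> \<theta> ` g\<^sub>0 \<subseteq> g\<^sub>0
    \<and> (\<forall>x\<in>g\<^sub>0. x \<noteq> 0 \<longrightarrow> Re (killing x (\<theta> x)) < 0)"

definition complexification :: "'g::complex_vector set \<Rightarrow> 'g set"
  where "complexification V = {x + \<i> *\<^sub>C y | x y. x \<in> V \<and> y \<in> V}"

definition compact_part :: "('g::complex_lie_algebra \<Rightarrow> 'g) \<Rightarrow> 'g set \<Rightarrow> 'g set"
  where "compact_part \<theta> g\<^sub>0 = complexification {x \<in> g\<^sub>0. \<theta> x = x}"

definition noncompact_part :: "('g::complex_lie_algebra \<Rightarrow> 'g) \<Rightarrow> 'g set \<Rightarrow> 'g set"
  where "noncompact_part \<theta> g\<^sub>0 = complexification {x \<in> g\<^sub>0. \<theta> x = - x}"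

definition isotropic :: "'g::complex_lie_algebra set \<Rightarrow> bool"
  where "isotropic U \<longleftrightarrow> (\<forall>x\<in>U. \<forall>y\<in>U. killing x y = 0)"

definition maximal_isotropic :: "'g::complex_lie_algebra set \<Rightarrow> 'g set \<Rightarrow> bool"
  where "maximal_isotropic p U \<longleftrightarrow> csubspace U \<and> U \<subseteq> p \<and> isotropic U
    \<and> (\<forall>W. csubspace W \<and> W \<subseteq> p \<and> isotropic W \<and> U \<subseteq> W \<longrightarrow> W = U)"

locale hermitian_symmetric_pair =
  fixes \<theta> :: "'g::complex_lie_algebra \<Rightarrow> 'g"
    and g\<^sub>0 t p_plus p_minus :: "'g set"
  assumes semisimple: "lie_semisimple TYPE('g)"
    and real_form: "real_form g\<^sub>0"
    and cartan_involution: "cartan_involution \<theta> g\<^sub>0"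
    and cartan_subalgebra: "cartan_subalgebra t" "t \<subseteq> compact_part \<theta> g\<^sub>0"
    and decomposition: "subspace_sum p_plus p_minus = noncompact_part \<theta> g\<^sub>0"
      "p_plus \<inter> p_minus = {0}"
    and k_stable: "\<And>x y. x \<in> compact_part \<theta> g\<^sub>0 \<Longrightarrow> y \<in> p_plus \<Longrightarrow> [x, y]\<^sub>L \<in> p_plus"
      "\<And>x y. x \<in> compact_part \<theta> g\<^sub>0 \<Longrightarrow> y \<in> p_minus \<Longrightarrow> [x, y]\<^sub>L \<in> p_minus"
    and abelian: "lie_subalgebra p_plus" "abelian p_plus" "lie_subalgebra p_minus" "abelian p_minus"
    and maximal_isotropic: "maximal_isotropic (noncompact_part \<theta> g\<^sub>0) p_plus"
      "maximal_isotropic (noncompact_part \<theta> g\<^sub>0) p_minus"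
    and dual: "\<And>x. x \<in> p_plus \<Longrightarrow> (\<And>y. y \<in> p_minus \<Longrightarrow> killing x y = 0) \<Longrightarrow> x = 0"
      "\<And>y. y \<in> p_minus \<Longrightarrow> (\<And>x. x \<in> p_plus \<Longrightarrow> killing x y = 0) \<Longrightarrow> y = 0"
    and parabolic: "parabolic_subalgebra (subspace_sum (compact_part \<theta> g\<^sub>0) p_plus)"


section \<open>Representations of Lie algebras\<close>

record ('g, 'v) lie_rep =
  rcarrier :: "'v set"
  rzero :: 'v
  radd :: "'v \<Rightarrow> 'v \<Rightarrow> 'v"
  rscale :: "complex \<Rightarrow> 'v \<Rightarrow> 'v"
  ract :: "'g \<Rightarrow> 'v \<Rightarrow> 'v"

definition lie_module :: "'g::complex_lie_algebra set \<Rightarrow> ('g, 'v) lie_rep \<Rightarrow> bool" where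
  "lie_module h V \<longleftrightarrow>
    rzero V \<in> rcarrier V
    \<and> (\<forall>u\<in>rcarrier V. \<forall>v\<in>rcarrier V. radd V u v \<in> rcarrier V)
    \<and> (\<forall>c. \<forall>v\<in>rcarrier V. rscale V c v \<in> rcarrier V)
    \<and> (\<forall>x\<in>h. \<forall>v\<in>rcarrier V. ract V x v \<in> rcarrier V)
    \<and> (\<forall>u\<in>rcarrier V. \<forall>v\<in>rcarrier V. \<forall>w\<in>rcarrier V. radd V (radd V u v) w = radd V u (radd V v w))
    \<and> (\<forall>u\<in>rcarrier V. \<forall>v\<in>rcarrier V. radd V u v = radd V v u)
    \<and> (\<forall>v\<in>rcarrier V. radd V (rzero V) v = v)
    \<and> (\<forall>v\<in>rcarrier V. radd V (rscale V (- 1) v) v = rzero V)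
    \<and> (\<forall>c. \<forall>u\<in>rcarrier V. \<forall>v\<in>rcarrier V.
         rscale V c (radd V u v) = radd V (rscale V c u) (rscale V c v))
    \<and> (\<forall>c d. \<forall>v\<in>rcarrier V. rscale V (c + d) v = radd V (rscale V c v) (rscale V d v))
    \<and> (\<forall>c d. \<forall>v\<in>rcarrier V. rscale V c (rscale V d v) = rscale V (c * d) v)
    \<and> (\<forall>v\<in>rcarrier V. rscale V 1 v = v)
    \<and> (\<forall>x\<in>h. \<forall>u\<in>rcarrier V. \<forall>v\<in>rcarrier V. ract V x (radd V u v) = radd V (ract V x u) (ract V x v))
    \<and> (\<forall>x\<in>h. \<forall>c. \<forall>v\<in>rcarrier V. ract V x (rscale V c v) = rscale V c (ract V x v))
    \<and> (\<forall>x\<in>h. \<forall>y\<in>h. \<forall>v\<in>rcarrier V. ract V (x + y) v = radd V (ract V x v) (ract V y v))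
    \<and> (\<forall>x\<in>h. \<forall>c. \<forall>v\<in>rcarrier V. ract V (c *\<^sub>C x) v = rscale V c (ract V x v))
    \<and> (\<forall>x\<in>h. \<forall>y\<in>h. \<forall>v\<in>rcarrier V.
         radd V (ract V [x, y]\<^sub>L v) (ract V y (ract V x v)) = ract V x (ract V y v))"

definition isomorphic_modules ::
    "'g::complex_lie_algebra set \<Rightarrow> ('g, 'v) lie_rep \<Rightarrow> ('g, 'w) lie_rep \<Rightarrow> bool" where
  "isomorphic_modules h V W \<longleftrightarrow> lie_module h V \<and> lie_module h W
    \<and> (\<exists>f. bij_betw f (rcarrier V) (rcarrier W)
         \<and> (\<forall>u\<in>rcarrier V. \<forall>v\<in>rcarrier V. f (radd V u v) = radd W (f u) (f v))
         \<and> (\<forall>c. \<forall>v\<in>rcarrier V. f (rscale V c v) = rscale W c (f v))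
         \<and> (\<forall>x\<in>h. \<forall>v\<in>rcarrier V. f (ract V x v) = ract W x (f v)))"

definition sub_rep :: "'v::complex_vector set \<Rightarrow> ('g \<Rightarrow> 'v \<Rightarrow> 'v) \<Rightarrow> ('g, 'v) lie_rep"
  where "sub_rep K \<pi> = \<lparr>rcarrier = K, rzero = 0, radd = (+), rscale = scaleC, ract = \<pi>\<rparr>"

(* K / U for subspaces U \<subseteq> K, with cosets as elements. The representatives are translated by U
   once more so that 0 acts as the coset U and not as the set {0}. *)
definition quot_rep :: "'v::complex_vector set \<Rightarrow> 'v set \<Rightarrow> ('g \<Rightarrow> 'v \<Rightarrow> 'v) \<Rightarrow> ('g, 'v set) lie_rep"
  where "quot_rep K U \<pi> = \<lparr>rcarrier = {{v + u | u. u \<in> U} | v. v \<in> K}, rzero = U,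
    radd = (\<lambda>A B. {a + b | a b. a \<in> A \<and> b \<in> B}),
    rscale = (\<lambda>c A. {c *\<^sub>C a + u | a u. a \<in> A \<and> u \<in> U}),
    ract = (\<lambda>x A. {\<pi> x a + u | a u. a \<in> A \<and> u \<in> U})\<rparr>"

definition direct_sum_rep :: "(nat \<Rightarrow> ('g, 'v) lie_rep) \<Rightarrow> ('g, nat \<Rightarrow> 'v) lie_rep" where
  "direct_sum_rep V =
    \<lparr>rcarrier = {F. (\<forall>k. F k \<in> rcarrier (V k)) \<and> finite {k. F k \<noteq> rzero (V k)}},
     rzero = (\<lambda>k. rzero (V k)),
     radd = (\<lambda>F G k. radd (V k) (F k) (G k)),
     rscale = (\<lambda>c F k. rscale (V k) c (F k)),
     ract = (\<lambda>x F k. ract (V k) x (F k))\<rparr>"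

(* The linear functional by which h acts on its one-dimensional module of weight \<mu>. *)
definition character_of_weight ::
    "'g::complex_lie_algebra set \<Rightarrow> 'g set \<Rightarrow> ('g \<Rightarrow> complex) \<Rightarrow> 'g \<Rightarrow> complex"
  where "character_of_weight h t \<mu> =
    (THE \<chi>. \<chi> \<in> dual_space h \<and> (\<forall>x\<in>h. \<forall>y\<in>h. \<chi> [x, y]\<^sub>L = 0) \<and> (\<forall>x\<in>t. \<chi> x = \<mu> x))"

(* The tensor product of V with the one-dimensional module of character \<chi>, where v \<otimes> z is
   identified with z v. *)
definition twist :: "('g, 'v) lie_rep \<Rightarrow> ('g \<Rightarrow> complex) \<Rightarrow> ('g, 'v) lie_rep"
  where "twist V \<chi> = V\<lparr>ract := (\<lambda>x v. radd V (ract V x v) (rscale V (\<chi> x) v))\<rparr>"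

definition generated_submodule ::
    "('g \<Rightarrow> 'm \<Rightarrow> 'm::complex_vector) \<Rightarrow> 'g set \<Rightarrow> 'm set \<Rightarrow> 'm set"
  where "generated_submodule \<pi> h S = \<Inter>{W. csubspace W \<and> S \<subseteq> W \<and> (\<forall>x\<in>h. \<forall>w\<in>W. \<pi> x w \<in> W)}"

(* Modules over the universal enveloping algebra are treated as representations of the Lie
   algebra; both have the same submodules, hence the same notion of finite generation. *)
definition category_O ::
    "'g::complex_lie_algebra set \<Rightarrow> 'g set \<Rightarrow> ('g \<Rightarrow> 'm \<Rightarrow> 'm::complex_vector) \<Rightarrow> bool" where
  "category_O t n \<pi> \<longleftrightarrow> lie_module UNIV (sub_rep UNIV \<pi>)
    \<and> (\<exists>F. finite F \<and> generated_submodule \<pi> UNIV F = UNIV)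
    \<and> cspan (\<Union>\<mu>\<in>dual_space t. weight_space \<pi> t \<mu>) = UNIV
    \<and> (\<forall>v. finite_dim (generated_submodule \<pi> n {v}))"

definition hermitian_inner_product :: "('m::complex_vector \<Rightarrow> 'm \<Rightarrow> complex) \<Rightarrow> bool"
  where "hermitian_inner_product ip \<longleftrightarrow> (\<forall>u v w. ip (u + v) w = ip u w + ip v w)
    \<and> (\<forall>c u v. ip (c *\<^sub>C u) v = c * ip u v) \<and> (\<forall>u v. ip v u = cnj (ip u v))
    \<and> (\<forall>u. u \<noteq> 0 \<longrightarrow> Re (ip u u) > 0)"

definition unitary :: "'g set \<Rightarrow> ('g \<Rightarrow> 'm \<Rightarrow> 'm::complex_vector) \<Rightarrow> bool"
  where "unitary g\<^sub>0 \<pi> \<longleftrightarrow> (\<exists>ip. hermitian_inner_product ip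
    \<and> (\<forall>x\<in>g\<^sub>0. \<forall>u v. ip (\<pi> x u) v + ip u (\<pi> x v) = 0))"


section \<open>The spin module and Dirac cohomology\<close>

text \<open>The spin module is \<^term>\<open>ext_algebra p_minus\<close>. All operators below are defined on the
  exterior algebra of the whole Lie algebra and preserve the spin module.\<close>

definition contraction :: "'g::complex_lie_algebra \<Rightarrow> 'g exterior \<Rightarrow> 'g exterior" where
  "contraction x =
    ext_lift UNIV (\<lambda>ys. \<Sum>i<length ys. ((- 1) ^ i * killing x (ys ! i)) *\<^sub>C wedge (omit i ys))"

definition clifford_action ::
    "'g::complex_lie_algebra set \<Rightarrow> 'g set \<Rightarrow> 'g \<Rightarrow> 'g exterior \<Rightarrow> 'g exterior"
  where "clifford_action p_plus p_minus a =
    (\<lambda>w. ext_mult (component p_minus p_plus a) w + contraction (component p_plus p_minus a) w)"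

definition so_operator :: "'g::complex_lie_algebra \<Rightarrow> 'g \<Rightarrow> 'g \<Rightarrow> 'g"
  where "so_operator a b v = killing b v *\<^sub>C a - killing a v *\<^sub>C b"

(* The composite of \<phi> : so(p) \<rightarrow> C(p) with the action of C(p) on the spin module: a sum of
   operators R a b acts by the sum of the operators 1/2 [\<gamma> a, \<gamma> b]. *)
definition spin_map :: "'g::complex_lie_algebra set \<Rightarrow> 'g set \<Rightarrow> 'g set \<Rightarrow>
    ('g \<Rightarrow> 'g) \<Rightarrow> 'g exterior \<Rightarrow> 'g exterior" where
  "spin_map p p_plus p_minus A =
    (THE T. \<exists>(n::nat) a b. (\<forall>i<n. a i \<in> p \<and> b i \<in> p)
      \<and> (\<forall>v\<in>p. A v = (\<Sum>i<n. so_operator (a i) (b i) v))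
      \<and> T = (\<lambda>w. \<Sum>i<n. (1 / 2) *\<^sub>C
           (clifford_action p_plus p_minus (a i) (clifford_action p_plus p_minus (b i) w)
            - clifford_action p_plus p_minus (b i) (clifford_action p_plus p_minus (a i) w))))"

definition spin_action :: "'g::complex_lie_algebra set \<Rightarrow> 'g set \<Rightarrow> 'g set \<Rightarrow>
    'g \<Rightarrow> 'g exterior \<Rightarrow> 'g exterior"
  where "spin_action p p_plus p_minus x = spin_map p p_plus p_minus (lie_bracket x)"

definition diagonal_action :: "('g \<Rightarrow> 'm \<Rightarrow> 'm) \<Rightarrow> ('g \<Rightarrow> 's \<Rightarrow> 's) \<Rightarrow>
    'g \<Rightarrow> ('m::complex_vector, 's::complex_vector) tensor \<Rightarrow> ('m, 's) tensor"
  where "diagonal_action \<pi> \<sigma> x = (\<lambda>y. tensor_map (\<pi> x) id y + tensor_map id (\<sigma> x) y)"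

(* M \<otimes> W for a subspace W, as a subspace of the tensor product with the ambient space of W. *)
definition tensor_subspace :: "'s set \<Rightarrow> ('m::complex_vector, 's::complex_vector) tensor set"
  where "tensor_subspace W = cspan {v \<otimes>\<^sub>C w | v w. w \<in> W}"

definition orthonormal_basis :: "'g::complex_lie_algebra set \<Rightarrow> 'g set \<Rightarrow> bool"
  where "orthonormal_basis p Z \<longleftrightarrow> finite Z \<and> cspan Z = p
    \<and> (\<forall>x\<in>Z. \<forall>y\<in>Z. killing x y = (if x = y then 1 else 0))"

definition dirac :: "'g::complex_lie_algebra set \<Rightarrow> 'g set \<Rightarrow> 'g set \<Rightarrow>
    ('g \<Rightarrow> 'm \<Rightarrow> 'm::complex_vector) \<Rightarrow> ('m, 'g exterior) tensor \<Rightarrow> ('m, 'g exterior) tensor"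
  where "dirac p_plus p_minus Z \<pi> =
    (\<lambda>x. \<Sum>z\<in>Z. tensor_map (\<pi> z) (clifford_action p_plus p_minus z) x)"

definition ker_dirac :: "'g::complex_lie_algebra set \<Rightarrow> 'g set \<Rightarrow> 'g set \<Rightarrow>
    ('g \<Rightarrow> 'm \<Rightarrow> 'm::complex_vector) \<Rightarrow> ('m, 'g exterior) tensor set"
  where "ker_dirac p_plus p_minus Z \<pi> =
    {x \<in> tensor_subspace (ext_algebra p_minus). dirac p_plus p_minus Z \<pi> x = 0}"

definition im_dirac :: "'g::complex_lie_algebra set \<Rightarrow> 'g set \<Rightarrow> 'g set \<Rightarrow>
    ('g \<Rightarrow> 'm \<Rightarrow> 'm::complex_vector) \<Rightarrow> ('m, 'g exterior) tensor set"
  where "im_dirac p_plus p_minus Z \<pi> =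
    dirac p_plus p_minus Z \<pi> ` tensor_subspace (ext_algebra p_minus)"

definition dirac_kernel :: "'g::complex_lie_algebra set \<Rightarrow> 'g set \<Rightarrow> 'g set \<Rightarrow> 'g set \<Rightarrow>
    ('g \<Rightarrow> 'm \<Rightarrow> 'm::complex_vector) \<Rightarrow> ('g, ('m, 'g exterior) tensor) lie_rep"
  where "dirac_kernel p p_plus p_minus Z \<pi> =
    sub_rep (ker_dirac p_plus p_minus Z \<pi>) (diagonal_action \<pi> (spin_action p p_plus p_minus))"

definition dirac_cohomology :: "'g::complex_lie_algebra set \<Rightarrow> 'g set \<Rightarrow> 'g set \<Rightarrow> 'g set \<Rightarrow>
    ('g \<Rightarrow> 'm \<Rightarrow> 'm::complex_vector) \<Rightarrow> ('g, ('m, 'g exterior) tensor set) lie_rep"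
  where "dirac_cohomology p p_plus p_minus Z \<pi> =
    quot_rep (ker_dirac p_plus p_minus Z \<pi>)
      (im_dirac p_plus p_minus Z \<pi> \<inter> ker_dirac p_plus p_minus Z \<pi>)
      (diagonal_action \<pi> (spin_action p p_plus p_minus))"


section \<open>Cohomology and homology of abelian subalgebras\<close>

(* The extension of ad x to a derivation of the exterior algebra. *)
definition ext_ad :: "'g::complex_lie_algebra \<Rightarrow> 'g exterior \<Rightarrow> 'g exterior"
  where "ext_ad x = ext_lift UNIV (\<lambda>ys. \<Sum>i<length ys. wedge (ys[i := [x, ys ! i]\<^sub>L]))"

(* Linear maps from the k-th exterior power of V to M, extended by 0. *)
definition cochains ::
    "'g::complex_vector set \<Rightarrow> nat \<Rightarrow> ('g exterior \<Rightarrow> 'm::complex_vector) set" where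
  "cochains V k = {\<omega>.
    (\<forall>v\<in>ext_power V k. \<forall>w\<in>ext_power V k. \<omega> (v + w) = \<omega> v + \<omega> w)
    \<and> (\<forall>c. \<forall>w\<in>ext_power V k. \<omega> (c *\<^sub>C w) = c *\<^sub>C \<omega> w)
    \<and> (\<forall>w. w \<notin> ext_power V k \<longrightarrow> \<omega> w = 0)}"

definition coboundary :: "'g::complex_vector set \<Rightarrow> ('g \<Rightarrow> 'm \<Rightarrow> 'm::complex_vector) \<Rightarrow> nat \<Rightarrow>
    ('g exterior \<Rightarrow> 'm) \<Rightarrow> 'g exterior \<Rightarrow> 'm"
  where "coboundary V \<pi> k \<omega> = (\<lambda>w. if w \<in> ext_power V (Suc k)
    then ext_lift V (\<lambda>xs. \<Sum>i<length xs. (- 1) ^ i *\<^sub>C \<pi> (xs ! i) (\<omega> (wedge (omit i xs)))) w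
    else 0)"

definition cochain_action :: "'g::complex_lie_algebra set \<Rightarrow> ('g \<Rightarrow> 'm \<Rightarrow> 'm::complex_vector) \<Rightarrow>
    nat \<Rightarrow> 'g \<Rightarrow> ('g exterior \<Rightarrow> 'm) \<Rightarrow> 'g exterior \<Rightarrow> 'm"
  where "cochain_action V \<pi> k x \<omega> =
    (\<lambda>w. if w \<in> ext_power V k then \<pi> x (\<omega> w) - \<omega> (ext_ad x w) else 0)"

definition cohomology_degree :: "'g::complex_lie_algebra set \<Rightarrow>
    ('g \<Rightarrow> 'm \<Rightarrow> 'm::complex_vector) \<Rightarrow> nat \<Rightarrow> ('g, ('g exterior \<Rightarrow> 'm) set) lie_rep"
  where "cohomology_degree V \<pi> k = quot_rep
    {\<omega> \<in> cochains V k. coboundary V \<pi> k \<omega> = 0}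
    (case k of 0 \<Rightarrow> {0} | Suc j \<Rightarrow> coboundary V \<pi> j ` cochains V j)
    (cochain_action V \<pi> k)"

definition cohomology :: "'g::complex_lie_algebra set \<Rightarrow>
    ('g \<Rightarrow> 'm \<Rightarrow> 'm::complex_vector) \<Rightarrow> ('g, nat \<Rightarrow> ('g exterior \<Rightarrow> 'm) set) lie_rep"
  where "cohomology V \<pi> = direct_sum_rep (cohomology_degree V \<pi>)"

definition boundary :: "('g::complex_vector \<Rightarrow> 'm \<Rightarrow> 'm::complex_vector) \<Rightarrow>
    ('m, 'g exterior) tensor \<Rightarrow> ('m, 'g exterior) tensor"
  where "boundary \<pi> = tensor_lift (\<lambda>v. ext_lift UNIV
    (\<lambda>ys. \<Sum>i<length ys. (- 1) ^ i *\<^sub>C (\<pi> (ys ! i) v \<otimes>\<^sub>C wedge (omit i ys))))"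

(* In degree 0 the boundary map is 0, so that the kernel is the whole space. *)
definition homology_degree :: "'g::complex_lie_algebra set \<Rightarrow>
    ('g \<Rightarrow> 'm \<Rightarrow> 'm::complex_vector) \<Rightarrow> nat \<Rightarrow> ('g, ('m, 'g exterior) tensor set) lie_rep"
  where "homology_degree V \<pi> k = quot_rep
    {x \<in> tensor_subspace (ext_power V k). boundary \<pi> x = 0}
    (boundary \<pi> ` tensor_subspace (ext_power V (Suc k)))
    (diagonal_action \<pi> ext_ad)"

definition homology :: "'g::complex_lie_algebra set \<Rightarrow>
    ('g \<Rightarrow> 'm \<Rightarrow> 'm::complex_vector) \<Rightarrow> ('g, nat \<Rightarrow> ('m, 'g exterior) tensor set) lie_rep"
  where "homology V \<pi> = direct_sum_rep (homology_degree V \<pi>)"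

end

theory Submission
  imports Defs
begin

text \<open>
  Let \<open>e\<^sub>1, \<dots>, e\<^sub>n\<close> be a basis of \<open>p\<^sup>+\<close> that is orthonormal for the positive form \<open>\<langle>x, \<sigma> y\<rangle>\<close>, where
  \<open>\<sigma>\<close> is the conjugation of \<open>g\<close> with respect to the real form. Since the weights of \<open>p\<^sup>+\<close> are positive and those
  of \<open>p\<^sup>-\<close> negative, \<open>\<sigma>\<close> exchanges \<open>p\<^sup>+\<close> and \<open>p\<^sup>-\<close>, so the \<open>\<sigma> e\<^sub>j\<close> are the dual basis. The Dirac operator is
  \<open>D = C + C'\<close> with \<open>C = \<Sum> e\<^sub>j \<otimes> (\<sigma> e\<^sub>j \<and> -)\<close> and \<open>C' = \<Sum> \<sigma> e\<^sub>j \<otimes> \<iota>(e\<^sub>j)\<close>. Under the duality of \<open>\<Lambda> p\<^sup>-\<close> and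
  \<open>\<Lambda> p\<^sup>+\<close> the operator \<open>C\<close> is the coboundary of the cohomology of \<open>p\<^sup>+\<close>, and \<open>C'\<close> is the boundary of the homology
  of \<open>p\<^sup>-\<close>. Unitarity gives a positive definite form for which \<open>C' = - C\<^sup>*\<close>; the operators commute with
  \<open>t\<close>, and a regular element of \<open>t\<close> acts on \<open>M \<otimes> \<Lambda> p\<^sup>-\<close> with finite-dimensional eigenspaces because \<open>M\<close> is in
  category O. Finite-dimensional Hodge theory then identifies \<open>ker D\<close> with all three (co)homologies.
  The spin action of \<open>x \<in> k\<close> on \<open>\<Lambda> p\<^sup>-\<close> is the adjoint action plus \<open>tr (ad x | p\<^sup>+) / 2\<close>, and this character
  is \<open>\<rho> - \<rho>\<^sub>k\<close> on \<open>t\<close> because the root spaces in \<open>p\<^sup>+\<close> are one-dimensional.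
\<close>

subsection \<open>Linear algebra\<close>

text \<open>The obstacle is that M is infinite-dimensional and carries no completeness, so skewness
  of D alone does not split the space into kernel and image. It does show that D D u = 0 forces D u
  = 0; on each finite-dimensional eigenspace of the regular element, D is then bijective on its own
  image, whence u = v + D (D y) with D v = 0. The same positivity applied to C and C' turns ker D
  into the intersection of their kernels, which makes the kernel graded although D is not
  homogeneous. Exterior algebras are quotients of a free space on lists. Operators on them are
  therefore built by recursion over lists, and identities are checked one factor at a time; the
  positive form and the duality with cochains are likewise obtained by splitting off one dual pair
  e, \<sigma> e at a time. The one-dimensionality of the root spaces rests on the three-step grading
  p-, k, p+: the third power of ad e vanishes for e in p+ or p-, and this replaces a full discussion
  of weight strings.\<close>

lemma clinearI:
  assumes "\<And>x y. f (x + y) = f x + f y" "\<And>c x. f (c *\<^sub>C x) = c *\<^sub>C f x"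
  shows "clinear f"
  using assms by (simp add: clinear_iff)

lemma clinear_sum:
  assumes "clinear f"
  shows "f (sum g A) = (\<Sum>i\<in>A. f (g i))"
proof -
  interpret Vector_Spaces.linear scaleC scaleC f by (fact assms)
  show ?thesis by (rule sum)
qed

lemma clinear_neg:
  assumes "clinear f"
  shows "f (- x) = - f x"
  using clinear_simps(2)[OF assms, of 0 x] clinear_simps(4)[OF assms] by simp

lemma clinear_id: "clinear (\<lambda>x. x)"
  by (rule clinearI) simp_all

lemma clinear_compose: "clinear f \<Longrightarrow> clinear g \<Longrightarrow> clinear (\<lambda>x. f (g x))"
  by (rule clinearI) (simp_all add: clinear_simps)

lemma clinear_add: "clinear f \<Longrightarrow> clinear g \<Longrightarrow> clinear (\<lambda>x. f x + g x)"
  by (rule clinearI) (simp_all add: clinear_simps scaleC_add_right)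

lemma clinear_minus: "clinear f \<Longrightarrow> clinear (\<lambda>x. f x - g x)" if "clinear g"
  using that by (intro clinearI) (simp_all add: clinear_simps complex_vector.scale_right_diff_distrib)

lemma clinear_scale: "clinear f \<Longrightarrow> clinear (\<lambda>x. c *\<^sub>C f x)"
  by (rule clinearI) (simp_all add: clinear_simps scaleC_add_right scaleC_scaleC mult.commute)

lemma clinear_sum_fun: "(\<And>i. i \<in> A \<Longrightarrow> clinear (f i)) \<Longrightarrow> clinear (\<lambda>x. \<Sum>i\<in>A. f i x)"
  by (rule clinearI) (simp_all add: clinear_simps sum.distrib complex_vector.scale_sum_right cong: sum.cong)

lemma scaleC_complex_eq [simp]: "c *\<^sub>C d = c * d" for d :: complex
  by (simp add: scaleC_complex_def)

lemma scaleC_minus1_left: "(- 1) *\<^sub>C x = - x"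
  by (simp add: scaleC_one)

lemma clinear_image_span_subset:
  assumes "clinear f" "f ` S \<subseteq> cspan T"
  shows "f ` cspan S \<subseteq> cspan T"
proof -
  interpret Vector_Spaces.linear scaleC scaleC f by (fact assms)
  have "f ` cspan S = cspan (f ` S)"
    using span_image by (simp add: cspan_def)
  then show ?thesis
    using assms(2) by (metis complex_vector.span_span complex_vector.span_mono)
qed

lemma span_subspace_eq: "csubspace W \<Longrightarrow> cspan W = W"
  by (metis complex_vector.span_minimal complex_vector.span_superset subset_antisym subset_refl)

lemma clinear_eq_on_span:
  assumes "clinear f" "clinear g" "\<And>x. x \<in> S \<Longrightarrow> f x = g x" "x \<in> cspan S"
  shows "f x = g x"
  using clinear_vanishes_on_span[OF clinear_minus[OF assms(2,1)], of S x] assms by simp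

lemma finite_span_subset:
  assumes "finite_dim W" "W = cspan S"
  shows "\<exists>F. finite F \<and> F \<subseteq> S \<and> cspan F = W"
proof -
  obtain B where B: "finite B" "cspan B = W"
    using assms(1) by (auto simp: finite_dim_def)
  have "\<exists>F. finite F \<and> F \<subseteq> S \<and> x \<in> cspan F" if "x \<in> B" for x
  proof -
    have "x \<in> cspan S" using that B assms(2) complex_vector.span_base by blast
    then obtain t r where "finite t" "t \<subseteq> S" "x = (\<Sum>a\<in>t. r a *\<^sub>C a)"
      by (auto simp: complex_vector.span_explicit)
    then show ?thesis
      by (intro exI[of _ t] conjI) (simp_all add: complex_vector.span_sum complex_vector.span_scale complex_vector.span_base)
  qed
  then obtain F where F: "\<And>x. x \<in> B \<Longrightarrow> finite (F x) \<and> F x \<subseteq> S \<and> x \<in> cspan (F x)"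
    by metis
  let ?F = "\<Union>x\<in>B. F x"
  have "cspan ?F = W"
  proof
    show "cspan ?F \<subseteq> W"
      unfolding assms(2) by (rule complex_vector.span_mono) (use F in blast)
    have "B \<subseteq> cspan ?F"
      using F complex_vector.span_mono[of "F _" ?F] by blast
    then show "W \<subseteq> cspan ?F"
      unfolding B(2)[symmetric] by (rule complex_vector.span_minimal) simp
  qed
  then show ?thesis using F B(1) by (intro exI[of _ ?F]) auto
qed

lemma finite_dim_subspace:
  assumes "finite_dim V" "csubspace W" "W \<subseteq> V"
  shows "finite_dim W"
proof -
  obtain F where F: "finite F" "cspan F = V"
    using assms(1) by (auto simp: finite_dim_def)
  obtain B where B: "B \<subseteq> W" "complex_vector.independent B" "W \<subseteq> cspan B"
    using complex_vector.maximal_independent_subset[of W] by blast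
  have "finite B"
    using complex_vector.independent_span_bound[OF F(1) B(2)] F(2) B(1) assms(3) by blast
  moreover have "cspan B = W"
    using B assms(2) complex_vector.span_minimal by blast
  ultimately show ?thesis by (auto simp: finite_dim_def)
qed

lemma finite_dim_span: "finite S \<Longrightarrow> finite_dim (cspan S)"
  by (auto simp: finite_dim_def)

lemma finite_dim_injective_surjective:
  assumes fd: "finite_dim W" and W: "csubspace W" and f: "clinear f" and fW: "f ` W \<subseteq> W"
    and inj: "\<And>x. x \<in> W \<Longrightarrow> f x = 0 \<Longrightarrow> x = 0"
  shows "f ` W = W"
proof -
  interpret f: Vector_Spaces.linear scaleC scaleC f by (fact f)
  obtain B where B: "B \<subseteq> W" "complex_vector.independent B" "W \<subseteq> cspan B"
    using complex_vector.maximal_independent_subset[of W] by blast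
  have WB: "cspan B = W" using B W complex_vector.span_minimal by blast
  obtain F where F: "finite F" "cspan F = W"
    using fd by (auto simp: finite_dim_def)
  have finB: "finite B"
    using complex_vector.independent_span_bound[OF F(1) B(2)] F(2) B(1) by blast
  have inj_on: "inj_on f W"
  proof (rule inj_onI)
    fix x y assume "x \<in> W" "y \<in> W" "f x = f y"
    then have "x - y \<in> W" "f (x - y) = 0"
      using W by (simp_all add: complex_vector.subspace_diff f.diff)
    then show "x = y" using inj by fastforce
  qed
  have ind: "complex_vector.independent (f ` B)"
    using f.independent_injective_image[OF B(2)] inj_on WB by (simp add: cspan_def)
  have "f ` B \<subseteq> cspan B" using fW B(1) WB by blast
  have "card (f ` B) = card B"
    by (rule card_image) (use inj_on B(1) inj_on_subset in blast)
  have "W \<subseteq> cspan (f ` B)"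
  proof
    fix w assume w: "w \<in> W"
    show "w \<in> cspan (f ` B)"
    proof (rule ccontr)
      assume nw: "w \<notin> cspan (f ` B)"
      then have "complex_vector.independent (insert w (f ` B))"
        using ind complex_vector.independent_insertI by blast
      from complex_vector.independent_span_bound[OF finB this] \<open>f ` B \<subseteq> cspan B\<close> w WB
      have "card (insert w (f ` B)) \<le> card B" by blast
      moreover have "w \<notin> f ` B" using nw complex_vector.span_base by blast
      ultimately show False using finB \<open>card (f ` B) = card B\<close> by simp
    qed
  qed
  also have "\<dots> = f ` W"
    using f.span_image[of B] WB by (simp add: cspan_def)
  finally show ?thesis using fW by blast
qed

subsection \<open>Trace and Killing form\<close>

lemma cextend_basis_props:
  shows "complex_vector.independent (cextend_basis ({} :: 'a::complex_vector set))"
    and "cspan (cextend_basis ({} :: 'a set)) = UNIV"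
  using complex_vector.independent_extend_basis[of "{} :: 'a set"]
    complex_vector.span_extend_basis[of "{} :: 'a set"] complex_vector.independent_empty
  by (auto simp: cextend_basis_def)

lemma clinear_crepresentation:
  assumes "complex_vector.independent B" "cspan B = (UNIV :: 'a::complex_vector set)"
  shows "clinear (\<lambda>v. crepresentation B v b)"
  using assms complex_vector.representation_add[of B] complex_vector.representation_scale[of B]
  by (intro clinearI) auto

lemma crepresentation_sum:
  assumes "complex_vector.independent B" "cspan B = (UNIV :: 'a::complex_vector set)" "finite B"
  shows "v = (\<Sum>b\<in>B. crepresentation B v b *\<^sub>C b)"
  using complex_vector.sum_representation_eq[of B v B] assms by auto

lemma ctrace_add: "ctrace (\<lambda>x. f x + g x) = ctrace f + ctrace g"
  by (simp add: ctrace_def sum.distrib clinear_simps[OF clinear_crepresentation[OF cextend_basis_props]])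

lemma ctrace_scale: "ctrace (\<lambda>x. c *\<^sub>C f x) = c * ctrace f"
  by (simp add: ctrace_def sum_distrib_left clinear_simps[OF clinear_crepresentation[OF cextend_basis_props]])

lemma ctrace_minus: "ctrace (\<lambda>x. f x - g x) = ctrace f - ctrace g"
  by (simp add: ctrace_def sum_subtractf clinear_simps[OF clinear_crepresentation[OF cextend_basis_props]])

lemma ctrace_commute:
  fixes f g :: "'a::complex_vector \<Rightarrow> 'a"
  assumes f: "clinear f" and g: "clinear g"
  shows "ctrace (\<lambda>x. f (g x)) = ctrace (\<lambda>x. g (f x))"
proof (cases "finite (cextend_basis ({} :: 'a set))")
  case True
  let ?B = "cextend_basis ({} :: 'a set)"
  note rep = crepresentation_sum[OF cextend_basis_props True]
  note lin = clinear_crepresentation[OF cextend_basis_props]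
  have *: "ctrace (\<lambda>x. f (g x))
      = (\<Sum>b\<in>?B. \<Sum>c\<in>?B. crepresentation ?B (g b) c * crepresentation ?B (f c) b)"
    if "clinear f" for f g :: "'a \<Rightarrow> 'a"
  proof -
    have "crepresentation ?B (f (g b)) b
        = (\<Sum>c\<in>?B. crepresentation ?B (g b) c * crepresentation ?B (f c) b)" for b
      by (subst rep[of "g b"])
        (simp add: clinear_sum[OF that] clinear_simps[OF that] clinear_sum[OF lin] clinear_simps[OF lin])
    then show ?thesis by (simp add: ctrace_def)
  qed
  show ?thesis
    unfolding *[OF f] *[OF g] by (subst sum.swap) (simp add: mult.commute)
\<comment> \<open>If the chosen basis is infinite, both traces are sums over an infinite set and
  hence 0.\<close>
qed (simp add: ctrace_def)

text \<open>Expanding each v i in the fixed basis and exchanging the two finite sums moves the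
  coefficient functionals d i past f. This lets the trace be computed in another basis with its
  coordinate functionals, in particular in the conjugate of the fixed basis.\<close>

lemma ctrace_frame:
  fixes f :: "'a::complex_vector \<Rightarrow> 'a"
  assumes f: "clinear f" and I: "finite I" and d: "\<And>i. i \<in> I \<Longrightarrow> clinear (d i)"
    and frame: "\<And>x. x = (\<Sum>i\<in>I. d i x *\<^sub>C v i)"
  shows "ctrace f = (\<Sum>i\<in>I. d i (f (v i)))"
proof -
  let ?B = "cextend_basis ({} :: 'a set)"
  have "UNIV \<subseteq> cspan (v ` I)"
  proof
    fix x :: 'a
    show "x \<in> cspan (v ` I)"
      by (subst frame) (intro complex_vector.span_sum complex_vector.span_scale complex_vector.span_base, simp)
  qed
  then have fin: "finite ?B"
    using complex_vector.independent_span_bound[of "v ` I" ?B] I cextend_basis_props by blast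
  note rep = crepresentation_sum[OF cextend_basis_props fin]
  note lin = clinear_crepresentation[OF cextend_basis_props]
  have "ctrace f = (\<Sum>b\<in>?B. crepresentation ?B (f (\<Sum>i\<in>I. d i b *\<^sub>C v i)) b)"
    unfolding ctrace_def using frame by simp
  also have "\<dots> = (\<Sum>b\<in>?B. \<Sum>i\<in>I. d i b * crepresentation ?B (f (v i)) b)"
    by (simp add: clinear_sum[OF f] clinear_simps[OF f] clinear_sum[OF lin] clinear_simps[OF lin])
  also have "\<dots> = (\<Sum>i\<in>I. d i (\<Sum>b\<in>?B. crepresentation ?B (f (v i)) b *\<^sub>C b))"
    by (subst sum.swap) (simp add: clinear_sum[OF d] clinear_simps[OF d] mult.commute)
  also have "\<dots> = (\<Sum>i\<in>I. d i (f (v i)))"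
    using rep by simp
  finally show ?thesis .
qed

lemma clinear_lie_bracket: "clinear (lie_bracket x)"
  by (rule clinearI) (simp_all add: lie_bracket_add_right lie_bracket_scale_right)

lemma clinear_lie_bracket_left: "clinear (\<lambda>x. [x, y]\<^sub>L)"
  by (rule clinearI) (simp_all add: lie_bracket_add_left lie_bracket_scale_left)

lemmas lie_bracket_linear [simp] = clinear_simps[OF clinear_lie_bracket] clinear_simps[OF clinear_lie_bracket_left]
  clinear_neg[OF clinear_lie_bracket] clinear_neg[OF clinear_lie_bracket_left]

lemma lie_bracket_anticommute: "[x, y]\<^sub>L = - [y, x]\<^sub>L"
proof -
  have "[x, y]\<^sub>L + [y, x]\<^sub>L = 0"
    using lie_bracket_self[of "x + y"]
    unfolding lie_bracket_add_left lie_bracket_add_right by (simp add: lie_bracket_self add.commute)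
  then show ?thesis by (simp add: eq_neg_iff_add_eq_0)
qed

lemma lie_bracket_bracket: "[[x, y]\<^sub>L, z]\<^sub>L = [x, [y, z]\<^sub>L]\<^sub>L - [y, [x, z]\<^sub>L]\<^sub>L"
  using lie_bracket_jacobi[of x y z] lie_bracket_anticommute[of z "[x, y]\<^sub>L"]
    lie_bracket_anticommute[of z x]
  by (simp add: algebra_simps eq_neg_iff_add_eq_0)

lemma clinear_killing: "clinear (killing x)"
  by (rule clinearI) (simp_all add: killing_def ctrace_add ctrace_scale)

lemma clinear_killing_left: "clinear (\<lambda>x. killing x y)"
  by (rule clinearI) (simp_all add: killing_def ctrace_add ctrace_scale)

lemmas killing_linear [simp] = clinear_simps[OF clinear_killing] clinear_simps[OF clinear_killing_left]
  clinear_neg[OF clinear_killing] clinear_neg[OF clinear_killing_left]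

lemma killing_commute: "killing x y = killing y x"
  unfolding killing_def by (rule ctrace_commute) (rule clinear_lie_bracket)+

lemma killing_invariant: "killing [x, y]\<^sub>L z = killing x [y, z]\<^sub>L"
proof -
  have "ctrace (\<lambda>w. [y, [x, [z, w]\<^sub>L]\<^sub>L]\<^sub>L) = ctrace (\<lambda>w. [x, [z, [y, w]\<^sub>L]\<^sub>L]\<^sub>L)"
    using ctrace_commute[OF clinear_lie_bracket[of y]
        clinear_compose[OF clinear_lie_bracket[of x] clinear_lie_bracket[of z]]] by simp
  then show ?thesis
    by (simp add: killing_def lie_bracket_bracket ctrace_minus)
qed

lemma killing_invariant': "killing [x, y]\<^sub>L z = - killing y [x, z]\<^sub>L"
  by (subst lie_bracket_anticommute) (simp only: killing_linear killing_invariant)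

subsection \<open>Components of weight vectors\<close>

lemma span_UN_sum:
  assumes "v \<in> cspan (\<Union>i. R i)"
  shows "\<exists>S r. finite S \<and> (\<forall>i\<in>S. r i \<in> cspan (R i)) \<and> v = (\<Sum>i\<in>S. r i)"
  using assms
proof (induction rule: complex_vector.span_induct_alt)
  case base
  show ?case by (rule exI[of _ "{}"]) simp
next
  case (step c x y)
  then obtain S r where S: "finite S" "\<forall>i\<in>S. r i \<in> cspan (R i)" "y = (\<Sum>i\<in>S. r i)"
    by blast
  from step obtain i where i: "x \<in> R i" by blast
  define r' where "r' = (\<lambda>j. (if j \<in> S then r j else 0) + (if j = i then c *\<^sub>C x else 0))"
  have "c *\<^sub>C x + y = (\<Sum>j\<in>insert i S. r' j)"
  proof -
    have "(\<Sum>j\<in>insert i S. if j \<in> S then r j else 0) = (\<Sum>j\<in>S. r j)"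
      by (rule sum.mono_neutral_cong_right) (use S(1) in auto)
    moreover have "(\<Sum>j\<in>insert i S. if j = i then c *\<^sub>C x else 0) = c *\<^sub>C x"
      using S(1) by (subst sum.delta) auto
    ultimately show ?thesis
      unfolding r'_def sum.distrib S(3) by (simp only: add.commute)
  qed
  moreover have "r' j \<in> cspan (R j)" if "j \<in> insert i S" for j
    unfolding r'_def using S(2) i that
    by (intro complex_vector.span_add) (auto intro: complex_vector.span_scale complex_vector.span_base complex_vector.span_zero)
  ultimately show ?case
    using S(1) by (intro exI[of _ "insert i S"] exI[of _ r']) auto
qed

text \<open>The operator \<open>T\<^sub>h - \<nu> h\<close> kills the component of weight \<open>\<nu>\<close> and rescales the others.\<close>

lemma weight_component_in_invariant:
  fixes \<pi> :: "'g \<Rightarrow> 'v \<Rightarrow> 'v::complex_vector"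
  assumes lin: "\<And>h. h \<in> t \<Longrightarrow> clinear (\<pi> h)"
    and W: "csubspace W" "\<And>h w. h \<in> t \<Longrightarrow> w \<in> W \<Longrightarrow> \<pi> h w \<in> W"
    and u: "u \<in> weight_space \<pi> t \<mu>"
    and S: "finite S"
  shows "(\<And>i. i \<in> S \<Longrightarrow> v i \<in> weight_space \<pi> t (m i)) \<Longrightarrow>
    (\<And>i. i \<in> S \<Longrightarrow> \<exists>h\<in>t. m i h \<noteq> \<mu> h) \<Longrightarrow> u + (\<Sum>i\<in>S. v i) \<in> W \<Longrightarrow> u \<in> W"
  using S
proof (induction S arbitrary: v rule: finite_induct)
  case empty
  then show ?case by simp
next
  case (insert i S)
  obtain h where h: "h \<in> t" "m i h \<noteq> \<mu> h" using insert.prems(2) by blast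
  let ?x = "u + (\<Sum>j\<in>insert i S. v j)"
  let ?c = "\<mu> h - m i h"
  \<comment> \<open>Dividing by \<open>\<mu> h - m i h\<close> restores the coefficient 1 of u, so
    the induction hypothesis applies with the other vectors rescaled and \<open>v i\<close>
    gone.\<close>
  define v' where "v' = (\<lambda>j. ((m j h - m i h) / ?c) *\<^sub>C v j)"
  have *: "\<pi> h u = \<mu> h *\<^sub>C u" "\<And>j. j \<in> insert i S \<Longrightarrow> \<pi> h (v j) = m j h *\<^sub>C v j"
    using u insert.prems(1) h by (auto simp: weight_space_def)
  have "\<pi> h ?x - m i h *\<^sub>C ?x = \<mu> h *\<^sub>C u - m i h *\<^sub>C u + (\<Sum>j\<in>insert i S. m j h *\<^sub>C v j - m i h *\<^sub>C v j)"
    using * by (simp add: clinear_simps[OF lin[OF h(1)]] clinear_sum[OF lin[OF h(1)]]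
        scaleC_add_right complex_vector.scale_sum_right sum_subtractf del: sum.insert)
  also have "\<dots> = ?c *\<^sub>C u + (\<Sum>j\<in>S. (m j h - m i h) *\<^sub>C v j)"
    using insert.hyps by (simp add: complex_vector.scale_left_diff_distrib)
  finally have "(1 / ?c) *\<^sub>C (\<pi> h ?x - m i h *\<^sub>C ?x) = u + (\<Sum>j\<in>S. v' j)"
    using h by (simp add: v'_def scaleC_add_right complex_vector.scale_sum_right scaleC_scaleC scaleC_one)
  moreover have "(1 / ?c) *\<^sub>C (\<pi> h ?x - m i h *\<^sub>C ?x) \<in> W"
    using W h insert.prems(3)
    by (simp add: complex_vector.subspace_scale complex_vector.subspace_diff)
  ultimately have "u + (\<Sum>j\<in>S. v' j) \<in> W" by simp
  moreover have "v' j \<in> weight_space \<pi> t (m j)" if "j \<in> S" for j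
    using insert.prems(1)[of j] that lin
    by (auto simp: v'_def weight_space_def clinear_simps scaleC_scaleC mult.commute)
  ultimately show ?case
    using insert.IH[of v'] insert.prems(2) by blast
qed

text \<open>The components come from the ambient space, and each is isolated inside W by
  \<open>weight_component_in_invariant\<close>; W itself may be infinite-dimensional. The hypothesis
  \<open>distinct\<close> provides the separating elements of t.\<close>

lemma weight_decomposition_in_invariant:
  fixes \<pi> :: "'g \<Rightarrow> 'v \<Rightarrow> 'v::complex_vector"
  assumes lin: "\<And>h. h \<in> t \<Longrightarrow> clinear (\<pi> h)"
    and W: "csubspace W" "\<And>h w. h \<in> t \<Longrightarrow> w \<in> W \<Longrightarrow> \<pi> h w \<in> W"
    and distinct: "\<And>\<alpha> \<beta>. \<alpha> \<in> A \<Longrightarrow> \<beta> \<in> A \<Longrightarrow> \<alpha> \<noteq> \<beta> \<Longrightarrow> \<exists>h\<in>t. \<alpha> h \<noteq> \<beta> h"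
    and w: "w \<in> W" "w \<in> cspan (\<Union>\<alpha>\<in>A. weight_space \<pi> t \<alpha>)"
  shows "\<exists>S r. finite S \<and> S \<subseteq> A \<and> (\<forall>\<alpha>\<in>S. r \<alpha> \<in> weight_space \<pi> t \<alpha> \<inter> W) \<and> w = (\<Sum>\<alpha>\<in>S. r \<alpha>)"
proof -
  \<comment> \<open>Indices outside A receive the empty set, so that \<open>span_UN_sum\<close>
    applies to a union over all indices; the corresponding summands lie in the span of the empty set
    and vanish.\<close>
  define R where "R = (\<lambda>\<alpha>. if \<alpha> \<in> A then weight_space \<pi> t \<alpha> else {})"
  have "(\<Union>\<alpha>\<in>A. weight_space \<pi> t \<alpha>) = (\<Union>\<alpha>. R \<alpha>)"
    by (auto simp: R_def split: if_splits)
  with span_UN_sum[of w R] w obtain S r where S: "finite S" "\<forall>\<alpha>\<in>S. r \<alpha> \<in> cspan (R \<alpha>)" "w = (\<Sum>\<alpha>\<in>S. r \<alpha>)"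
    by auto
  have sub: "csubspace (weight_space \<pi> t \<alpha>)" for \<alpha>
    unfolding complex_vector.subspace_def weight_space_def
    by (auto simp: lin clinear_simps scaleC_add_right scaleC_scaleC mult.commute)
  let ?S = "S \<inter> A"
  have out: "r \<alpha> = 0" if "\<alpha> \<in> S - ?S" for \<alpha>
  proof -
    have "R \<alpha> = {}" "\<alpha> \<in> S" using that by (auto simp: R_def)
    then have "r \<alpha> \<in> cspan {}" using S(2) by fastforce
    then show ?thesis by simp
  qed
  have in': "r \<alpha> \<in> weight_space \<pi> t \<alpha>" if "\<alpha> \<in> ?S" for \<alpha>
  proof -
    have "r \<alpha> \<in> cspan (weight_space \<pi> t \<alpha>)" using that S(2) by (auto simp: R_def)
    then show ?thesis using span_subspace_eq[OF sub] by blast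
  qed
  have sum: "w = (\<Sum>\<alpha>\<in>?S. r \<alpha>)"
    unfolding S(3) by (rule sum.mono_neutral_right) (use S out in auto)
  have "r \<alpha> \<in> W" if "\<alpha> \<in> ?S" for \<alpha>
  proof (rule weight_component_in_invariant[OF lin W in'[OF that], where S = "?S - {\<alpha>}" and v = r and m = "\<lambda>x. x"])
    show "finite (?S - {\<alpha>})" using S by simp
    show "\<exists>h\<in>t. i h \<noteq> \<alpha> h" if "i \<in> ?S - {\<alpha>}" for i
      using distinct[of i \<alpha>] that \<open>\<alpha> \<in> ?S\<close> by blast
    show "r \<alpha> + sum r (?S - {\<alpha>}) \<in> W"
      using w(1) that S(1) unfolding sum by (simp add: sum.remove)
  qed (use in' in auto)
  then show ?thesis using S(1) in' sum by (intro exI[of _ ?S] exI[of _ r]) auto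
qed

definition eigenspace :: "('v::complex_vector \<Rightarrow> 'v) \<Rightarrow> complex \<Rightarrow> 'v set"
  where "eigenspace T c = {v. T v = c *\<^sub>C v}"

text \<open>A single operator is regarded as an action of the one-element type \<open>unit\<close>;
  its weights are functions from \<open>unit\<close> to the scalars, that is, eigenvalues.\<close>

lemma eigen_decomposition_in_invariant:
  assumes T: "clinear T" and W: "csubspace W" "\<And>w. w \<in> W \<Longrightarrow> T w \<in> W"
    and w: "w \<in> W" "w \<in> cspan (\<Union>c. eigenspace T c)"
  shows "\<exists>S r. finite S \<and> (\<forall>c\<in>S. r c \<in> eigenspace T c \<inter> W) \<and> w = (\<Sum>c\<in>S. r c)"
proof -
  have ws: "weight_space (\<lambda>_. T) {()} (\<lambda>_. c) = eigenspace T c" for c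
    by (simp add: weight_space_def eigenspace_def)
  have "(\<Union>\<alpha>\<in>UNIV. weight_space (\<lambda>_. T) {()} \<alpha>) = (\<Union>c. eigenspace T c)"
    by (auto simp: weight_space_def eigenspace_def) 
  then have "\<exists>S r. finite S \<and> S \<subseteq> UNIV \<and> (\<forall>\<alpha>\<in>S. r \<alpha> \<in> weight_space (\<lambda>_. T) {()} \<alpha> \<inter> W) \<and> w = (\<Sum>\<alpha>\<in>S. r \<alpha>)"
    using weight_decomposition_in_invariant[of "{()}" "\<lambda>_. T" W UNIV w] assms by (auto simp: fun_eq_iff)
  then obtain S r where S: "finite S" "\<forall>\<alpha>\<in>S. r \<alpha> \<in> weight_space (\<lambda>_. T) {()} \<alpha> \<inter> W" "w = (\<Sum>\<alpha>\<in>S. r \<alpha>)"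
    by blast
  let ?ev = "\<lambda>\<alpha>::unit \<Rightarrow> complex. \<alpha> ()"
  have inj: "inj_on ?ev S" by (auto simp: inj_on_def fun_eq_iff)
  have cst: "(\<lambda>_. \<alpha> ()) = \<alpha>" for \<alpha> :: "unit \<Rightarrow> complex" by (simp add: fun_eq_iff)
  show ?thesis
  proof (intro exI conjI)
    show "finite (?ev ` S)" using S by simp
    show "\<forall>c\<in>?ev ` S. r (\<lambda>_. c) \<in> eigenspace T c \<inter> W"
      using S(2) by (auto simp: cst weight_space_def eigenspace_def)
    show "w = (\<Sum>c\<in>?ev ` S. r (\<lambda>_. c))"
      using S(3) by (simp add: sum.reindex[OF inj] cst)
  qed
qed

text \<open>Eigenvectors for different eigenvalues are independent, so only the generators of
  eigenvalue c contribute to y. This is how an eigenspace inherits a finite spanning set from a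
  spanning family of eigenvectors.\<close>

lemma eigenspace_span:
  assumes T: "clinear T" and R: "\<And>c. R c \<subseteq> eigenspace T c"
    and y: "y \<in> cspan (\<Union>c. R c)" "y \<in> eigenspace T c"
  shows "y \<in> cspan (R c)"
proof -
  have sub: "csubspace (eigenspace T c)" for c
    unfolding complex_vector.subspace_def eigenspace_def
    by (auto simp: clinear_simps[OF T] scaleC_add_right scaleC_scaleC mult.commute)
  obtain S r where S: "finite S" "\<forall>i\<in>S. r i \<in> cspan (R i)" "y = (\<Sum>i\<in>S. r i)"
    using span_UN_sum[OF y(1)] by blast
  have r: "r i \<in> eigenspace T i" if "i \<in> S" for i
    using S(2) that complex_vector.span_minimal[OF R, of i] sub by auto
  define r' where "r' = (if c \<in> S then r c else 0)"
  have "r' - y = 0"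
  proof -
    \<comment> \<open>With {0} as the invariant subspace, the component lemma becomes the
      independence of eigenvectors for distinct eigenvalues.\<close>
    have "r' - y \<in> {0}"
    proof (rule weight_component_in_invariant[where \<pi> = "\<lambda>_. T" and t = "{()}" and \<mu> = "\<lambda>_. c"
          and S = "S - {c}" and v = r and m = "\<lambda>i _. i"])
      have "(\<Sum>i\<in>S. r i) = r' + sum r (S - {c})"
        using S(1) by (simp add: r'_def sum.remove)
      then show "r' - y + sum r (S - {c}) \<in> {0}" using S(3) by simp
      have "r' \<in> eigenspace T c" using r sub[of c] by (auto simp: r'_def complex_vector.subspace_0)
      then show "r' - y \<in> weight_space (\<lambda>_. T) {()} (\<lambda>_. c)"
        using y(2) by (simp add: weight_space_def eigenspace_def clinear_simps[OF T] complex_vector.scale_right_diff_distrib)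
    qed (use S T r in \<open>auto simp: weight_space_def eigenspace_def clinear_simps\<close>)
    then show ?thesis by simp
  qed
  then have "y = r'" by simp
  then show ?thesis
    using S(2) by (auto simp: r'_def complex_vector.span_zero)
qed

subsection \<open>Operators on the exterior algebra\<close>

lemma ext_algebra_UNIV: "ext_algebra UNIV = UNIV"
  unfolding ext_algebra_eq by (auto intro: exterior.abs_induct)

lemma span_wedge: "cspan (range (wedge :: 'a::complex_vector list \<Rightarrow> _)) = UNIV"
proof -
  have "{wedge xs |xs. xs \<in> lists (UNIV :: 'a set)} = range wedge" by auto
  then show ?thesis using ext_algebra_UNIV[where 'a = 'a] by (simp add: ext_algebra_def)
qed

lemma exterior_eqI:
  assumes "clinear f" "clinear g" "\<And>xs. f (wedge xs) = g (wedge xs)"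
  shows "f w = g w"
  using clinear_eq_on_span[OF assms(1,2), of "range wedge" w] assms(3) span_wedge by auto

lemma wedge_add: "wedge (xs @ (x + y) # ys) = wedge (xs @ x # ys) + wedge (xs @ y # ys)"
proof -
  have "Poly_Mapping.single (xs @ [x + y] @ ys) 1 - Poly_Mapping.single (xs @ [x] @ ys) 1
       - Poly_Mapping.single (xs @ [y] @ ys) (1::complex) \<in> exterior_relations"
    unfolding exterior_relations_def by blast
  then show ?thesis
    unfolding wedge.abs_eq plus_exterior.abs_eq abs_exterior_eq_iff diff_diff_eq[symmetric]
    using complex_vector.span_base by fastforce
qed

lemma wedge_scale: "wedge (xs @ (c *\<^sub>C x) # ys) = c *\<^sub>C wedge (xs @ x # ys)"
proof -
  have "Poly_Mapping.single (xs @ [c *\<^sub>C x] @ ys) 1 - c *\<^sub>C Poly_Mapping.single (xs @ [x] @ ys) (1::complex)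
      \<in> exterior_relations"
    unfolding exterior_relations_def by blast
  then show ?thesis
    unfolding wedge.abs_eq scaleC_exterior.abs_eq abs_exterior_eq_iff
    using complex_vector.span_base by fastforce
qed

lemma wedge_alternating: "wedge (xs @ x # x # ys) = 0"
proof -
  have "Poly_Mapping.single (xs @ [x, x] @ ys) (1::complex) \<in> exterior_relations"
    unfolding exterior_relations_def by blast
  then show ?thesis
    unfolding wedge.abs_eq zero_exterior.abs_eq abs_exterior_eq_iff
    using complex_vector.span_base by fastforce
qed

text \<open>The recursion carries multilinearity and alternation from the tail to the whole list,
  because A only sees the wedge of the tail and B is linear. Only a repetition in the first two
  places remains, and this is what \<open>alt\<close> controls. Contraction, adjoint action, pairing
  and boundary are all instances.\<close>

lemma alternating_on_cons_rec:
  fixes f :: "'a::complex_vector list \<Rightarrow> 'v::complex_vector"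
  assumes rec: "\<And>a xs. f (a # xs) = A a (wedge xs) + B a (f xs)"
    and A: "\<And>a. clinear (A a)" "\<And>w. clinear (\<lambda>a. A a w)"
    and B: "\<And>a. clinear (B a)" "\<And>xs. clinear (\<lambda>a. B a (f xs))"
    and alt: "\<And>a xs. A a (wedge (a # xs)) + B a (A a (wedge xs)) = 0" "\<And>a xs. B a (B a (f xs)) = 0"
  shows "alternating_on UNIV f"
proof -
  note simps = clinear_simps[OF A(1)] clinear_simps[OF A(2)] clinear_simps[OF B(1)] clinear_simps[OF B(2)]
  have "f (xs @ (x + y) # ys) = f (xs @ x # ys) + f (xs @ y # ys)" for xs x y ys
  proof (induction xs)
    case Nil
    show ?case by (simp add: rec simps)
  next
    case (Cons a xs)
    then show ?case by (simp add: rec simps wedge_add)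
  qed
  moreover have "f (xs @ (c *\<^sub>C x) # ys) = c *\<^sub>C f (xs @ x # ys)" for xs c x ys
  proof (induction xs)
    case Nil
    show ?case by (simp add: rec simps scaleC_add_right)
  next
    case (Cons a xs)
    then show ?case by (simp add: rec simps wedge_scale scaleC_add_right)
  qed
  moreover have "f (xs @ x # x # ys) = 0" for xs x ys
  proof (induction xs)
    case Nil
    show ?case using alt[of x ys] by (simp add: rec simps add.assoc[symmetric])
  next
    case (Cons a xs)
    then show ?case by (simp add: rec simps wedge_alternating)
  qed
  ultimately show ?thesis by (simp add: alternating_on_def)
qed

lemma clinear_ext_lift:
  assumes "alternating_on UNIV f"
  shows "clinear (ext_lift UNIV f)"
  using ext_lift_add[OF complex_vector.subspace_UNIV assms] ext_lift_scale[OF complex_vector.subspace_UNIV assms]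
  by (intro clinearI) (simp_all add: ext_algebra_UNIV)

lemma ext_lift_UNIV_wedge:
  assumes "alternating_on UNIV f"
  shows "ext_lift UNIV f (wedge xs) = f xs"
  by (rule ext_lift_wedge[OF complex_vector.subspace_UNIV assms]) auto

lemma alternating_on_wedge_Cons: "alternating_on UNIV (\<lambda>ys. wedge (y # ys))"
  using wedge_add[of "y # _"] wedge_scale[of "y # _"] wedge_alternating[of "y # _"]
  by (simp add: alternating_on_def)

lemma ext_mult_wedge [simp]: "ext_mult y (wedge ys) = wedge (y # ys)"
  by (simp add: ext_mult_def ext_lift_UNIV_wedge[OF alternating_on_wedge_Cons])

lemma clinear_ext_mult: "clinear (ext_mult y)"
  unfolding ext_mult_def by (rule clinear_ext_lift[OF alternating_on_wedge_Cons])

lemma clinear_ext_mult_left: "clinear (\<lambda>y. ext_mult y w)"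
proof (rule clinearI)
  show "ext_mult (x + y) w = ext_mult x w + ext_mult y w" for x y
    by (rule exterior_eqI[of "ext_mult (x + y)" "\<lambda>w. ext_mult x w + ext_mult y w"])
      (use wedge_add[of "[]"] in \<open>simp_all add: clinear_ext_mult clinear_add\<close>)
  show "ext_mult (c *\<^sub>C x) w = c *\<^sub>C ext_mult x w" for c x
    by (rule exterior_eqI[of "ext_mult (c *\<^sub>C x)" "\<lambda>w. c *\<^sub>C ext_mult x w"])
      (use wedge_scale[of "[]"] in \<open>simp_all add: clinear_ext_mult clinear_scale\<close>)
qed

lemmas ext_mult_linear [simp] = clinear_simps[OF clinear_ext_mult] clinear_simps[OF clinear_ext_mult_left]
  clinear_neg[OF clinear_ext_mult] clinear_neg[OF clinear_ext_mult_left]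

lemma ext_mult_square: "ext_mult y (ext_mult y w) = 0"
  by (rule exterior_eqI[of "\<lambda>w. ext_mult y (ext_mult y w)" "\<lambda>_. 0"])
    (use wedge_alternating[of "[]"] in \<open>simp_all add: clinear_compose clinear_ext_mult clinearI\<close>)

lemma ext_mult_anticommute: "ext_mult x (ext_mult y w) = - ext_mult y (ext_mult x w)"
proof -
  have "ext_mult x (ext_mult y w) + ext_mult y (ext_mult x w) = 0"
    using ext_mult_square[of "x + y" w] by (simp add: ext_mult_square add.commute)
  then show ?thesis by (simp add: eq_neg_iff_add_eq_0)
qed

lemma omit_Cons [simp]: "omit 0 (x # xs) = xs" "omit (Suc i) (x # xs) = x # omit i xs"
  by (simp_all add: omit_def)

lemma alternating_on_contraction:
  "alternating_on UNIV (\<lambda>ys. \<Sum>i<length ys. ((- 1) ^ i * killing x (ys ! i)) *\<^sub>C wedge (omit i ys))"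
  (is "alternating_on UNIV ?f")
proof (rule alternating_on_cons_rec[where A = "\<lambda>a w. killing x a *\<^sub>C w" and B = "\<lambda>a w. - ext_mult a w"])
  show "?f (a # xs) = killing x a *\<^sub>C wedge xs + - ext_mult a (?f xs)" for a xs
    by (simp add: sum.lessThan_Suc_shift clinear_sum[OF clinear_ext_mult] sum_negf
        complex_vector.scale_minus_left del: sum.lessThan_Suc)
  show "killing x a *\<^sub>C wedge (a # xs) + - ext_mult a (killing x a *\<^sub>C wedge xs) = 0" for a xs
    by simp
qed (simp_all add: clinearI scaleC_add_right scaleC_add_left scaleC_scaleC mult.commute ext_mult_square)

lemma clinear_contraction: "clinear (contraction x)"
  unfolding contraction_def by (rule clinear_ext_lift[OF alternating_on_contraction])

lemma contraction_wedge:
  "contraction x (wedge ys) = (\<Sum>i<length ys. ((- 1) ^ i * killing x (ys ! i)) *\<^sub>C wedge (omit i ys))"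
  unfolding contraction_def by (rule ext_lift_UNIV_wedge[OF alternating_on_contraction])

lemma contraction_Nil [simp]: "contraction x (wedge []) = 0"
  by (simp add: contraction_wedge)

text \<open>Splitting off the summand i = 0 and shifting the others by one place flips their signs.
  The resulting rule is the Clifford relation between contractions and exterior
  multiplications.\<close>

lemma contraction_ext_mult:
  "contraction x (ext_mult y w) = killing x y *\<^sub>C w - ext_mult y (contraction x w)"
proof (rule exterior_eqI[of "\<lambda>w. contraction x (ext_mult y w)"])
  show "clinear (\<lambda>w. contraction x (ext_mult y w))"
    by (intro clinear_compose[OF clinear_contraction] clinear_ext_mult)
  show "clinear (\<lambda>w. killing x y *\<^sub>C w - ext_mult y (contraction x w))"
    by (intro clinear_minus clinear_scale clinear_id clinear_compose[OF clinear_ext_mult] clinear_contraction)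
  show "contraction x (ext_mult y (wedge ys))
      = killing x y *\<^sub>C wedge ys - ext_mult y (contraction x (wedge ys))" for ys
    by (simp add: contraction_wedge sum.lessThan_Suc_shift clinear_sum[OF clinear_ext_mult] sum_negf
        complex_vector.scale_minus_left del: sum.lessThan_Suc)
qed

lemma contraction_Cons:
  "contraction x (wedge (y # ys)) = killing x y *\<^sub>C wedge ys - ext_mult y (contraction x (wedge ys))"
  using contraction_ext_mult[of x y "wedge ys"] by simp

text \<open>Products are built up one factor at a time from the empty product, so an operator
  identity follows from the commutation rules of both sides with \<open>ext_mult\<close>.\<close>

lemma exterior_cons_eqI:
  assumes "clinear f" "clinear g" "f (wedge []) = g (wedge [])"
    and "\<And>x xs. f (wedge xs) = g (wedge xs) \<Longrightarrow> f (ext_mult x (wedge xs)) = g (ext_mult x (wedge xs))"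
  shows "f w = g w"
proof (rule exterior_eqI[OF assms(1,2)])
  show "f (wedge xs) = g (wedge xs)" for xs
    by (induction xs) (use assms(3,4) in auto)
qed

lemma clinear_contraction_left: "clinear (\<lambda>x. contraction x w)"
proof (rule clinearI)
  show "contraction (x + y) w = contraction x w + contraction y w" for x y
    by (rule exterior_cons_eqI[of "contraction (x + y)" "\<lambda>w. contraction x w + contraction y w"])
      (simp_all only: clinear_contraction clinear_add contraction_Nil contraction_ext_mult
        killing_linear scaleC_add_left ext_mult_linear, simp_all)
  show "contraction (c *\<^sub>C x) w = c *\<^sub>C contraction x w" for c x
    by (rule exterior_cons_eqI[of "contraction (c *\<^sub>C x)" "\<lambda>w. c *\<^sub>C contraction x w"])
      (simp_all only: clinear_contraction clinear_scale contraction_Nil contraction_ext_mult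
        killing_linear ext_mult_linear scaleC_scaleC scaleC_complex_eq, simp_all add: complex_vector.scale_right_diff_distrib scaleC_scaleC)
qed

lemmas contraction_linear [simp] = clinear_simps[OF clinear_contraction] clinear_simps[OF clinear_contraction_left]
  clinear_neg[OF clinear_contraction] clinear_neg[OF clinear_contraction_left]

lemmas clinear_intros = clinear_compose[OF clinear_contraction] clinear_compose[OF clinear_ext_mult]
  clinear_add clinear_minus clinear_scale clinear_id clinear_contraction clinear_ext_mult

lemma contraction_anticommute: "contraction x (contraction y w) = - contraction y (contraction x w)"
proof (rule exterior_cons_eqI[of "\<lambda>w. contraction x (contraction y w)"])
  show "clinear (\<lambda>w. - contraction y (contraction x w))"
    using clinear_scale[OF clinear_compose[OF clinear_contraction clinear_contraction], of "- 1" y x]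
    by (simp add: scaleC_one)
qed (simp_all only: contraction_ext_mult contraction_linear contraction_Nil ext_mult_linear clinear_intros, simp_all)

lemma contraction_square: "contraction x (contraction x w) = 0"
proof -
  have "(2::complex) *\<^sub>C contraction x (contraction x w) = 0"
    using contraction_anticommute[of x x w] scaleC_add_left[of 1 1 "contraction x (contraction x w)"]
    by (simp add: scaleC_one eq_neg_iff_add_eq_0)
  then show ?thesis by simp
qed

lemma alternating_on_ext_ad:
  "alternating_on UNIV (\<lambda>ys. \<Sum>i<length ys. wedge (ys[i := [x, ys ! i]\<^sub>L]))"
  (is "alternating_on UNIV ?f")
proof (rule alternating_on_cons_rec[where A = "\<lambda>a w. ext_mult [x, a]\<^sub>L w" and B = "\<lambda>a w. ext_mult a w"])
  show "?f (a # xs) = ext_mult [x, a]\<^sub>L (wedge xs) + ext_mult a (?f xs)" for a xs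
    by (simp add: sum.lessThan_Suc_shift clinear_sum[OF clinear_ext_mult] del: sum.lessThan_Suc)
  show "ext_mult [x, a]\<^sub>L (wedge (a # xs)) + ext_mult a (ext_mult [x, a]\<^sub>L (wedge xs)) = 0" for a xs
    using ext_mult_anticommute[of a "[x, a]\<^sub>L" "wedge xs"] by simp
qed (simp_all add: clinearI ext_mult_square)

lemma clinear_ext_ad: "clinear (ext_ad x)"
  unfolding ext_ad_def by (rule clinear_ext_lift[OF alternating_on_ext_ad])

lemma ext_ad_wedge: "ext_ad x (wedge ys) = (\<Sum>i<length ys. wedge (ys[i := [x, ys ! i]\<^sub>L]))"
  unfolding ext_ad_def by (rule ext_lift_UNIV_wedge[OF alternating_on_ext_ad])

lemma ext_ad_Nil [simp]: "ext_ad x (wedge []) = 0"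
  by (simp add: ext_ad_wedge)

lemma ext_ad_ext_mult: "ext_ad x (ext_mult y w) = ext_mult [x, y]\<^sub>L w + ext_mult y (ext_ad x w)"
proof (rule exterior_eqI[of "\<lambda>w. ext_ad x (ext_mult y w)"])
  show "clinear (\<lambda>w. ext_ad x (ext_mult y w))"
    by (intro clinear_compose[OF clinear_ext_ad] clinear_ext_mult)
  show "clinear (\<lambda>w. ext_mult [x, y]\<^sub>L w + ext_mult y (ext_ad x w))"
    by (intro clinear_add clinear_ext_mult clinear_compose[OF clinear_ext_mult] clinear_ext_ad)
  show "ext_ad x (ext_mult y (wedge ys)) = ext_mult [x, y]\<^sub>L (wedge ys) + ext_mult y (ext_ad x (wedge ys))" for ys
    by (simp add: ext_ad_wedge sum.lessThan_Suc_shift clinear_sum[OF clinear_ext_mult] del: sum.lessThan_Suc)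
qed

lemma clinear_ext_ad_left: "clinear (\<lambda>x. ext_ad x w)"
proof (rule clinearI)
  show "ext_ad (x + y) w = ext_ad x w + ext_ad y w" for x y
    by (rule exterior_cons_eqI[of "ext_ad (x + y)" "\<lambda>w. ext_ad x w + ext_ad y w"])
      (simp_all only: clinear_ext_ad clinear_add ext_ad_Nil ext_ad_ext_mult
        lie_bracket_linear ext_mult_linear, simp_all)
  show "ext_ad (c *\<^sub>C x) w = c *\<^sub>C ext_ad x w" for c x
    by (rule exterior_cons_eqI[of "ext_ad (c *\<^sub>C x)" "\<lambda>w. c *\<^sub>C ext_ad x w"])
      (simp_all only: clinear_ext_ad clinear_scale ext_ad_Nil ext_ad_ext_mult
        lie_bracket_linear ext_mult_linear, simp_all add: scaleC_add_right)
qed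

lemmas ext_ad_linear [simp] = clinear_simps[OF clinear_ext_ad] clinear_simps[OF clinear_ext_ad_left]
  clinear_neg[OF clinear_ext_ad] clinear_neg[OF clinear_ext_ad_left]

lemma ext_ad_bracket: "ext_ad [x, y]\<^sub>L w = ext_ad x (ext_ad y w) - ext_ad y (ext_ad x w)"
proof (rule exterior_cons_eqI[of "ext_ad [x, y]\<^sub>L"])
  show "clinear (\<lambda>w. ext_ad x (ext_ad y w) - ext_ad y (ext_ad x w))"
    by (intro clinear_minus clinear_compose[OF clinear_ext_ad] clinear_ext_ad)
qed (simp_all only: ext_ad_ext_mult ext_ad_linear ext_ad_Nil ext_mult_linear clinear_ext_ad lie_bracket_bracket, simp_all)

text \<open>Commuting both sides past a factor z leaves the scalar terms, which match by the
  invariance of the Killing form.\<close>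

lemma ext_ad_contraction: "ext_ad x (contraction y w) = contraction [x, y]\<^sub>L w + contraction y (ext_ad x w)"
proof (rule exterior_cons_eqI[of "\<lambda>w. ext_ad x (contraction y w)"])
  show "clinear (\<lambda>w. ext_ad x (contraction y w))"
    by (intro clinear_compose[OF clinear_ext_ad] clinear_contraction)
  show "clinear (\<lambda>w. contraction [x, y]\<^sub>L w + contraction y (ext_ad x w))"
    by (intro clinear_add clinear_contraction clinear_compose[OF clinear_contraction] clinear_ext_ad)
qed (simp_all only: contraction_ext_mult ext_ad_ext_mult contraction_linear ext_ad_linear
    contraction_Nil ext_ad_Nil ext_mult_linear killing_invariant', simp_all add: complex_vector.scale_minus_left)

text \<open>The coefficient of the empty product, that is, the projection to degree 0. It serves as
  the last step of the pairing.\<close>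

definition ext_vac :: "'a::complex_vector exterior \<Rightarrow> complex"
  where "ext_vac = ext_lift UNIV (\<lambda>xs. if xs = [] then 1 else 0)"

lemma alternating_on_vac: "alternating_on UNIV (\<lambda>xs. if xs = [] then 1 else (0::complex))"
  by (simp add: alternating_on_def)

lemma clinear_ext_vac: "clinear ext_vac"
  unfolding ext_vac_def by (rule clinear_ext_lift[OF alternating_on_vac])

lemmas ext_vac_linear [simp] = clinear_simps[OF clinear_ext_vac] clinear_neg[OF clinear_ext_vac]

lemma ext_vac_wedge: "ext_vac (wedge xs) = (if xs = [] then 1 else 0)"
  unfolding ext_vac_def by (rule ext_lift_UNIV_wedge[OF alternating_on_vac])

lemma clinear_zero: "clinear (\<lambda>_. 0)"
  by (rule clinearI) simp_all

lemma ext_vac_ext_mult [simp]: "ext_vac (ext_mult x w) = 0"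
  by (rule exterior_eqI[of "\<lambda>w. ext_vac (ext_mult x w)" "\<lambda>_. 0"])
    (simp_all add: ext_vac_wedge clinear_compose[OF clinear_ext_vac clinear_ext_mult] clinear_zero)

lemma ext_vac_ext_ad [simp]: "ext_vac (ext_ad x w) = 0"
  by (rule exterior_cons_eqI[of "\<lambda>w. ext_vac (ext_ad x w)" "\<lambda>_. 0"])
    (simp_all add: ext_ad_ext_mult clinear_compose[OF clinear_ext_vac clinear_ext_ad] clinear_zero
      del: ext_mult_wedge)

text \<open>Degrees are handled by these projectors, so that membership in an exterior power becomes
  the fixed-point equation \<open>ext_proj k w = w\<close>.\<close>

definition ext_proj :: "nat \<Rightarrow> 'a::complex_vector exterior \<Rightarrow> 'a exterior"
  where "ext_proj k = ext_lift UNIV (\<lambda>xs. if length xs = k then wedge xs else 0)"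

lemma alternating_on_proj: "alternating_on UNIV (\<lambda>xs. if length xs = k then wedge xs else 0)"
  by (simp add: alternating_on_def wedge_add wedge_scale wedge_alternating)

lemma clinear_ext_proj: "clinear (ext_proj k)"
  unfolding ext_proj_def by (rule clinear_ext_lift[OF alternating_on_proj])

lemmas ext_proj_linear [simp] = clinear_simps[OF clinear_ext_proj] clinear_neg[OF clinear_ext_proj]

lemma ext_proj_wedge: "ext_proj k (wedge xs) = (if length xs = k then wedge xs else 0)"
  unfolding ext_proj_def by (rule ext_lift_UNIV_wedge[OF alternating_on_proj])

lemma ext_proj_ext_mult: "ext_proj (Suc k) (ext_mult x w) = ext_mult x (ext_proj k w)"
  by (rule exterior_eqI[of "\<lambda>w. ext_proj (Suc k) (ext_mult x w)"])
    (simp_all add: ext_proj_wedge clinear_compose clinear_ext_proj clinear_ext_mult)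

lemma ext_proj_0_ext_mult: "ext_proj 0 (ext_mult x w) = 0"
  by (rule exterior_eqI[of "\<lambda>w. ext_proj 0 (ext_mult x w)"])
    (simp_all add: ext_proj_wedge clinear_compose clinear_ext_proj clinear_ext_mult clinear_zero)

lemma length_omit: "i < length xs \<Longrightarrow> length (omit i xs) = length xs - 1"
  by (simp add: omit_def)

lemma ext_proj_contraction: "ext_proj k (contraction x w) = contraction x (ext_proj (Suc k) w)"
  by (rule exterior_eqI[of "\<lambda>w. ext_proj k (contraction x w)"])
    (auto simp: ext_proj_wedge clinear_compose clinear_ext_proj clinear_contraction contraction_wedge
      clinear_sum[OF clinear_ext_proj] length_omit intro!: sum.cong sum.neutral)

lemma contraction_ext_proj_0: "contraction x (ext_proj 0 w) = 0"
  by (rule exterior_eqI[of "\<lambda>w. contraction x (ext_proj 0 w)"])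
    (auto simp: ext_proj_wedge clinear_compose clinear_ext_proj clinear_contraction clinear_zero)

lemma ext_proj_ext_ad: "ext_proj k (ext_ad x w) = ext_ad x (ext_proj k w)"
  by (rule exterior_eqI[of "\<lambda>w. ext_proj k (ext_ad x w)"])
    (auto simp: ext_proj_wedge clinear_compose clinear_ext_proj clinear_ext_ad ext_ad_wedge
      clinear_sum[OF clinear_ext_proj] intro!: sum.cong sum.neutral)

lemma ext_vac_ext_proj: "ext_vac (ext_proj k w) = (if k = 0 then ext_vac w else 0)"
  by (rule exterior_eqI[of "\<lambda>w. ext_vac (ext_proj k w)"]; cases "k = 0")
    (auto simp: ext_proj_wedge ext_vac_wedge clinear_compose clinear_ext_proj clinear_ext_vac clinear_zero)

lemma ext_proj_ext_proj: "ext_proj k (ext_proj l w) = (if k = l then ext_proj l w else 0)"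
  by (rule exterior_eqI[of "\<lambda>w. ext_proj k (ext_proj l w)"]; cases "k = l")
    (auto simp: ext_proj_wedge clinear_compose clinear_ext_proj clinear_zero)

text \<open>On products of equal length this is the determinant of the matrix of the
  \<open>killing x_i y_j\<close>: contracting with the first entry first expands along the first
  row. The order also makes exterior multiplication by x on the left side adjoint to contraction by
  x on the right side.\<close>

definition ext_pair :: "'g::complex_lie_algebra exterior \<Rightarrow> 'g exterior \<Rightarrow> complex"
  where "ext_pair = ext_lift UNIV (\<lambda>xs u. ext_vac (fold contraction xs u))"

lemma clinear_fold_contraction: "clinear (fold contraction xs)"
proof (induction xs)
  case Nil
  show ?case by (simp add: id_def clinear_id)
next
  case (Cons x xs)
  then show ?case by (simp add: comp_def clinear_compose clinear_contraction)
qed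

lemma alternating_on_pair: "alternating_on UNIV (\<lambda>xs u. ext_vac (fold contraction xs u))"
  (is "alternating_on UNIV ?f")
\<comment> \<open>The values are functions of u and form a vector space themselves, so a single
  recursion treats all u; passing to a longer list precomposes with a contraction.\<close>
proof (rule alternating_on_cons_rec[where A = "\<lambda>_ _. 0" and B = "\<lambda>a F u. F (contraction a u)"])
  show "clinear (\<lambda>a u. ?f xs (contraction a u))" for xs
    by (rule clinearI) (simp_all add: fun_eq_iff plus_fun_def scaleC_fun_def
        clinear_simps[OF clinear_fold_contraction])
qed (simp_all add: fun_eq_iff plus_fun_def zero_fun_def scaleC_fun_def clinearI contraction_square
      clinear_simps[OF clinear_fold_contraction])

lemma clinear_ext_pair': "clinear ext_pair"
  unfolding ext_pair_def by (rule clinear_ext_lift[OF alternating_on_pair])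

lemma clinear_ext_pair_left: "clinear (\<lambda>w. ext_pair w u)"
  by (rule clinearI) (simp_all add: clinear_simps[OF clinear_ext_pair'] scaleC_fun_def)

lemma ext_pair_wedge: "ext_pair (wedge xs) u = ext_vac (fold contraction xs u)"
  unfolding ext_pair_def ext_lift_UNIV_wedge[OF alternating_on_pair] ..

lemma clinear_ext_pair: "clinear (ext_pair w)"
proof (rule clinearI)
  show "ext_pair w (x + y) = ext_pair w x + ext_pair w y" for x y
    by (rule exterior_eqI[of "\<lambda>w. ext_pair w (x + y)"])
      (simp_all add: clinear_ext_pair_left clinear_add ext_pair_wedge clinear_simps[OF clinear_fold_contraction])
  show "ext_pair w (c *\<^sub>C x) = c *\<^sub>C ext_pair w x" for c x
    by (rule exterior_eqI[of "\<lambda>w. ext_pair w (c *\<^sub>C x)" "\<lambda>w. c *\<^sub>C ext_pair w x"])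
      (simp_all only: clinear_ext_pair_left clinear_scale ext_pair_wedge clinear_simps[OF clinear_fold_contraction] ext_vac_linear)
qed

lemmas ext_pair_linear [simp] = clinear_simps[OF clinear_ext_pair] clinear_simps[OF clinear_ext_pair_left]
  clinear_neg[OF clinear_ext_pair] clinear_neg[OF clinear_ext_pair_left]

lemma ext_pair_Nil [simp]: "ext_pair (wedge []) u = ext_vac u"
  by (simp add: ext_pair_wedge)

lemma ext_pair_ext_mult: "ext_pair (ext_mult x w) u = ext_pair w (contraction x u)"
  by (rule exterior_eqI[of "\<lambda>w. ext_pair (ext_mult x w) u"])
    (simp_all add: clinear_compose[OF clinear_ext_pair_left] clinear_ext_mult clinear_ext_pair_left ext_pair_wedge)

lemma ext_pair_ext_ad: "ext_pair (ext_ad x w) u = - ext_pair w (ext_ad x u)"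
proof -
  have "\<forall>u. ext_pair (ext_ad x (wedge xs)) u = - ext_pair (wedge xs) (ext_ad x u)" for xs
  proof (induction xs)
    case Nil
    show ?case by simp
  next
    case (Cons y ys)
    then show ?case
      by (simp only: ext_mult_wedge[symmetric] ext_ad_ext_mult ext_pair_linear ext_pair_ext_mult ext_ad_contraction) simp
  qed
  moreover have "clinear (\<lambda>w. - ext_pair w (ext_ad x u))"
    by (rule clinearI) simp_all
  ultimately show ?thesis
    using exterior_eqI[OF clinear_compose[OF clinear_ext_pair_left clinear_ext_ad]] by blast
qed

lemma ext_pair_ext_proj:
  fixes w u :: "'a::complex_lie_algebra exterior"
  shows "ext_pair (ext_proj k w) u = ext_pair w (ext_proj k u)"
proof -
  have "\<forall>k u. ext_pair (ext_proj k (wedge xs)) u = ext_pair (wedge xs) (ext_proj k u)"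
    for xs :: "'a list"
  proof (induction xs)
    case Nil
    show ?case by (simp add: ext_proj_wedge ext_vac_ext_proj)
  next
    case (Cons y ys)
    have "ext_pair (ext_proj k (wedge (y # ys))) u = ext_pair (wedge (y # ys)) (ext_proj k u)" for k u
      using Cons
      by (cases k) (simp_all only: ext_mult_wedge[symmetric] ext_proj_0_ext_mult ext_proj_ext_mult
          ext_pair_ext_mult contraction_ext_proj_0 ext_proj_contraction ext_pair_linear)
    then show ?case by blast
  qed
  then show ?thesis
    using exterior_eqI[OF clinear_compose[OF clinear_ext_pair_left clinear_ext_proj] clinear_ext_pair_left] by blast
qed

text \<open>Every element is a finite combination of products of lists, so its degrees are bounded
  even if the underlying space is infinite-dimensional.\<close>

lemma ext_proj_sum: "\<exists>N. w = (\<Sum>k<N. ext_proj k w) \<and> (\<forall>k\<ge>N. ext_proj k w = 0)"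
proof -
  have "w \<in> cspan (range wedge)" by (simp add: span_wedge)
  then show ?thesis
  proof (induction rule: complex_vector.span_induct_alt)
    case base
    show ?case by simp
  next
    case (step c x y)
    then obtain xs N where x: "x = wedge xs" and N: "y = (\<Sum>k<N. ext_proj k y)" "\<forall>k\<ge>N. ext_proj k y = 0" by blast
    let ?N = "max N (Suc (length xs))"
    have "y = (\<Sum>k<?N. ext_proj k y)"
      by (subst N(1), rule sum.mono_neutral_left) (use N(2) in auto)
    moreover have "wedge xs = (\<Sum>k<?N. ext_proj k (wedge xs))"
      by (auto simp: ext_proj_wedge less_max_iff_disj)
    ultimately have "c *\<^sub>C x + y = (\<Sum>k<?N. ext_proj k (c *\<^sub>C x + y))"
      by (simp add: x sum.distrib complex_vector.scale_sum_right[symmetric])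
    moreover have "\<forall>k\<ge>?N. ext_proj k (c *\<^sub>C x + y) = 0"
      using N(2) by (simp add: x ext_proj_wedge)
    ultimately show ?case by blast
  qed
qed

subsection \<open>Tensor products with the exterior algebra\<close>

lemma span_tens: "cspan (range (\<lambda>(x, y). x \<otimes>\<^sub>C y)) = (UNIV :: ('a::complex_vector, 'b::complex_vector) tensor set)"
proof -
  have "abs_tensor p \<in> cspan (range (\<lambda>(x, y). x \<otimes>\<^sub>C y))" for p :: "'a \<times> 'b \<Rightarrow>\<^sub>0 complex"
  proof -
    have "clinear (abs_tensor :: ('a \<times> 'b \<Rightarrow>\<^sub>0 complex) \<Rightarrow> _)"
      by (simp add: clinear_iff plus_tensor.abs_eq scaleC_tensor.abs_eq)
    note lin = clinear_simps[OF this] clinear_sum[OF this]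
    have "p = (\<Sum>z\<in>Poly_Mapping.keys p. Poly_Mapping.lookup p z *\<^sub>C Poly_Mapping.single z 1)"
    proof (rule poly_mapping_eqI)
      fix y
      have "Poly_Mapping.lookup (\<Sum>z\<in>Poly_Mapping.keys p. Poly_Mapping.lookup p z *\<^sub>C Poly_Mapping.single z 1) y
          = (\<Sum>z\<in>Poly_Mapping.keys p. if z = y then Poly_Mapping.lookup p y else 0)"
        unfolding lookup_sum by (rule sum.cong) (auto simp: lookup_scaleC lookup_single when_def)
      then show "Poly_Mapping.lookup p y = Poly_Mapping.lookup
          (\<Sum>z\<in>Poly_Mapping.keys p. Poly_Mapping.lookup p z *\<^sub>C Poly_Mapping.single z 1) y"
        by (simp add: in_keys_iff)
    qed
    then have "abs_tensor p = abs_tensor (\<Sum>z\<in>Poly_Mapping.keys p. Poly_Mapping.lookup p z *\<^sub>C Poly_Mapping.single z 1)"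
      by simp
    also have "\<dots> = (\<Sum>z\<in>Poly_Mapping.keys p. Poly_Mapping.lookup p z *\<^sub>C (fst z \<otimes>\<^sub>C snd z))"
      by (simp add: lin tens.abs_eq)
    also have "\<dots> \<in> cspan (range (\<lambda>(x, y). x \<otimes>\<^sub>C y))"
      by (intro complex_vector.span_sum complex_vector.span_scale complex_vector.span_base) auto
    finally show ?thesis .
  qed
  then show ?thesis by (auto intro: tensor.abs_induct)
qed

lemma tensor_eqI:
  assumes "clinear f" "clinear g" "\<And>x y. f (x \<otimes>\<^sub>C y) = g (x \<otimes>\<^sub>C y)"
  shows "f w = g w"
proof (rule clinear_eq_on_span[OF assms(1,2)])
  show "w \<in> cspan (range (\<lambda>(x, y). x \<otimes>\<^sub>C y))" by (simp add: span_tens)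
qed (use assms(3) in auto)

lemma clinear_tens: "clinear (tens x)"
  by (rule clinearI) (simp_all add: tens_add_right tens_scale_right)

lemma clinear_tens_left: "clinear (\<lambda>x. x \<otimes>\<^sub>C y)"
  by (rule clinearI) (simp_all add: tens_add_left tens_scale_left)

lemmas tens_linear [simp] = clinear_simps[OF clinear_tens] clinear_simps[OF clinear_tens_left]
  clinear_neg[OF clinear_tens] clinear_neg[OF clinear_tens_left]

lemma cbilinear_tensor_map: "clinear A \<Longrightarrow> clinear B \<Longrightarrow> cbilinear (\<lambda>x y. A x \<otimes>\<^sub>C B y)"
  unfolding cbilinear_def
  by (auto intro!: clinearI simp: clinear_simps)

lemma clinear_tensor_map: "clinear A \<Longrightarrow> clinear B \<Longrightarrow> clinear (tensor_map A B)"
  unfolding tensor_map_def by (rule clinear_tensor_lift) (rule cbilinear_tensor_map)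

lemma tensor_map_tens: "clinear A \<Longrightarrow> clinear B \<Longrightarrow> tensor_map A B (x \<otimes>\<^sub>C y) = A x \<otimes>\<^sub>C B y"
  unfolding tensor_map_def by (rule tensor_lift_tens) (rule cbilinear_tensor_map)

lemma tensor_map_compose:
  assumes "clinear A" "clinear B" "clinear A'" "clinear B'"
  shows "tensor_map A B (tensor_map A' B' x) = tensor_map (\<lambda>x. A (A' x)) (\<lambda>x. B (B' x)) x"
  by (rule tensor_eqI[of "\<lambda>x. tensor_map A B (tensor_map A' B' x)"])
    (simp_all add: assms clinear_compose clinear_tensor_map tensor_map_tens)

lemma tensor_map_add_right:
  assumes "clinear A" "clinear B" "clinear B'"
  shows "tensor_map A (\<lambda>x. B x + B' x) x = tensor_map A B x + tensor_map A B' x"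
  by (rule tensor_eqI[of "tensor_map A (\<lambda>x. B x + B' x)"])
    (simp_all add: assms clinear_add clinear_tensor_map tensor_map_tens)

abbreviation lmap :: "('m::complex_vector \<Rightarrow> 'm) \<Rightarrow> ('m, 's::complex_vector) tensor \<Rightarrow> ('m, 's) tensor"
  where "lmap A \<equiv> tensor_map A (\<lambda>x. x)"

abbreviation rmap :: "('s::complex_vector \<Rightarrow> 's) \<Rightarrow> ('m::complex_vector, 's) tensor \<Rightarrow> ('m, 's) tensor"
  where "rmap B \<equiv> tensor_map (\<lambda>x. x) B"

lemma lmap_rmap: "clinear A \<Longrightarrow> clinear B \<Longrightarrow> lmap A (rmap B x) = tensor_map A B x"
  by (simp add: tensor_map_compose clinear_id)

lemma rmap_lmap: "clinear A \<Longrightarrow> clinear B \<Longrightarrow> rmap B (lmap A x) = tensor_map A B x"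
  by (simp add: tensor_map_compose clinear_id)

lemma clinear_rmap: "clinear B \<Longrightarrow> clinear (rmap B)"
  by (rule clinear_tensor_map[OF clinear_id])

lemma clinear_lmap: "clinear A \<Longrightarrow> clinear (lmap A)"
  by (rule clinear_tensor_map[OF _ clinear_id])

definition ewedge :: "'g::complex_lie_algebra \<Rightarrow> ('m::complex_vector, 'g exterior) tensor \<Rightarrow> ('m, 'g exterior) tensor"
  where "ewedge y = rmap (ext_mult y)"

definition econtract :: "'g::complex_lie_algebra \<Rightarrow> ('m::complex_vector, 'g exterior) tensor \<Rightarrow> ('m, 'g exterior) tensor"
  where "econtract y = rmap (contraction y)"

definition ead :: "'g::complex_lie_algebra \<Rightarrow> ('m::complex_vector, 'g exterior) tensor \<Rightarrow> ('m, 'g exterior) tensor"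
  where "ead y = rmap (ext_ad y)"

definition eproj :: "nat \<Rightarrow> ('m::complex_vector, 'g::complex_lie_algebra exterior) tensor \<Rightarrow> ('m, 'g exterior) tensor"
  where "eproj k = rmap (ext_proj k)"

lemma clinear_e:
  fixes y :: "'g::complex_lie_algebra"
  shows "clinear (ewedge y :: ('m::complex_vector, 'g exterior) tensor \<Rightarrow> _)"
    "clinear (econtract y :: ('m, 'g exterior) tensor \<Rightarrow> _)"
    "clinear (ead y :: ('m, 'g exterior) tensor \<Rightarrow> _)"
    "clinear (eproj k :: ('m, 'g exterior) tensor \<Rightarrow> _)"
  unfolding ewedge_def econtract_def ead_def eproj_def
  by (intro clinear_rmap clinear_ext_mult clinear_contraction clinear_ext_ad clinear_ext_proj)+

lemmas e_linear [simp] =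
  clinear_simps[OF clinear_e(1)] clinear_simps[OF clinear_e(2)] clinear_simps[OF clinear_e(3)] clinear_simps[OF clinear_e(4)]
  clinear_neg[OF clinear_e(1)] clinear_neg[OF clinear_e(2)] clinear_neg[OF clinear_e(3)] clinear_neg[OF clinear_e(4)]

lemma e_tens [simp]:
  fixes w :: "'g::complex_lie_algebra exterior"
  shows "ewedge y (m \<otimes>\<^sub>C w) = m \<otimes>\<^sub>C ext_mult y w"
  "econtract y (m \<otimes>\<^sub>C w) = m \<otimes>\<^sub>C contraction y w"
  "ead y (m \<otimes>\<^sub>C w) = m \<otimes>\<^sub>C ext_ad y w"
  "eproj k (m \<otimes>\<^sub>C w) = m \<otimes>\<^sub>C ext_proj k w"
  unfolding ewedge_def econtract_def ead_def eproj_def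
  by (simp_all add: tensor_map_tens clinear_id clinear_ext_mult clinear_contraction clinear_ext_ad clinear_ext_proj)

lemma clinear_e_left:
  fixes x :: "('m::complex_vector, 'g::complex_lie_algebra exterior) tensor"
  shows "clinear (\<lambda>y. ewedge y x)" "clinear (\<lambda>y. econtract y x)" "clinear (\<lambda>y. ead y x)"
proof -
  show "clinear (\<lambda>y. ewedge y x)"
    by (rule clinearI; rule tensor_eqI) (simp_all add: clinear_e clinear_add clinear_scale)
  show "clinear (\<lambda>y. econtract y x)"
    by (rule clinearI; rule tensor_eqI) (simp_all add: clinear_e clinear_add clinear_scale)
  show "clinear (\<lambda>y. ead y x)"
    by (rule clinearI; rule tensor_eqI) (simp_all add: clinear_e clinear_add clinear_scale)
qed

lemmas e_linear_left [simp] = clinear_simps[OF clinear_e_left(1)] clinear_simps[OF clinear_e_left(2)]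
  clinear_simps[OF clinear_e_left(3)] clinear_neg[OF clinear_e_left(1)] clinear_neg[OF clinear_e_left(2)]
  clinear_neg[OF clinear_e_left(3)]

lemma clinear_uminus: "clinear f \<Longrightarrow> clinear (\<lambda>x. - f x)"
  by (rule clinearI) (simp_all add: clinear_simps)

lemmas e_intros = clinear_e clinear_add clinear_minus clinear_scale clinear_uminus clinear_id clinear_zero
  clinear_compose[OF clinear_e(1)] clinear_compose[OF clinear_e(2)] clinear_compose[OF clinear_e(3)]
  clinear_compose[OF clinear_e(4)]

lemma econtract_ewedge: "econtract x (ewedge y u) = killing x y *\<^sub>C u - ewedge y (econtract x u)"
  by (rule tensor_eqI[of "\<lambda>u. econtract x (ewedge y u)" "\<lambda>u. killing x y *\<^sub>C u - ewedge y (econtract x u)"])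
    ((intro e_intros)+, simp add: contraction_ext_mult)

lemma ewedge_anticommute: "ewedge x (ewedge y u) = - ewedge y (ewedge x u)"
  by (rule tensor_eqI[of "\<lambda>u. ewedge x (ewedge y u)" "\<lambda>u. - ewedge y (ewedge x u)"])
    ((intro e_intros)+, simp add: ext_mult_anticommute[of x y])

lemma econtract_anticommute: "econtract x (econtract y u) = - econtract y (econtract x u)"
  by (rule tensor_eqI[of "\<lambda>u. econtract x (econtract y u)" "\<lambda>u. - econtract y (econtract x u)"])
    ((intro e_intros)+, simp add: contraction_anticommute[of x y])

lemma ewedge_square: "ewedge x (ewedge x u) = 0"
  by (rule tensor_eqI[of "\<lambda>u. ewedge x (ewedge x u)" "\<lambda>u. 0"])
    ((intro e_intros)+, simp add: ext_mult_square)

lemma econtract_square: "econtract x (econtract x u) = 0"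
  by (rule tensor_eqI[of "\<lambda>u. econtract x (econtract x u)" "\<lambda>u. 0"])
    ((intro e_intros)+, simp add: contraction_square)

lemma ead_ewedge: "ead x (ewedge y u) = ewedge [x, y]\<^sub>L u + ewedge y (ead x u)"
  by (rule tensor_eqI[of "\<lambda>u. ead x (ewedge y u)" "\<lambda>u. ewedge [x, y]\<^sub>L u + ewedge y (ead x u)"])
    ((intro e_intros)+, simp add: ext_ad_ext_mult)

lemma ead_econtract: "ead x (econtract y u) = econtract [x, y]\<^sub>L u + econtract y (ead x u)"
  by (rule tensor_eqI[of "\<lambda>u. ead x (econtract y u)" "\<lambda>u. econtract [x, y]\<^sub>L u + econtract y (ead x u)"])
    ((intro e_intros)+, simp add: ext_ad_contraction)

lemma ead_bracket: "ead [x, y]\<^sub>L u = ead x (ead y u) - ead y (ead x u)"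
  by (rule tensor_eqI[of "ead [x, y]\<^sub>L" "\<lambda>u. ead x (ead y u) - ead y (ead x u)"])
    ((intro e_intros)+, simp add: ext_ad_bracket)

lemma eproj_ewedge: "eproj (Suc k) (ewedge x u) = ewedge x (eproj k u)"
  by (rule tensor_eqI[of "\<lambda>u. eproj (Suc k) (ewedge x u)" "\<lambda>u. ewedge x (eproj k u)"])
    ((intro e_intros)+, simp add: ext_proj_ext_mult)

lemma eproj_0_ewedge: "eproj 0 (ewedge x u) = 0"
  by (rule tensor_eqI[of "\<lambda>u. eproj 0 (ewedge x u)" "\<lambda>u. 0"])
    ((intro e_intros)+, simp add: ext_proj_0_ext_mult)

lemma eproj_econtract: "eproj k (econtract x u) = econtract x (eproj (Suc k) u)"
  by (rule tensor_eqI[of "\<lambda>u. eproj k (econtract x u)" "\<lambda>u. econtract x (eproj (Suc k) u)"])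
    ((intro e_intros)+, simp add: ext_proj_contraction)

lemma econtract_eproj_0: "econtract x (eproj 0 u) = 0"
  by (rule tensor_eqI[of "\<lambda>u. econtract x (eproj 0 u)" "\<lambda>u. 0"])
    ((intro e_intros)+, simp add: contraction_ext_proj_0)

lemma eproj_ead: "eproj k (ead x u) = ead x (eproj k u)"
  by (rule tensor_eqI[of "\<lambda>u. eproj k (ead x u)" "\<lambda>u. ead x (eproj k u)"])
    ((intro e_intros)+, simp add: ext_proj_ext_ad)

lemma eproj_eproj: "eproj k (eproj l u) = (if k = l then eproj l u else 0)"
  by (cases "k = l"; rule tensor_eqI[of "\<lambda>u. eproj k (eproj l u)"])
    (auto intro!: e_intros simp: ext_proj_ext_proj)

lemma eproj_sum: "\<exists>N. u = (\<Sum>k<N. eproj k u) \<and> (\<forall>k\<ge>N. eproj k u = 0)"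
proof -
  have "u \<in> cspan (range (\<lambda>(x, y). x \<otimes>\<^sub>C y))" by (simp add: span_tens)
  then show ?thesis
  proof (induction rule: complex_vector.span_induct_alt)
    case base
    show ?case by simp
  next
    case (step c x y)
    obtain m w where x: "x = m \<otimes>\<^sub>C w" using step(1) by auto
    obtain N where N: "y = (\<Sum>k<N. eproj k y)" "\<forall>k\<ge>N. eproj k y = 0" using step(2) by blast
    obtain N' where N': "w = (\<Sum>k<N'. ext_proj k w)" "\<forall>k\<ge>N'. ext_proj k w = 0"
      using ext_proj_sum by blast
    let ?N = "max N N'"
    have "y = (\<Sum>k<?N. eproj k y)"
      by (subst N(1), rule sum.mono_neutral_left) (use N(2) in auto)
    moreover have "w = (\<Sum>k<?N. ext_proj k w)"
      by (subst N'(1), rule sum.mono_neutral_left) (use N'(2) in auto)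
    then have "x = (\<Sum>k<?N. eproj k x)"
      by (simp add: x clinear_sum[OF clinear_tens, symmetric])
    ultimately have "c *\<^sub>C x + y = (\<Sum>k<?N. eproj k (c *\<^sub>C x + y))"
      by (simp add: sum.distrib complex_vector.scale_sum_right[symmetric])
    moreover have "\<forall>k\<ge>?N. eproj k (c *\<^sub>C x + y) = 0"
      using N(2) N'(2) by (simp add: x)
    ultimately show ?case by blast
  qed
qed

lemma lmap_e:
  assumes "clinear A"
  shows "lmap A (ewedge y u) = ewedge y (lmap A u)" "lmap A (econtract z u') = econtract z (lmap A u')"
    "lmap A (ead z u') = ead z (lmap A u')" "lmap A (eproj k u) = eproj k (lmap A u)"
  unfolding ewedge_def econtract_def ead_def eproj_def
  by (simp_all add: assms lmap_rmap rmap_lmap clinear_ext_mult clinear_contraction clinear_ext_ad clinear_ext_proj)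

text \<open>The map from M \<otimes> \<Lambda> to Hom (\<Lambda>, M) induced by
  \<open>ext_pair\<close>. Restricted to the exterior algebras of p- and p+ it will identify tensors
  with cochains.\<close>

definition epair :: "('m::complex_vector, 'g::complex_lie_algebra exterior) tensor \<Rightarrow> 'g exterior \<Rightarrow> 'm"
  where "epair x w = tensor_lift (\<lambda>m u. ext_pair w u *\<^sub>C m) x"

lemma cbilinear_epair: "cbilinear (\<lambda>m u. ext_pair w u *\<^sub>C m)"
  unfolding cbilinear_def by (auto intro!: clinearI simp: scaleC_add_right scaleC_add_left scaleC_scaleC mult.commute)

lemma clinear_epair_left: "clinear (\<lambda>x. epair x w)"
  unfolding epair_def by (rule clinear_tensor_lift[OF cbilinear_epair])

lemma epair_tens: "epair (m \<otimes>\<^sub>C u) w = ext_pair w u *\<^sub>C m"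
  unfolding epair_def by (rule tensor_lift_tens[OF cbilinear_epair])

lemma clinear_epair: "clinear (epair x)"
  by (rule clinearI; rule tensor_eqI)
    (simp_all add: clinear_epair_left clinear_add clinear_scale epair_tens scaleC_add_left scaleC_scaleC)

lemmas epair_linear [simp] = clinear_simps[OF clinear_epair] clinear_simps[OF clinear_epair_left]
  clinear_neg[OF clinear_epair] clinear_neg[OF clinear_epair_left]

lemma epair_ext_mult: "epair x (ext_mult y w) = epair (econtract y x) w"
  by (rule tensor_eqI) (auto intro!: clinear_epair_left clinear_compose[OF clinear_epair_left] e_intros
      simp: epair_tens ext_pair_ext_mult)

lemma epair_ext_ad: "epair x (ext_ad y w) = - epair (ead y x) w"
  by (rule tensor_eqI[of "\<lambda>x. epair x (ext_ad y w)" "\<lambda>x. - epair (ead y x) w"])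
   (auto intro!: clinear_epair_left clinear_uminus clinear_compose[OF clinear_epair_left] clinear_e
      simp: epair_tens ext_pair_ext_ad complex_vector.scale_minus_left)

lemma epair_ext_proj: "epair x (ext_proj k w) = epair (eproj k x) w"
  by (rule tensor_eqI) (auto intro!: clinear_epair_left clinear_compose[OF clinear_epair_left] clinear_e
      simp: epair_tens ext_pair_ext_proj)

lemma epair_lmap: "clinear A \<Longrightarrow> epair (lmap A x) w = A (epair x w)"
  by (rule tensor_eqI[of "\<lambda>x. epair (lmap A x) w" "\<lambda>x. A (epair x w)"])
    (auto intro!: clinear_compose[of A] clinear_compose[OF clinear_epair_left] clinear_lmap clinear_epair_left
      simp: epair_tens tensor_map_tens clinear_id clinear_simps)

lemma epair_ewedge_Nil [simp]: "epair (ewedge y x) (wedge []) = 0"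
  by (rule tensor_eqI[of "\<lambda>x. epair (ewedge y x) (wedge [])" "\<lambda>x. 0"])
    (auto intro!: clinear_compose[OF clinear_epair_left] clinear_e clinear_zero simp: epair_tens)

subsection \<open>Exterior algebras of spans\<close>

lemma csubspace_ext_algebra: "csubspace (ext_algebra V)"
  unfolding ext_algebra_def by simp

lemma wedge_in_ext_algebra: "xs \<in> lists V \<Longrightarrow> wedge xs \<in> ext_algebra V"
  unfolding ext_algebra_def by (rule complex_vector.span_base) blast

lemma ext_algebra_mono: "V \<subseteq> W \<Longrightarrow> ext_algebra V \<subseteq> ext_algebra W"
  unfolding ext_algebra_def by (rule complex_vector.span_mono) auto

lemma ext_mult_in_ext_algebra:
  assumes "y \<in> V" "w \<in> ext_algebra V"
  shows "ext_mult y w \<in> ext_algebra V"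
proof -
  have "ext_mult y ` cspan {wedge xs |xs. xs \<in> lists V} \<subseteq> cspan {wedge xs |xs. xs \<in> lists V}"
    by (rule clinear_image_span_subset[OF clinear_ext_mult])
      (use assms(1) in \<open>auto intro!: complex_vector.span_base, metis Cons_in_lists_iff in_listsI lists.Cons\<close>)
  then show ?thesis using assms(2) unfolding ext_algebra_def by blast
qed

lemma ext_algebra_empty:
  assumes "w \<in> ext_algebra (cspan {})"
  shows "\<exists>c. w = c *\<^sub>C wedge []"
proof -
  have "wedge xs \<in> cspan {wedge []}" if "xs \<in> lists {0}" for xs :: "'a list"
  proof (cases xs)
    case (Cons x ys)
    with that have "wedge xs = ext_mult 0 (wedge ys)" by simp
    then show ?thesis by (simp only: ext_mult_linear complex_vector.span_zero)
  qed (simp add: complex_vector.span_base)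
  then have "ext_algebra (cspan {}) \<subseteq> cspan {wedge ([] :: 'a list)}"
    unfolding ext_algebra_def by (intro complex_vector.span_minimal) auto
  then show ?thesis using assms complex_vector.span_singleton[of "wedge []"] by auto
qed

text \<open>Any occurrence of f can be moved to the front by anticommutation, and two occurrences
  cancel. Uniqueness of the two parts is not claimed here; for a dual pair they are recovered later
  by contractions.\<close>

lemma ext_algebra_insert:
  assumes "w \<in> ext_algebra (cspan (insert f S))"
  shows "\<exists>w0\<in>ext_algebra (cspan S). \<exists>w1\<in>ext_algebra (cspan S). w = w0 + ext_mult f w1"
proof -
  let ?A = "ext_algebra (cspan S)"
  note sub = csubspace_ext_algebra[of "cspan S"]
  have "\<exists>w0\<in>?A. \<exists>w1\<in>?A. wedge xs = w0 + ext_mult f w1"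
    if "xs \<in> lists (cspan (insert f S))" for xs
    using that
  proof (induction xs)
    case Nil
    show ?case
      by (rule bexI[of _ "wedge []"], rule bexI[of _ 0])
        (simp_all add: wedge_in_ext_algebra complex_vector.subspace_0[OF sub])
  next
    case (Cons x xs)
    then obtain w0 w1 where w: "w0 \<in> ?A" "w1 \<in> ?A" "wedge xs = w0 + ext_mult f w1" by auto
    from Cons obtain c where c: "x - c *\<^sub>C f \<in> cspan S"
      using complex_vector.span_breakdown_eq by blast
    let ?s = "x - c *\<^sub>C f"
    have "wedge (x # xs) = ext_mult (?s + c *\<^sub>C f) (w0 + ext_mult f w1)"
      using w(3) by (simp flip: ext_mult_wedge)
    \<comment> \<open>The term with f twice vanishes, and moving f in front of \<open>?s\<close>
      accounts for the minus sign.\<close>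
    also have "\<dots> = ext_mult ?s w0 + ext_mult f (c *\<^sub>C w0 - ext_mult ?s w1)"
      unfolding ext_mult_linear by (simp add: ext_mult_square ext_mult_anticommute[of x f] algebra_simps)
    finally show ?case
      using w c ext_mult_in_ext_algebra[OF c]
      by (intro bexI[of _ "ext_mult ?s w0"] bexI[of _ "c *\<^sub>C w0 - ext_mult ?s w1"])
        (simp_all del: ext_mult_linear add: complex_vector.subspace_diff[OF sub] complex_vector.subspace_scale[OF sub])
  qed
  note wedge = this
  have "w \<in> cspan {wedge xs |xs. xs \<in> lists (cspan (insert f S))}"
    using assms by (simp add: ext_algebra_def)
  then show ?thesis
  proof (induction rule: complex_vector.span_induct_alt)
    case base
    then show ?case using complex_vector.subspace_0[OF sub] by force
  next
    case (step c x y)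
    obtain x0 x1 where "x0 \<in> ?A" "x1 \<in> ?A" "x = x0 + ext_mult f x1"
      using step(1) wedge by blast
    moreover obtain y0 y1 where "y0 \<in> ?A" "y1 \<in> ?A" "y = y0 + ext_mult f y1"
      using step by blast
    ultimately show ?case
      by (intro bexI[of _ "c *\<^sub>C x0 + y0"] bexI[of _ "c *\<^sub>C x1 + y1"])
        (simp_all add: complex_vector.subspace_add[OF sub] complex_vector.subspace_scale[OF sub] scaleC_add_right algebra_simps)
  qed
qed

text \<open>Scalars are absorbed into the factor from M, so the induction has no separate case for
  them.\<close>

lemma tensor_subspace_induct [consumes 1, case_names zero step]:
  assumes "x \<in> tensor_subspace W" "P 0"
    and "\<And>m w y. w \<in> W \<Longrightarrow> P y \<Longrightarrow> P (m \<otimes>\<^sub>C w + y)"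
  shows "P x"
  using assms(1) unfolding tensor_subspace_def
proof (induction rule: complex_vector.span_induct_alt)
  case (step c x y)
  then obtain v w where "x = v \<otimes>\<^sub>C w" "w \<in> W" by blast
  then show ?case using assms(3)[of w y "c *\<^sub>C v"] step by simp
qed (rule assms(2))

lemma tens_in_tensor_subspace: "w \<in> W \<Longrightarrow> m \<otimes>\<^sub>C w \<in> tensor_subspace W"
  unfolding tensor_subspace_def by (rule complex_vector.span_base) blast

lemma csubspace_tensor_subspace: "csubspace (tensor_subspace W)"
  unfolding tensor_subspace_def by simp

lemma tensor_map_in_tensor_subspace:
  assumes "clinear A" "clinear B" "\<And>w. w \<in> W \<Longrightarrow> B w \<in> W'" "x \<in> tensor_subspace W"
  shows "tensor_map A B x \<in> tensor_subspace W'"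
  using assms(4)
proof (induction rule: tensor_subspace_induct)
  case zero
  then show ?case
    by (simp add: clinear_simps[OF clinear_tensor_map[OF assms(1,2)]] complex_vector.subspace_0[OF csubspace_tensor_subspace])
next
  case (step m w y)
  then show ?case
    by (simp add: clinear_simps[OF clinear_tensor_map[OF assms(1,2)]] tensor_map_tens assms
        complex_vector.subspace_add[OF csubspace_tensor_subspace] tens_in_tensor_subspace)
qed

lemma tensor_subspace_empty:
  assumes "x \<in> tensor_subspace (ext_algebra (cspan {}))"
  shows "\<exists>m. x = m \<otimes>\<^sub>C wedge []"
  using assms
proof (induction rule: tensor_subspace_induct)
  case zero
  show ?case by (rule exI[of _ 0]) simp
next
  case (step m w y)
  then obtain c m' where "w = c *\<^sub>C wedge []" "y = m' \<otimes>\<^sub>C wedge []"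
    using ext_algebra_empty by blast
  then have "m \<otimes>\<^sub>C w + y = (c *\<^sub>C m + m') \<otimes>\<^sub>C wedge []" by simp
  then show ?case by blast
qed

lemma tensor_subspace_insert:
  assumes "x \<in> tensor_subspace (ext_algebra (cspan (insert f S)))"
  shows "\<exists>x0\<in>tensor_subspace (ext_algebra (cspan S)). \<exists>x1\<in>tensor_subspace (ext_algebra (cspan S)).
    x = x0 + ewedge f x1"
  using assms
proof (induction rule: tensor_subspace_induct)
  case zero
  show ?case using complex_vector.subspace_0[OF csubspace_tensor_subspace] by force
next
  case (step m w y)
  let ?T = "tensor_subspace (ext_algebra (cspan S))"
  from step obtain x0 x1 where "x0 \<in> ?T" "x1 \<in> ?T" "y = x0 + ewedge f x1" by blast
  moreover obtain w0 w1 where "w0 \<in> ext_algebra (cspan S)" "w1 \<in> ext_algebra (cspan S)" "w = w0 + ext_mult f w1"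
    using ext_algebra_insert[OF step(1)] by blast
  ultimately show ?case
    by (intro bexI[of _ "m \<otimes>\<^sub>C w0 + x0"] bexI[of _ "m \<otimes>\<^sub>C w1 + x1"])
      (simp_all add: complex_vector.subspace_add[OF csubspace_tensor_subspace] tens_in_tensor_subspace)
qed

lemma contraction_eq_0:
  assumes "\<And>y. y \<in> V \<Longrightarrow> killing x y = 0" "w \<in> ext_algebra V"
  shows "contraction x w = 0"
proof -
  have "contraction x (wedge ys) = 0" if "ys \<in> lists V" for ys
    using that by (induction ys) (simp_all add: contraction_Cons assms(1))
  with clinear_vanishes_on_span[OF clinear_contraction, of "{wedge xs |xs. xs \<in> lists V}" x w]
  show ?thesis using assms(2) unfolding ext_algebra_def by blast
qed

lemma econtract_eq_0:
  assumes "\<And>y. y \<in> V \<Longrightarrow> killing x y = 0" "u \<in> tensor_subspace (ext_algebra V)"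
  shows "econtract x u = 0"
  using assms(2) by (induction rule: tensor_subspace_induct) (simp_all add: contraction_eq_0[OF assms(1)])

lemma contraction_in_ext_algebra:
  assumes "w \<in> ext_algebra V"
  shows "contraction x w \<in> ext_algebra V"
proof -
  note sub = csubspace_ext_algebra[of V]
  have "contraction x (wedge ys) \<in> ext_algebra V" if "ys \<in> lists V" for ys
    using that
    by (induction ys)
      (simp_all add: contraction_Cons complex_vector.subspace_0[OF sub] complex_vector.subspace_diff[OF sub]
        complex_vector.subspace_scale[OF sub] ext_mult_in_ext_algebra wedge_in_ext_algebra)
  then have "contraction x ` cspan {wedge xs |xs. xs \<in> lists V} \<subseteq> cspan {wedge xs |xs. xs \<in> lists V}"
    by (intro clinear_image_span_subset[OF clinear_contraction]) (auto simp: ext_algebra_def)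
  then show ?thesis using assms unfolding ext_algebra_def by blast
qed

lemma ext_ad_in_ext_algebra:
  assumes "\<And>y. y \<in> V \<Longrightarrow> [x, y]\<^sub>L \<in> V" "w \<in> ext_algebra V"
  shows "ext_ad x w \<in> ext_algebra V"
proof -
  note sub = csubspace_ext_algebra[of V]
  have "ext_ad x (wedge ys) \<in> ext_algebra V" if "ys \<in> lists V" for ys
    using that
  proof (induction ys)
    case (Cons y ys)
    then show ?case
      using ext_ad_ext_mult[of x y "wedge ys"] ext_mult_in_ext_algebra[of "[x, y]\<^sub>L" V "wedge ys"]
      by (simp add: complex_vector.subspace_add[OF sub] ext_mult_in_ext_algebra wedge_in_ext_algebra assms(1))
  qed (simp_all add: complex_vector.subspace_0[OF sub])
  then have "ext_ad x ` cspan {wedge xs |xs. xs \<in> lists V} \<subseteq> cspan {wedge xs |xs. xs \<in> lists V}"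
    by (intro clinear_image_span_subset[OF clinear_ext_ad]) (auto simp: ext_algebra_def)
  then show ?thesis using assms unfolding ext_algebra_def by blast
qed

lemma ext_proj_in_ext_power: "w \<in> ext_algebra V \<Longrightarrow> ext_proj k w \<in> ext_power V k"
proof -
  have "ext_proj k (wedge xs) \<in> ext_power V k" if "xs \<in> lists V" for xs
  proof (cases "length xs = k")
    case True
    then have "wedge xs \<in> ext_power V k"
      unfolding ext_power_def by (intro complex_vector.span_base) (use that in blast)
    then show ?thesis by (simp add: ext_proj_wedge True)
  next
    case False
    then show ?thesis by (simp add: ext_proj_wedge ext_power_def complex_vector.span_zero)
  qed
  then have "ext_proj k ` cspan {wedge xs |xs. xs \<in> lists V} \<subseteq> ext_power V k"
    unfolding ext_power_def by (intro clinear_image_span_subset[OF clinear_ext_proj]) blast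
  then show "w \<in> ext_algebra V \<Longrightarrow> ext_proj k w \<in> ext_power V k"
    unfolding ext_algebra_def by blast
qed

lemma ext_power_eq: "ext_power V k = {w \<in> ext_algebra V. ext_proj k w = w}"
proof
  have "csubspace {w \<in> ext_algebra V. ext_proj k w = w}"
    using csubspace_ext_algebra[of V] by (simp add: complex_vector.subspace_def)
  moreover have "wedge xs \<in> {w \<in> ext_algebra V. ext_proj k w = w}" if "xs \<in> lists V" "length xs = k" for xs
    using wedge_in_ext_algebra[OF that(1)] that(2) by (simp add: ext_proj_wedge)
  ultimately show "ext_power V k \<subseteq> {w \<in> ext_algebra V. ext_proj k w = w}"
    unfolding ext_power_def by (intro complex_vector.span_minimal) blast+
  show "{w \<in> ext_algebra V. ext_proj k w = w} \<subseteq> ext_power V k"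
    using ext_proj_in_ext_power[of _ V k] by (auto, metis)
qed

lemma eproj_in: "u \<in> tensor_subspace (ext_algebra V) \<Longrightarrow> eproj k u \<in> tensor_subspace (ext_power V k)"
  unfolding eproj_def by (rule tensor_map_in_tensor_subspace[OF clinear_id clinear_ext_proj ext_proj_in_ext_power])

lemma tensor_subspace_ext_power_eq:
  "tensor_subspace (ext_power V k) = {u \<in> tensor_subspace (ext_algebra V). eproj k u = u}"
proof
  have "u \<in> tensor_subspace (ext_algebra V) \<and> eproj k u = u" if "u \<in> tensor_subspace (ext_power V k)" for u
    using that
    by (induction rule: tensor_subspace_induct)
      (simp_all add: ext_power_eq complex_vector.subspace_add[OF csubspace_tensor_subspace]
        complex_vector.subspace_0[OF csubspace_tensor_subspace] tens_in_tensor_subspace)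
  then show "tensor_subspace (ext_power V k) \<subseteq> {u \<in> tensor_subspace (ext_algebra V). eproj k u = u}"
    by blast
  show "{u \<in> tensor_subspace (ext_algebra V). eproj k u = u} \<subseteq> tensor_subspace (ext_power V k)"
  proof
    fix u assume "u \<in> {u \<in> tensor_subspace (ext_algebra V). eproj k u = u}"
    then show "u \<in> tensor_subspace (ext_power V k)"
      using eproj_in[of u V k] by simp
  qed
qed

section \<open>The operators C, C', D and the positive form on M \<otimes> \<Lambda> p-\<close>

lemma antisymmetric_sum_eq_0:
  fixes f :: "'i \<Rightarrow> 'i \<Rightarrow> 'v::complex_vector"
  assumes "\<And>i j. i \<in> A \<Longrightarrow> j \<in> A \<Longrightarrow> f i j = - f j i"
  shows "(\<Sum>i\<in>A. \<Sum>j\<in>A. f i j) = 0"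
proof -
  let ?s = "\<Sum>i\<in>A. \<Sum>j\<in>A. f i j"
  have "?s = (\<Sum>i\<in>A. \<Sum>j\<in>A. f j i)" by (rule sum.swap)
  also have "\<dots> = (\<Sum>i\<in>A. \<Sum>j\<in>A. - f i j)" by (intro sum.cong refl assms)
  also have "\<dots> = - ?s" by (simp add: sum_negf)
  finally have "2 *\<^sub>C ?s = 0"
    using scaleC_add_left[of 1 1 ?s] by (simp add: scaleC_one eq_neg_iff_add_eq_0)
  then show ?thesis by simp
qed

lemma hermitian_inner_productD:
  assumes "hermitian_inner_product ip"
  shows "ip (u + v) w = ip u w + ip v w" "ip (c *\<^sub>C u) w = c * ip u w" "ip v u = cnj (ip u v)"
    "ip w (u + v) = ip w u + ip w v" "ip w (c *\<^sub>C u) = cnj c * ip w u"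
    "Re (ip u u) \<ge> 0" "ip 0 w = 0" "ip w 0 = 0" "Re (ip u u) = 0 \<Longrightarrow> u = 0"
proof -
  have add: "ip (u + v) w = ip u w + ip v w" and scale: "ip (c *\<^sub>C u) w = c * ip u w"
    and sym: "ip v u = cnj (ip u v)" and pos: "u \<noteq> 0 \<Longrightarrow> Re (ip u u) > 0" for u v w c
    using assms unfolding hermitian_inner_product_def by blast+
  show "ip (u + v) w = ip u w + ip v w" "ip (c *\<^sub>C u) w = c * ip u w" "ip v u = cnj (ip u v)"
    by (fact add scale sym)+
  show "ip w (u + v) = ip w u + ip w v"
    by (subst sym) (simp add: add sym[of u w] sym[of v w])
  show "ip w (c *\<^sub>C u) = cnj c * ip w u"
    by (subst sym) (simp add: scale sym[of u w])
  show zero: "ip 0 w = 0" for w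
    using scale[of 0 0 w] by simp
  show "ip w 0 = 0"
    by (subst sym) (simp add: zero)
  show "Re (ip u u) \<ge> 0"
    using pos[of u] zero[of 0] by (cases "u = 0") auto
  show "Re (ip u u) = 0 \<Longrightarrow> u = 0"
    using pos[of u] by force
qed

text \<open>The algebraic core in isolation: \<open>es\<close> and its image under \<sigma> are dual
  bases of p+ and p-, and \<open>adjoint\<close> is the unitarity of M expressed through \<sigma>.
  Roots, the real form and category O only enter when the locale is instantiated and when
  eigenvectors in M are supplied.\<close>

locale dirac_setup =
  fixes es :: "'g::complex_lie_algebra list" and \<sigma> :: "'g \<Rightarrow> 'g" and k :: "'g set"
    and \<pi> :: "'g \<Rightarrow> 'm::complex_vector \<Rightarrow> 'm" and ip :: "'m \<Rightarrow> 'm \<Rightarrow> complex"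
  assumes distinct_es: "distinct es"
    and orthonormal: "\<And>e e'. e \<in> set es \<Longrightarrow> e' \<in> set es \<Longrightarrow> killing e (\<sigma> e') = (if e = e' then 1 else 0)"
    and subspace_k: "csubspace k"
    and bracket_k: "\<And>x y. x \<in> k \<Longrightarrow> y \<in> k \<Longrightarrow> [x, y]\<^sub>L \<in> k"
    and k_plus: "\<And>y x. y \<in> k \<Longrightarrow> x \<in> cspan (set es) \<Longrightarrow> [y, x]\<^sub>L \<in> cspan (set es)"
    and k_minus: "\<And>y x. y \<in> k \<Longrightarrow> x \<in> cspan (\<sigma> ` set es) \<Longrightarrow> [y, x]\<^sub>L \<in> cspan (\<sigma> ` set es)"
    and abelian_plus: "\<And>x y. x \<in> set es \<Longrightarrow> y \<in> set es \<Longrightarrow> [x, y]\<^sub>L = 0"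
    and abelian_minus: "\<And>x y. x \<in> set es \<Longrightarrow> y \<in> set es \<Longrightarrow> [\<sigma> x, \<sigma> y]\<^sub>L = 0"
    and clinear_rep: "\<And>x. clinear (\<pi> x)" and clinear_rep_left: "\<And>v. clinear (\<lambda>x. \<pi> x v)"
    and rep_bracket: "\<And>x y v. \<pi> [x, y]\<^sub>L v = \<pi> x (\<pi> y v) - \<pi> y (\<pi> x v)"
    and hermitian: "hermitian_inner_product ip"
    and adjoint: "\<And>e u v. e \<in> set es \<Longrightarrow> ip (\<pi> e u) v = - ip u (\<pi> (\<sigma> e) v)"
begin

abbreviation "pp \<equiv> cspan (set es)"
abbreviation "pm \<equiv> cspan (\<sigma> ` set es)"
abbreviation "TT \<equiv> tensor_subspace (ext_algebra pm) :: ('m, 'g exterior) tensor set"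

definition mact :: "'g \<Rightarrow> ('m, 'g exterior) tensor \<Rightarrow> ('m, 'g exterior) tensor"
  where "mact y = lmap (\<pi> y)"

lemma clinear_mact: "clinear (mact y)"
  unfolding mact_def by (rule clinear_lmap[OF clinear_rep])

lemma mact_tens: "mact y (m \<otimes>\<^sub>C w) = \<pi> y m \<otimes>\<^sub>C w"
  by (simp add: mact_def tensor_map_tens clinear_rep clinear_id)

lemma clinear_mact_left: "clinear (\<lambda>y. mact y u)"
  by (rule clinearI; rule tensor_eqI)
    (simp_all add: clinear_mact clinear_add clinear_scale mact_tens clinear_simps[OF clinear_rep_left])

lemmas mact_linear [simp] = clinear_simps[OF clinear_mact] clinear_simps[OF clinear_mact_left]
  clinear_neg[OF clinear_mact] clinear_neg[OF clinear_mact_left]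

lemma mact_bracket: "mact [x, y]\<^sub>L u = mact x (mact y u) - mact y (mact x u)"
  by (rule tensor_eqI[of "mact [x, y]\<^sub>L" "\<lambda>u. mact x (mact y u) - mact y (mact x u)"])
    (auto intro!: clinear_mact clinear_minus clinear_compose[OF clinear_mact] simp: mact_tens rep_bracket)

lemma mact_commute:
  shows "ewedge x (mact y u) = mact y (ewedge x u)" "econtract x (mact y u) = mact y (econtract x u)"
    "ead x (mact y u) = mact y (ead x u)" "eproj n (mact y u) = mact y (eproj n u)"
  by (simp_all add: mact_def lmap_e clinear_rep)

lemma plus_expansion:
  assumes "x \<in> pp"
  shows "x = (\<Sum>e\<in>set es. killing x (\<sigma> e) *\<^sub>C e)"
proof (rule clinear_eq_on_span[OF clinear_id _ _ assms])
  show "clinear (\<lambda>x. \<Sum>e\<in>set es. killing x (\<sigma> e) *\<^sub>C e)"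
    by (rule clinearI) (simp_all add: scaleC_add_left sum.distrib complex_vector.scale_sum_right scaleC_scaleC)
  show "y = (\<Sum>e\<in>set es. killing y (\<sigma> e) *\<^sub>C e)" if "y \<in> set es" for y
  proof -
    have "(\<Sum>e\<in>set es. killing y (\<sigma> e) *\<^sub>C e) = (\<Sum>e\<in>set es. if y = e then e else 0)"
      by (rule sum.cong) (auto simp: orthonormal that scaleC_one)
    then show ?thesis using that by simp
  qed
qed

lemma minus_expansion:
  assumes "x \<in> pm"
  shows "x = (\<Sum>e\<in>set es. killing e x *\<^sub>C \<sigma> e)"
proof (rule clinear_eq_on_span[OF clinear_id _ _ assms])
  show "clinear (\<lambda>x. \<Sum>e\<in>set es. killing e x *\<^sub>C \<sigma> e)"
    by (rule clinearI) (simp_all add: scaleC_add_left sum.distrib complex_vector.scale_sum_right scaleC_scaleC)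
  show "y = (\<Sum>e\<in>set es. killing e y *\<^sub>C \<sigma> e)" if "y \<in> \<sigma> ` set es" for y
  proof -
    from that obtain e' where e': "e' \<in> set es" "y = \<sigma> e'" by blast
    have "(\<Sum>e\<in>set es. killing e y *\<^sub>C \<sigma> e) = (\<Sum>e\<in>set es. if e = e' then \<sigma> e' else 0)"
      by (rule sum.cong) (auto simp: orthonormal e' scaleC_one)
    then show ?thesis using e' by simp
  qed
qed

text \<open>By invariance of the Killing form, the matrix of ad y on p- in the dual basis is minus
  the transpose of its matrix on p+. So y annihilates the canonical element, the sum of all e
  \<otimes> \<sigma> e. As F is an arbitrary bilinear map, this covers C, C' and the spin
  action.\<close>

lemma canonical_element_invariant:
  assumes y: "y \<in> k" and F: "\<And>b. clinear (\<lambda>a. F a b)" "\<And>a. clinear (F a)"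
  shows "(\<Sum>e\<in>set es. F [y, e]\<^sub>L (\<sigma> e) + F e [y, \<sigma> e]\<^sub>L) = 0"
proof -
  have "F [y, e]\<^sub>L (\<sigma> e) = (\<Sum>e'\<in>set es. killing [y, e]\<^sub>L (\<sigma> e') *\<^sub>C F e' (\<sigma> e))" if "e \<in> set es" for e
  proof -
    have "[y, e]\<^sub>L = (\<Sum>e'\<in>set es. killing [y, e]\<^sub>L (\<sigma> e') *\<^sub>C e')"
      by (rule plus_expansion[OF k_plus[OF y complex_vector.span_base[OF that]]])
    then have "F [y, e]\<^sub>L (\<sigma> e) = F (\<Sum>e'\<in>set es. killing [y, e]\<^sub>L (\<sigma> e') *\<^sub>C e') (\<sigma> e)"
      by (rule arg_cong)
    then show ?thesis by (simp add: clinear_sum[OF F(1)] clinear_simps[OF F(1)])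
  qed
  then have "(\<Sum>e\<in>set es. F [y, e]\<^sub>L (\<sigma> e))
      = (\<Sum>e\<in>set es. \<Sum>e'\<in>set es. killing [y, e]\<^sub>L (\<sigma> e') *\<^sub>C F e' (\<sigma> e))" by simp
  also have "\<dots> = (\<Sum>e\<in>set es. \<Sum>e'\<in>set es. killing [y, e']\<^sub>L (\<sigma> e) *\<^sub>C F e (\<sigma> e'))"
    by (rule sum.swap)
  finally have 1: "(\<Sum>e\<in>set es. F [y, e]\<^sub>L (\<sigma> e)) =
    (\<Sum>e\<in>set es. \<Sum>e'\<in>set es. killing [y, e']\<^sub>L (\<sigma> e) *\<^sub>C F e (\<sigma> e'))" .
  have "F e [y, \<sigma> e]\<^sub>L = (\<Sum>e'\<in>set es. killing e' [y, \<sigma> e]\<^sub>L *\<^sub>C F e (\<sigma> e'))" if "e \<in> set es" for e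
  proof -
    have "\<sigma> e \<in> pm" using that complex_vector.span_base by blast
    from minus_expansion[OF k_minus[OF y this]]
    have "F e [y, \<sigma> e]\<^sub>L = F e (\<Sum>e'\<in>set es. killing e' [y, \<sigma> e]\<^sub>L *\<^sub>C \<sigma> e')" by (rule arg_cong)
    then show ?thesis by (simp add: clinear_sum[OF F(2)] clinear_simps[OF F(2)])
  qed
  then have 2: "(\<Sum>e\<in>set es. F e [y, \<sigma> e]\<^sub>L)
      = (\<Sum>e\<in>set es. \<Sum>e'\<in>set es. - (killing [y, e']\<^sub>L (\<sigma> e) *\<^sub>C F e (\<sigma> e')))"
    by (simp add: killing_invariant' complex_vector.scale_minus_left)
  show ?thesis unfolding sum.distrib 1 2 by (simp add: sum_negf)
qed

definition C :: "('m, 'g exterior) tensor \<Rightarrow> ('m, 'g exterior) tensor"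
  where "C u = (\<Sum>e\<in>set es. mact e (ewedge (\<sigma> e) u))"

definition C' :: "('m, 'g exterior) tensor \<Rightarrow> ('m, 'g exterior) tensor"
  where "C' u = (\<Sum>e\<in>set es. mact (\<sigma> e) (econtract e u))"

definition D :: "('m, 'g exterior) tensor \<Rightarrow> ('m, 'g exterior) tensor"
  where "D u = C u + C' u"

text \<open>The diagonal action with the plain adjoint action on the exterior factor. It is the
  action that induces the one on homology and cohomology; the spin action differs from it by a
  character.\<close>

definition lact :: "'g \<Rightarrow> ('m, 'g exterior) tensor \<Rightarrow> ('m, 'g exterior) tensor"
  where "lact y u = mact y u + ead y u"

lemma clinear_ops: "clinear C" "clinear C'" "clinear D" "clinear (lact y)"
  unfolding C_def C'_def D_def lact_def
  by (intro clinear_sum_fun clinear_add clinear_compose[OF clinear_mact] clinear_e clinear_mact)+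

lemma clinear_lact_left: "clinear (\<lambda>y. lact y u)"
  unfolding lact_def by (rule clinear_add[OF clinear_mact_left clinear_e_left(3)])

lemmas ops_linear [simp] = clinear_simps[OF clinear_ops(1)] clinear_simps[OF clinear_ops(2)]
  clinear_simps[OF clinear_ops(3)] clinear_simps[OF clinear_ops(4)] clinear_neg[OF clinear_ops(1)]
  clinear_neg[OF clinear_ops(2)] clinear_neg[OF clinear_ops(3)] clinear_neg[OF clinear_ops(4)]

lemma C_C: "C (C u) = 0"
proof -
  have comm: "mact e (mact e' v) = mact e' (mact e v)" if "e \<in> set es" "e' \<in> set es" for e e' v
    using mact_bracket[of e e' v] abelian_plus[OF that] by simp
  have "C (C u) = (\<Sum>e\<in>set es. \<Sum>e'\<in>set es. mact e (mact e' (ewedge (\<sigma> e) (ewedge (\<sigma> e') u))))"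
    by (simp add: C_def clinear_sum[OF clinear_e(1)] clinear_sum[OF clinear_mact] mact_commute)
  also have "\<dots> = 0"
  proof (rule antisymmetric_sum_eq_0)
    fix i j assume "i \<in> set es" "j \<in> set es"
    then show "mact i (mact j (ewedge (\<sigma> i) (ewedge (\<sigma> j) u)))
      = - mact j (mact i (ewedge (\<sigma> j) (ewedge (\<sigma> i) u)))"
      by (simp add: comm[of i j] ewedge_anticommute[of "\<sigma> i" "\<sigma> j"])
  qed
  finally show ?thesis .
qed

lemma C'_C': "C' (C' u) = 0"
proof -
  have comm: "mact (\<sigma> e) (mact (\<sigma> e') v) = mact (\<sigma> e') (mact (\<sigma> e) v)" if "e \<in> set es" "e' \<in> set es" for e e' v
    using mact_bracket[of "\<sigma> e" "\<sigma> e'" v] abelian_minus[OF that] by simp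
  have "C' (C' u) = (\<Sum>e\<in>set es. \<Sum>e'\<in>set es. mact (\<sigma> e) (mact (\<sigma> e') (econtract e (econtract e' u))))"
    by (simp add: C'_def clinear_sum[OF clinear_e(2)] clinear_sum[OF clinear_mact] mact_commute)
  also have "\<dots> = 0"
  proof (rule antisymmetric_sum_eq_0)
    fix i j assume "i \<in> set es" "j \<in> set es"
    then show "mact (\<sigma> i) (mact (\<sigma> j) (econtract i (econtract j u)))
      = - mact (\<sigma> j) (mact (\<sigma> i) (econtract j (econtract i u)))"
      by (simp add: comm[of i j] econtract_anticommute[of i j])
  qed
  finally show ?thesis .
qed

lemma D_D: "D (D u) = C (C' u) + C' (C u)"
  by (simp add: D_def C_C C'_C')

text \<open>The Clifford relation produces the sum of
  \<open>killing x (\<sigma> e) *\<^sub>C e\<close>, which is x itself. This is the recursion of the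
  coboundary operator in its first argument and drives the comparison in
  \<open>epair_C\<close>.\<close>

lemma econtract_C:
  assumes "x \<in> pp"
  shows "econtract x (C u) = mact x u - C (econtract x u)"
proof -
  have "econtract x (C u) = (\<Sum>e\<in>set es. killing x (\<sigma> e) *\<^sub>C mact e u - mact e (ewedge (\<sigma> e) (econtract x u)))"
    by (simp add: C_def clinear_sum[OF clinear_e(2)] mact_commute econtract_ewedge)
  also have "\<dots> = mact (\<Sum>e\<in>set es. killing x (\<sigma> e) *\<^sub>C e) u - C (econtract x u)"
    by (simp add: C_def sum_subtractf clinear_sum[OF clinear_mact_left])
  also have "\<dots> = mact x u - C (econtract x u)"
    using plus_expansion[OF assms] by simp
  finally show ?thesis .
qed

text \<open>The commutator of the two operators is the derivative of the canonical element,
  evaluated in a bilinear map, and hence 0.\<close>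

lemma lact_C:
  assumes "y \<in> k"
  shows "lact y (C u) = C (lact y u)"
proof -
  have "lact y (mact e (ewedge (\<sigma> e) u)) - mact e (ewedge (\<sigma> e) (lact y u))
    = mact [y, e]\<^sub>L (ewedge (\<sigma> e) u) + mact e (ewedge [y, \<sigma> e]\<^sub>L u)" for e
    by (simp add: lact_def mact_commute ead_ewedge mact_bracket)
  then have "lact y (C u) - C (lact y u)
    = (\<Sum>e\<in>set es. mact [y, e]\<^sub>L (ewedge (\<sigma> e) u) + mact e (ewedge [y, \<sigma> e]\<^sub>L u))"
    by (simp add: C_def clinear_sum[OF clinear_ops(4)] sum_subtractf[symmetric])
  also have "\<dots> = 0"
    by (rule canonical_element_invariant[OF assms, of "\<lambda>a b. mact a (ewedge b u)"])
      (intro clinear_mact_left clinear_compose[OF clinear_mact] clinear_e_left)+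
  finally show ?thesis by simp
qed

lemma lact_C':
  assumes "y \<in> k"
  shows "lact y (C' u) = C' (lact y u)"
proof -
  have "lact y (mact (\<sigma> e) (econtract e u)) - mact (\<sigma> e) (econtract e (lact y u))
    = mact (\<sigma> e) (econtract [y, e]\<^sub>L u) + mact [y, \<sigma> e]\<^sub>L (econtract e u)" for e
    by (simp add: lact_def mact_commute ead_econtract mact_bracket)
  then have "lact y (C' u) - C' (lact y u)
    = (\<Sum>e\<in>set es. mact (\<sigma> e) (econtract [y, e]\<^sub>L u) + mact [y, \<sigma> e]\<^sub>L (econtract e u))"
    by (simp add: C'_def clinear_sum[OF clinear_ops(4)] sum_subtractf[symmetric])
  also have "\<dots> = 0"
    by (rule canonical_element_invariant[OF assms, of "\<lambda>a b. mact b (econtract a u)"])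
      (intro clinear_mact_left clinear_compose[OF clinear_mact] clinear_e_left)+
  finally show ?thesis by simp
qed

lemma lact_D: "y \<in> k \<Longrightarrow> lact y (D u) = D (lact y u)"
  by (simp add: D_def lact_C lact_C')

lemma lact_bracket: "lact [x, y]\<^sub>L u = lact x (lact y u) - lact y (lact x u)"
  by (simp add: lact_def mact_bracket ead_bracket mact_commute)

lemma eproj_ops:
  "eproj (Suc n) (C u) = C (eproj n u)" "eproj 0 (C u) = 0"
  "eproj n (C' u) = C' (eproj (Suc n) u)" "C' (eproj 0 u) = 0"
  "eproj n (lact y u) = lact y (eproj n u)"
  by (simp_all add: C_def C'_def lact_def clinear_sum[OF clinear_e(4)] mact_commute eproj_ewedge
      eproj_0_ewedge eproj_econtract econtract_eproj_0 eproj_ead)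

lemma subspace_TT: "csubspace TT"
  by (rule csubspace_tensor_subspace)

lemma mact_in_TT: "u \<in> TT \<Longrightarrow> mact y u \<in> TT"
  unfolding mact_def by (rule tensor_map_in_tensor_subspace[OF clinear_rep clinear_id])

lemma C_in_TT: "u \<in> TT \<Longrightarrow> C u \<in> TT"
  unfolding C_def ewedge_def
  by (intro complex_vector.subspace_sum[OF subspace_TT] mact_in_TT
      tensor_map_in_tensor_subspace[OF clinear_id clinear_ext_mult ext_mult_in_ext_algebra])
    (auto intro: complex_vector.span_base)

lemma C'_in_TT: "u \<in> TT \<Longrightarrow> C' u \<in> TT"
  unfolding C'_def econtract_def
  by (intro complex_vector.subspace_sum[OF subspace_TT] mact_in_TT
      tensor_map_in_tensor_subspace[OF clinear_id clinear_contraction contraction_in_ext_algebra])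

lemma D_in_TT: "u \<in> TT \<Longrightarrow> D u \<in> TT"
  unfolding D_def by (intro complex_vector.subspace_add[OF subspace_TT] C_in_TT C'_in_TT)

lemma lact_in_TT: "y \<in> k \<Longrightarrow> u \<in> TT \<Longrightarrow> lact y u \<in> TT"
  unfolding lact_def ead_def
  by (intro complex_vector.subspace_add[OF subspace_TT] mact_in_TT
      tensor_map_in_tensor_subspace[OF clinear_id clinear_ext_ad ext_ad_in_ext_algebra[OF k_minus]])

lemma eproj_in_TT: "u \<in> TT \<Longrightarrow> eproj n u \<in> TT"
  using eproj_in[of u pm n] unfolding tensor_subspace_ext_power_eq by blast

text \<open>The form \<open>form es\<close> makes the products of the elements \<open>\<sigma> e\<close> an orthonormal family over the
  form on \<open>M\<close>. With \<open>f = \<sigma> e\<close> and \<open>i\<close> the contraction with \<open>e\<close>, the components of \<open>u\<close> without and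
  with the factor \<open>f\<close> are \<open>i (f \<and> u)\<close> and \<open>i u\<close>; so no basis of the exterior algebra is
  needed.\<close>

primrec form :: "'g list \<Rightarrow> ('m, 'g exterior) tensor \<Rightarrow> ('m, 'g exterior) tensor \<Rightarrow> complex" where
  "form [] u v = ip (epair u (wedge [])) (epair v (wedge []))"
| "form (e # l) u v = form l (econtract e (ewedge (\<sigma> e) u)) (econtract e (ewedge (\<sigma> e) v))
     + form l (econtract e u) (econtract e v)"

lemma form_hermitian:
  shows form_add: "form l (u + v) w = form l u w + form l v w"
    and form_scale: "form l (c *\<^sub>C u) w = c * form l u w"
    and form_sym: "form l v u = cnj (form l u v)"
    and form_ge_0: "Re (form l u u) \<ge> 0"
proof -
  note ip = hermitian_inner_productD[OF hermitian]
  show "form l (u + v) w = form l u w + form l v w"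
    by (induction l arbitrary: u v w) (simp_all add: ip(1))
  show "form l (c *\<^sub>C u) w = c * form l u w"
    by (induction l arbitrary: u w) (simp_all add: ip(2) algebra_simps)
  show "form l v u = cnj (form l u v)"
  proof (induction l arbitrary: u v)
    case Nil
    show ?case unfolding form.simps by (rule ip(3))
  next
    case (Cons e l)
    show ?case unfolding form.simps complex_cnj_add Cons[symmetric] ..
  qed
  show "Re (form l u u) \<ge> 0"
    by (induction l arbitrary: u) (simp_all add: ip(6))
qed

lemma form_add_right: "form l w (u + v) = form l w u + form l w v"
  by (subst form_sym) (simp add: form_add form_sym[of l u w] form_sym[of l v w])

lemma form_sum: "form l (\<Sum>i\<in>A. f i) w = (\<Sum>i\<in>A. form l (f i) w)"
  using form_scale[of l 0 0 w] by (induction A rule: infinite_finite_induct) (simp_all add: form_add)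

lemma form_sum_right: "form l w (\<Sum>i\<in>A. f i) = (\<Sum>i\<in>A. form l w (f i))"
  by (subst form_sym) (simp add: form_sum form_sym[of l w])

lemma form_neg: "form l (- u) w = - form l u w"
  using form_scale[of l "- 1" u w] by (simp add: scaleC_one)

lemma form_neg_right: "form l w (- u) = - form l w u"
  by (subst form_sym) (simp add: form_neg form_sym[of l w])

lemma form_mact:
  assumes "e \<in> set es"
  shows "form l (mact e u) v = - form l u (mact (\<sigma> e) v)"
proof (induction l arbitrary: u v)
  case Nil
  have "epair (mact y u) w = \<pi> y (epair u w)" for y u w
    unfolding mact_def by (rule epair_lmap[OF clinear_rep])
  then show ?case by (simp add: adjoint[OF assms])
qed (simp add: mact_commute)

text \<open>For j = e the Clifford relation leaves one and the same term on both sides. For j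
  different from e, \<open>ewedge (\<sigma> j)\<close> and \<open>econtract j\<close> each change
  sign when they pass contraction with e, and the two signs cancel.\<close>

lemma form_adjoint:
  assumes "set l \<subseteq> set es" "distinct l" "j \<in> set l"
  shows "form l (ewedge (\<sigma> j) u) v = form l u (econtract j v)"
  using assms
proof (induction l arbitrary: u v)
  case (Cons e l)
  have e: "e \<in> set es" "killing e (\<sigma> e) = 1" using Cons.prems orthonormal by auto
  show ?case
  proof (cases "j = e")
    case True
    have 0: "form l 0 w = 0" "form l w 0 = 0" for w
      using form_scale[of l 0 0 w] form_sym[of l w 0] by simp_all
    show ?thesis
      by (simp add: True econtract_ewedge ewedge_square econtract_square e scaleC_one 0)
  next
    case False
    then have j: "j \<in> set l" "j \<in> set es" using Cons.prems by auto
    have K: "killing e (\<sigma> j) = 0" "killing j (\<sigma> e) = 0"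
      using orthonormal e j False by auto
    have "econtract e (ewedge (\<sigma> e) (ewedge (\<sigma> j) u)) = ewedge (\<sigma> j) (econtract e (ewedge (\<sigma> e) u))"
      by (subst ewedge_anticommute) (simp add: econtract_ewedge K)
    moreover have "econtract e (ewedge (\<sigma> e) (econtract j v)) = econtract j (econtract e (ewedge (\<sigma> e) v))"
      by (subst econtract_anticommute) (simp add: econtract_ewedge K)
    ultimately show ?thesis
      using Cons.IH[OF _ _ j(1)] Cons.prems
      by (simp add: econtract_ewedge[of e "\<sigma> j"] K econtract_anticommute[of e j] form_neg form_neg_right)
  qed
qed simp

text \<open>Write u = u0 + \<sigma> e \<and> u1 with u0, u1 free of \<sigma> e. Contraction with e
  kills u0 and u1, so the form of u is the sum of the nonnegative forms of u0 and u1, and both must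
  vanish.\<close>

lemma form_definite:
  assumes "set l \<subseteq> set es" "distinct l" "u \<in> tensor_subspace (ext_algebra (cspan (\<sigma> ` set l)))"
    and "Re (form l u u) = 0"
  shows "u = 0"
  using assms
proof (induction l arbitrary: u)
  case Nil
  then obtain m where "u = m \<otimes>\<^sub>C wedge []"
    using tensor_subspace_empty[of u] by auto
  with Nil show ?case
    using hermitian_inner_productD(9)[OF hermitian, of m] by (simp add: epair_tens ext_vac_wedge scaleC_one)
next
  case (Cons e l)
  let ?T = "tensor_subspace (ext_algebra (cspan (\<sigma> ` set l)))"
  have "u \<in> tensor_subspace (ext_algebra (cspan (insert (\<sigma> e) (\<sigma> ` set l))))"
    using Cons.prems(3) by simp
  from tensor_subspace_insert[OF this]
  obtain u0 u1 where u: "u0 \<in> ?T" "u1 \<in> ?T" "u = u0 + ewedge (\<sigma> e) u1" by blast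
  have e: "killing e (\<sigma> e) = 1" using Cons.prems orthonormal by auto
  have K0: "killing e y = 0" if "y \<in> cspan (\<sigma> ` set l)" for y
    by (rule clinear_vanishes_on_span[OF clinear_killing _ that]) (use Cons.prems orthonormal in auto)
  have 0: "econtract e u0 = 0" "econtract e u1 = 0"
    using econtract_eq_0[OF K0] u by blast+
  have "econtract e u = u1" "econtract e (ewedge (\<sigma> e) u) = u0"
    by (simp_all add: u(3) econtract_ewedge ewedge_square e 0 scaleC_one)
  then have "Re (form l u0 u0) = 0" "Re (form l u1 u1) = 0"
    using Cons.prems(4) form_ge_0[of l u0] form_ge_0[of l u1] by simp_all
  then have "u0 = 0" "u1 = 0" using Cons.IH u Cons.prems by auto
  then show ?case using u by simp
qed

lemma form_C: "form es (C u) v = - form es u (C' v)"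
  by (simp add: C_def C'_def form_sum form_sum_right form_mact form_adjoint distinct_es mact_commute sum_negf)

lemma form_C': "form es (C' u) v = - form es u (C v)"
  by (subst (1 2) form_sym) (simp add: form_C)

lemma form_D: "form es (D u) v = - form es u (D v)"
  by (simp add: D_def form_add form_add_right form_C form_C')

lemma definite: "u \<in> TT \<Longrightarrow> Re (form es u u) = 0 \<Longrightarrow> u = 0"
  using form_definite[of es u] distinct_es by simp

text \<open>Skewness gives (D u, D u) = - (u, D (D u)) = 0, and the form is definite. The two lemmas
  after it use the adjointness of C and - C' in the same way.\<close>

lemma D_D_eq_0: "u \<in> TT \<Longrightarrow> D (D u) = 0 \<Longrightarrow> D u = 0"
  using definite[OF D_in_TT, of u] form_D[of u "D u"] form_scale[of es 0 0 u] form_sym[of es u 0] by simp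

lemma C_C'_eq_0: "u \<in> TT \<Longrightarrow> C (C' u) = 0 \<Longrightarrow> C' u = 0"
  using definite[OF C'_in_TT, of u] form_C'[of u "C' u"] form_scale[of es 0 0 u] form_sym[of es u 0] by simp

lemma C'_C_eq_0: "u \<in> TT \<Longrightarrow> C' (C u) = 0 \<Longrightarrow> C u = 0"
  using definite[OF C_in_TT, of u] form_C[of u "C u"] form_scale[of es 0 0 u] form_sym[of es u 0] by simp

text \<open>Since C and C' square to zero, applying them to D u = 0 isolates C (C' u) = 0 and C' (C
  u) = 0; positivity then removes the outer operator.\<close>

lemma D_eq_0_iff:
  assumes "u \<in> TT"
  shows "D u = 0 \<longleftrightarrow> C u = 0 \<and> C' u = 0"
proof
  assume D: "D u = 0"
  have "C (D u) = C (C' u)" "C' (D u) = C' (C u)"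
    by (simp_all add: D_def C_C C'_C')
  then have "C (C' u) = 0" "C' (C u) = 0" using D by simp_all
  then show "C u = 0 \<and> C' u = 0" using C_C'_eq_0 C'_C_eq_0 assms by blast
qed (simp add: D_def)

text \<open>D mixes degrees, but C raises and C' lowers the degree by one, and the kernel of D is
  the intersection of theirs. In degree 0 the condition for C' is automatic, hence the case
  distinction.\<close>

lemma eproj_harmonic: "u \<in> TT \<Longrightarrow> D u = 0 \<Longrightarrow> D (eproj n u) = 0"
  using D_eq_0_iff[of u] D_eq_0_iff[OF eproj_in_TT, of u n]
    eproj_ops(1)[of n u] eproj_ops(3)[of "n - 1" u] eproj_ops(4)[of u]
  by (cases n) auto

end

subsection \<open>Modules\<close>

text \<open>\<open>isomorphic_modules\<close> demands the module axioms on both sides. They are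
  equations between the operations and pass to the image of a compatible map, so they never have to
  be checked on quotients and direct sums directly.\<close>

lemma lie_module_transport:
  assumes V: "lie_module h V" and W: "rcarrier W = f ` rcarrier V"
    and add: "\<And>u v. u \<in> rcarrier V \<Longrightarrow> v \<in> rcarrier V \<Longrightarrow> f (radd V u v) = radd W (f u) (f v)"
    and scale: "\<And>c v. v \<in> rcarrier V \<Longrightarrow> f (rscale V c v) = rscale W c (f v)"
    and act: "\<And>x v. x \<in> h \<Longrightarrow> v \<in> rcarrier V \<Longrightarrow> f (ract V x v) = ract W x (f v)"
    and zero: "f (rzero V) = rzero W" and h: "lie_subalgebra h"
  shows "lie_module h W"
proof -
  have sub: "x + y \<in> h" "c *\<^sub>C x \<in> h" "[x, y]\<^sub>L \<in> h" if "x \<in> h" "y \<in> h" for x y c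
    using h that by (auto simp: lie_subalgebra_def complex_vector.subspace_add complex_vector.subspace_scale)
  have cl: "rzero V \<in> rcarrier V" "u \<in> rcarrier V \<Longrightarrow> v \<in> rcarrier V \<Longrightarrow> radd V u v \<in> rcarrier V"
    "v \<in> rcarrier V \<Longrightarrow> rscale V c v \<in> rcarrier V" "x \<in> h \<Longrightarrow> v \<in> rcarrier V \<Longrightarrow> ract V x v \<in> rcarrier V"
    for u v c x
    using V by (auto simp: lie_module_def)
  note r = add[symmetric] scale[symmetric] act[symmetric] zero[symmetric]
  show ?thesis
    using V unfolding lie_module_def W
    by (elim conjE, intro conjI) (simp_all only: ball_simps image_iff r cl sub bex_simps, auto simp: r cl sub)
qed

lemma isomorphic_modules_transport:
  assumes V: "lie_module h V" and f: "bij_betw f (rcarrier V) (rcarrier W)"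
    and add: "\<And>u v. u \<in> rcarrier V \<Longrightarrow> v \<in> rcarrier V \<Longrightarrow> f (radd V u v) = radd W (f u) (f v)"
    and scale: "\<And>c v. v \<in> rcarrier V \<Longrightarrow> f (rscale V c v) = rscale W c (f v)"
    and act: "\<And>x v. x \<in> h \<Longrightarrow> v \<in> rcarrier V \<Longrightarrow> f (ract V x v) = ract W x (f v)"
    and zero: "f (rzero V) = rzero W" and h: "lie_subalgebra h"
  shows "isomorphic_modules h V W"
proof -
  have "rcarrier W = f ` rcarrier V" using f by (simp add: bij_betw_def)
  from lie_module_transport[OF V this add scale act zero h]
  have "lie_module h W" by blast
  then show ?thesis
    unfolding isomorphic_modules_def using V f add scale act by blast
qed

lemma isomorphic_modules_sym:
  assumes "isomorphic_modules h V W"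
  shows "isomorphic_modules h W V"
proof -
  obtain f where V: "lie_module h V" and W: "lie_module h W" and f: "bij_betw f (rcarrier V) (rcarrier W)"
    and add: "\<And>u v. u \<in> rcarrier V \<Longrightarrow> v \<in> rcarrier V \<Longrightarrow> f (radd V u v) = radd W (f u) (f v)"
    and scale: "\<And>c v. v \<in> rcarrier V \<Longrightarrow> f (rscale V c v) = rscale W c (f v)"
    and act: "\<And>x v. x \<in> h \<Longrightarrow> v \<in> rcarrier V \<Longrightarrow> f (ract V x v) = ract W x (f v)"
    using assms unfolding isomorphic_modules_def by blast
  let ?g = "inv_into (rcarrier V) f"
  have g: "bij_betw ?g (rcarrier W) (rcarrier V)" using f by (rule bij_betw_inv_into)
  have gV: "?g w \<in> rcarrier V" "f (?g w) = w" if "w \<in> rcarrier W" for w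
    using bij_betw_apply[OF g that] bij_betw_inv_into_right[OF f that] by auto
  have gf: "?g (f v) = v" if "v \<in> rcarrier V" for v
    using bij_betw_inv_into_left[OF f that] .
  have cl: "u \<in> rcarrier V \<Longrightarrow> v \<in> rcarrier V \<Longrightarrow> radd V u v \<in> rcarrier V"
    "v \<in> rcarrier V \<Longrightarrow> rscale V c v \<in> rcarrier V" "x \<in> h \<Longrightarrow> v \<in> rcarrier V \<Longrightarrow> ract V x v \<in> rcarrier V"
    for u v c x
    using V by (auto simp: lie_module_def)
  have "?g (radd W u v) = radd V (?g u) (?g v)" if "u \<in> rcarrier W" "v \<in> rcarrier W" for u v
    using gf[OF cl(1)[OF gV(1)[OF that(1)] gV(1)[OF that(2)]]] add[OF gV(1)[OF that(1)] gV(1)[OF that(2)]] gV(2) that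
    by simp
  moreover have "?g (rscale W c v) = rscale V c (?g v)" if "v \<in> rcarrier W" for c v
    using gf[OF cl(2)[OF gV(1)[OF that]], of c] scale[OF gV(1)[OF that], of c] gV(2)[OF that] by simp
  moreover have "?g (ract W x v) = ract V x (?g v)" if "x \<in> h" "v \<in> rcarrier W" for x v
    using gf[OF cl(3)[OF that(1) gV(1)[OF that(2)]]] act[OF that(1) gV(1)[OF that(2)]] gV(2)[OF that(2)] by simp
  ultimately show ?thesis
    unfolding isomorphic_modules_def using V W g by blast
qed

lemma isomorphic_modules_trans:
  assumes "isomorphic_modules h U V" "isomorphic_modules h V W"
  shows "isomorphic_modules h U W"
proof -
  obtain f where f: "lie_module h U" "bij_betw f (rcarrier U) (rcarrier V)"
    "\<And>u v. u \<in> rcarrier U \<Longrightarrow> v \<in> rcarrier U \<Longrightarrow> f (radd U u v) = radd V (f u) (f v)"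
    "\<And>c v. v \<in> rcarrier U \<Longrightarrow> f (rscale U c v) = rscale V c (f v)"
    "\<And>x v. x \<in> h \<Longrightarrow> v \<in> rcarrier U \<Longrightarrow> f (ract U x v) = ract V x (f v)"
    using assms(1) unfolding isomorphic_modules_def by blast
  obtain g where g: "lie_module h W" "bij_betw g (rcarrier V) (rcarrier W)"
    "\<And>u v. u \<in> rcarrier V \<Longrightarrow> v \<in> rcarrier V \<Longrightarrow> g (radd V u v) = radd W (g u) (g v)"
    "\<And>c v. v \<in> rcarrier V \<Longrightarrow> g (rscale V c v) = rscale W c (g v)"
    "\<And>x v. x \<in> h \<Longrightarrow> v \<in> rcarrier V \<Longrightarrow> g (ract V x v) = ract W x (g v)"
    using assms(2) unfolding isomorphic_modules_def by blast
  have fV: "f u \<in> rcarrier V" if "u \<in> rcarrier U" for u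
    using bij_betw_apply[OF f(2) that] .
  show ?thesis
    unfolding isomorphic_modules_def
    using f(1) g(1) bij_betw_trans[OF f(2) g(2)] fV
    by (intro conjI exI[of _ "g \<circ> f"]) (simp_all add: f g)
qed

definition coset :: "'v::complex_vector set \<Rightarrow> 'v \<Rightarrow> 'v set"
  where "coset U v = {v + u | u. u \<in> U}"

lemma coset_eq_iff:
  assumes "csubspace U"
  shows "coset U v = coset U w \<longleftrightarrow> v - w \<in> U"
proof
  assume "coset U v = coset U w"
  moreover have "v \<in> coset U v"
    unfolding coset_def using complex_vector.subspace_0[OF assms] by force
  ultimately show "v - w \<in> U" by (auto simp: coset_def)
next
  assume vw: "v - w \<in> U"
  have "coset U v \<subseteq> coset U w" if "v - w \<in> U" for v w
  proof
    fix x assume "x \<in> coset U v"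
    then obtain u where "u \<in> U" "x = v + u" by (auto simp: coset_def)
    then have "x = w + (v - w + u)" "v - w + u \<in> U"
      using complex_vector.subspace_add[OF assms that] by auto
    then show "x \<in> coset U w" unfolding coset_def by blast
  qed
  then show "coset U v = coset U w"
    using vw complex_vector.subspace_neg[OF assms vw] by (simp add: subset_antisym)
qed

lemma coset_0: "coset U 0 = U"
  by (simp add: coset_def)

lemma coset_eq_self_iff: "csubspace U \<Longrightarrow> coset U v = U \<longleftrightarrow> v \<in> U"
  using coset_eq_iff[of U v 0] by (simp add: coset_0)

lemma coset_operations:
  assumes U: "csubspace U"
  shows "{a + b | a b. a \<in> coset U v \<and> b \<in> coset U w} = coset U (v + w)"
    and "{c *\<^sub>C a + u | a u. a \<in> coset U v \<and> u \<in> U} = coset U (c *\<^sub>C v)"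
    and "clinear \<tau> \<Longrightarrow> (\<And>u. u \<in> U \<Longrightarrow> \<tau> u \<in> U) \<Longrightarrow>
      {\<tau> a + u | a u. a \<in> coset U v \<and> u \<in> U} = coset U (\<tau> v)"
proof -
  have *: "{\<tau> a + u | a u. a \<in> coset U v \<and> u \<in> U} = coset U (\<tau> v)"
    if \<tau>: "clinear \<tau>" "\<And>u. u \<in> U \<Longrightarrow> \<tau> u \<in> U" for \<tau> :: "'a \<Rightarrow> 'a" and v
  proof (intro subset_antisym subsetI)
    fix x assume "x \<in> {\<tau> a + u | a u. a \<in> coset U v \<and> u \<in> U}"
    then obtain u u' where u: "u \<in> U" "u' \<in> U" "x = \<tau> (v + u') + u" by (auto simp: coset_def)
    then have "x = \<tau> v + (\<tau> u' + u)" by (simp add: clinear_simps[OF \<tau>(1)])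
    then show "x \<in> coset U (\<tau> v)"
      unfolding coset_def using complex_vector.subspace_add[OF U \<tau>(2)[OF u(2)] u(1)] by blast
  next
    fix x assume "x \<in> coset U (\<tau> v)"
    then obtain u where "u \<in> U" "x = \<tau> v + u" by (auto simp: coset_def)
    moreover have "v \<in> coset U v"
      unfolding coset_def using complex_vector.subspace_0[OF U] by force
    ultimately show "x \<in> {\<tau> a + u | a u. a \<in> coset U v \<and> u \<in> U}" by blast
  qed
  show "{c *\<^sub>C a + u | a u. a \<in> coset U v \<and> u \<in> U} = coset U (c *\<^sub>C v)"
    by (rule *) (simp_all add: clinear_scale clinear_id complex_vector.subspace_scale[OF U])
  show "clinear \<tau> \<Longrightarrow> (\<And>u. u \<in> U \<Longrightarrow> \<tau> u \<in> U) \<Longrightarrow>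
      {\<tau> a + u | a u. a \<in> coset U v \<and> u \<in> U} = coset U (\<tau> v)"
    by (rule *)
  show "{a + b | a b. a \<in> coset U v \<and> b \<in> coset U w} = coset U (v + w)"
  proof (intro subset_antisym subsetI)
    fix x assume "x \<in> {a + b | a b. a \<in> coset U v \<and> b \<in> coset U w}"
    then obtain u u' where u: "u \<in> U" "u' \<in> U" "x = (v + u) + (w + u')" by (auto simp: coset_def)
    then have "x = (v + w) + (u + u')" by (simp add: algebra_simps)
    then show "x \<in> coset U (v + w)"
      unfolding coset_def using complex_vector.subspace_add[OF U u(1,2)] by blast
  next
    fix x assume "x \<in> coset U (v + w)"
    then obtain u where u: "u \<in> U" "x = v + w + u" by (auto simp: coset_def)
    then have "x = (v + u) + (w + 0)" by (simp add: algebra_simps)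
    then show "x \<in> {a + b | a b. a \<in> coset U v \<and> b \<in> coset U w}"
      unfolding coset_def using u(1) complex_vector.subspace_0[OF U] by blast
  qed
qed

lemma quot_rep_operations:
  assumes U: "csubspace U"
  shows "radd (quot_rep K U \<tau>) (coset U v) (coset U w) = coset U (v + w)"
    and "rscale (quot_rep K U \<tau>) c (coset U v) = coset U (c *\<^sub>C v)"
    and "clinear (\<tau> x) \<Longrightarrow> (\<And>u. u \<in> U \<Longrightarrow> \<tau> x u \<in> U) \<Longrightarrow>
      ract (quot_rep K U \<tau>) x (coset U v) = coset U (\<tau> x v)"
    and "rzero (quot_rep K U \<tau>) = coset U 0"
  unfolding quot_rep_def lie_rep.simps coset_operations(1,2)[OF U] coset_0
  by (simp_all only: coset_operations(3)[OF U])

lemma sub_rep_iso_quot_rep_0: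
  assumes "lie_module h (sub_rep K \<tau>)" "lie_subalgebra h"
  shows "isomorphic_modules h (sub_rep K \<tau>) (quot_rep K {0} \<tau>)"
  by (rule isomorphic_modules_transport[OF assms(1), where f = "\<lambda>v. {v}"])
    (auto simp: sub_rep_def quot_rep_def bij_betw_def inj_on_def assms(2))

text \<open>The principle of harmonic representatives in abstract form, with the map sending u to
  the family of classes of \<open>f n u\<close>. Here \<open>inj\<close> says that a harmonic
  element with trivial classes is 0, and \<open>surj\<close> that every cycle is equivalent to a
  harmonic one concentrated in its degree. The character \<chi> acts by scalars on both
  sides.\<close>

lemma sub_rep_iso_direct_sum_quot:
  fixes \<tau> :: "'g::complex_lie_algebra \<Rightarrow> 'v::complex_vector \<Rightarrow> 'v" and f :: "nat \<Rightarrow> 'v \<Rightarrow> 'w::complex_vector"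
  assumes h: "lie_subalgebra h" and K: "csubspace K" and V: "lie_module h (sub_rep K \<tau>')"
    and \<tau>': "\<And>x v. x \<in> h \<Longrightarrow> v \<in> K \<Longrightarrow> \<tau>' x v = \<tau> x v + \<chi> x *\<^sub>C v"
    and f: "\<And>n. clinear (f n)" "\<And>n u. u \<in> K \<Longrightarrow> f n u \<in> Z n"
    and ZU: "\<And>n. csubspace (U n)"
    and inj: "\<And>u. u \<in> K \<Longrightarrow> (\<And>n. f n u \<in> U n) \<Longrightarrow> u = 0"
    and surj: "\<And>n z. z \<in> Z n \<Longrightarrow> \<exists>u\<in>K. z - f n u \<in> U n \<and> (\<forall>m. m \<noteq> n \<longrightarrow> f m u = 0)"
    and fin: "\<And>u. u \<in> K \<Longrightarrow> finite {n. f n u \<notin> U n}"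
    and eq: "\<And>x u n. x \<in> h \<Longrightarrow> u \<in> K \<Longrightarrow> f n (\<tau> x u) = \<tau>n n x (f n u)"
    and \<tau>n: "\<And>n x. clinear (\<tau>n n x)" "\<And>n x u. x \<in> h \<Longrightarrow> u \<in> U n \<Longrightarrow> \<tau>n n x u \<in> U n"
  shows "isomorphic_modules h (sub_rep K \<tau>')
    (twist (direct_sum_rep (\<lambda>n. quot_rep (Z n) (U n) (\<tau>n n))) \<chi>)"
proof (rule isomorphic_modules_transport[OF V])
  let ?F = "\<lambda>u n. coset (U n) (f n u)"
  let ?W = "twist (direct_sum_rep (\<lambda>n. quot_rep (Z n) (U n) (\<tau>n n))) \<chi>"
  have carV: "rcarrier (sub_rep K \<tau>') = K" by (simp add: sub_rep_def)
  have carW: "rcarrier ?W = {F. (\<forall>n. \<exists>z\<in>Z n. F n = coset (U n) z) \<and> finite {n. F n \<noteq> U n}}"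
    by (simp add: twist_def direct_sum_rep_def quot_rep_def coset_def Bex_def conj_commute)
  show "bij_betw ?F (rcarrier (sub_rep K \<tau>')) (rcarrier ?W)"
    unfolding bij_betw_def
  proof (intro conjI subset_antisym)
    show "inj_on ?F (rcarrier (sub_rep K \<tau>'))"
    proof (rule inj_onI, unfold carV)
      fix u v assume uv: "u \<in> K" "v \<in> K" "?F u = ?F v"
      then have "f n (u - v) \<in> U n" for n
        using coset_eq_iff[OF ZU, of n "f n u" "f n v"] by (auto simp: fun_eq_iff clinear_simps[OF f(1)])
      then show "u = v"
        using inj[of "u - v"] complex_vector.subspace_diff[OF K uv(1,2)] by auto
    qed
    show "?F ` rcarrier (sub_rep K \<tau>') \<subseteq> rcarrier ?W"
      unfolding carV carW using f(2) fin by (auto simp: coset_eq_self_iff[OF ZU])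
    show "rcarrier ?W \<subseteq> ?F ` rcarrier (sub_rep K \<tau>')"
    proof
      fix F assume F: "F \<in> rcarrier ?W"
      then obtain z where z: "\<And>n. z n \<in> Z n" "\<And>n. F n = coset (U n) (z n)"
        unfolding carW by (auto simp: choice_iff') metis
      let ?S = "{n. F n \<noteq> U n}"
      have fS: "finite ?S" using F carW by blast
      obtain u where u: "\<And>n. u n \<in> K" "\<And>n. z n - f n (u n) \<in> U n" "\<And>m n. m \<noteq> n \<Longrightarrow> f m (u n) = 0"
        using surj[OF z(1)] by metis
      \<comment> \<open>Only the finitely many nontrivial classes are represented; since
        \<open>f m (u n)\<close> vanishes for m different from n, the summands do not disturb each
        other.\<close>
      let ?u = "\<Sum>n\<in>?S. u n"
      have uK: "?u \<in> K" by (rule complex_vector.subspace_sum[OF K]) (rule u(1))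
      have "coset (U n) (f n ?u) = F n" for n
      proof (cases "n \<in> ?S")
        case True
        have "f n ?u = (\<Sum>m\<in>?S. if m = n then f n (u n) else 0)"
          unfolding clinear_sum[OF f(1)] by (rule sum.cong) (auto simp: u(3))
        also have "\<dots> = f n (u n)" using True fS by simp
        finally have "z n - f n ?u \<in> U n" using u(2) by simp
        then show ?thesis using coset_eq_iff[OF ZU, of n "z n" "f n ?u"] z(2) by simp
      next
        case False
        have "f n ?u = (\<Sum>m\<in>?S. 0)"
          unfolding clinear_sum[OF f(1)]
          by (rule sum.cong[OF refl], rule u(3)) (use False in blast)
        then show ?thesis using False by (simp add: coset_0)
      qed
      then have "F = ?F ?u" by (simp add: fun_eq_iff)
      then show "F \<in> ?F ` rcarrier (sub_rep K \<tau>')" unfolding carV using uK by blast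
    qed
  qed
  note ops = quot_rep_operations[OF ZU]
  show "?F (radd (sub_rep K \<tau>') u v) = radd ?W (?F u) (?F v)" for u v
    by (simp add: twist_def direct_sum_rep_def sub_rep_def ops(1) clinear_simps[OF f(1)])
  show "?F (rscale (sub_rep K \<tau>') c v) = rscale ?W c (?F v)" for c v
    by (simp add: twist_def direct_sum_rep_def sub_rep_def ops(2) clinear_simps[OF f(1)])
  show "?F (ract (sub_rep K \<tau>') x v) = ract ?W x (?F v)" if "x \<in> h" "v \<in> rcarrier (sub_rep K \<tau>')" for x v
  proof -
    have v: "v \<in> K" using that carV by simp
    have act: "ract (quot_rep (Z n) (U n) (\<tau>n n)) x (coset (U n) w) = coset (U n) (\<tau>n n x w)" for n w
      by (rule ops(3)) (use \<tau>n that in auto)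
    have "ract ?W x (?F v) = (\<lambda>n. coset (U n) (\<tau>n n x (f n v) + \<chi> x *\<^sub>C f n v))"
      by (simp add: twist_def direct_sum_rep_def ops(1,2) act)
    then show ?thesis
      by (simp add: sub_rep_def \<tau>'[OF that(1) v] eq[OF that(1) v] clinear_simps[OF f(1)])
  qed
  show "?F (rzero (sub_rep K \<tau>')) = rzero ?W"
    by (simp add: twist_def direct_sum_rep_def sub_rep_def clinear_simps[OF f(1)] ops(4))
qed (rule h)

section \<open>Finite-dimensional eigenspaces and the Hodge decomposition\<close>

primrec wedge_products :: "'g::complex_vector list \<Rightarrow> 'g exterior set" where
  "wedge_products [] = {wedge []}"
| "wedge_products (f # fs) = wedge_products fs \<union> ext_mult f ` wedge_products fs"

lemma finite_wedge_products: "finite (wedge_products fs)"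
  by (induction fs) auto

text \<open>The products of subfamilies of fs, in the order of the list, suffice by
  \<open>ext_algebra_insert\<close>. They are finitely many, and they are eigenvectors of the
  adjoint action of x as soon as the entries of fs are.\<close>

lemma ext_algebra_subset_span_wedge_products: "ext_algebra (cspan (set fs)) \<subseteq> cspan (wedge_products fs)"
proof (induction fs)
  case Nil
  show ?case
  proof
    fix w :: "'a exterior" assume "w \<in> ext_algebra (cspan (set []))"
    then obtain c where "w = c *\<^sub>C wedge []" using ext_algebra_empty by auto
    then show "w \<in> cspan (wedge_products [])"
      by (simp add: complex_vector.span_scale complex_vector.span_base)
  qed
next
  case (Cons f fs)
  show ?case
  proof
    fix w assume "w \<in> ext_algebra (cspan (set (f # fs)))"
    then obtain w0 w1 where w: "w0 \<in> ext_algebra (cspan (set fs))" "w1 \<in> ext_algebra (cspan (set fs))"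
      "w = w0 + ext_mult f w1" using ext_algebra_insert by fastforce
    have "ext_mult f ` cspan (wedge_products fs) \<subseteq> cspan (ext_mult f ` wedge_products fs)"
      by (rule clinear_image_span_subset[OF clinear_ext_mult complex_vector.span_superset])
    then have "ext_mult f w1 \<in> cspan (ext_mult f ` wedge_products fs)" using w Cons by blast
    then show "w \<in> cspan (wedge_products (f # fs))"
      using w Cons complex_vector.span_mono[of "wedge_products fs" "wedge_products (f # fs)"]
        complex_vector.span_mono[of "ext_mult f ` wedge_products fs" "wedge_products (f # fs)"]
      by (auto intro!: complex_vector.span_add)
  qed
qed

lemma wedge_products_subset: "set fs \<subseteq> V \<Longrightarrow> wedge_products fs \<subseteq> ext_algebra V"
  by (induction fs) (auto simp: wedge_in_ext_algebra intro!: ext_mult_in_ext_algebra)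

lemma wedge_products_eigen:
  assumes "\<And>f. f \<in> set fs \<Longrightarrow> \<exists>c. [x, f]\<^sub>L = c *\<^sub>C f" "w \<in> wedge_products fs"
  shows "\<exists>c. ext_ad x w = c *\<^sub>C w"
  using assms
proof (induction fs arbitrary: w)
  case Nil
  then show ?case by (intro exI[of _ 0]) simp
next
  case (Cons f fs)
  obtain c where c: "[x, f]\<^sub>L = c *\<^sub>C f" using Cons.prems(1)[of f] by auto
  have "\<exists>c. ext_ad x (ext_mult f w') = c *\<^sub>C ext_mult f w'" if w': "w' \<in> wedge_products fs" for w'
  proof -
    from Cons.IH[OF Cons.prems(1) w'] obtain d where "ext_ad x w' = d *\<^sub>C w'" by auto
    then have "ext_ad x (ext_mult f w') = (c + d) *\<^sub>C ext_mult f w'"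
      by (simp add: ext_ad_ext_mult c scaleC_add_left)
    then show ?thesis by blast
  qed
  then show ?case using Cons.prems Cons.IH[of w] by auto
qed

lemma tensor_subspace_span:
  assumes "cspan Q = UNIV" "W \<subseteq> cspan R"
  shows "tensor_subspace W \<subseteq> cspan {v \<otimes>\<^sub>C w | v w. v \<in> Q \<and> w \<in> R}"
proof -
  let ?S = "cspan {v \<otimes>\<^sub>C w | v w. v \<in> Q \<and> w \<in> R}"
  have 1: "v \<otimes>\<^sub>C w \<in> ?S" if "w \<in> R" for v w
  proof -
    have "(\<lambda>v. v \<otimes>\<^sub>C w) ` cspan Q \<subseteq> ?S"
      by (rule clinear_image_span_subset[OF clinear_tens_left]) (use that in \<open>auto intro!: complex_vector.span_base\<close>)
    then show ?thesis using assms(1) by blast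
  qed
  have "v \<otimes>\<^sub>C w \<in> ?S" if "w \<in> W" for v w
  proof -
    have "tens v ` cspan R \<subseteq> ?S"
      by (rule clinear_image_span_subset[OF clinear_tens]) (use 1 in auto)
    then show ?thesis using assms(2) that by blast
  qed
  then show ?thesis
    unfolding tensor_subspace_def by (intro complex_vector.span_minimal) auto
qed

context dirac_setup
begin

text \<open>D commutes with h and preserves its eigenspaces in M \<otimes> \<Lambda> p-, which are
  finite-dimensional. There it is injective on its image by \<open>D_D_eq_0\<close>, hence
  surjective from its image to its image.\<close>

lemma hodge_decomposition:
  assumes h: "h \<in> k" and Q: "\<And>c. finite (Q c)" "\<And>c v. v \<in> Q c \<Longrightarrow> \<pi> h v = c *\<^sub>C v" "cspan (\<Union>c. Q c) = UNIV"
    and fs: "cspan (set fs) = pm" "\<And>f. f \<in> set fs \<Longrightarrow> \<exists>c. [h, f]\<^sub>L = c *\<^sub>C f"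
    and u: "u \<in> TT"
  shows "\<exists>v\<in>TT. \<exists>y\<in>TT. D v = 0 \<and> u = v + D (D y)"
proof -
  obtain \<beta> where \<beta>: "\<And>w. w \<in> wedge_products fs \<Longrightarrow> ext_ad h w = \<beta> w *\<^sub>C w"
    using wedge_products_eigen[OF fs(2)] by metis
  \<comment> \<open>The eigenvalue of v \<otimes> w is the sum of those of v and w, so the
    eigenvalue c calls for v in \<open>Q (c - \<beta> w)\<close>. There are finitely many w, hence
    each \<open>R c\<close> is finite.\<close>
  define R where "R = (\<lambda>c. \<Union>w\<in>wedge_products fs. (\<lambda>v. v \<otimes>\<^sub>C w) ` Q (c - \<beta> w))"
  have finR: "finite (R c)" for c
    unfolding R_def using finite_wedge_products Q(1) by blast
  have RT: "R c \<subseteq> TT" for c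
  proof -
    have "set fs \<subseteq> pm" using fs(1) complex_vector.span_superset by blast
    from wedge_products_subset[OF this] show ?thesis
      unfolding R_def by (auto intro!: tens_in_tensor_subspace)
  qed
  have Reig: "R c \<subseteq> eigenspace (lact h) c" for c
    unfolding R_def eigenspace_def
    by (auto simp: lact_def mact_tens \<beta> Q(2) scaleC_add_left[symmetric])
  have "TT \<subseteq> cspan {v \<otimes>\<^sub>C w | v w. v \<in> (\<Union>c. Q c) \<and> w \<in> wedge_products fs}"
    using tensor_subspace_span[OF Q(3)] ext_algebra_subset_span_wedge_products[of fs] fs(1) by auto
  also have "\<dots> \<subseteq> cspan (\<Union>c. R c)"
  proof (rule complex_vector.span_mono, clarify)
    fix v w c assume "w \<in> wedge_products fs" "v \<in> Q c"
    then have "v \<otimes>\<^sub>C w \<in> R (c + \<beta> w)" unfolding R_def by (intro UN_I[of w]) auto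
    then show "v \<otimes>\<^sub>C w \<in> (\<Union>c. R c)" by blast
  qed
  finally have TR: "TT \<subseteq> cspan (\<Union>c. R c)" .
  have fd: "finite_dim (TT \<inter> eigenspace (lact h) c)" for c
  proof (rule finite_dim_subspace[OF finite_dim_span[OF finR[of c]]])
    show "csubspace (TT \<inter> eigenspace (lact h) c)"
      using subspace_TT by (auto simp: complex_vector.subspace_def eigenspace_def
          scaleC_add_right scaleC_scaleC mult.commute)
    show "TT \<inter> eigenspace (lact h) c \<subseteq> cspan (R c)"
      using eigenspace_span[where R = R and T = "lact h"] Reig TR clinear_ops(4) by blast
  qed
  let ?P = "\<lambda>u. \<exists>v\<in>TT. \<exists>y\<in>TT. D v = 0 \<and> u = v + D (D y)"
  have eig: "?P u" if u: "u \<in> TT \<inter> eigenspace (lact h) c" for u c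
  proof -
    let ?V = "TT \<inter> eigenspace (lact h) c"
    have DV: "D ` ?V \<subseteq> ?V"
      using D_in_TT lact_D[OF h] by (auto simp: eigenspace_def)
    have subV: "csubspace ?V"
      using subspace_TT by (auto simp: complex_vector.subspace_def eigenspace_def
          scaleC_add_right scaleC_scaleC mult.commute)
    have subDV: "csubspace (D ` ?V)"
    proof (rule complex_vector.subspaceI)
      show "0 \<in> D ` ?V" using complex_vector.subspace_0[OF subV] by (metis ops_linear(12) image_eqI)
      show "x + y \<in> D ` ?V" if xy: "x \<in> D ` ?V" "y \<in> D ` ?V" for x y
      proof -
        obtain a b where ab: "a \<in> ?V" "b \<in> ?V" "x = D a" "y = D b" using xy by blast
        then have "x + y = D (a + b)" by simp
        then show ?thesis using complex_vector.subspace_add[OF subV ab(1,2)] by blast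
      qed
      show "c *\<^sub>C x \<in> D ` ?V" if xy: "x \<in> D ` ?V" for x c
      proof -
        obtain a where ab: "a \<in> ?V" "x = D a" using xy by blast
        then have "c *\<^sub>C x = D (c *\<^sub>C a)" by simp
        then show ?thesis using complex_vector.subspace_scale[OF subV ab(1)] by blast
      qed
    qed
    \<comment> \<open>It follows that D and its third power have the same image on this eigenspace.
      Solving D u = D (D (D y)) makes u - D (D y) harmonic.\<close>
    have "D ` (D ` ?V) = D ` ?V"
    proof (rule finite_dim_injective_surjective[OF finite_dim_subspace[OF fd subDV DV] subDV clinear_ops(3)])
      show "D ` D ` ?V \<subseteq> D ` ?V" using DV by blast
      show "x = 0" if "x \<in> D ` ?V" "D x = 0" for x
        using that D_D_eq_0 by auto
    qed
    moreover have "D u \<in> D ` ?V" using u by blast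
    ultimately have "D u \<in> D ` D ` D ` ?V" by simp
    then obtain y where y: "y \<in> ?V" "D u = D (D (D y))" by blast
    then have "D (u - D (D y)) = 0" "u = (u - D (D y)) + D (D y)" by simp_all
    moreover have "u - D (D y) \<in> TT"
      using u y(1) by (intro complex_vector.subspace_diff[OF subspace_TT] D_in_TT) auto
    ultimately show ?thesis using y(1) by blast
  qed
  \<comment> \<open>The decomposable elements form a subspace, so it is enough to decompose the
    eigenvectors that span.\<close>
  have PS: "csubspace {u. ?P u}"
  proof (rule complex_vector.subspaceI)
    show "0 \<in> {u. ?P u}"
      using complex_vector.subspace_0[OF subspace_TT] by force
  next
    fix x x' assume "x \<in> {u. ?P u}" "x' \<in> {u. ?P u}"
    then obtain v v' y y' where *: "v \<in> TT" "v' \<in> TT" "y \<in> TT" "y' \<in> TT" "D v = 0" "D v' = 0"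
      and x: "x = v + D (D y)" "x' = v' + D (D y')" by blast
    have "x + x' = (v + v') + D (D (y + y'))" "D (v + v') = 0" using x * by simp_all
    moreover have "v + v' \<in> TT" "y + y' \<in> TT" using * by (simp_all add: complex_vector.subspace_add[OF subspace_TT])
    ultimately show "x + x' \<in> {u. ?P u}" by blast
  next
    fix c x assume "x \<in> {u. ?P u}"
    then obtain v y where *: "v \<in> TT" "y \<in> TT" "D v = 0" "x = v + D (D y)" by blast
    then have "c *\<^sub>C x = c *\<^sub>C v + D (D (c *\<^sub>C y))" "D (c *\<^sub>C v) = 0" by (simp_all add: scaleC_add_right)
    moreover have "c *\<^sub>C v \<in> TT" "c *\<^sub>C y \<in> TT" using * by (simp_all add: complex_vector.subspace_scale[OF subspace_TT])
    ultimately show "c *\<^sub>C x \<in> {u. ?P u}" by blast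
  qed
  have "cspan (\<Union>c. R c) \<subseteq> {u. ?P u}"
    by (rule complex_vector.span_minimal[OF _ PS]) (use Reig RT eig in blast)
  then show ?thesis using u TR by blast
qed

section \<open>Cochains on p+ as elements of M \<otimes> \<Lambda> p-\<close>

lemma zero_TT: "0 \<in> TT"
  by (rule complex_vector.subspace_0[OF subspace_TT])

lemma lie_subalgebra_k: "lie_subalgebra k"
  unfolding lie_subalgebra_def using subspace_k bracket_k by blast

text \<open>The value 0 outside degree n follows the convention of \<open>cochains\<close>, whose
  members are extended by 0 and can therefore be compared as total functions.\<close>

definition cochain :: "nat \<Rightarrow> ('m, 'g exterior) tensor \<Rightarrow> 'g exterior \<Rightarrow> 'm"
  where "cochain n u w = (if w \<in> ext_power pp n then epair u w else 0)"

lemma clinear_cochain: "clinear (cochain n)"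
  by (rule clinearI) (auto simp: cochain_def fun_eq_iff scaleC_fun_def)

lemma subspace_ext_power: "csubspace (ext_power V n)"
  unfolding ext_power_def by simp

lemma cochain_in_cochains: "cochain n u \<in> cochains pp n"
  using subspace_ext_power[of pp n]
  by (auto simp: cochains_def cochain_def complex_vector.subspace_add complex_vector.subspace_scale)

lemma ext_power_proj: "w \<in> ext_power pp n \<Longrightarrow> ext_proj m w = (if m = n then w else 0)"
  using ext_proj_ext_proj[of m n w] by (auto simp: ext_power_eq)

lemma cochain_eproj: "cochain m (eproj n u) = (if m = n then cochain n u else 0)"
  by (auto simp: cochain_def fun_eq_iff epair_ext_proj[symmetric] ext_power_proj)

text \<open>Pairing with x \<and> xs means contracting with x first, and \<open>econtract_C\<close>
  then gives the recursion of the coboundary. Its minus sign accumulates to (-1)^i.\<close>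

lemma epair_C:
  assumes "xs \<in> lists pp"
  shows "epair (C u) (wedge xs) = (\<Sum>i<length xs. (- 1) ^ i *\<^sub>C \<pi> (xs ! i) (epair u (wedge (omit i xs))))"
  using assms
proof (induction xs arbitrary: u)
  case Nil
  have "epair (mact y v) w = \<pi> y (epair v w)" for y v w
    unfolding mact_def by (rule epair_lmap[OF clinear_rep])
  then show ?case by (simp add: C_def clinear_sum[OF clinear_epair_left] clinear_simps[OF clinear_rep])
next
  case (Cons x xs)
  then have x: "x \<in> pp" and xs: "xs \<in> lists pp" by auto
  have e: "epair v (wedge (y # ys)) = epair (econtract y v) (wedge ys)" for v and y and ys
    using epair_ext_mult[of v y "wedge ys"] by simp
  have m: "epair (mact y v) w = \<pi> y (epair v w)" for y v w
    unfolding mact_def by (rule epair_lmap[OF clinear_rep])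
  have "epair (C u) (wedge (x # xs)) = \<pi> x (epair u (wedge xs)) - epair (C (econtract x u)) (wedge xs)"
    by (simp add: e econtract_C[OF x] m)
  also have "\<dots> = \<pi> x (epair u (wedge xs))
     - (\<Sum>i<length xs. (- 1) ^ i *\<^sub>C \<pi> (xs ! i) (epair u (wedge (x # omit i xs))))"
    by (simp only: Cons.IH e)
  also have "\<dots> = (\<Sum>i<length (x # xs). (- 1) ^ i *\<^sub>C \<pi> ((x # xs) ! i) (epair u (wedge (omit i (x # xs)))))"
    by (simp add: sum.lessThan_Suc_shift scaleC_one sum_negf complex_vector.scale_minus_left del: sum.lessThan_Suc)
  finally show ?case .
qed

lemma omit_in_lists: "xs \<in> lists V \<Longrightarrow> omit i xs \<in> lists V"
  by (auto simp: omit_def in_lists_conv_set dest: in_set_takeD in_set_dropD)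

lemma coboundary_cochain: "coboundary pp \<pi> n (cochain n u) = cochain (Suc n) (C u)"
proof
  fix w
  let ?f = "\<lambda>xs. \<Sum>i<length xs. (- 1) ^ i *\<^sub>C \<pi> (xs ! i) (cochain n u (wedge (omit i xs)))"
  \<comment> \<open>The projection to degree n + 1 makes \<open>?g\<close> match \<open>?f\<close>
    on lists of every length, since the cochain vanishes on products of the wrong length.\<close>
  let ?g = "\<lambda>w. epair (C u) (ext_proj (Suc n) w)"
  have g: "clinear ?g" by (rule clinear_compose[OF clinear_epair clinear_ext_proj])
  have fg: "?f xs = ?g (wedge xs)" if xs: "xs \<in> lists pp" for xs
  proof (cases "length xs = Suc n")
    case True
    have "cochain n u (wedge (omit i xs)) = epair u (wedge (omit i xs))" if "i < length xs" for i
    proof -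
      have "wedge (omit i xs) \<in> ext_power pp n"
        unfolding ext_power_def using omit_in_lists[OF xs, of i] length_omit[OF that] True
        by (intro complex_vector.span_base) auto
      then show ?thesis by (simp add: cochain_def)
    qed
    then show ?thesis using epair_C[OF xs, of u] True by (simp add: ext_proj_wedge)
  next
    case False
    \<comment> \<open>A product of the wrong length lies in \<open>ext_power pp n\<close> only if it
      is 0, where \<open>epair u\<close> vanishes as well.\<close>
    have "cochain n u (wedge (omit i xs)) = 0" if "i < length xs" for i
    proof -
      have "length (omit i xs) \<noteq> n" using length_omit[OF that] that False by auto
      then show ?thesis
        using ext_power_proj[of "wedge (omit i xs)" n n] by (auto simp: cochain_def ext_proj_wedge)
    qed
    then show ?thesis using False by (simp add: ext_proj_wedge clinear_simps[OF clinear_rep])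
  qed
  \<comment> \<open>On lists over p+, \<open>?f\<close> is the linear map \<open>?g\<close> composed
    with \<open>wedge\<close>, so the relations of the exterior algebra give multilinearity and
    alternation.\<close>
  have alt: "alternating_on pp ?f"
    unfolding alternating_on_def
  proof (intro ballI allI)
    fix xs ys x y c assume l: "xs \<in> lists pp" "ys \<in> lists pp" "x \<in> pp" "y \<in> pp"
    have in_pp: "xs @ [x + y] @ ys \<in> lists pp" "xs @ [x] @ ys \<in> lists pp" "xs @ [y] @ ys \<in> lists pp"
      "xs @ [c *\<^sub>C x] @ ys \<in> lists pp" "xs @ [x, x] @ ys \<in> lists pp"
      using l by (auto simp: complex_vector.span_add complex_vector.span_scale)
    show "?f (xs @ [x + y] @ ys) = ?f (xs @ [x] @ ys) + ?f (xs @ [y] @ ys) \<and>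
      ?f (xs @ [c *\<^sub>C x] @ ys) = c *\<^sub>C ?f (xs @ [x] @ ys) \<and> ?f (xs @ [x, x] @ ys) = 0"
      unfolding in_pp[THEN fg] by (simp add: wedge_add wedge_scale wedge_alternating clinear_simps[OF g])
  qed
  have sub: "csubspace pp" by simp
  note lift = ext_lift_wedge[OF sub alt] ext_lift_add[OF sub alt] ext_lift_scale[OF sub alt]
  note A = csubspace_ext_algebra[of pp]
  let ?S = "{w \<in> ext_algebra pp. ext_lift pp ?f w = ?g w}"
  have wedge: "wedge xs \<in> ?S" if "xs \<in> lists pp" for xs
    using wedge_in_ext_algebra[OF that] by (simp only: mem_Collect_eq lift(1)[OF that] fg[OF that] simp_thms)
  have "csubspace ?S"
  proof (rule complex_vector.subspaceI)
    have "ext_lift pp ?f (0 *\<^sub>C 0) = 0" by (subst lift(3)) (simp_all add: complex_vector.subspace_0[OF A])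
    then show "0 \<in> ?S" by (simp add: complex_vector.subspace_0[OF A])
  qed (simp_all add: lift(2,3) clinear_simps[OF g] complex_vector.subspace_add[OF A] complex_vector.subspace_scale[OF A])
  then have "ext_algebra pp \<subseteq> ?S"
    unfolding ext_algebra_def[of pp] using wedge by (intro complex_vector.span_minimal) (auto simp: ext_algebra_def)
  then show "coboundary pp \<pi> n (cochain n u) w = cochain (Suc n) (C u) w"
    using ext_power_proj[of w "Suc n" "Suc n"]
    by (auto simp: coboundary_def cochain_def ext_power_eq)
qed

text \<open>In u = u0 + \<sigma> e \<and> u1, pairing with e \<and> w reads off u1. Once u1 = 0,
  pairing with products free of e determines u0, so the dual pairs can be removed one by
  one.\<close>

lemma epair_nondegenerate:
  assumes "set l \<subseteq> set es" "distinct l" "u \<in> tensor_subspace (ext_algebra (cspan (\<sigma> ` set l)))"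
    and "\<And>w. w \<in> ext_algebra (cspan (set l)) \<Longrightarrow> epair u w = 0"
  shows "u = 0"
  using assms
proof (induction l arbitrary: u)
  case Nil
  then obtain m where "u = m \<otimes>\<^sub>C wedge []"
    using tensor_subspace_empty[of u] by auto
  with Nil(4)[of "wedge []"] show ?case
    by (simp add: epair_tens ext_vac_wedge scaleC_one wedge_in_ext_algebra)
next
  case (Cons e l)
  let ?T = "tensor_subspace (ext_algebra (cspan (\<sigma> ` set l)))"
  have "u \<in> tensor_subspace (ext_algebra (cspan (insert (\<sigma> e) (\<sigma> ` set l))))"
    using Cons.prems(3) by simp
  from tensor_subspace_insert[OF this]
  obtain u0 u1 where u: "u0 \<in> ?T" "u1 \<in> ?T" "u = u0 + ewedge (\<sigma> e) u1" by blast
  have e: "killing e (\<sigma> e) = 1" using Cons.prems orthonormal by auto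
  have K0: "killing e y = 0" if "y \<in> cspan (\<sigma> ` set l)" for y
    by (rule clinear_vanishes_on_span[OF clinear_killing _ that]) (use Cons.prems orthonormal in auto)
  have 0: "econtract e u0 = 0" "econtract e u1 = 0"
    using econtract_eq_0[OF K0] u by blast+
  have u1: "econtract e u = u1"
    by (simp_all add: u(3) econtract_ewedge e 0 scaleC_one)
  have mono: "ext_algebra (cspan (set l)) \<subseteq> ext_algebra (cspan (set (e # l)))"
    by (intro ext_algebra_mono complex_vector.span_mono) auto
  have "u1 = 0"
  proof (rule Cons.IH)
    fix w assume "w \<in> ext_algebra (cspan (set l))"
    then have "ext_mult e w \<in> ext_algebra (cspan (set (e # l)))"
      using mono by (intro ext_mult_in_ext_algebra) (auto intro: complex_vector.span_base)
    from Cons.prems(4)[OF this] show "epair u1 w = 0" by (simp add: epair_ext_mult u1)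
  qed (use Cons.prems u in auto)
  then have "u = u0" using u by simp
  moreover have "u0 = 0"
    by (rule Cons.IH) (use Cons.prems u \<open>u = u0\<close> mono in auto)
  ultimately show ?case by simp
qed

text \<open>By induction u0 represents \<omega> on the products free of e and u1 represents w
  \<mapsto> \<omega> (e \<and> w). Their combination u0 + \<sigma> e \<and> u1 represents \<omega>,
  since \<sigma> e \<and> u1 pairs to 0 with the products free of e and u0 pairs to 0 with e \<and>
  w.\<close>

lemma epair_surjective:
  assumes "set l \<subseteq> set es" "distinct l"
    and "\<And>v w. v \<in> ext_algebra (cspan (set l)) \<Longrightarrow> w \<in> ext_algebra (cspan (set l)) \<Longrightarrow> \<omega> (v + w) = \<omega> v + \<omega> w"
    and "\<And>c w. w \<in> ext_algebra (cspan (set l)) \<Longrightarrow> \<omega> (c *\<^sub>C w) = c *\<^sub>C \<omega> w"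
  shows "\<exists>u\<in>tensor_subspace (ext_algebra (cspan (\<sigma> ` set l))). \<forall>w\<in>ext_algebra (cspan (set l)). epair u w = \<omega> w"
  using assms
proof (induction l arbitrary: \<omega>)
  case Nil
  show ?case
  proof (intro bexI ballI)
    fix w :: "'g exterior" assume "w \<in> ext_algebra (cspan (set []))"
    then obtain c where "w = c *\<^sub>C wedge []" using ext_algebra_empty by auto
    then show "epair (\<omega> (wedge []) \<otimes>\<^sub>C wedge []) w = \<omega> w"
      by (simp add: epair_tens ext_vac_wedge Nil(4) wedge_in_ext_algebra scaleC_one)
  qed (simp add: tens_in_tensor_subspace wedge_in_ext_algebra)
next
  case (Cons e l)
  let ?A = "ext_algebra (cspan (set l))" and ?A' = "ext_algebra (cspan (set (e # l)))"
  let ?T = "tensor_subspace (ext_algebra (cspan (\<sigma> ` set l)))"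
  let ?T' = "tensor_subspace (ext_algebra (cspan (\<sigma> ` set (e # l))))"
  have mono: "?A \<subseteq> ?A'"
    by (intro ext_algebra_mono complex_vector.span_mono) auto
  have mult: "ext_mult e w \<in> ?A'" if "w \<in> ?A" for w
    using mono that by (intro ext_mult_in_ext_algebra) (auto intro: complex_vector.span_base)
  have "\<exists>u\<in>?T. \<forall>w\<in>?A. epair u w = \<omega> w"
    by (rule Cons.IH; (rule Cons.prems(3)[OF subsetD[OF mono] subsetD[OF mono]] Cons.prems(4)[OF subsetD[OF mono]])?)
      (use Cons.prems in auto)
  then obtain u0 where u0: "u0 \<in> ?T" "\<And>w. w \<in> ?A \<Longrightarrow> epair u0 w = \<omega> w" by blast
  have "\<exists>u\<in>?T. \<forall>w\<in>?A. epair u w = \<omega> (ext_mult e w)"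
    by (rule Cons.IH; (simp only: ext_mult_linear, rule Cons.prems(3)[OF mult mult] Cons.prems(4)[OF mult])?)
      (use Cons.prems in auto)
  then obtain u1 where u1: "u1 \<in> ?T" "\<And>w. w \<in> ?A \<Longrightarrow> epair u1 w = \<omega> (ext_mult e w)" by blast
  have e: "killing e (\<sigma> e) = 1" using Cons.prems orthonormal by auto
  have K0: "killing e y = 0" if "y \<in> cspan (\<sigma> ` set l)" for y
    by (rule clinear_vanishes_on_span[OF clinear_killing _ that]) (use Cons.prems orthonormal in auto)
  have 0: "econtract e u0 = 0" "econtract e u1 = 0"
    using econtract_eq_0[OF K0] u0 u1 by blast+
  have K1: "killing y (\<sigma> e) = 0" if "y \<in> cspan (set l)" for y
    by (rule clinear_vanishes_on_span[OF clinear_killing_left _ that]) (use Cons.prems orthonormal in auto)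
  have perp: "epair (ewedge (\<sigma> e) u) w = 0" if "w \<in> ?A" for u w
  proof -
    have "\<forall>u. epair (ewedge (\<sigma> e) u) (wedge ys) = 0" if "ys \<in> lists (cspan (set l))" for ys
      using that
    proof (induction ys)
      case (Cons y ys)
      then show ?case
        using K1 by (simp add: epair_ext_mult econtract_ewedge flip: ext_mult_wedge)
    qed simp
    then show ?thesis
      using clinear_vanishes_on_span[OF clinear_epair, of "{wedge xs |xs. xs \<in> lists (cspan (set l))}"] that
      unfolding ext_algebra_def by blast
  qed
  show ?case
  proof (intro bexI ballI)
    let ?u = "u0 + ewedge (\<sigma> e) u1"
    have "?T \<subseteq> ?T'"
      unfolding tensor_subspace_def
      using ext_algebra_mono[OF complex_vector.span_mono, of "\<sigma> ` set l" "\<sigma> ` set (e # l)"]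
      by (intro complex_vector.span_mono) auto
    then have "u0 \<in> ?T'" "u1 \<in> ?T'" using u0 u1 by auto
    then show "?u \<in> ?T'"
      unfolding ewedge_def
      by (intro complex_vector.subspace_add[OF csubspace_tensor_subspace]
          tensor_map_in_tensor_subspace[OF clinear_id clinear_ext_mult ext_mult_in_ext_algebra])
        (auto intro: complex_vector.span_base)
    fix w assume "w \<in> ?A'"
    then obtain w0 w1 where w: "w0 \<in> ?A" "w1 \<in> ?A" "w = w0 + ext_mult e w1"
      using ext_algebra_insert[of w e "set l"] by auto
    then show "epair ?u w = \<omega> w"
      using mult mono Cons.prems(3)[of w0 "ext_mult e w1"]
      by (simp add: epair_ext_mult u0 u1 perp econtract_ewedge e 0 scaleC_one in_mono)
  qed
qed

lemma cochain_surjective: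
  assumes "\<omega> \<in> cochains pp n"
  shows "\<exists>u\<in>TT. eproj n u = u \<and> cochain n u = \<omega>"
proof -
  have add: "\<omega> (v + w) = \<omega> v + \<omega> w" if "v \<in> ext_power pp n" "w \<in> ext_power pp n" for v w
    using assms that by (auto simp: cochains_def)
  have scale: "\<omega> (c *\<^sub>C w) = c *\<^sub>C \<omega> w" if "w \<in> ext_power pp n" for w c
    using assms that by (auto simp: cochains_def)
  have out: "\<omega> w = 0" if "w \<notin> ext_power pp n" for w
    using assms that by (auto simp: cochains_def)
  note P = ext_proj_in_ext_power[of _ pp n]
  \<comment> \<open>A cochain is linear only on its own degree; composing with
    \<open>ext_proj n\<close> extends it linearly to the whole exterior algebra of p+.\<close>
  have "\<exists>u\<in>TT. \<forall>w\<in>ext_algebra pp. epair u w = \<omega> (ext_proj n w)"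
    by (rule epair_surjective[of es]) (auto simp: distinct_es add scale P)
  then obtain u where u: "u \<in> TT" "\<And>w. w \<in> ext_algebra pp \<Longrightarrow> epair u w = \<omega> (ext_proj n w)" by blast
  have "cochain n (eproj n u) = \<omega>"
    using u(2) out by (auto simp: cochain_eproj fun_eq_iff cochain_def ext_power_eq)
  then show ?thesis using u(1) eproj_in_TT by (intro bexI[of _ "eproj n u"]) (auto simp: eproj_eproj)
qed

lemma cochain_injective:
  assumes "u \<in> TT" "eproj n u = u" "cochain n u = 0"
  shows "u = 0"
proof (rule epair_nondegenerate[of es])
  fix w assume "w \<in> ext_algebra pp"
  then have "ext_proj n w \<in> ext_power pp n" by (rule ext_proj_in_ext_power)
  then have "epair u (ext_proj n w) = 0"
    using assms(3) by (auto simp: cochain_def fun_eq_iff split: if_splits)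
  then show "epair u w = 0" using assms(2) by (simp add: epair_ext_proj)
qed (use assms distinct_es in auto)

lemma cochain_action_cochain:
  assumes "x \<in> k"
  shows "cochain_action pp \<pi> n x (cochain n u) = cochain n (lact x u)"
proof
  fix w
  have m: "epair (mact y v) w = \<pi> y (epair v w)" for y v w
    unfolding mact_def by (rule epair_lmap[OF clinear_rep])
  have "ext_ad x w \<in> ext_power pp n" if "w \<in> ext_power pp n"
    using that ext_ad_in_ext_algebra[OF k_plus[OF assms]] ext_proj_ext_ad[of n x w] by (auto simp: ext_power_eq)
  then show "cochain_action pp \<pi> n x (cochain n u) w = cochain n (lact x u) w"
    by (auto simp: cochain_action_def cochain_def lact_def m epair_ext_ad)
qed

end

lemma component_eq:
  assumes "csubspace U" "csubspace W" "U \<inter> W = {0}" "u \<in> U" "w \<in> W"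
  shows "component U W (u + w) = u"
  unfolding component_def
proof (rule the_equality)
  show "u \<in> U \<and> u + w - u \<in> W" using assms by simp
  fix v assume v: "v \<in> U \<and> u + w - v \<in> W"
  have "u - v \<in> U" using complex_vector.subspace_diff[OF assms(1,4)] v by blast
  moreover have "(u + w - v) - w \<in> W" using complex_vector.subspace_diff[OF assms(2) _ assms(5)] v by blast
  ultimately have "u - v \<in> U \<inter> W" by (simp add: algebra_simps)
  then show "v = u" using assms(3) by simp
qed

lemma orthonormal_expansion:
  assumes "orthonormal_basis p Z" "v \<in> p"
  shows "v = (\<Sum>z\<in>Z. killing z v *\<^sub>C z)"
proof (rule clinear_eq_on_span[OF clinear_id])
  have Z: "finite Z" "cspan Z = p" "\<And>x y. x \<in> Z \<Longrightarrow> y \<in> Z \<Longrightarrow> killing x y = (if x = y then 1 else 0)"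
    using assms(1) by (auto simp: orthonormal_basis_def)
  show "clinear (\<lambda>v. \<Sum>z\<in>Z. killing z v *\<^sub>C z)"
    by (rule clinearI) (simp_all add: scaleC_add_left sum.distrib complex_vector.scale_sum_right scaleC_scaleC)
  show "v \<in> cspan Z" using assms(2) Z by simp
  show "y = (\<Sum>z\<in>Z. killing z y *\<^sub>C z)" if "y \<in> Z" for y
  proof -
    have "(\<Sum>z\<in>Z. killing z y *\<^sub>C z) = (\<Sum>z\<in>Z. if z = y then z else 0)"
      by (rule sum.cong) (auto simp: Z that scaleC_one)
    then show ?thesis using that Z by simp
  qed
qed

context dirac_setup
begin

subsection \<open>Cohomology and homology\<close>

abbreviation "HH \<equiv> {u \<in> TT. D u = 0}"

lemma subspace_HH: "csubspace HH"
  using subspace_TT by (simp add: complex_vector.subspace_def)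

text \<open>The spin action is given by a description and is controlled only for x in k and on
  \<Lambda> p-. The module axioms on the kernel are therefore derived from the formula
  \<open>act\<close>; the vanishing of \<chi> on brackets keeps the shifted action compatible with
  commutators.\<close>

lemma lie_module_kernel:
  assumes act: "\<And>x u. x \<in> k \<Longrightarrow> u \<in> HH \<Longrightarrow> \<tau> x u = lact x u + \<chi> x *\<^sub>C u"
    and \<chi>: "\<And>x y. x \<in> k \<Longrightarrow> y \<in> k \<Longrightarrow> \<chi> (x + y) = \<chi> x + \<chi> y"
      "\<And>c x. x \<in> k \<Longrightarrow> \<chi> (c *\<^sub>C x) = c * \<chi> x" "\<And>x y. x \<in> k \<Longrightarrow> y \<in> k \<Longrightarrow> \<chi> [x, y]\<^sub>L = 0"
  shows "lie_module k (sub_rep HH \<tau>)"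
proof -
  note H = complex_vector.subspace_add[OF subspace_HH] complex_vector.subspace_scale[OF subspace_HH]
    complex_vector.subspace_0[OF subspace_HH]
  have L: "lact x u \<in> HH" if "x \<in> k" "u \<in> HH" for x u
    using that lact_in_TT lact_D[of x u] by auto
  have cl: "\<tau> x u \<in> HH" if "x \<in> k" "u \<in> HH" for x u
    unfolding act[OF that] by (intro H L that)
  have k: "x + y \<in> k" "c *\<^sub>C x \<in> k" if "x \<in> k" "y \<in> k" for x y c
    using subspace_k that by (auto simp: complex_vector.subspace_add complex_vector.subspace_scale)
  have "\<tau> x (u + v) = \<tau> x u + \<tau> x v" if "x \<in> k" "u \<in> HH" "v \<in> HH" for x u v
    unfolding act[OF that(1,2)] act[OF that(1,3)] act[OF that(1) H(1)[OF that(2,3)]] by (simp add: scaleC_add_right)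
  moreover have "\<tau> x (c *\<^sub>C u) = c *\<^sub>C \<tau> x u" if "x \<in> k" "u \<in> HH" for x u c
    unfolding act[OF that] act[OF that(1) H(2)[OF that(2)]] by (simp add: scaleC_add_right scaleC_scaleC mult.commute)
  moreover have "\<tau> (x + y) u = \<tau> x u + \<tau> y u" if "x \<in> k" "y \<in> k" "u \<in> HH" for x y u
    unfolding act[OF that(1,3)] act[OF that(2,3)] act[OF k(1)[OF that(1,2)] that(3)]
    by (simp add: \<chi> that scaleC_add_left clinear_simps[OF clinear_lact_left])
  moreover have "\<tau> (c *\<^sub>C x) u = c *\<^sub>C \<tau> x u" if "x \<in> k" "u \<in> HH" for x c u
    unfolding act[OF that] act[OF k(2)[OF that(1,1)] that(2)]
    by (simp add: \<chi> that scaleC_add_right scaleC_scaleC clinear_simps[OF clinear_lact_left])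
  moreover have "\<tau> [x, y]\<^sub>L u + \<tau> y (\<tau> x u) = \<tau> x (\<tau> y u)" if "x \<in> k" "y \<in> k" "u \<in> HH" for x y u
  proof -
    have "\<tau> y (\<tau> x u) = lact y (lact x u + \<chi> x *\<^sub>C u) + \<chi> y *\<^sub>C (lact x u + \<chi> x *\<^sub>C u)"
      "\<tau> x (\<tau> y u) = lact x (lact y u + \<chi> y *\<^sub>C u) + \<chi> x *\<^sub>C (lact y u + \<chi> y *\<^sub>C u)"
      using act[OF that(2) cl[OF that(1,3)]] act[OF that(1,3)] act[OF that(1) cl[OF that(2,3)]] act[OF that(2,3)]
      by simp_all
    then show ?thesis
      using act[OF bracket_k[OF that(1,2)] that(3)]
      by (simp add: \<chi> that scaleC_add_right scaleC_scaleC lact_bracket mult.commute)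
  qed
  ultimately show ?thesis
    unfolding lie_module_def sub_rep_def lie_rep.simps
    by (simp only: H cl scaleC_minus1_left scaleC_add_right scaleC_add_left scaleC_scaleC scaleC_one
        add.assoc add.commute add_0_left left_minus simp_thms ball_simps)
      (use cl in \<open>simp add: H complex_vector.subspace_add[OF subspace_TT]
        complex_vector.subspace_scale[OF subspace_TT] algebra_simps\<close>)
qed

lemma alternating_on_boundary:
  "alternating_on UNIV (\<lambda>ys. \<Sum>i<length ys. (- 1) ^ i *\<^sub>C (\<pi> (ys ! i) v \<otimes>\<^sub>C wedge (omit i ys)))"
  (is "alternating_on UNIV ?f")
proof (rule alternating_on_cons_rec[where A = "\<lambda>a w. \<pi> a v \<otimes>\<^sub>C w" and B = "\<lambda>a u. - ewedge a u"])
  show "?f (a # xs) = \<pi> a v \<otimes>\<^sub>C wedge xs + - ewedge a (?f xs)" for a xs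
    by (simp add: sum.lessThan_Suc_shift clinear_sum[OF clinear_e(1)] sum_negf scaleC_one
        complex_vector.scale_minus_left del: sum.lessThan_Suc)
qed (auto intro!: clinear_tens clinear_uminus clinear_e clinear_e_left clinear_compose[OF clinear_tens_left clinear_rep_left]
    simp: ewedge_square)

text \<open>Both operators satisfy the same recursion when a factor y is put in front. For C' the
  term with y acting on v comes from expanding y in the basis \<sigma> e of p-, which is why u is
  taken from TT.\<close>

lemma boundary_eq_C':
  assumes "u \<in> TT"
  shows "boundary \<pi> u = C' u"
proof -
  let ?f = "\<lambda>v ys. \<Sum>i<length ys. (- 1) ^ i *\<^sub>C (\<pi> (ys ! i) v \<otimes>\<^sub>C wedge (omit i ys))"
  let ?b = "\<lambda>v. ext_lift UNIV (?f v)"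
  note alt = alternating_on_boundary
  have w: "?b v (wedge ys) = ?f v ys" for v ys
    by (rule ext_lift_UNIV_wedge[OF alt])
  have lin: "clinear (?b v)" for v
    by (rule clinear_ext_lift[OF alt])
  have lin2: "clinear (\<lambda>v. ?b v w)" for w
  proof (rule clinearI)
    show "?b (x + y) w = ?b x w + ?b y w" for x y
      by (rule exterior_eqI[OF lin clinear_add[OF lin lin]])
        (simp only: w, simp add: clinear_simps[OF clinear_rep] scaleC_add_right sum.distrib)
    show "?b (c *\<^sub>C x) w = c *\<^sub>C ?b x w" for c x
      by (rule exterior_eqI[OF lin clinear_scale[OF lin]])
        (simp only: w, simp add: clinear_simps[OF clinear_rep] complex_vector.scale_sum_right scaleC_scaleC mult.commute)
  qed
  have bil: "cbilinear ?b" unfolding cbilinear_def using lin lin2 by blast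
  have b_Cons: "?b v (wedge (y # ys)) = \<pi> y v \<otimes>\<^sub>C wedge ys - ewedge y (?b v (wedge ys))" for v y ys
    unfolding w by (simp add: sum.lessThan_Suc_shift clinear_sum[OF clinear_e(1)] sum_negf scaleC_one
        complex_vector.scale_minus_left del: sum.lessThan_Suc)
  have C'_Cons: "C' (v \<otimes>\<^sub>C ext_mult y w) = \<pi> y v \<otimes>\<^sub>C w - ewedge y (C' (v \<otimes>\<^sub>C w))" if "y \<in> pm" for v y w
  proof -
    have "C' (v \<otimes>\<^sub>C ext_mult y w) = (\<Sum>e\<in>set es. mact (killing e y *\<^sub>C \<sigma> e) (v \<otimes>\<^sub>C w)
        - ewedge y (mact (\<sigma> e) (v \<otimes>\<^sub>C contraction e w)))"
      by (simp add: C'_def contraction_ext_mult mact_commute mact_tens clinear_simps[OF clinear_rep_left])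
    also have "\<dots> = mact (\<Sum>e\<in>set es. killing e y *\<^sub>C \<sigma> e) (v \<otimes>\<^sub>C w) - ewedge y (C' (v \<otimes>\<^sub>C w))"
      by (simp add: C'_def sum_subtractf clinear_sum[OF clinear_mact_left] clinear_sum[OF clinear_e(1)])
    also have "\<dots> = \<pi> y v \<otimes>\<^sub>C w - ewedge y (C' (v \<otimes>\<^sub>C w))"
      using minus_expansion[OF that] by (simp add: mact_tens)
    finally show ?thesis .
  qed
  have eq: "?b v (wedge ys) = C' (v \<otimes>\<^sub>C wedge ys)" if "ys \<in> lists pm" for v ys
    using that
  proof (induction ys)
    case Nil
    show ?case by (simp add: w C'_def)
  next
    case (Cons y ys)
    then show ?case using C'_Cons[of y v "wedge ys"] by (simp only: b_Cons ext_mult_wedge)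
  qed
  have "?b v w = C' (v \<otimes>\<^sub>C w)" if "w \<in> ext_algebra pm" for v w
    using clinear_eq_on_span[OF lin clinear_compose[OF clinear_ops(2) clinear_tens], of "{wedge xs |xs. xs \<in> lists pm}"]
      that eq unfolding ext_algebra_def by blast
  with assms show ?thesis
    by (induction rule: tensor_subspace_induct)
      (simp_all add: boundary_def clinear_simps[OF clinear_tensor_lift[OF bil]] tensor_lift_tens[OF bil])
qed

lemma eproj_all_0: "(\<And>n. eproj n u = 0) \<Longrightarrow> u = 0"
  using eproj_sum[of u] by auto

lemma csubspace_image:
  assumes "csubspace V" "clinear f"
  shows "csubspace (f ` V)"
proof (rule complex_vector.subspaceI)
  show "0 \<in> f ` V"
    using complex_vector.subspace_0[OF assms(1)] clinear_simps(4)[OF assms(2)] by (metis image_eqI)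
next
  fix x y assume "x \<in> f ` V" "y \<in> f ` V"
  then obtain a b where "a \<in> V" "b \<in> V" "x = f a" "y = f b" by blast
  then show "x + y \<in> f ` V"
    using complex_vector.subspace_add[OF assms(1)] clinear_simps(1)[OF assms(2)] by (metis image_eqI)
next
  fix c x assume "x \<in> f ` V"
  then obtain a where "a \<in> V" "x = f a" by blast
  then show "c *\<^sub>C x \<in> f ` V"
    using complex_vector.subspace_scale[OF assms(1)] clinear_simps(3)[OF assms(2)] by (metis image_eqI)
qed

lemma tensor_power: "tensor_subspace (ext_power pm n) = {u \<in> TT. eproj n u = u}"
  by (rule tensor_subspace_ext_power_eq)

lemma subspace_tensor_power: "csubspace {u \<in> TT. eproj n u = u}"
  unfolding tensor_power[symmetric] by (rule csubspace_tensor_subspace)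

text \<open>A harmonic u is killed by C, so u = C' y gives C (C' y) = 0, and positivity yields C' y
  = 0. The next lemma exchanges the roles of C and C'.\<close>

lemma harmonic_C': "u \<in> HH \<Longrightarrow> u = C' y \<Longrightarrow> y \<in> TT \<Longrightarrow> u = 0"
  using D_eq_0_iff[of u] C_C'_eq_0[of y] by simp

lemma harmonic_C: "u \<in> HH \<Longrightarrow> u = C y \<Longrightarrow> y \<in> TT \<Longrightarrow> u = 0"
  using D_eq_0_iff[of u] C'_C_eq_0[of y] by simp

lemma eproj_HH: "u \<in> HH \<Longrightarrow> eproj n u \<in> HH"
  using eproj_harmonic eproj_in_TT by blast

context
  fixes \<tau> :: "'g \<Rightarrow> ('m, 'g exterior) tensor \<Rightarrow> ('m, 'g exterior) tensor" and \<chi> :: "'g \<Rightarrow> complex"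
  assumes hodge: "\<And>u. u \<in> TT \<Longrightarrow> \<exists>v\<in>TT. \<exists>y\<in>TT. D v = 0 \<and> u = v + D (D y)"
    and act: "\<And>x u. x \<in> k \<Longrightarrow> u \<in> HH \<Longrightarrow> \<tau> x u = lact x u + \<chi> x *\<^sub>C u"
    and kernel: "lie_module k (sub_rep HH \<tau>)"
begin

text \<open>In z = v + C (C' y) + C' (C y), applying C' leaves C' (C (C' y)) = 0, so the middle term
  vanishes by positivity and z differs from the harmonic v by a boundary. The case of C is
  symmetric.\<close>

lemma hodge_C':
  assumes "z \<in> TT" "C' z = 0"
  shows "\<exists>v\<in>HH. \<exists>y\<in>TT. z = v + C' y"
proof -
  obtain v y where vy: "v \<in> TT" "y \<in> TT" "D v = 0" "z = v + (C (C' y) + C' (C y))"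
    using hodge[OF assms(1)] by (auto simp: D_D)
  then have "C' (C (C' y)) = 0" using assms(2) D_eq_0_iff[of v] by (simp add: C'_C')
  then have "C (C' y) = 0" using C'_C_eq_0 C'_in_TT vy by blast
  then show ?thesis using vy C_in_TT by (intro bexI[of _ v] bexI[of _ "C y"]) auto
qed

lemma hodge_C:
  assumes "z \<in> TT" "C z = 0"
  shows "\<exists>v\<in>HH. \<exists>y\<in>TT. z = v + C y"
proof -
  obtain v y where vy: "v \<in> TT" "y \<in> TT" "D v = 0" "z = v + (C (C' y) + C' (C y))"
    using hodge[OF assms(1)] by (auto simp: D_D)
  then have "C (C' (C y)) = 0" using assms(2) D_eq_0_iff[of v] by (simp add: C_C)
  then have "C' (C y) = 0" using C_C'_eq_0 C_in_TT vy by blast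
  then show ?thesis using vy C'_in_TT by (intro bexI[of _ v] bexI[of _ "C' y"]) auto
qed

text \<open>The degree parts of a harmonic element are cycles. They are boundaries only if they
  vanish, by \<open>harmonic_C'\<close>, and every cycle has a harmonic representative, by
  \<open>hodge_C'\<close>.\<close>

lemma kernel_iso_homology: "isomorphic_modules k (sub_rep HH \<tau>) (twist (homology pm \<pi>) \<chi>)"
proof -
  let ?T = "\<lambda>n. {u \<in> TT. eproj n u = u}"
  let ?Z = "\<lambda>n. {u \<in> ?T n. C' u = 0}" and ?U = "\<lambda>n. C' ` ?T (Suc n)"
  have Z: "{u \<in> ?T n. boundary \<pi> u = 0} = ?Z n" and U: "boundary \<pi> ` ?T n = C' ` ?T n" for n
    using boundary_eq_C' by (auto intro!: image_cong)
  have lact: "diagonal_action \<pi> ext_ad = lact"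
    by (simp add: fun_eq_iff diagonal_action_def lact_def mact_def ead_def id_def)
  have hom: "homology pm \<pi> = direct_sum_rep (\<lambda>n. quot_rep (?Z n) (?U n) lact)"
    unfolding homology_def homology_degree_def tensor_power Z U lact ..
  show ?thesis
    unfolding hom
  proof (rule sub_rep_iso_direct_sum_quot[where f = eproj and \<tau> = lact and \<tau>n = "\<lambda>_. lact"])
    show "u = 0" if u: "u \<in> HH" "\<And>n. eproj n u \<in> ?U n" for u
    proof (rule eproj_all_0)
      show "eproj n u = 0" for n
        using u(2)[of n] harmonic_C'[OF eproj_HH[OF u(1)]] by blast
    qed
    show "\<exists>u\<in>HH. z - eproj n u \<in> ?U n \<and> (\<forall>m. m \<noteq> n \<longrightarrow> eproj m u = 0)" if z: "z \<in> ?Z n" for n z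
    proof -
      obtain v y where vy: "v \<in> HH" "y \<in> TT" "z = v + C' y" using hodge_C'[of z] z by blast
      \<comment> \<open>The harmonic part v of a homogeneous cycle need not be homogeneous;
        projecting to degree n replaces it and y by homogeneous ones.\<close>
      have "z - eproj n v = eproj n z - eproj n v" using z by simp
      also have "\<dots> = C' (eproj (Suc n) y)" using vy(3) eproj_ops(3)[of n y] by simp
      finally have "z - eproj n (eproj n v) \<in> ?U n"
        using eproj_in_TT[OF vy(2)] by (auto simp: eproj_eproj)
      then show ?thesis
        using eproj_HH[OF vy(1)] by (intro bexI[of _ "eproj n v"]) (auto simp: eproj_eproj)
    qed
    show "finite {n. eproj n u \<notin> ?U n}" for u
    proof -
      obtain N where N: "\<forall>n\<ge>N. eproj n u = 0" using eproj_sum by blast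
      have "0 \<in> ?U n" for n
        using complex_vector.subspace_0[OF csubspace_image[OF subspace_tensor_power clinear_ops(2)]] .
      then have "{n. eproj n u \<notin> ?U n} \<subseteq> {..<N}" using N by (auto simp: not_le[symmetric])
      then show ?thesis using finite_subset by blast
    qed
    show "lact x u \<in> ?U n" if xu: "x \<in> k" "u \<in> ?U n" for n x u
    proof -
      obtain y where "y \<in> TT" "eproj (Suc n) y = y" "u = C' y" using xu(2) by blast
      then show ?thesis
        using xu(1) lact_C'[OF xu(1), of y] eproj_ops(5)[of "Suc n" x y] lact_in_TT by auto
    qed
    show "eproj n u \<in> ?Z n" if "u \<in> HH" for n u
      using eproj_HH[OF that, of n] D_eq_0_iff[of "eproj n u"] by (auto simp: eproj_eproj)
  qed (use lie_subalgebra_k subspace_HH kernel act in \<open>auto simp: eproj_ops(5)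
      intro: csubspace_image subspace_tensor_power clinear_ops clinear_e\<close>)
qed

text \<open>\<open>cochain n\<close> only sees the part of degree n and is injective on homogeneous
  tensors of that degree, so the Hodge argument for C carries over from tensors to cochains.\<close>

lemma kernel_iso_cohomology: "isomorphic_modules k (sub_rep HH \<tau>) (twist (cohomology pp \<pi>) \<chi>)"
proof -
  let ?T = "\<lambda>n. {u \<in> TT. eproj n u = u}"
  let ?Z = "\<lambda>n. cochain n ` {u \<in> ?T n. C u = 0}"
  let ?U = "\<lambda>n. case n of 0 \<Rightarrow> {0} | Suc j \<Rightarrow> cochain (Suc j) ` C ` ?T j"
  have coch: "cochains pp n = cochain n ` ?T n" for n
    using cochain_surjective cochain_in_cochains by fastforce
  have CT: "C u \<in> ?T (Suc n)" if "u \<in> ?T n" for u n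
    using that C_in_TT[of u] eproj_ops(1)[of n u] by auto
  have Z: "{\<omega> \<in> cochains pp n. coboundary pp \<pi> n \<omega> = 0} = ?Z n" for n
  proof (intro subset_antisym subsetI)
    fix \<omega> assume "\<omega> \<in> {\<omega> \<in> cochains pp n. coboundary pp \<pi> n \<omega> = 0}"
    then obtain u where u: "u \<in> ?T n" "\<omega> = cochain n u" "cochain (Suc n) (C u) = 0"
      using coch[of n] coboundary_cochain[of n] by auto
    then have "C u = 0" using cochain_injective[of "C u" "Suc n"] CT[OF u(1)] by blast
    then show "\<omega> \<in> ?Z n" using u by blast
  qed (auto simp: coch coboundary_cochain clinear_simps[OF clinear_cochain])
  have U: "(case n of 0 \<Rightarrow> {0} | Suc j \<Rightarrow> coboundary pp \<pi> j ` cochains pp j) = ?U n" for n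
    by (cases n) (simp_all add: coch image_image coboundary_cochain)
  have hom: "cohomology pp \<pi> = direct_sum_rep (\<lambda>n. quot_rep (?Z n) (?U n) (cochain_action pp \<pi> n))"
    unfolding cohomology_def cohomology_degree_def Z U ..
  have subU: "csubspace (?U n)" for n
    by (cases n) (simp_all add: csubspace_image[OF csubspace_image[OF subspace_tensor_power clinear_ops(1)] clinear_cochain])
  show ?thesis
    unfolding hom
  proof (rule sub_rep_iso_direct_sum_quot[where f = cochain and \<tau> = lact])
    show "u = 0" if u: "u \<in> HH" "\<And>n. cochain n u \<in> ?U n" for u
    proof (rule eproj_all_0)
      fix n
      have c: "cochain n (eproj n u) = cochain n u" by (simp add: cochain_eproj)
      have T: "eproj n u \<in> ?T n" using eproj_HH[OF u(1)] by (auto simp: eproj_eproj)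
      show "eproj n u = 0"
      proof (cases n)
        case 0
        then have "cochain n (eproj n u) = 0" using u(2)[of n] c by simp
        then show ?thesis using T cochain_injective by blast
      next
        case (Suc j)
        then obtain y where y: "y \<in> ?T j" "cochain n u = cochain n (C y)" using u(2)[of n] by auto
        have "eproj n u - C y \<in> ?T n"
          using T CT[OF y(1)] Suc by (intro complex_vector.subspace_diff[OF subspace_tensor_power]) auto
        moreover have "cochain n (eproj n u - C y) = 0"
          by (simp add: clinear_simps[OF clinear_cochain] c y(2))
        ultimately have "eproj n u - C y = 0" using cochain_injective by blast
        then show ?thesis using harmonic_C[OF eproj_HH[OF u(1)], of n y] y(1) by simp
      qed
    qed
    show "\<exists>u\<in>HH. z - cochain n u \<in> ?U n \<and> (\<forall>m. m \<noteq> n \<longrightarrow> cochain m u = 0)" if z: "z \<in> ?Z n" for n z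
    proof -
      obtain u where u: "u \<in> ?T n" "C u = 0" "z = cochain n u" using z by blast
      obtain v y where vy: "v \<in> HH" "y \<in> TT" "u = v + C y" using hodge_C[of u] u by blast
      have "z - cochain n (eproj n v) = cochain n (eproj n (C y))"
        using vy(3) u(3) by (simp add: cochain_eproj clinear_simps[OF clinear_cochain])
      moreover have "cochain n (eproj n (C y)) \<in> ?U n"
      proof (cases n)
        case (Suc j)
        have "eproj j y \<in> ?T j" using eproj_in_TT[OF vy(2)] by (auto simp: eproj_eproj)
        then show ?thesis using Suc eproj_ops(1)[of j y] by auto
      qed (simp add: eproj_ops clinear_simps[OF clinear_cochain])
      ultimately show ?thesis
        using eproj_HH[OF vy(1)] by (intro bexI[of _ "eproj n v"]) (auto simp: cochain_eproj)
    qed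
    show "finite {n. cochain n u \<notin> ?U n}" for u
    proof -
      obtain N where N: "\<forall>n\<ge>N. eproj n u = 0" using eproj_sum by blast
      have "cochain n u \<in> ?U n" if "n \<ge> N" for n
      proof -
        have "cochain n u = cochain n (eproj n u)" by (simp add: cochain_eproj)
        then show ?thesis
          using N that complex_vector.subspace_0[OF subU[of n]] by (simp add: clinear_simps[OF clinear_cochain])
      qed
      then have "{n. cochain n u \<notin> ?U n} \<subseteq> {..<N}" by (auto simp: not_le[symmetric])
      then show ?thesis using finite_subset by blast
    qed
    show "cochain n (lact x u) = cochain_action pp \<pi> n x (cochain n u)" if "x \<in> k" for n x u
      using cochain_action_cochain[OF that] by simp
    show "clinear (cochain_action pp \<pi> n x)" for n x
      by (rule clinearI) (simp_all add: cochain_action_def fun_eq_iff scaleC_fun_def clinear_simps[OF clinear_rep]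
          complex_vector.scale_right_diff_distrib)
    show "cochain_action pp \<pi> n x u \<in> ?U n" if xu: "x \<in> k" "u \<in> ?U n" for n x u
    proof (cases n)
      case 0
      have "cochain_action pp \<pi> 0 x 0 = 0"
        using cochain_action_cochain[OF xu(1), of 0 0] by (simp add: clinear_simps[OF clinear_cochain])
      then show ?thesis using 0 xu by simp
    next
      case (Suc j)
      then obtain y where y: "y \<in> ?T j" "u = cochain n (C y)" using xu by auto
      have "lact x y \<in> ?T j" using y(1) lact_in_TT[OF xu(1)] eproj_ops(5)[of j x y] by auto
      then show ?thesis
        using Suc y(2) cochain_action_cochain[OF xu(1), of n "C y"] lact_C[OF xu(1), of y] by auto
    qed
    show "cochain n u \<in> ?Z n" if "u \<in> HH" for n u
    proof -
      have "eproj n u \<in> {u \<in> ?T n. C u = 0}"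
        using eproj_HH[OF that, of n] D_eq_0_iff[of "eproj n u"] by (auto simp: eproj_eproj)
      moreover have "cochain n u = cochain n (eproj n u)" by (simp add: cochain_eproj)
      ultimately show ?thesis by blast
    qed
  qed (use lie_subalgebra_k subspace_HH kernel act subU clinear_cochain in auto)
qed

end

subsection \<open>Clifford and spin actions\<close>

text \<open>The formulas in dual bases are linear on the whole Lie algebra, whereas
  \<open>component\<close> is a description that is only meaningful on p. They make
  \<open>cliff a\<close> linear in a without side conditions.\<close>

definition proj_plus :: "'g \<Rightarrow> 'g" where "proj_plus a = (\<Sum>e\<in>set es. killing a (\<sigma> e) *\<^sub>C e)"
definition proj_minus :: "'g \<Rightarrow> 'g" where "proj_minus a = (\<Sum>e\<in>set es. killing e a *\<^sub>C \<sigma> e)"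

definition cliff :: "'g \<Rightarrow> 'g exterior \<Rightarrow> 'g exterior"
  where "cliff a w = ext_mult (proj_minus a) w + contraction (proj_plus a) w"

lemma clinear_proj: "clinear proj_plus" "clinear proj_minus"
  unfolding proj_plus_def proj_minus_def
  by (rule clinearI; simp add: scaleC_add_left sum.distrib complex_vector.scale_sum_right scaleC_scaleC)+

lemma clinear_cliff: "clinear (cliff a)"
  unfolding cliff_def by (intro clinear_add clinear_ext_mult clinear_contraction)

lemma clinear_cliff_left: "clinear (\<lambda>a. cliff a w)"
  unfolding cliff_def
  by (intro clinear_add clinear_compose[OF clinear_ext_mult_left] clinear_compose[OF clinear_contraction_left] clinear_proj)

end

locale dirac_spin = dirac_setup es \<sigma> k \<pi> ip
  for es :: "'g::complex_lie_algebra list" and \<sigma> k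
    and \<pi> :: "'g \<Rightarrow> 'm::complex_vector \<Rightarrow> 'm" and ip +
  fixes p Z :: "'g set"
  assumes isotropic_plus: "\<And>x y. x \<in> pp \<Longrightarrow> y \<in> pp \<Longrightarrow> killing x y = 0"
    and isotropic_minus: "\<And>x y. x \<in> pm \<Longrightarrow> y \<in> pm \<Longrightarrow> killing x y = 0"
    and p_eq: "p = subspace_sum pp pm" and disjoint: "pp \<inter> pm = {0}"
    and basis: "orthonormal_basis p Z"
begin

lemma proj_sum:
  assumes "x \<in> pp" "y \<in> pm"
  shows "proj_plus (x + y) = x" "proj_minus (x + y) = y"
proof -
  have "killing y (\<sigma> e) = 0" "killing e x = 0" if "e \<in> set es" for e
    using isotropic_minus[OF assms(2), of "\<sigma> e"] isotropic_plus[OF _ assms(1), of e] that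
      complex_vector.span_base[of e "set es"] complex_vector.span_base[of "\<sigma> e" "\<sigma> ` set es"] by auto
  then show "proj_plus (x + y) = x" "proj_minus (x + y) = y"
    using plus_expansion[OF assms(1)] minus_expansion[OF assms(2)] by (simp_all add: proj_plus_def proj_minus_def)
qed

lemma clifford_action_eq:
  assumes "a \<in> p"
  shows "clifford_action pp pm a = cliff a"
proof -
  obtain x y where xy: "x \<in> pp" "y \<in> pm" "a = x + y"
    using assms by (auto simp: p_eq subspace_sum_def)
  have "component pp pm (x + y) = x"
    by (rule component_eq[OF _ _ disjoint xy(1,2)]) simp_all
  moreover have "component pm pp (y + x) = y"
    by (rule component_eq[OF _ _ _ xy(2,1)]) (use disjoint in \<open>auto simp: Int_commute\<close>)
  ultimately show ?thesis
    using proj_sum[OF xy(1,2)] xy(3) by (simp add: clifford_action_def cliff_def fun_eq_iff add.commute)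
qed

lemma basis_props: "finite Z" "z \<in> Z \<Longrightarrow> z \<in> p"
  using basis complex_vector.span_base by (auto simp: orthonormal_basis_def)

lemma pp_subset: "pp \<subseteq> p" "pm \<subseteq> p"
  using complex_vector.span_zero[of "set es"] complex_vector.span_zero[of "\<sigma> ` set es"]
  unfolding p_eq subspace_sum_def by force+

lemma es_in: "e \<in> set es \<Longrightarrow> e \<in> pp" "e \<in> set es \<Longrightarrow> \<sigma> e \<in> pm"
  by (auto intro: complex_vector.span_base)

lemma subspace_p: "csubspace p"
  unfolding p_eq subspace_sum_def by (rule complex_vector.subspace_sums) auto

lemma p_decomposition: "a \<in> p \<Longrightarrow> a = proj_plus a + proj_minus a"
  by (auto simp: p_eq subspace_sum_def proj_sum)

lemma cliff_plus: "a \<in> pp \<Longrightarrow> cliff a w = contraction a w"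
  and cliff_minus: "a \<in> pm \<Longrightarrow> cliff a w = ext_mult a w"
  using proj_sum[OF _ complex_vector.span_zero, of a] proj_sum[OF complex_vector.span_zero, of a]
  by (simp_all add: cliff_def)

text \<open>The sum of z \<otimes> z over an orthonormal basis equals the sum of e \<otimes>
  \<sigma> e + \<sigma> e \<otimes> e. A factor from p- acts by exterior multiplication and gives C;
  a factor from p+ acts by contraction and gives C'.\<close>

lemma dirac_eq_D: "dirac pp pm Z \<pi> u = D u"
proof -
  have "dirac pp pm Z \<pi> u = (\<Sum>z\<in>Z. mact z (ewedge (proj_minus z) u) + mact z (econtract (proj_plus z) u))"
    unfolding dirac_def
  proof (rule sum.cong)
    fix z assume "z \<in> Z"
    then have "clifford_action pp pm z = (\<lambda>w. ext_mult (proj_minus z) w + contraction (proj_plus z) w)"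
      using clifford_action_eq basis_props by (simp add: cliff_def fun_eq_iff)
    then show "tensor_map (\<pi> z) (clifford_action pp pm z) u
        = mact z (ewedge (proj_minus z) u) + mact z (econtract (proj_plus z) u)"
      by (simp add: tensor_map_add_right clinear_rep clinear_ext_mult clinear_contraction mact_def ewedge_def
          econtract_def lmap_rmap)
  qed simp
  also have "\<dots> = (\<Sum>z\<in>Z. \<Sum>e\<in>set es. mact (killing z e *\<^sub>C z) (ewedge (\<sigma> e) u))
      + (\<Sum>z\<in>Z. \<Sum>e\<in>set es. mact (killing z (\<sigma> e) *\<^sub>C z) (econtract e u))"
    by (simp add: proj_minus_def proj_plus_def sum.distrib clinear_sum[OF clinear_mact]
        clinear_sum[OF clinear_e_left(1)] clinear_sum[OF clinear_e_left(2)] killing_commute[of _ "_ :: 'g"])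
  also have "\<dots> = (\<Sum>e\<in>set es. mact (\<Sum>z\<in>Z. killing z e *\<^sub>C z) (ewedge (\<sigma> e) u))
      + (\<Sum>e\<in>set es. mact (\<Sum>z\<in>Z. killing z (\<sigma> e) *\<^sub>C z) (econtract e u))"
    by (simp only: clinear_sum[OF clinear_mact_left]) (simp only: sum.swap[of _ Z])
  also have "\<dots> = C u + C' u"
  proof -
    have "(\<Sum>z\<in>Z. killing z e *\<^sub>C z) = e" "(\<Sum>z\<in>Z. killing z (\<sigma> e) *\<^sub>C z) = \<sigma> e" if "e \<in> set es" for e
      using orthonormal_expansion[OF basis] es_in[OF that] pp_subset by (metis subsetD)+
    then show ?thesis by (simp add: C_def C'_def)
  qed
  finally show ?thesis by (simp add: D_def)
qed

text \<open>Expanding one of the two entries z in the dual bases and resumming the other by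
  orthonormality replaces Z by \<open>es\<close> and its image under \<sigma>, for any bilinear
  expression.\<close>

lemma sum_basis:
  assumes "\<And>b. clinear (\<lambda>a. F a b)" "\<And>a. clinear (F a)"
  shows "(\<Sum>z\<in>Z. F z z) = (\<Sum>e\<in>set es. F (\<sigma> e) e + F e (\<sigma> e))"
proof -
  have "(\<Sum>z\<in>Z. F z z) = (\<Sum>z\<in>Z. F z (proj_plus z + proj_minus z))"
    using p_decomposition basis_props by (intro sum.cong) auto
  also have "\<dots> = (\<Sum>z\<in>Z. \<Sum>e\<in>set es. F (killing z (\<sigma> e) *\<^sub>C z) e + F (killing z e *\<^sub>C z) (\<sigma> e))"
    by (simp add: proj_plus_def proj_minus_def clinear_simps[OF assms(2)] clinear_simps[OF assms(1)]
        clinear_sum[OF assms(2)] sum.distrib killing_commute[of _ "_ :: 'g"])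
  also have "\<dots> = (\<Sum>e\<in>set es. F (\<Sum>z\<in>Z. killing z (\<sigma> e) *\<^sub>C z) e + F (\<Sum>z\<in>Z. killing z e *\<^sub>C z) (\<sigma> e))"
    by (subst sum.swap) (simp add: clinear_sum[OF assms(1)] sum.distrib)
  also have "\<dots> = (\<Sum>e\<in>set es. F (\<sigma> e) e + F e (\<sigma> e))"
  proof -
    have "(\<Sum>z\<in>Z. killing z e *\<^sub>C z) = e" "(\<Sum>z\<in>Z. killing z (\<sigma> e) *\<^sub>C z) = \<sigma> e" if "e \<in> set es" for e
      using orthonormal_expansion[OF basis] es_in[OF that] pp_subset by (metis subsetD)+
    then show ?thesis by simp
  qed
  finally show ?thesis .
qed

lemma k_p: "x \<in> k \<Longrightarrow> a \<in> p \<Longrightarrow> [x, a]\<^sub>L \<in> p"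
  using k_plus[of x] k_minus[of x] unfolding p_eq subspace_sum_def by simp (metis lie_bracket_linear(1))

definition half_trace :: "'g \<Rightarrow> complex"
  where "half_trace x = (\<Sum>e\<in>set es. killing [x, e]\<^sub>L (\<sigma> e)) / 2"

text \<open>The description in \<open>spin_map\<close> ranges over all ways of writing ad x as a sum
  of operators R a b. Inserting such a sum into the right-hand side and resumming over Z recovers
  the half commutators, so all choices give the same operator.\<close>

lemma spin_action_eq_cliff:
  assumes x: "x \<in> k"
  shows "spin_action p pp pm x = (\<lambda>w. (1 / 2) *\<^sub>C (\<Sum>z\<in>Z. cliff [x, z]\<^sub>L (cliff z w)))"
  unfolding spin_action_def spin_map_def
proof (rule the_equality)
  let ?c = "clifford_action pp pm"
  have main: "(\<Sum>i<n. (1 / 2) *\<^sub>C (?c (a i) (?c (b i) w) - ?c (b i) (?c (a i) w)))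
      = (1 / 2) *\<^sub>C (\<Sum>z\<in>Z. cliff [x, z]\<^sub>L (cliff z w))"
    if ab: "\<forall>i<n. a i \<in> p \<and> b i \<in> p" "\<forall>v\<in>p. [x, v]\<^sub>L = (\<Sum>i<n. so_operator (a i) (b i) v)" for n :: nat and a b w
  proof -
    have "(\<Sum>z\<in>Z. cliff [x, z]\<^sub>L (cliff z w))
        = (\<Sum>z\<in>Z. \<Sum>i<n. cliff (a i) (cliff (killing z (b i) *\<^sub>C z) w) - cliff (b i) (cliff (killing z (a i) *\<^sub>C z) w))"
      using ab(2) basis_props(2)
      by (intro sum.cong) (auto simp: so_operator_def clinear_sum[OF clinear_cliff_left] clinear_simps[OF clinear_cliff_left]
          clinear_simps[OF clinear_cliff] killing_commute[of _ "_ :: 'g"])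
    also have "\<dots> = (\<Sum>i<n. cliff (a i) (cliff (\<Sum>z\<in>Z. killing z (b i) *\<^sub>C z) w)
        - cliff (b i) (cliff (\<Sum>z\<in>Z. killing z (a i) *\<^sub>C z) w))"
      by (subst sum.swap) (simp add: clinear_sum[OF clinear_cliff] clinear_sum[OF clinear_cliff_left] sum_subtractf)
    also have "\<dots> = (\<Sum>i<n. ?c (a i) (?c (b i) w) - ?c (b i) (?c (a i) w))"
      using ab(1) by (intro sum.cong refl) (simp add: clifford_action_eq orthonormal_expansion[OF basis, symmetric])
    finally show ?thesis by (simp add: complex_vector.scale_sum_right)
  qed
  {
    fix T
    assume "\<exists>(n::nat) a b. (\<forall>i<n. a i \<in> p \<and> b i \<in> p) \<and> (\<forall>v\<in>p. [x, v]\<^sub>L = (\<Sum>i<n. so_operator (a i) (b i) v))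
      \<and> T = (\<lambda>w. \<Sum>i<n. (1 / 2) *\<^sub>C (?c (a i) (?c (b i) w) - ?c (b i) (?c (a i) w)))"
    then show "T = (\<lambda>w. (1 / 2) *\<^sub>C (\<Sum>z\<in>Z. cliff [x, z]\<^sub>L (cliff z w)))"
      using main by (elim exE conjE) (simp add: fun_eq_iff)
  }
  obtain n :: nat and g where g: "bij_betw g {..<n} Z"
    using ex_bij_betw_nat_finite[OF basis_props(1)] by (auto simp: atLeast0LessThan)
  \<comment> \<open>A concrete decomposition of ad x: the operators R [x, z] z over the orthonormal
    basis add up to 2 ad x by the skewness of ad x, hence the factor 1/2.\<close>
  define a where "a = (\<lambda>i. (1 / 2) *\<^sub>C [x, g i]\<^sub>L)"
  have gZ: "g i \<in> Z" if "i < n" for i using bij_betw_apply[OF g] that by auto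
  have 1: "\<forall>i<n. a i \<in> p \<and> g i \<in> p"
    using gZ basis_props(2) k_p[OF x] complex_vector.subspace_scale[OF subspace_p] by (auto simp: a_def)
  have 2: "[x, v]\<^sub>L = (\<Sum>i<n. so_operator (a i) (g i) v)" if v: "v \<in> p" for v
  proof -
    have "(\<Sum>i<n. so_operator (a i) (g i) v) = (\<Sum>z\<in>Z. so_operator ((1 / 2) *\<^sub>C [x, z]\<^sub>L) z v)"
      unfolding a_def by (rule sum.reindex_bij_betw[OF g])
    also have "\<dots> = (1 / 2) *\<^sub>C ([x, \<Sum>z\<in>Z. killing z v *\<^sub>C z]\<^sub>L + (\<Sum>z\<in>Z. killing z [x, v]\<^sub>L *\<^sub>C z))"
      by (simp add: so_operator_def killing_invariant' clinear_sum[OF clinear_lie_bracket] complex_vector.scale_sum_right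
          scaleC_add_right sum.distrib scaleC_scaleC complex_vector.scale_minus_left mult.commute)
    also have "\<dots> = (1 / 2) *\<^sub>C ([x, v]\<^sub>L + [x, v]\<^sub>L)"
      using orthonormal_expansion[OF basis v] orthonormal_expansion[OF basis k_p[OF x v]] by simp
    also have "\<dots> = [x, v]\<^sub>L"
      by (simp add: scaleC_add_right scaleC_add_left[symmetric] scaleC_one)
    finally show ?thesis by simp
  qed
  show "\<exists>(n::nat) a b. (\<forall>i<n. a i \<in> p \<and> b i \<in> p) \<and> (\<forall>v\<in>p. [x, v]\<^sub>L = (\<Sum>i<n. so_operator (a i) (b i) v))
      \<and> (\<lambda>w. (1 / 2) *\<^sub>C (\<Sum>z\<in>Z. cliff [x, z]\<^sub>L (cliff z w)))
        = (\<lambda>w. \<Sum>i<n. (1 / 2) *\<^sub>C (?c (a i) (?c (b i) w) - ?c (b i) (?c (a i) w)))"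
    using 1 2 main[OF 1] by (intro exI[of _ n] exI[of _ a] exI[of _ g]) (simp add: fun_eq_iff)
qed

text \<open>In dual bases, the terms with \<sigma> e acting first are reordered by the Clifford
  relation, which produces the trace of ad x on p+. By invariance of the canonical element the
  reordered terms equal the remaining ones, so the overall factor 1/2 only halves the trace.\<close>

lemma spin_action_eq:
  assumes x: "x \<in> k"
  shows "spin_action p pp pm x w = (\<Sum>e\<in>set es. ext_mult [x, \<sigma> e]\<^sub>L (contraction e w)) + half_trace x *\<^sub>C w"
proof -
  let ?s = "\<Sum>e\<in>set es. ext_mult [x, \<sigma> e]\<^sub>L (contraction e w)"
  have "(\<Sum>z\<in>Z. cliff [x, z]\<^sub>L (cliff z w))
      = (\<Sum>e\<in>set es. cliff [x, \<sigma> e]\<^sub>L (cliff e w) + cliff [x, e]\<^sub>L (cliff (\<sigma> e) w))"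
    by (rule sum_basis[of "\<lambda>a b. cliff [x, a]\<^sub>L (cliff b w)"])
      (intro clinear_compose[OF clinear_cliff] clinear_cliff_left clinear_compose[OF clinear_cliff_left clinear_lie_bracket])+
  also have "\<dots> = (\<Sum>e\<in>set es. ext_mult [x, \<sigma> e]\<^sub>L (contraction e w) + killing [x, e]\<^sub>L (\<sigma> e) *\<^sub>C w
      - ext_mult (\<sigma> e) (contraction [x, e]\<^sub>L w))"
    by (intro sum.cong refl)
      (simp add: cliff_plus cliff_minus es_in k_plus[OF x] k_minus[OF x] contraction_ext_mult algebra_simps)
  also have "\<dots> = ?s + (2 * half_trace x) *\<^sub>C w - (\<Sum>e\<in>set es. ext_mult (\<sigma> e) (contraction [x, e]\<^sub>L w))"
    by (simp add: sum.distrib sum_subtractf half_trace_def complex_vector.scale_sum_left)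
  also have "(\<Sum>e\<in>set es. ext_mult (\<sigma> e) (contraction [x, e]\<^sub>L w)) = - ?s"
  proof -
    have "(\<Sum>e\<in>set es. ext_mult (\<sigma> e) (contraction [x, e]\<^sub>L w) + ext_mult [x, \<sigma> e]\<^sub>L (contraction e w)) = 0"
      by (rule canonical_element_invariant[OF x, of "\<lambda>a b. ext_mult b (contraction a w)"])
        (intro clinear_compose[OF clinear_ext_mult] clinear_contraction_left clinear_ext_mult_left)+
    then show ?thesis by (simp add: sum.distrib eq_neg_iff_add_eq_0)
  qed
  finally have "(\<Sum>z\<in>Z. cliff [x, z]\<^sub>L (cliff z w)) = ?s + (2 * half_trace x) *\<^sub>C w + ?s" by simp
  moreover have "(1 / 2) *\<^sub>C (?s + (2 * half_trace x) *\<^sub>C w + ?s) = ?s + half_trace x *\<^sub>C w"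
  proof -
    have "?s + (2 * half_trace x) *\<^sub>C w + ?s = 2 *\<^sub>C (?s + half_trace x *\<^sub>C w)"
      using scaleC_add_left[of 1 1 ?s] by (simp add: scaleC_add_right scaleC_scaleC scaleC_one)
    then show ?thesis by (simp add: scaleC_scaleC scaleC_one)
  qed
  ultimately show ?thesis by (simp add: spin_action_eq_cliff[OF x])
qed

text \<open>The sum of the operators [x, \<sigma> e] \<and> \<iota>(e) kills the empty product and
  obeys the Leibniz rule of ad x for factors in p-, so it is the derivation \<open>ext_ad x\<close>
  on \<Lambda> p-.\<close>

lemma spin_action_ext_algebra:
  assumes x: "x \<in> k" and w: "w \<in> ext_algebra pm"
  shows "spin_action p pp pm x w = ext_ad x w + half_trace x *\<^sub>C w"
proof -
  let ?s = "\<lambda>w. \<Sum>e\<in>set es. ext_mult [x, \<sigma> e]\<^sub>L (contraction e w)"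
  have lin: "clinear ?s"
    by (intro clinear_sum_fun clinear_compose[OF clinear_ext_mult] clinear_contraction)
  have s: "?s (ext_mult y w) = ext_mult [x, y]\<^sub>L w + ext_mult y (?s w)" if "y \<in> pm" for y w
  proof -
    have "?s (ext_mult y w) = (\<Sum>e\<in>set es. ext_mult [x, killing e y *\<^sub>C \<sigma> e]\<^sub>L w
        + ext_mult y (ext_mult [x, \<sigma> e]\<^sub>L (contraction e w)))"
      by (simp add: contraction_ext_mult ext_mult_anticommute[of "[x, _]\<^sub>L" y])
    also have "\<dots> = ext_mult [x, \<Sum>e\<in>set es. killing e y *\<^sub>C \<sigma> e]\<^sub>L w + ext_mult y (?s w)"
      by (simp only: sum.distrib clinear_sum[OF clinear_ext_mult_left] clinear_sum[OF clinear_lie_bracket]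
          clinear_sum[OF clinear_ext_mult])
    finally show ?thesis using minus_expansion[OF that] by simp
  qed
  have "?s (wedge ys) = ext_ad x (wedge ys)" if "ys \<in> lists pm" for ys
    using that
  proof (induction ys)
    case (Cons y ys)
    then show ?case using s[of y "wedge ys"] ext_ad_ext_mult[of x y "wedge ys"] by simp
  qed simp
  then have "?s w = ext_ad x w"
    using clinear_eq_on_span[OF lin clinear_ext_ad, of "{wedge xs |xs. xs \<in> lists pm}"] w
    unfolding ext_algebra_def by blast
  then show ?thesis by (simp add: spin_action_eq[OF x])
qed

lemma diagonal_spin_action:
  assumes x: "x \<in> k" and u: "u \<in> TT"
  shows "diagonal_action \<pi> (spin_action p pp pm) x u = lact x u + half_trace x *\<^sub>C u"
proof -
  have lin: "clinear (spin_action p pp pm x)"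
    unfolding spin_action_eq[OF x]
    by (intro clinear_add clinear_scale clinear_id clinear_sum_fun clinear_compose[OF clinear_ext_mult] clinear_contraction)
  note t = clinear_simps[OF clinear_rmap[OF lin]]
  have "tensor_map (\<lambda>x. x) (spin_action p pp pm x) u = ead x u + half_trace x *\<^sub>C u"
    using u
    by (induction rule: tensor_subspace_induct)
      (simp_all add: t tensor_map_tens clinear_id lin spin_action_ext_algebra[OF x] scaleC_add_right)
  then show ?thesis by (simp add: diagonal_action_def lact_def mact_def id_def)
qed

lemma half_trace_linear:
  "half_trace (x + y) = half_trace x + half_trace y" "half_trace (c *\<^sub>C x) = c * half_trace x"
  by (simp_all add: half_trace_def sum.distrib add_divide_distrib sum_distrib_left)

text \<open>The trace of ad x ad y on p+ is a double sum over matrix entries that is symmetric in x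
  and y, so the trace of the commutator vanishes.\<close>

lemma half_trace_bracket:
  assumes "x \<in> k" "y \<in> k"
  shows "half_trace [x, y]\<^sub>L = 0"
proof -
  have e: "killing [x, [y, e]\<^sub>L]\<^sub>L (\<sigma> e) = (\<Sum>e'\<in>set es. killing [y, e]\<^sub>L (\<sigma> e') * killing [x, e']\<^sub>L (\<sigma> e))"
    if "e \<in> set es" "y \<in> k" for e x y
  proof -
    have "killing [x, [y, e]\<^sub>L]\<^sub>L (\<sigma> e) = killing [x, \<Sum>e'\<in>set es. killing [y, e]\<^sub>L (\<sigma> e') *\<^sub>C e']\<^sub>L (\<sigma> e)"
      using plus_expansion[OF k_plus[OF that(2) es_in(1)[OF that(1)]]] by simp
    then show ?thesis
      by (simp add: clinear_sum[OF clinear_lie_bracket] clinear_sum[OF clinear_killing_left])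
  qed
  have "(\<Sum>e\<in>set es. killing [x, [y, e]\<^sub>L]\<^sub>L (\<sigma> e)) = (\<Sum>e\<in>set es. killing [y, [x, e]\<^sub>L]\<^sub>L (\<sigma> e))"
    using e assms by (simp, subst sum.swap) (simp add: mult.commute)
  then show ?thesis by (simp add: half_trace_def lie_bracket_bracket sum_subtractf)
qed

theorem dirac_isomorphisms:
  assumes hodge: "\<And>u. u \<in> TT \<Longrightarrow> \<exists>v\<in>TT. \<exists>y\<in>TT. D v = 0 \<and> u = v + D (D y)"
    and \<chi>: "\<And>x. x \<in> k \<Longrightarrow> \<chi> x = half_trace x"
  shows "isomorphic_modules k (dirac_cohomology p pp pm Z \<pi>) (dirac_kernel p pp pm Z \<pi>)
    \<and> isomorphic_modules k (dirac_kernel p pp pm Z \<pi>) (twist (cohomology pp \<pi>) \<chi>)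
    \<and> isomorphic_modules k (twist (cohomology pp \<pi>) \<chi>) (twist (homology pm \<pi>) \<chi>)"
proof -
  let ?\<tau> = "diagonal_action \<pi> (spin_action p pp pm)"
  have ker: "ker_dirac pp pm Z \<pi> = HH"
    by (simp add: ker_dirac_def dirac_eq_D)
  have kernel: "dirac_kernel p pp pm Z \<pi> = sub_rep HH ?\<tau>"
    by (simp add: dirac_kernel_def ker)
  \<comment> \<open>An element D u of the kernel satisfies D (D u) = 0 and so is 0. Thus Dirac
    cohomology is the kernel divided by {0}.\<close>
  have "im_dirac pp pm Z \<pi> \<inter> HH = {0}"
    using D_D_eq_0 zero_TT by (force simp: im_dirac_def dirac_eq_D)
  then have coh: "dirac_cohomology p pp pm Z \<pi> = quot_rep HH {0} ?\<tau>"
    by (simp add: dirac_cohomology_def ker)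
  have act: "?\<tau> x u = lact x u + \<chi> x *\<^sub>C u" if "x \<in> k" "u \<in> HH" for x u
    using diagonal_spin_action[of x u] \<chi> that by simp
  have mod: "lie_module k (sub_rep HH ?\<tau>)"
  proof (rule lie_module_kernel[OF act])
    show "\<chi> (x + y) = \<chi> x + \<chi> y" if "x \<in> k" "y \<in> k" for x y
      using that \<chi> complex_vector.subspace_add[OF subspace_k that] half_trace_linear by simp
    show "\<chi> (c *\<^sub>C x) = c * \<chi> x" if "x \<in> k" for c x
      using that \<chi> complex_vector.subspace_scale[OF subspace_k that] half_trace_linear by simp
    show "\<chi> [x, y]\<^sub>L = 0" if "x \<in> k" "y \<in> k" for x y
      using \<chi>[OF bracket_k[OF that]] half_trace_bracket that by simp
  qed
  have 1: "isomorphic_modules k (dirac_cohomology p pp pm Z \<pi>) (dirac_kernel p pp pm Z \<pi>)"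
    unfolding kernel coh by (rule isomorphic_modules_sym[OF sub_rep_iso_quot_rep_0[OF mod lie_subalgebra_k]])
  have 2: "isomorphic_modules k (dirac_kernel p pp pm Z \<pi>) (twist (cohomology pp \<pi>) \<chi>)"
    unfolding kernel by (rule kernel_iso_cohomology[OF hodge act mod])
  have 3: "isomorphic_modules k (dirac_kernel p pp pm Z \<pi>) (twist (homology pm \<pi>) \<chi>)"
    unfolding kernel by (rule kernel_iso_homology[OF hodge act mod])
  show ?thesis using 1 2 isomorphic_modules_trans[OF isomorphic_modules_sym[OF 2] 3] by blast
qed

end

subsection \<open>Orthonormal bases\<close>

lemma gram_schmidt:
  fixes H :: "'v::complex_vector \<Rightarrow> 'v \<Rightarrow> complex"
  assumes lin: "\<And>y. clinear (\<lambda>x. H x y)" and sym: "\<And>x y. H y x = cnj (H x y)"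
    and V: "csubspace V" and pos: "\<And>x. x \<in> V \<Longrightarrow> x \<noteq> 0 \<Longrightarrow> Re (H x x) > 0"
    and B: "finite B" "B \<subseteq> V"
  shows "\<exists>es. distinct es \<and> cspan (set es) = cspan B
    \<and> (\<forall>x\<in>set es. \<forall>y\<in>set es. H x y = (if x = y then 1 else 0))"
  using B
proof (induction B rule: finite_induct)
  case empty
  show ?case by (rule exI[of _ "[]"]) simp
next
  case (insert b B)
  then obtain es where es: "distinct es" "cspan (set es) = cspan B"
    "\<And>x y. x \<in> set es \<Longrightarrow> y \<in> set es \<Longrightarrow> H x y = (if x = y then 1 else 0)" by auto
  define s where "s = (\<Sum>e\<in>set es. H b e *\<^sub>C e)"
  define b' where "b' = b - s"
  have s_in: "s \<in> cspan (set es)"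
    unfolding s_def by (intro complex_vector.span_sum complex_vector.span_scale complex_vector.span_base)
  have orth: "H b' e = 0" if e: "e \<in> set es" for e
  proof -
    have "H s e = (\<Sum>e'\<in>set es. if e' = e then H b e else 0)"
      unfolding s_def clinear_sum[OF lin] by (rule sum.cong) (auto simp: clinear_simps[OF lin] es(3) e)
    also have "\<dots> = H b e" using e by simp
    finally show ?thesis by (simp add: b'_def clinear_simps[OF lin])
  qed
  show ?case
  proof (cases "b' = 0")
    case True
    then have "b \<in> cspan B" using s_in es(2) by (simp add: b'_def)
    then have "cspan (insert b B) = cspan B" by (rule complex_vector.span_redundant)
    then show ?thesis using es by (intro exI[of _ es]) auto
  next
    case False
    have "cspan B \<subseteq> V" using insert.prems V by (intro complex_vector.span_minimal) auto
    then have "b' \<in> V"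
      unfolding b'_def using insert.prems s_in es(2) by (intro complex_vector.subspace_diff[OF V]) auto
    then have pos': "Re (H b' b') > 0" using pos False by blast
    \<comment> \<open>Hermitian symmetry makes this value real, so the normalizing factor r is real
      and is not changed by conjugation in the second argument.\<close>
    have real: "H b' b' = of_real (Re (H b' b'))"
      using sym[of b' b'] by (simp add: complex_eq_iff)
    define r where "r = complex_of_real (sqrt (Re (H b' b')))"
    have r: "r \<noteq> 0" "r * r = H b' b'" "cnj r = r"
      using pos' real by (auto simp: r_def simp flip: of_real_mult)
    define e0 where "e0 = (1 / r) *\<^sub>C b'"
    have H1: "H e0 x = (1 / r) * H b' x" for x by (simp add: e0_def clinear_simps[OF lin])
    have H2: "H b' e0 = (1 / r) * H b' b'"
      by (subst sym) (simp add: H1 r(3) sym[of b' b', symmetric])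
    have H00: "H e0 e0 = 1" using r(1) by (simp add: H1 H2 flip: r(2))
    have H0: "H e0 e = 0" "H e e0 = 0" if "e \<in> set es" for e
      using orth[OF that] sym[of e0 e] by (simp_all add: H1)
    have "e0 \<notin> set es" using H0(1)[of e0] H00 by auto
    moreover have "cspan (set (e0 # es)) = cspan (insert b B)"
    proof -
      have sub: "cspan B \<subseteq> cspan (insert b B)" "cspan (set es) \<subseteq> cspan (set (e0 # es))"
        by (intro complex_vector.span_mono; auto)+
      have "b' \<in> cspan (insert b B)"
        unfolding b'_def using s_in es(2) sub(1)
        by (intro complex_vector.span_diff) (auto intro: complex_vector.span_base)
      then have "e0 \<in> cspan (insert b B)" unfolding e0_def by (rule complex_vector.span_scale)
      moreover have "set es \<subseteq> cspan (insert b B)"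
        using complex_vector.span_superset[of "set es"] es(2) sub(1) by auto
      moreover have "b = r *\<^sub>C e0 + s" using r(1) by (simp add: e0_def b'_def scaleC_scaleC scaleC_one)
      then have "b \<in> cspan (set (e0 # es))"
        using complex_vector.span_scale[OF complex_vector.span_base[of e0 "set (e0 # es)"], of r] s_in sub(2)
        by (simp add: complex_vector.span_add subsetD)
      moreover have "B \<subseteq> cspan (set (e0 # es))"
        using complex_vector.span_superset[of B] es(2) sub(2) by auto
      ultimately show ?thesis by (intro complex_vector.span_eq[THEN iffD2]) auto
    qed
    ultimately show ?thesis
      using es H00 H0 by (intro exI[of _ "e0 # es"]) auto
  qed
qed

subsection \<open>Simultaneous diagonalization\<close>

text \<open>Elements of t commute, so ad b preserves each joint eigenspace of the previous
  operators. Splitting a joint eigenvector by the eigenvalues of b therefore stays inside that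
  eigenspace.\<close>

lemma cartan_joint_eigenvectors:
  fixes t :: "'g::complex_lie_algebra set"
  assumes t: "cartan_subalgebra t" and B: "finite B" "B \<subseteq> t"
  shows "cspan {x. \<forall>b\<in>B. \<exists>c. [b, x]\<^sub>L = c *\<^sub>C x} = UNIV"
  using B
proof (induction B rule: finite_induct)
  case empty
  show ?case by simp
next
  case (insert b B)
  let ?S = "\<lambda>B. {x. \<forall>b\<in>B. \<exists>c. [b, x]\<^sub>L = c *\<^sub>C x}"
  have comm: "[b', [b, y]\<^sub>L]\<^sub>L = [b, [b', y]\<^sub>L]\<^sub>L" if "b' \<in> B" for b' y
  proof -
    have "[b', b]\<^sub>L = 0" using t insert.prems that unfolding cartan_subalgebra_def abelian_def by blast
    then show ?thesis using lie_bracket_bracket[of b' b y] by simp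
  qed
  have "?S B \<subseteq> cspan (?S (insert b B))"
  proof
    fix x assume "x \<in> ?S B"
    then obtain l where l: "\<And>b'. b' \<in> B \<Longrightarrow> [b', x]\<^sub>L = l b' *\<^sub>C x" by simp metis
    let ?W = "{y. \<forall>b'\<in>B. [b', y]\<^sub>L = l b' *\<^sub>C y}"
    have W: "csubspace ?W"
      by (auto simp: complex_vector.subspace_def scaleC_add_right scaleC_scaleC mult.commute)
    have "{x. \<exists>c. [b, x]\<^sub>L = c *\<^sub>C x} = (\<Union>c. eigenspace (lie_bracket b) c)"
      by (auto simp: eigenspace_def)
    moreover have "cspan {x. \<exists>c. [b, x]\<^sub>L = c *\<^sub>C x} = UNIV"
      using t insert.prems unfolding cartan_subalgebra_def by blast
    ultimately have "x \<in> cspan (\<Union>c. eigenspace (lie_bracket b) c)" by simp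
    from eigen_decomposition_in_invariant[OF clinear_lie_bracket W _ _ this]
    obtain S r where S: "\<forall>c\<in>S. r c \<in> eigenspace (lie_bracket b) c \<inter> ?W" and x: "x = (\<Sum>c\<in>S. r c)"
      using l comm by auto
    have "r c \<in> ?S (insert b B)" if "c \<in> S" for c
      using S that unfolding eigenspace_def by blast
    then show "x \<in> cspan (?S (insert b B))"
      unfolding x by (intro complex_vector.span_sum complex_vector.span_base)
  qed
  then have "cspan (?S B) \<subseteq> cspan (?S (insert b B))"
    by (rule complex_vector.span_minimal) simp
  then show ?case using insert by auto
qed

text \<open>A joint eigenvector for a finite spanning set of t is an eigenvector for all of t,
  because the elements of t of which it is an eigenvector form a subspace.\<close>

lemma cartan_weight_spaces:
  fixes t :: "'g::complex_lie_algebra set"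
  assumes t: "cartan_subalgebra t" and fd: "finite_dim (UNIV :: 'g set)"
  shows "cspan (\<Union>\<alpha>\<in>dual_space t. weight_space lie_bracket t \<alpha>) = UNIV"
proof -
  have sub: "csubspace t" using t by (simp add: cartan_subalgebra_def)
  obtain B where B: "finite B" "cspan B = t"
    using finite_dim_subspace[OF fd sub] by (auto simp: finite_dim_def)
  have Bt: "B \<subseteq> t" using B(2) complex_vector.span_superset by blast
  have "x \<in> (\<Union>\<alpha>\<in>dual_space t. weight_space lie_bracket t \<alpha>)" if x: "\<forall>b\<in>B. \<exists>c. [b, x]\<^sub>L = c *\<^sub>C x" for x
  proof (cases "x = 0")
    case True
    have "(\<lambda>_. 0) \<in> dual_space t" by (simp add: dual_space_def)
    moreover have "x \<in> weight_space lie_bracket t (\<lambda>_. 0)" using True by (simp add: weight_space_def)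
    ultimately show ?thesis by blast
  next
    case False
    have "csubspace {h. \<exists>c. [h, x]\<^sub>L = c *\<^sub>C x}"
    proof (rule complex_vector.subspaceI)
      show "0 \<in> {h. \<exists>c. [h, x]\<^sub>L = c *\<^sub>C x}" by (auto intro: exI[of _ 0])
    qed (auto simp: scaleC_add_left[symmetric] scaleC_scaleC)
    from complex_vector.span_minimal[OF _ this, of B]
    have "\<forall>h\<in>t. \<exists>c. [h, x]\<^sub>L = c *\<^sub>C x" using x B(2) by auto
    then obtain a where a: "\<And>h. h \<in> t \<Longrightarrow> [h, x]\<^sub>L = a h *\<^sub>C x" by metis
    define \<alpha> where "\<alpha> = (\<lambda>h. if h \<in> t then a h else 0)"
    have \<alpha>: "[h, x]\<^sub>L = \<alpha> h *\<^sub>C x" if "h \<in> t" for h using a that by (simp add: \<alpha>_def)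
    \<comment> \<open>As x is nonzero its eigenvalues are unique, and this is what makes them depend
      linearly on h. For x = 0 the zero weight was chosen.\<close>
    have inj: "c = d" if "c *\<^sub>C x = d *\<^sub>C x" for c d
      using that False by simp
    have "\<alpha> \<in> dual_space t"
      unfolding dual_space_def
    proof (intro CollectI conjI ballI allI impI)
      fix y z c assume yz: "y \<in> t"
      show "\<alpha> (y + z) = \<alpha> y + \<alpha> z" if "z \<in> t"
        by (rule inj) (simp add: scaleC_add_left \<alpha>[symmetric] yz that complex_vector.subspace_add[OF sub])
      have "\<alpha> (c *\<^sub>C y) *\<^sub>C x = c *\<^sub>C \<alpha> y *\<^sub>C x"
        by (simp add: \<alpha>[symmetric] yz complex_vector.subspace_scale[OF sub])
      then show "\<alpha> (c *\<^sub>C y) = c * \<alpha> y"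
        by (intro inj) (simp add: scaleC_scaleC)
    qed (simp add: \<alpha>_def)
    moreover have "x \<in> weight_space lie_bracket t \<alpha>" using \<alpha> by (simp add: weight_space_def)
    ultimately show ?thesis by blast
  qed
  then have "{x. \<forall>b\<in>B. \<exists>c. [b, x]\<^sub>L = c *\<^sub>C x} \<subseteq> (\<Union>\<alpha>\<in>dual_space t. weight_space lie_bracket t \<alpha>)" by blast
  then show ?thesis
    using complex_vector.span_mono cartan_joint_eigenvectors[OF t B(1) Bt] by blast
qed

lemma dual_space_distinct: "\<alpha> \<in> dual_space t \<Longrightarrow> \<beta> \<in> dual_space t \<Longrightarrow> \<alpha> \<noteq> \<beta> \<Longrightarrow> \<exists>h\<in>t. \<alpha> h \<noteq> \<beta> h"
  by (auto simp: dual_space_def fun_eq_iff) metis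

lemma csubspace_weight_space:
  "(\<And>h. h \<in> t \<Longrightarrow> clinear (\<pi> h)) \<Longrightarrow> csubspace (weight_space \<pi> t \<alpha>)"
  by (auto simp: complex_vector.subspace_def weight_space_def clinear_simps scaleC_add_right scaleC_scaleC mult.commute)

text \<open>A finite spanning set of weight vectors involves only finitely many weights, and a
  vector of any other weight would be independent of the space they span.\<close>

lemma finite_roots:
  fixes t :: "'g::complex_lie_algebra set"
  assumes t: "cartan_subalgebra t" and fd: "finite_dim (UNIV :: 'g set)"
  shows "finite (roots UNIV t)"
proof -
  let ?g = "weight_space lie_bracket t"
  obtain F where F: "finite F" "F \<subseteq> (\<Union>\<alpha>\<in>dual_space t. ?g \<alpha>)" "cspan F = UNIV"
    using finite_span_subset[OF fd cartan_weight_spaces[OF t fd, symmetric]] by blast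
  then obtain a where a: "\<And>x. x \<in> F \<Longrightarrow> a x \<in> dual_space t \<and> x \<in> ?g (a x)"
    by (metis UN_E subsetD)
  have "roots UNIV t \<subseteq> a ` F"
  proof
    fix \<alpha> assume "\<alpha> \<in> roots UNIV t"
    moreover have "0 \<in> ?g \<alpha>" by (simp add: weight_space_def)
    ultimately obtain x where x: "\<alpha> \<in> dual_space t" "x \<in> ?g \<alpha>" "x \<noteq> 0" by (auto simp: roots_def)
    show "\<alpha> \<in> a ` F"
    proof (rule ccontr)
      assume n: "\<alpha> \<notin> a ` F"
      have "F \<subseteq> (\<Union>\<beta>\<in>a ` F. ?g \<beta>)" using a by blast
      then have xs: "x \<in> cspan (\<Union>\<beta>\<in>a ` F. ?g \<beta>)" using F(3) complex_vector.span_mono by blast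
      have "\<exists>S r. finite S \<and> S \<subseteq> a ` F \<and> (\<forall>\<beta>\<in>S. r \<beta> \<in> ?g \<beta> \<inter> UNIV) \<and> x = (\<Sum>\<beta>\<in>S. r \<beta>)"
      proof (rule weight_decomposition_in_invariant)
        show "\<exists>h\<in>t. \<beta> h \<noteq> \<gamma> h" if "\<beta> \<in> a ` F" "\<gamma> \<in> a ` F" "\<beta> \<noteq> \<gamma>" for \<beta> \<gamma>
          using dual_space_distinct[of \<beta> t \<gamma>] that a by blast
      qed (use xs clinear_lie_bracket in auto)
      then obtain S r where S: "finite S" "S \<subseteq> a ` F" "\<And>\<beta>. \<beta> \<in> S \<Longrightarrow> r \<beta> \<in> ?g \<beta>" "x = (\<Sum>\<beta>\<in>S. r \<beta>)"
        by blast
      \<comment> \<open>The difference of x and its expansion is 0, and \<alpha> is none of the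
        weights in the expansion; the component lemma for the subspace {0} then gives x = 0.\<close>
      have "x \<in> {0}"
      proof (rule weight_component_in_invariant[where S = S and v = "\<lambda>\<beta>. - r \<beta>" and m = "\<lambda>\<beta>. \<beta>"])
        show "x \<in> ?g \<alpha>" by (fact x)
        show "- r \<beta> \<in> ?g \<beta>" if "\<beta> \<in> S" for \<beta>
          using complex_vector.subspace_neg[OF csubspace_weight_space S(3)[OF that]] clinear_lie_bracket by blast
        show "\<exists>h\<in>t. \<beta> h \<noteq> \<alpha> h" if "\<beta> \<in> S" for \<beta>
          using dual_space_distinct[of \<beta> t \<alpha>] x(1) n that S(2) a by blast
      qed (use S in \<open>auto simp: clinear_lie_bracket sum_negf\<close>)
      then show False using x by simp
    qed
  qed
  then show ?thesis using F(1) finite_subset by blast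
qed

subsection \<open>Finiteness of eigenspaces in category O\<close>

lemma generated_submodule_props:
  shows csubspace_generated_submodule: "csubspace (generated_submodule \<pi> h S)"
    and subset_generated_submodule: "S \<subseteq> generated_submodule \<pi> h S"
    and generated_submodule_stable: "x \<in> h \<Longrightarrow> w \<in> generated_submodule \<pi> h S \<Longrightarrow> \<pi> x w \<in> generated_submodule \<pi> h S"
    and generated_submodule_minimal: "csubspace W \<Longrightarrow> S \<subseteq> W \<Longrightarrow> (\<And>x w. x \<in> h \<Longrightarrow> w \<in> W \<Longrightarrow> \<pi> x w \<in> W) \<Longrightarrow>
      generated_submodule \<pi> h S \<subseteq> W"
proof -
  show "csubspace (generated_submodule \<pi> h S)"
    unfolding generated_submodule_def by (rule complex_vector.subspace_Inter) blast
  show "S \<subseteq> generated_submodule \<pi> h S"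
    unfolding generated_submodule_def by blast
  show "x \<in> h \<Longrightarrow> w \<in> generated_submodule \<pi> h S \<Longrightarrow> \<pi> x w \<in> generated_submodule \<pi> h S"
    unfolding generated_submodule_def by blast
  assume "csubspace W" "S \<subseteq> W" "\<And>x w. x \<in> h \<Longrightarrow> w \<in> W \<Longrightarrow> \<pi> x w \<in> W"
  then have "W \<in> {W. csubspace W \<and> S \<subseteq> W \<and> (\<forall>x\<in>h. \<forall>w\<in>W. \<pi> x w \<in> W)}" by simp
  then show "generated_submodule \<pi> h S \<subseteq> W"
    unfolding generated_submodule_def by (rule Inter_lower)
qed

lemma nilradical_stable:
  assumes "h \<in> t" "x \<in> nilradical t P"
  shows "[h, x]\<^sub>L \<in> nilradical t P"
proof -
  have "lie_bracket h ` nilradical t P \<subseteq> nilradical t P"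
    unfolding nilradical_def
    by (rule clinear_image_span_subset[OF clinear_lie_bracket])
      (use assms in \<open>auto simp: weight_space_def intro!: complex_vector.span_scale complex_vector.span_base\<close>)
  then show ?thesis using assms(2) by blast
qed

lemma category_O_rep:
  assumes "category_O t n \<pi>"
  shows "clinear (\<pi> x)" "clinear (\<lambda>x. \<pi> x v)" "\<pi> [x, y]\<^sub>L v = \<pi> x (\<pi> y v) - \<pi> y (\<pi> x v)"
proof -
  have *: "lie_module UNIV (sub_rep UNIV \<pi>)" using assms by (simp add: category_O_def)
  then show "clinear (\<pi> x)" "clinear (\<lambda>x. \<pi> x v)"
    by (auto simp: lie_module_def sub_rep_def intro!: clinearI)
  have "\<pi> [x, y]\<^sub>L v + \<pi> y (\<pi> x v) = \<pi> x (\<pi> y v)"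
    using * by (simp add: lie_module_def sub_rep_def)
  then show "\<pi> [x, y]\<^sub>L v = \<pi> x (\<pi> y v) - \<pi> y (\<pi> x v)" by (simp add: eq_diff_eq)
qed

lemma finite_span_subset_elt:
  assumes "v \<in> cspan S"
  shows "\<exists>F. finite F \<and> F \<subseteq> S \<and> v \<in> cspan F"
proof -
  obtain T r where "finite T" "T \<subseteq> S" "v = (\<Sum>a\<in>T. r a *\<^sub>C a)"
    using assms by (auto simp: complex_vector.span_explicit)
  then show ?thesis
    by (intro exI[of _ T] conjI) (simp_all add: complex_vector.span_sum complex_vector.span_scale complex_vector.span_base)
qed

lemma eigenvector_basis_in_invariant:
  assumes T: "clinear T" and W: "csubspace W" "\<And>w. w \<in> W \<Longrightarrow> T w \<in> W" "finite_dim W"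
    and span: "cspan (\<Union>c. eigenspace T c) = UNIV"
  shows "\<exists>B. finite B \<and> (\<forall>b\<in>B. \<exists>c. T b = c *\<^sub>C b) \<and> cspan B = W"
proof -
  let ?S = "W \<inter> (\<Union>c. eigenspace T c)"
  have "W \<subseteq> cspan ?S"
  proof
    fix w assume "w \<in> W"
    then obtain S r where "finite S" "\<forall>c\<in>S. r c \<in> eigenspace T c \<inter> W" "w = (\<Sum>c\<in>S. r c)"
      using eigen_decomposition_in_invariant[OF T W(1,2), of w] span by auto
    moreover from this have "r c \<in> cspan ?S" if "c \<in> S" for c
      using that by (intro complex_vector.span_base) blast
    ultimately show "w \<in> cspan ?S" by (simp add: complex_vector.span_sum)
  qed
  moreover have "cspan ?S \<subseteq> W" using W(1) by (intro complex_vector.span_minimal) auto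
  ultimately have "W = cspan ?S" by blast
  from finite_span_subset[OF W(3) this] show ?thesis by (fastforce simp: eigenspace_def)
qed

text \<open>A module of category O is spanned by the vectors \<open>y\<^sub>1 \<cdots> y\<^sub>r v\<close>, where the \<open>y\<^sub>i\<close> are negative root
  vectors and \<open>v\<close> runs through finitely many weight vectors spanning a \<open>t + n\<close>-stable space. No
  ordering of the \<open>y\<^sub>i\<close> is imposed, so the Poincare-Birkhoff-Witt theorem is not needed.\<close>

lemma category_O_finite_eigenspaces:
  fixes t :: "'g::complex_lie_algebra set" and \<pi> :: "'g \<Rightarrow> 'm::complex_vector \<Rightarrow> 'm"
  assumes t: "cartan_subalgebra t" and fd: "finite_dim (UNIV :: 'g set)"
    and h: "h \<in> t" "\<And>\<alpha>. \<alpha> \<in> roots UNIV t \<Longrightarrow> Re (\<alpha> h) \<noteq> 0" "P = {\<alpha> \<in> roots UNIV t. Re (\<alpha> h) > 0}"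
    and O: "category_O t (nilradical t P) \<pi>"
  shows "\<exists>Q. (\<forall>c. finite (Q c)) \<and> (\<forall>c. \<forall>v\<in>Q c. \<pi> h v = c *\<^sub>C v) \<and> cspan (\<Union>c. Q c) = UNIV"
proof -
  let ?n = "nilradical t P"
  note lin = category_O_rep(1)[OF O] and lin2 = category_O_rep(2)[OF O] and rep = category_O_rep(3)[OF O]
  let ?wt = "\<Union>\<mu>\<in>dual_space t. weight_space \<pi> t \<mu>"
  have wt: "cspan ?wt = UNIV" using O by (simp add: category_O_def)
  have nfin: "finite_dim (generated_submodule \<pi> ?n {v})" for v using O by (simp add: category_O_def)
  obtain F where F: "finite F" "generated_submodule \<pi> UNIV F = UNIV" using O by (auto simp: category_O_def)
  have "?wt \<subseteq> (\<Union>c. eigenspace (\<pi> h) c)"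
    using h(1) by (auto simp: weight_space_def eigenspace_def)
  then have eig: "cspan (\<Union>c. eigenspace (\<pi> h) c) = UNIV" using wt complex_vector.span_mono by blast
  have "\<forall>v\<in>F. \<exists>G. finite G \<and> G \<subseteq> ?wt \<and> v \<in> cspan G"
    using finite_span_subset_elt wt by blast
  then obtain G where G: "\<And>v. v \<in> F \<Longrightarrow> finite (G v) \<and> G v \<subseteq> ?wt \<and> v \<in> cspan (G v)" by metis
  define F' where "F' = (\<Union>v\<in>F. G v)"
  have F': "finite F'" "F' \<subseteq> ?wt" "F \<subseteq> cspan F'"
  proof -
    show "F \<subseteq> cspan F'"
    proof
      fix v assume v: "v \<in> F"
      then have "G v \<subseteq> F'" by (auto simp: F'_def)
      then show "v \<in> cspan F'" using G[OF v] complex_vector.span_mono by blast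
    qed
  qed (use G F in \<open>auto simp: F'_def\<close>)
  \<comment> \<open>As h (x w) = x (h w) + [h, x] w and n is stable under t, the vectors whose
    t-translates remain in the n-submodule form an n-stable subspace containing the weight vector
    v.\<close>
  have tstable: "\<pi> h' w \<in> generated_submodule \<pi> ?n {v}"
    if v: "v \<in> ?wt" and h': "h' \<in> t" and w: "w \<in> generated_submodule \<pi> ?n {v}" for v h' w
  proof -
    let ?N = "generated_submodule \<pi> ?n {v}"
    note N = csubspace_generated_submodule[of \<pi> ?n "{v}"]
    let ?W = "{w \<in> ?N. \<forall>h\<in>t. \<pi> h w \<in> ?N}"
    have "?N \<subseteq> ?W"
    proof (rule generated_submodule_minimal)
      show "csubspace ?W"
        by (rule complex_vector.subspaceI)
          (auto simp: clinear_simps[OF lin] complex_vector.subspace_0[OF N]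
            complex_vector.subspace_add[OF N] complex_vector.subspace_scale[OF N])
      have "v \<in> ?N" using subset_generated_submodule[of "{v}"] by blast
      then show "{v} \<subseteq> ?W"
        using v complex_vector.subspace_scale[OF N] by (auto simp: weight_space_def)
      fix x w assume x: "x \<in> ?n" and w: "w \<in> ?W"
      have "\<pi> h (\<pi> x w) \<in> ?N" if "h \<in> t" for h
      proof -
        have "\<pi> h (\<pi> x w) = \<pi> x (\<pi> h w) + \<pi> [h, x]\<^sub>L w" by (simp add: rep)
        then show ?thesis
          using generated_submodule_stable[OF x, of "\<pi> h w" \<pi> "{v}"]
            generated_submodule_stable[OF nilradical_stable[OF that x], of w \<pi> "{v}"] w that
          by (simp add: complex_vector.subspace_add[OF N])
      qed
      then show "\<pi> x w \<in> ?W" using generated_submodule_stable[OF x] w by blast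
    qed
    then show ?thesis using w h' by blast
  qed
  have "\<forall>v\<in>F'. \<exists>B. finite B \<and> (\<forall>b\<in>B. \<exists>c. \<pi> h b = c *\<^sub>C b) \<and> cspan B = generated_submodule \<pi> ?n {v}"
    using F'(2) tstable[OF _ h(1)] nfin eig
    by (intro ballI eigenvector_basis_in_invariant[OF lin csubspace_generated_submodule]) auto
  then obtain N0 where N0: "\<And>v. v \<in> F' \<Longrightarrow> finite (N0 v) \<and> (\<forall>b\<in>N0 v. \<exists>c. \<pi> h b = c *\<^sub>C b)
      \<and> cspan (N0 v) = generated_submodule \<pi> ?n {v}" by metis
  define N where "N = (\<Union>v\<in>F'. N0 v)"
  have N_fin: "finite N" using F' N0 by (auto simp: N_def)
  have "\<forall>v\<in>N. \<exists>c. \<pi> h v = c *\<^sub>C v"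
    using N0 unfolding N_def by blast
  then obtain l where l: "\<And>v. v \<in> N \<Longrightarrow> \<pi> h v = l v *\<^sub>C v" by metis
  have N_stable: "\<pi> x v \<in> cspan N" if "x \<in> t \<or> x \<in> ?n" "v \<in> N" for x v
  proof -
    obtain w where w: "w \<in> F'" "v \<in> N0 w" using \<open>v \<in> N\<close> by (auto simp: N_def)
    then have "v \<in> generated_submodule \<pi> ?n {w}" using N0 complex_vector.span_base by blast
    then have "\<pi> x v \<in> generated_submodule \<pi> ?n {w}"
      using that(1) tstable[of w x v] w F'(2) generated_submodule_stable[of x ?n v \<pi> "{w}"] by blast
    moreover have "cspan (N0 w) \<subseteq> cspan N" using w(1) by (intro complex_vector.span_mono) (auto simp: N_def)
    ultimately show ?thesis using N0[OF w(1)] by blast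
  qed
  obtain Fg where Fg: "finite Fg" "Fg \<subseteq> (\<Union>\<alpha>\<in>dual_space t. weight_space lie_bracket t \<alpha>)" "cspan Fg = UNIV"
    using finite_span_subset[OF fd cartan_weight_spaces[OF t fd, symmetric]] by blast
  define Y where "Y = {y \<in> Fg. \<exists>c. Re c < 0 \<and> [h, y]\<^sub>L = c *\<^sub>C y}"
  \<comment> \<open>Vectors of weight 0 lie in t because t is its own centralizer. For a root,
    regularity of h excludes real part 0, so a root outside P is negative on h.\<close>
  have cases: "y \<in> Y \<or> y \<in> t \<or> y \<in> ?n" if y: "y \<in> Fg" for y
  proof (cases "y \<in> t")
    case False
    obtain \<alpha> where \<alpha>: "\<alpha> \<in> dual_space t" "y \<in> weight_space lie_bracket t \<alpha>" using Fg(2) y by blast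
    have "\<alpha> \<noteq> (\<lambda>_. 0)"
    proof
      assume "\<alpha> = (\<lambda>_. 0)"
      then have "\<forall>h\<in>t. [h, y]\<^sub>L = 0" using \<alpha> by (simp add: weight_space_def)
      then show False using t False unfolding cartan_subalgebra_def by blast
    qed
    moreover have "y \<noteq> 0" using False complex_vector.subspace_0[of t] t by (auto simp: cartan_subalgebra_def)
    ultimately have root: "\<alpha> \<in> roots UNIV t" using \<alpha> by (auto simp: roots_def)
    show ?thesis
    proof (cases "Re (\<alpha> h) > 0")
      case True
      then have "\<alpha> \<in> P" using root h(3) by simp
      then have "y \<in> ?n" unfolding nilradical_def using \<alpha> by (intro complex_vector.span_base) blast
      then show ?thesis by blast
    next
      case False
      then have "Re (\<alpha> h) < 0" using h(2)[OF root] by simp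
      then show ?thesis using y \<alpha> h(1) by (auto simp: Y_def weight_space_def)
    qed
  qed blast
  have Y_fin: "finite Y" using Fg by (simp add: Y_def)
  have "\<forall>y\<in>Y. \<exists>c. Re c < 0 \<and> [h, y]\<^sub>L = c *\<^sub>C y" by (simp add: Y_def)
  then obtain \<eta> where \<eta>: "\<And>y. y \<in> Y \<Longrightarrow> Re (\<eta> y) < 0 \<and> [h, y]\<^sub>L = \<eta> y *\<^sub>C y"
    by metis
  define A where "A = {foldr \<pi> ys v | ys v. ys \<in> lists Y \<and> v \<in> N}"
  have YA: "\<pi> y w \<in> cspan A" if "y \<in> Y" "w \<in> cspan A" for y w
  proof -
    have "\<pi> y (foldr \<pi> ys v) \<in> A" if "ys \<in> lists Y" "v \<in> N" for ys v
      unfolding A_def using \<open>y \<in> Y\<close> that by (intro CollectI exI[of _ "y # ys"] exI[of _ v]) auto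
    then have "\<pi> y ` A \<subseteq> A" by (auto simp only: A_def)
    then have "\<pi> y ` cspan A \<subseteq> cspan A"
      using complex_vector.span_superset[of A] by (intro clinear_image_span_subset[OF lin]) blast
    then show ?thesis using that by blast
  qed
  have NA: "cspan N \<subseteq> cspan A"
  proof (rule complex_vector.span_mono, rule subsetI)
    fix v assume "v \<in> N"
    then show "v \<in> A" unfolding A_def by (intro CollectI exI[of _ "[]"] exI[of _ v]) simp
  qed
  \<comment> \<open>The claim is made for all x at once: moving x past the first letter y leaves
    [x, y] acting on a shorter word, and nothing is known about [x, y].\<close>
  have gA: "\<forall>x. \<pi> x (foldr \<pi> ys v) \<in> cspan A" if "ys \<in> lists Y" "v \<in> N" for ys v
    using that(1)
  proof (induction ys)
    case Nil
    have "(\<lambda>x. \<pi> x v) ` cspan Fg \<subseteq> cspan A"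
    proof (rule clinear_image_span_subset[OF lin2], clarify)
      fix y assume "y \<in> Fg"
      then show "\<pi> y v \<in> cspan A"
        using cases[of y] YA[of y v] NA N_stable[of y v] \<open>v \<in> N\<close> complex_vector.span_base[of v N] by blast
    qed
    then show ?case using Fg(3) by auto
  next
    case (Cons y ys)
    show ?case
    proof
      fix x
      have "\<pi> x (foldr \<pi> (y # ys) v) = \<pi> y (\<pi> x (foldr \<pi> ys v)) + \<pi> [x, y]\<^sub>L (foldr \<pi> ys v)"
        by (simp add: rep)
      then show "\<pi> x (foldr \<pi> (y # ys) v) \<in> cspan A"
        using Cons YA[of y] by (auto intro!: complex_vector.span_add)
    qed
  qed
  have "generated_submodule \<pi> UNIV F \<subseteq> cspan A"
  proof (rule generated_submodule_minimal)
    have "F' \<subseteq> cspan N"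
    proof
      fix v assume v: "v \<in> F'"
      then have "v \<in> cspan (N0 v)" using N0 subset_generated_submodule[of "{v}" \<pi> ?n] by auto
      moreover have "cspan (N0 v) \<subseteq> cspan N" using v by (intro complex_vector.span_mono) (auto simp: N_def)
      ultimately show "v \<in> cspan N" by blast
    qed
    then show "F \<subseteq> cspan A"
      using F'(3) NA complex_vector.span_minimal[of F' "cspan N"] by auto
    fix x w assume "w \<in> cspan A"
    moreover have "\<pi> x ` cspan A \<subseteq> cspan A"
      by (rule clinear_image_span_subset[OF lin]) (use gA in \<open>auto simp: A_def\<close>)
    ultimately show "\<pi> x w \<in> cspan A" by blast
  qed simp
  then have spanA: "cspan A = UNIV" using F(2) by blast
  define val where "val = (\<lambda>ys v. l v + (\<Sum>y\<leftarrow>ys. \<eta> y))"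
  have eigA: "\<pi> h (foldr \<pi> ys v) = val ys v *\<^sub>C foldr \<pi> ys v" if "ys \<in> lists Y" "v \<in> N" for ys v
    using that(1)
  proof (induction ys)
    case Nil
    then show ?case using l that by (simp add: val_def)
  next
    case (Cons y ys)
    have "\<pi> h (\<pi> y (foldr \<pi> ys v)) = \<pi> y (\<pi> h (foldr \<pi> ys v)) + \<pi> [h, y]\<^sub>L (foldr \<pi> ys v)"
      by (simp add: rep)
    also have "\<dots> = val (y # ys) v *\<^sub>C \<pi> y (foldr \<pi> ys v)"
    proof -
      have "val (y # ys) v = val ys v + \<eta> y" by (simp add: val_def)
      moreover have "[h, y]\<^sub>L = \<eta> y *\<^sub>C y" using \<eta> Cons by blast
      ultimately show ?thesis
        using Cons by (simp only: clinear_simps[OF lin] clinear_simps[OF lin2] scaleC_add_left)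
    qed
    finally show ?case by simp
  qed
  define Q where "Q = (\<lambda>c. {foldr \<pi> ys v | ys v. ys \<in> lists Y \<and> v \<in> N \<and> val ys v = c})"
  \<comment> \<open>Each letter lowers the real part of the eigenvalue by at least \<epsilon>, and
    the starting values on N are at most m. So c bounds the length of the word, and there are
    finitely many words of bounded length over Y. If Y is empty, any positive \<epsilon> will
    do.\<close>
  have "finite (Q c)" for c
  proof -
    obtain \<epsilon> where \<epsilon>: "\<epsilon> > 0" "\<And>y. y \<in> Y \<Longrightarrow> Re (\<eta> y) \<le> - \<epsilon>"
    proof (cases "Y = {}")
      case False
      let ?M = "Max ((\<lambda>y. Re (\<eta> y)) ` Y)"
      have "?M \<in> (\<lambda>y. Re (\<eta> y)) ` Y" using False Y_fin by (intro Max_in) auto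
      then have "- ?M > 0" using \<eta> by auto
      moreover have "Re (\<eta> y) \<le> - (- ?M)" if "y \<in> Y" for y using Y_fin that by simp
      ultimately show ?thesis using that by blast
    qed (use that[of 1] in auto)
    define m where "m = Max ((\<lambda>v. Re (l v)) ` N)"
    have m: "Re (l v) \<le> m" if "v \<in> N" for v
      unfolding m_def using N_fin that by simp
    define K where "K = nat \<lceil>(m - Re c) / \<epsilon>\<rceil>"
    have len: "length ys \<le> K" if "ys \<in> lists Y" "v \<in> N" "val ys v = c" for ys v
    proof -
      have "Re (\<Sum>y\<leftarrow>ys. \<eta> y) \<le> - \<epsilon> * length ys"
        using that(1)
      proof (induction ys)
        case (Cons y ys)
        then show ?case using \<epsilon>(2)[of y] by (simp add: algebra_simps)
      qed simp
      then have "Re c \<le> m - \<epsilon> * length ys"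
        using m[OF that(2)] that(3) by (auto simp: val_def)
      then have "length ys \<le> (m - Re c) / \<epsilon>"
        using \<epsilon>(1) by (simp add: field_simps)
      then show ?thesis unfolding K_def by linarith
    qed
    have "Q c \<subseteq> (\<lambda>(ys, v). foldr \<pi> ys v) ` ({ys. set ys \<subseteq> Y \<and> length ys \<le> K} \<times> N)"
      unfolding Q_def using len by (force simp: in_lists_conv_set)
    moreover have "finite ({ys. set ys \<subseteq> Y \<and> length ys \<le> K} \<times> N)"
      using finite_lists_length_le[OF Y_fin] N_fin by simp
    ultimately show ?thesis using finite_surj by blast
  qed
  moreover have "\<forall>c. \<forall>v\<in>Q c. \<pi> h v = c *\<^sub>C v" using eigA by (auto simp: Q_def)
  moreover have "(\<Union>c. Q c) = A" by (auto simp: Q_def A_def)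
  ultimately show ?thesis using spanA by (intro exI[of _ Q]) auto
qed

context hermitian_symmetric_pair
begin

abbreviation "kk \<equiv> compact_part \<theta> g\<^sub>0"
abbreviation "pnc \<equiv> noncompact_part \<theta> g\<^sub>0"

subsection \<open>The real form\<close>

lemma real_form_closed: "0 \<in> g\<^sub>0" "x \<in> g\<^sub>0 \<Longrightarrow> y \<in> g\<^sub>0 \<Longrightarrow> x + y \<in> g\<^sub>0" "x \<in> g\<^sub>0 \<Longrightarrow> complex_of_real r *\<^sub>C x \<in> g\<^sub>0"
  "x \<in> g\<^sub>0 \<Longrightarrow> y \<in> g\<^sub>0 \<Longrightarrow> [x, y]\<^sub>L \<in> g\<^sub>0" "x \<in> g\<^sub>0 \<Longrightarrow> - x \<in> g\<^sub>0" "x \<in> g\<^sub>0 \<Longrightarrow> y \<in> g\<^sub>0 \<Longrightarrow> x - y \<in> g\<^sub>0"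
proof -
  note rf = real_form[unfolded real_form_def]
  show "0 \<in> g\<^sub>0" using rf by (rule conjunct1)
  show add: "x \<in> g\<^sub>0 \<Longrightarrow> y \<in> g\<^sub>0 \<Longrightarrow> x + y \<in> g\<^sub>0" for x y
    using rf[THEN conjunct2, THEN conjunct1] by blast
  show scale: "x \<in> g\<^sub>0 \<Longrightarrow> complex_of_real r *\<^sub>C x \<in> g\<^sub>0" for x r
    using rf[THEN conjunct2, THEN conjunct2, THEN conjunct1] by blast
  show "x \<in> g\<^sub>0 \<Longrightarrow> y \<in> g\<^sub>0 \<Longrightarrow> [x, y]\<^sub>L \<in> g\<^sub>0"
    using rf[THEN conjunct2, THEN conjunct2, THEN conjunct2, THEN conjunct1] by blast
  show neg: "x \<in> g\<^sub>0 \<Longrightarrow> - x \<in> g\<^sub>0" for x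
    using scale[of x "- 1"] by (simp add: scaleC_one)
  show "x \<in> g\<^sub>0 \<Longrightarrow> y \<in> g\<^sub>0 \<Longrightarrow> x - y \<in> g\<^sub>0"
    using add[of x "- y"] neg[of y] by simp
qed

lemma real_form_ex1: "\<exists>!(x, y). x \<in> g\<^sub>0 \<and> y \<in> g\<^sub>0 \<and> z = x + \<i> *\<^sub>C y"
  using real_form[unfolded real_form_def, THEN conjunct2, THEN conjunct2, THEN conjunct2, THEN conjunct2]
  by (rule spec)

lemma real_form_decomposition: "\<exists>x\<in>g\<^sub>0. \<exists>y\<in>g\<^sub>0. z = x + \<i> *\<^sub>C y"
  using ex1_implies_ex[OF real_form_ex1[of z]] by auto

lemma real_form_unique:
  assumes "x \<in> g\<^sub>0" "y \<in> g\<^sub>0" "x' \<in> g\<^sub>0" "y' \<in> g\<^sub>0" "x + \<i> *\<^sub>C y = x' + \<i> *\<^sub>C y'"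
  shows "x = x'" "y = y'"
proof -
  let ?P = "\<lambda>(a, b). a \<in> g\<^sub>0 \<and> b \<in> g\<^sub>0 \<and> x + \<i> *\<^sub>C y = a + \<i> *\<^sub>C b"
  have "\<exists>!p. ?P p" by (rule real_form_ex1)
  moreover have "?P (x, y)" "?P (x', y')" using assms by simp_all
  ultimately have "(x, y) = (x', y')" by (elim ex1E) (metis (lifting))
  then show "x = x'" "y = y'" by simp_all
qed

text \<open>Conjugation with respect to the real form; the choice is harmless because the
  decomposition into real and imaginary part is unique.\<close>

definition gconj :: "'g \<Rightarrow> 'g"
  where "gconj z = (SOME w. \<exists>x\<in>g\<^sub>0. \<exists>y\<in>g\<^sub>0. z = x + \<i> *\<^sub>C y \<and> w = x - \<i> *\<^sub>C y)"

lemma gconj_eq: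
  assumes "x \<in> g\<^sub>0" "y \<in> g\<^sub>0"
  shows "gconj (x + \<i> *\<^sub>C y) = x - \<i> *\<^sub>C y"
  unfolding gconj_def
proof (rule some_equality)
  show "\<exists>xa\<in>g\<^sub>0. \<exists>ya\<in>g\<^sub>0. x + \<i> *\<^sub>C y = xa + \<i> *\<^sub>C ya \<and> x - \<i> *\<^sub>C y = xa - \<i> *\<^sub>C ya"
    using assms by blast
  fix w assume "\<exists>xa\<in>g\<^sub>0. \<exists>ya\<in>g\<^sub>0. x + \<i> *\<^sub>C y = xa + \<i> *\<^sub>C ya \<and> w = xa - \<i> *\<^sub>C ya"
  then show "w = x - \<i> *\<^sub>C y" using real_form_unique assms by blast
qed

lemma gconj_add: "gconj (u + v) = gconj u + gconj v"
proof -
  obtain a b where u: "a \<in> g\<^sub>0" "b \<in> g\<^sub>0" "u = a + \<i> *\<^sub>C b" using real_form_decomposition by blast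
  obtain c d where v: "c \<in> g\<^sub>0" "d \<in> g\<^sub>0" "v = c + \<i> *\<^sub>C d" using real_form_decomposition by blast
  have "u + v = (a + c) + \<i> *\<^sub>C (b + d)" by (simp add: u v scaleC_add_right)
  then have "gconj (u + v) = gconj ((a + c) + \<i> *\<^sub>C (b + d))" by (rule arg_cong)
  also have "\<dots> = (a + c) - \<i> *\<^sub>C (b + d)" by (rule gconj_eq) (intro real_form_closed(2) u v)+
  finally have "gconj (u + v) = (a + c) - \<i> *\<^sub>C (b + d)" .
  then show ?thesis by (simp add: u v gconj_eq scaleC_add_right)
qed

lemma gconj_scale: "gconj (c *\<^sub>C u) = cnj c *\<^sub>C gconj u"
proof -
  obtain a b where u: "a \<in> g\<^sub>0" "b \<in> g\<^sub>0" "u = a + \<i> *\<^sub>C b" using real_form_decomposition by blast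
  let ?r = "complex_of_real (Re c)" and ?s = "complex_of_real (Im c)"
  have c: "c = ?r + \<i> * ?s" "cnj c = ?r - \<i> * ?s" by (simp_all add: complex_eq_iff)
  have ic: "\<i> * c = \<i> * ?r - ?s" "- \<i> * cnj c = - \<i> * ?r - ?s" by (simp_all add: complex_eq_iff)
  have "c *\<^sub>C u = c *\<^sub>C a + (\<i> * c) *\<^sub>C b"
    by (simp add: u scaleC_add_right scaleC_scaleC mult.commute)
  also have "\<dots> = (?r + \<i> * ?s) *\<^sub>C a + (\<i> * ?r - ?s) *\<^sub>C b"
    by (simp only: ic c(1)[symmetric])
  also have "\<dots> = (?r *\<^sub>C a - ?s *\<^sub>C b) + \<i> *\<^sub>C (?s *\<^sub>C a + ?r *\<^sub>C b)"
    by (simp add: scaleC_add_left complex_vector.scale_left_diff_distrib scaleC_add_right scaleC_scaleC)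
  finally have cu: "c *\<^sub>C u = (?r *\<^sub>C a - ?s *\<^sub>C b) + \<i> *\<^sub>C (?s *\<^sub>C a + ?r *\<^sub>C b)" .
  have "gconj (c *\<^sub>C u) = (?r *\<^sub>C a - ?s *\<^sub>C b) - \<i> *\<^sub>C (?s *\<^sub>C a + ?r *\<^sub>C b)"
    unfolding cu by (rule gconj_eq) (intro real_form_closed u)+
  also have "\<dots> = (?r - \<i> * ?s) *\<^sub>C a + (- \<i> * ?r - ?s) *\<^sub>C b"
    by (simp add: complex_vector.scale_left_diff_distrib scaleC_add_right scaleC_scaleC complex_vector.scale_minus_left)
  also have "\<dots> = cnj c *\<^sub>C a + (- \<i> * cnj c) *\<^sub>C b"
    by (simp only: ic c(2)[symmetric])
  also have "\<dots> = cnj c *\<^sub>C (a - \<i> *\<^sub>C b)"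
    by (simp add: complex_vector.scale_right_diff_distrib scaleC_scaleC complex_vector.scale_minus_left mult.commute)
  also have "\<dots> = cnj c *\<^sub>C gconj u" by (simp add: u gconj_eq)
  finally show ?thesis .
qed

lemma gconj_conj: "gconj (gconj u) = u"
proof -
  obtain a b where u: "a \<in> g\<^sub>0" "b \<in> g\<^sub>0" "u = a + \<i> *\<^sub>C b" using real_form_decomposition by blast
  have "gconj u = a + \<i> *\<^sub>C (- b)" by (simp add: u gconj_eq)
  then have "gconj (gconj u) = gconj (a + \<i> *\<^sub>C (- b))" by (rule arg_cong)
  also have "\<dots> = a - \<i> *\<^sub>C (- b)" by (rule gconj_eq) (intro real_form_closed(5) u)+
  finally have "gconj (gconj u) = a - \<i> *\<^sub>C (- b)" .
  then show ?thesis by (simp add: u)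
qed

lemma gconj_0: "gconj 0 = 0"
  using gconj_scale[of 0 0] by simp

lemma gconj_neg: "gconj (- u) = - gconj u"
  using gconj_scale[of "- 1" u] by (simp add: scaleC_one)

lemma gconj_diff: "gconj (u - v) = gconj u - gconj v"
  using gconj_add[of u "- v"] by (simp add: gconj_neg)

lemma gconj_sum: "gconj (sum f A) = (\<Sum>i\<in>A. gconj (f i))"
  by (induction A rule: infinite_finite_induct) (simp_all add: gconj_0 gconj_add)

lemma gconj_real_form: "x \<in> g\<^sub>0 \<Longrightarrow> gconj x = x"
  using gconj_eq[of x 0] real_form_closed(1) by simp

lemma gconj_bracket: "gconj [u, v]\<^sub>L = [gconj u, gconj v]\<^sub>L"
proof -
  obtain a b where u: "a \<in> g\<^sub>0" "b \<in> g\<^sub>0" "u = a + \<i> *\<^sub>C b" using real_form_decomposition by blast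
  obtain c d where v: "c \<in> g\<^sub>0" "d \<in> g\<^sub>0" "v = c + \<i> *\<^sub>C d" using real_form_decomposition by blast
  have "gconj [x, y]\<^sub>L = [x, y]\<^sub>L" if "x \<in> g\<^sub>0" "y \<in> g\<^sub>0" for x y using gconj_real_form real_form_closed(4) that by blast
  then have "gconj [u, v]\<^sub>L = [a, c]\<^sub>L + cnj \<i> *\<^sub>C [a, d]\<^sub>L + (cnj \<i> *\<^sub>C [b, c]\<^sub>L + (cnj \<i> * cnj \<i>) *\<^sub>C [b, d]\<^sub>L)"
    by (simp add: u v gconj_add gconj_neg gconj_diff gconj_scale scaleC_add_right scaleC_scaleC)
  also have "\<dots> = [a - \<i> *\<^sub>C b, c - \<i> *\<^sub>C d]\<^sub>L"
    by (simp add: complex_vector.scale_right_diff_distrib scaleC_scaleC)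
  finally show ?thesis by (simp add: u v gconj_eq)
qed

lemma finite_dim_UNIV: "finite_dim (UNIV :: 'g set)"
  using semisimple by (simp add: lie_semisimple_def)

text \<open>The conjugates of the basis vectors, with the conjugated coordinate functionals, form a
  frame in the sense of \<open>ctrace_frame\<close>; in it the trace is the conjugate of the
  original one.\<close>

lemma ctrace_conj:
  assumes A: "clinear A"
  shows "ctrace (\<lambda>x. gconj (A (gconj x))) = cnj (ctrace (A :: 'g \<Rightarrow> 'g))"
proof -
  let ?B = "cextend_basis ({} :: 'g set)"
  obtain F :: "'g set" where "finite F" "cspan F = UNIV" using finite_dim_UNIV by (auto simp: finite_dim_def)
  then have fin: "finite ?B"
    using complex_vector.independent_span_bound[of F ?B] cextend_basis_props by auto
  note rep = crepresentation_sum[OF cextend_basis_props fin]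
  note lin = clinear_simps[OF clinear_crepresentation[OF cextend_basis_props]]
  let ?d = "\<lambda>b x. cnj (crepresentation ?B (gconj x) b)"
  have "ctrace (\<lambda>x. gconj (A (gconj x))) = (\<Sum>b\<in>?B. ?d b (gconj (A (gconj (gconj b)))))"
  proof (rule ctrace_frame[OF _ fin])
    show "clinear (\<lambda>x. gconj (A (gconj x)))"
      by (rule clinearI) (simp_all add: gconj_add gconj_scale clinear_simps[OF A])
    show "clinear (?d b)" for b
      by (rule clinearI) (simp_all add: gconj_add gconj_scale lin)
    show "x = (\<Sum>b\<in>?B. ?d b x *\<^sub>C gconj b)" for x
    proof -
      have "x = gconj (\<Sum>b\<in>?B. crepresentation ?B (gconj x) b *\<^sub>C b)"
        using rep[of "gconj x"] gconj_conj[of x] by simp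
      then show ?thesis by (simp add: gconj_sum gconj_scale)
    qed
  qed
  then show ?thesis by (simp add: gconj_conj ctrace_def)
qed

lemma killing_conj: "killing (gconj u) (gconj v) = cnj (killing u v)"
proof -
  have "(\<lambda>z. [gconj u, [gconj v, z]\<^sub>L]\<^sub>L) = (\<lambda>z. gconj [u, [v, gconj z]\<^sub>L]\<^sub>L)"
    by (simp add: gconj_bracket gconj_conj)
  then show ?thesis
    unfolding killing_def
    using ctrace_conj[OF clinear_compose[OF clinear_lie_bracket clinear_lie_bracket]] by simp
qed

lemma killing_real: "x \<in> g\<^sub>0 \<Longrightarrow> y \<in> g\<^sub>0 \<Longrightarrow> Im (killing x y) = 0"
  using killing_conj[of x y] by (simp add: gconj_real_form complex_eq_iff)

subsection \<open>The Cartan decomposition\<close>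

lemma involution: "clinear \<theta>" "\<theta> [x, y]\<^sub>L = [\<theta> x, \<theta> y]\<^sub>L" "\<theta> (\<theta> x) = x" "x \<in> g\<^sub>0 \<Longrightarrow> \<theta> x \<in> g\<^sub>0"
  "x \<in> g\<^sub>0 \<Longrightarrow> x \<noteq> 0 \<Longrightarrow> Re (killing x (\<theta> x)) < 0"
  using cartan_involution unfolding cartan_involution_def by blast+

lemmas involution_linear [simp] = clinear_simps[OF involution(1)] clinear_neg[OF involution(1)]

text \<open>\<theta> preserves the real form, so by uniqueness of real and imaginary parts it fixes
  a vector only if it fixes both parts. The next lemma is the same with the sign -1.\<close>

lemma kk_eq: "kk = {x. \<theta> x = x}"
proof (intro subset_antisym subsetI)
  fix z assume "z \<in> {x. \<theta> x = x}"
  moreover obtain x y where xy: "x \<in> g\<^sub>0" "y \<in> g\<^sub>0" "z = x + \<i> *\<^sub>C y" using real_form_decomposition by blast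
  ultimately have "\<theta> x + \<i> *\<^sub>C \<theta> y = x + \<i> *\<^sub>C y" by simp
  from real_form_unique[OF involution(4)[OF xy(1)] involution(4)[OF xy(2)] xy(1,2) this] show "z \<in> kk"
    using xy by (auto simp: compact_part_def complexification_def)
qed (auto simp: compact_part_def complexification_def)

lemma pnc_eq: "pnc = {x. \<theta> x = - x}"
proof (intro subset_antisym subsetI)
  fix z assume "z \<in> {x. \<theta> x = - x}"
  moreover obtain x y where xy: "x \<in> g\<^sub>0" "y \<in> g\<^sub>0" "z = x + \<i> *\<^sub>C y" using real_form_decomposition by blast
  ultimately have "\<theta> x + \<i> *\<^sub>C \<theta> y = - x + \<i> *\<^sub>C (- y)" by simp
  from real_form_unique[OF involution(4)[OF xy(1)] involution(4)[OF xy(2)] real_form_closed(5)[OF xy(1)] real_form_closed(5)[OF xy(2)] this] show "z \<in> pnc"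
    using xy by (auto simp: noncompact_part_def complexification_def)
qed (auto simp: noncompact_part_def complexification_def)

lemma \<theta>_conj: "\<theta> (gconj u) = gconj (\<theta> u)"
proof -
  obtain a b where u: "a \<in> g\<^sub>0" "b \<in> g\<^sub>0" "u = a + \<i> *\<^sub>C b" using real_form_decomposition by blast
  then show ?thesis using gconj_eq[of a b] gconj_eq[of "\<theta> a" "\<theta> b"] involution(4) by simp
qed

lemma subspace_kk: "csubspace kk" and subspace_pnc: "csubspace pnc"
  by (auto simp: kk_eq pnc_eq complex_vector.subspace_def)

lemma brackets:
  "x \<in> kk \<Longrightarrow> y \<in> kk \<Longrightarrow> [x, y]\<^sub>L \<in> kk" "x \<in> kk \<Longrightarrow> y \<in> pnc \<Longrightarrow> [x, y]\<^sub>L \<in> pnc"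
  "x \<in> pnc \<Longrightarrow> y \<in> kk \<Longrightarrow> [x, y]\<^sub>L \<in> pnc" "x \<in> pnc \<Longrightarrow> y \<in> pnc \<Longrightarrow> [x, y]\<^sub>L \<in> kk"
  by (simp_all add: kk_eq pnc_eq involution(2))

lemma self_eq_neg: "x = - x \<Longrightarrow> x = 0" for x :: 'g
proof -
  assume "x = - x"
  then have "2 *\<^sub>C x = 0" using scaleC_add_left[of 1 1 x] by (simp add: scaleC_one eq_neg_iff_add_eq_0)
  then show "x = 0" by simp
qed

lemma kk_pnc: "x \<in> kk \<Longrightarrow> x \<in> pnc \<Longrightarrow> x = 0"
  using self_eq_neg[of x] by (simp add: kk_eq pnc_eq)

lemma kk_conj: "x \<in> kk \<Longrightarrow> gconj x \<in> kk" and pnc_conj: "x \<in> pnc \<Longrightarrow> gconj x \<in> pnc"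
  by (simp_all add: kk_eq pnc_eq \<theta>_conj gconj_neg)

lemma cartan_decomposition: "\<exists>a\<in>kk. \<exists>b\<in>pnc. x = a + b"
proof (intro bexI)
  show "x = (1 / 2) *\<^sub>C (x + \<theta> x) + (1 / 2) *\<^sub>C (x - \<theta> x)"
    by (simp add: scaleC_add_right complex_vector.scale_right_diff_distrib scaleC_add_left[symmetric] scaleC_one)
  show "(1 / 2) *\<^sub>C (x + \<theta> x) \<in> kk" "(1 / 2) *\<^sub>C (x - \<theta> x) \<in> pnc"
    by (simp_all add: kk_eq pnc_eq involution(3) add.commute complex_vector.scale_right_diff_distrib)
qed

text \<open>For x = a + i b the cross terms cancel and the value is the sum of the Killing norms of
  a and b. Since \<theta> is -1 on a and b, the negativity in the definition of a Cartan involution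
  becomes positivity.\<close>

lemma killing_conj_positive:
  assumes "x \<in> pnc" "x \<noteq> 0"
  shows "Re (killing x (gconj x)) > 0"
proof -
  obtain a b where ab: "a \<in> g\<^sub>0" "b \<in> g\<^sub>0" "\<theta> a = - a" "\<theta> b = - b" "x = a + \<i> *\<^sub>C b"
    using assms(1) by (auto simp: noncompact_part_def complexification_def)
  have "killing x (gconj x) = killing a a + killing b b"
    by (simp add: ab gconj_eq killing_commute[of b a] algebra_simps)
  moreover have pos: "Re (killing c c) > 0" if "c \<in> g\<^sub>0" "\<theta> c = - c" "c \<noteq> 0" for c
    using involution(5)[OF that(1,3)] that(2) by simp
  moreover have "Re (killing c c) \<ge> 0" if "c \<in> g\<^sub>0" "\<theta> c = - c" for c
    using pos[OF that] by (cases "c = 0") auto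
  moreover have "a \<noteq> 0 \<or> b \<noteq> 0" using ab(5) assms(2) by auto
  ultimately show ?thesis using ab by (auto intro: add_pos_nonneg add_nonneg_pos)
qed

text \<open>For z = a + i b over the real form, pairing with \<theta> a - i \<theta> b has real part
  \<open>killing a (\<theta> a)\<close> + \<open>killing b (\<theta> b)\<close>, because the Killing
  form is real there. Both terms are nonpositive and vanish only for a = 0 and b = 0.\<close>

lemma killing_nondegenerate:
  fixes z :: 'g
  assumes "\<And>y. killing z y = 0"
  shows "z = 0"
proof -
  obtain a b where ab: "a \<in> g\<^sub>0" "b \<in> g\<^sub>0" "z = a + \<i> *\<^sub>C b" using real_form_decomposition by blast
  have "killing z (\<theta> a - \<i> *\<^sub>C \<theta> b) = killing a (\<theta> a) + killing b (\<theta> b)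
      + \<i> * (killing b (\<theta> a) - killing a (\<theta> b))"
    by (simp add: ab algebra_simps)
  then have "Re (killing a (\<theta> a)) + Re (killing b (\<theta> b)) = 0"
    using assms killing_real ab(1,2) involution(4) by (simp add: complex_eq_iff)
  moreover have "Re (killing c (\<theta> c)) \<le> 0" if "c \<in> g\<^sub>0" for c
    using involution(5)[OF that] by (cases "c = 0") auto
  ultimately have "Re (killing a (\<theta> a)) = 0" "Re (killing b (\<theta> b)) = 0"
    using ab(1,2) by (smt (verit))+
  then have "a = 0" "b = 0" using involution(5) ab(1,2) by force+
  then show ?thesis using ab by simp
qed

subsection \<open>Weights\<close>

lemma t_kk: "x \<in> t \<Longrightarrow> x \<in> kk"
  using cartan_subalgebra(2) by blast

lemma subspace_t: "csubspace t"
  using cartan_subalgebra(1) by (simp add: cartan_subalgebra_def)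

lemma in_t_iff: "x \<in> t \<longleftrightarrow> (\<forall>h\<in>t. [h, x]\<^sub>L = 0)"
  using cartan_subalgebra(1) unfolding cartan_subalgebra_def abelian_def by blast

lemma subspace_plus: "csubspace p_plus" and subspace_minus: "csubspace p_minus"
  using abelian by (auto simp: lie_subalgebra_def)

lemma plus_pnc: "p_plus \<subseteq> pnc" and minus_pnc: "p_minus \<subseteq> pnc"
  using maximal_isotropic by (auto simp: maximal_isotropic_def)

abbreviation "gw \<equiv> weight_space lie_bracket t"

lemma subspace_gw: "csubspace (gw \<alpha>)"
  by (rule csubspace_weight_space[OF clinear_lie_bracket])

lemma weight_decomposition:
  assumes W: "csubspace W" "\<And>h w. h \<in> t \<Longrightarrow> w \<in> W \<Longrightarrow> [h, w]\<^sub>L \<in> W" and w: "w \<in> W"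
  shows "\<exists>S r. finite S \<and> S \<subseteq> dual_space t \<and> (\<forall>\<alpha>\<in>S. r \<alpha> \<in> gw \<alpha> \<inter> W) \<and> w = (\<Sum>\<alpha>\<in>S. r \<alpha>)"
  by (rule weight_decomposition_in_invariant[OF clinear_lie_bracket W dual_space_distinct w])
    (simp_all add: cartan_weight_spaces[OF cartan_subalgebra(1) finite_dim_UNIV])

lemma killing_weights:
  assumes "x \<in> gw \<alpha>" "y \<in> gw \<beta>" "killing x y \<noteq> 0" "h \<in> t"
  shows "\<beta> h = - \<alpha> h"
proof -
  have "killing [h, x]\<^sub>L y = - killing x [h, y]\<^sub>L" by (rule killing_invariant')
  then have "(\<alpha> h + \<beta> h) * killing x y = 0"
    using assms by (simp add: weight_space_def algebra_simps)
  then have "\<alpha> h + \<beta> h = 0" using assms(3) by simp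
  then show ?thesis by (simp add: add_eq_0_iff)
qed

lemma bracket_weights: "x \<in> gw \<alpha> \<Longrightarrow> y \<in> gw \<beta> \<Longrightarrow> [x, y]\<^sub>L \<in> gw (\<lambda>h. \<alpha> h + \<beta> h)"
  unfolding weight_space_def
proof (intro CollectI ballI)
  fix h assume xy: "x \<in> {v. \<forall>h\<in>t. [h, v]\<^sub>L = \<alpha> h *\<^sub>C v}" "y \<in> {v. \<forall>h\<in>t. [h, v]\<^sub>L = \<beta> h *\<^sub>C v}" and h: "h \<in> t"
  have "[h, [x, y]\<^sub>L]\<^sub>L = [[h, x]\<^sub>L, y]\<^sub>L + [x, [h, y]\<^sub>L]\<^sub>L" by (simp add: lie_bracket_bracket)
  then show "[h, [x, y]\<^sub>L]\<^sub>L = (\<alpha> h + \<beta> h) *\<^sub>C [x, y]\<^sub>L" using xy h by (simp add: scaleC_add_left)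
qed

text \<open>Some weight component of y still pairs nontrivially with x, and invariance of the
  Killing form forces its weight to be opposite; rescaling it makes the pairing 1.\<close>

lemma exists_paired_weight:
  assumes W: "csubspace W" "\<And>h w. h \<in> t \<Longrightarrow> w \<in> W \<Longrightarrow> [h, w]\<^sub>L \<in> W"
    and x: "x \<in> gw \<alpha>" and y: "y \<in> W" "killing x y \<noteq> 0"
  shows "\<exists>\<beta>\<in>dual_space t. \<exists>f\<in>gw \<beta> \<inter> W. killing x f = 1 \<and> (\<forall>h\<in>t. \<beta> h = - \<alpha> h)"
proof -
  obtain S r where S: "finite S" "S \<subseteq> dual_space t" "\<And>\<beta>. \<beta> \<in> S \<Longrightarrow> r \<beta> \<in> gw \<beta> \<inter> W" "y = (\<Sum>\<beta>\<in>S. r \<beta>)"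
    using weight_decomposition[OF W y(1)] by blast
  obtain \<beta> where \<beta>: "\<beta> \<in> S" "killing x (r \<beta>) \<noteq> 0"
    using y(2) unfolding S(4) clinear_sum[OF clinear_killing] by (meson sum.neutral)
  let ?f = "(1 / killing x (r \<beta>)) *\<^sub>C r \<beta>"
  have "?f \<in> gw \<beta> \<inter> W"
    using S(3)[OF \<beta>(1)] W(1) subspace_gw by (auto simp: complex_vector.subspace_scale)
  moreover have "killing x ?f = 1" using \<beta> by simp
  moreover have "\<forall>h\<in>t. \<beta> h = - \<alpha> h" using killing_weights[OF x _ \<beta>(2)] S(3)[OF \<beta>(1)] by blast
  ultimately show ?thesis using S(2) \<beta>(1) by blast
qed

subsection \<open>One-dimensional root spaces\<close>

text \<open>For e in p+, ad e maps p- to k, k to p+ and p+ to 0; for e in p- the roles of p+ and p-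
  are exchanged. W and W' treat both cases together.\<close>

lemma ad_cube:
  assumes W: "W = p_plus \<or> W = p_minus" and e: "e \<in> W"
  shows "[e, [e, [e, x]\<^sub>L]\<^sub>L]\<^sub>L = 0"
proof -
  obtain W' where W': "\<And>y. y \<in> W' \<Longrightarrow> y \<in> pnc" "\<And>x y. x \<in> kk \<Longrightarrow> y \<in> W \<Longrightarrow> [x, y]\<^sub>L \<in> W" "\<And>x y. x \<in> W \<Longrightarrow> y \<in> W \<Longrightarrow> [x, y]\<^sub>L = 0"
    "\<And>x. x \<in> W \<Longrightarrow> x \<in> pnc" "\<And>b. b \<in> pnc \<Longrightarrow> \<exists>u\<in>W. \<exists>v\<in>W'. b = u + v"
  proof -
    have dec: "\<exists>u\<in>p_plus. \<exists>v\<in>p_minus. b = u + v" if "b \<in> pnc" for b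
      using that unfolding decomposition(1)[symmetric] subspace_sum_def by blast
    then have dec': "\<exists>u\<in>p_minus. \<exists>v\<in>p_plus. b = u + v" if "b \<in> pnc" for b
      using that by (metis add.commute)
    show ?thesis
      using W
    proof
      assume "W = p_plus"
      then show ?thesis
        by (intro that[of p_minus]) (use dec k_stable abelian plus_pnc minus_pnc in \<open>auto simp: abelian_def\<close>)
    next
      assume "W = p_minus"
      then show ?thesis
        by (intro that[of p_plus]) (use dec' k_stable abelian plus_pnc minus_pnc in \<open>auto simp: abelian_def\<close>)
    qed
  qed
  have kW: "[e, a]\<^sub>L \<in> W" if "a \<in> kk" for a
    using W'(2)[OF that e] lie_bracket_anticommute[of e a] W subspace_plus subspace_minus
      complex_vector.subspace_neg by metis
  obtain a b where ab: "a \<in> kk" "b \<in> pnc" "x = a + b" using cartan_decomposition by blast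
  obtain u v where uv: "u \<in> W" "v \<in> W'" "b = u + v" using W'(5)[OF ab(2)] by blast
  have "[e, v]\<^sub>L \<in> kk" using brackets(4) W'(1,4) e uv by blast
  then show ?thesis
    using W'(3)[OF e uv(1)] W'(3)[OF e kW[OF ab(1)]] W'(3)[OF e kW[of "[e, v]\<^sub>L"]] by (simp add: ab uv)
qed

text \<open>The bracket has weight 0 and so lies in t. It is orthogonal to all vectors of nonzero
  weight, and its pairing with t is computed by invariance; if x and f are orthogonal, it is
  orthogonal to everything.\<close>

lemma bracket_pairing:
  assumes "x \<in> gw \<alpha>" "f \<in> gw \<beta>" "\<forall>h\<in>t. \<beta> h = - \<alpha> h"
  shows "[x, f]\<^sub>L \<in> t" "h \<in> t \<Longrightarrow> killing [x, f]\<^sub>L h = \<alpha> h * killing x f" "killing x f = 0 \<Longrightarrow> [x, f]\<^sub>L = 0"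
proof -
  have w0: "[x, f]\<^sub>L \<in> gw (\<lambda>h. \<alpha> h + \<beta> h)" by (rule bracket_weights[OF assms(1,2)])
  then show t: "[x, f]\<^sub>L \<in> t"
    unfolding in_t_iff using assms(3) by (auto simp: weight_space_def)
  have K: "killing [x, f]\<^sub>L h = \<alpha> h * killing x f" if "h \<in> t" for h
    using that assms(2,3) lie_bracket_anticommute[of f h] by (simp add: killing_invariant weight_space_def)
  show "h \<in> t \<Longrightarrow> killing [x, f]\<^sub>L h = \<alpha> h * killing x f" by (rule K)
  assume 0: "killing x f = 0"
  have "killing [x, f]\<^sub>L y = 0" if y: "y \<in> gw \<gamma>" for y \<gamma>
  proof (rule ccontr)
    assume nz: "killing [x, f]\<^sub>L y \<noteq> 0"
    have "\<gamma> h = 0" if "h \<in> t" for h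
      using killing_weights[OF w0 y nz that] assms(3) that by simp
    then have "\<forall>h\<in>t. [h, y]\<^sub>L = 0" using y unfolding weight_space_def by simp
    then have "y \<in> t" unfolding in_t_iff .
    then show False using K nz 0 by simp
  qed
  then have "killing [x, f]\<^sub>L y = 0" for y
    using clinear_vanishes_on_span[OF clinear_killing, of "\<Union>\<alpha>\<in>dual_space t. gw \<alpha>"]
      cartan_weight_spaces[OF cartan_subalgebra(1) finite_dim_UNIV] by (metis UN_E UNIV_I)
  then show "[x, f]\<^sub>L = 0" by (rule killing_nondegenerate)
qed

text \<open>Otherwise e, f and H = [e, f] span a Heisenberg algebra with H central. Nilpotency of ad
  e and ad f then leaves 0 as the only eigenvalue of the diagonalizable ad H, so H = 0 and \<alpha>
  vanishes on t. This puts e into t, hence into both k and p.\<close>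

lemma coroot_nonzero:
  assumes e: "e \<in> gw \<alpha>" "e \<in> p_plus" and f: "f \<in> gw \<beta>" "f \<in> p_minus" "\<forall>h\<in>t. \<beta> h = - \<alpha> h"
    and ef: "killing e f = 1"
  shows "\<alpha> [e, f]\<^sub>L \<noteq> 0"
proof
  assume c0: "\<alpha> [e, f]\<^sub>L = 0"
  let ?H = "[e, f]\<^sub>L"
  note Ht = bracket_pairing(1)[OF e(1) f(1,3)]
  have He: "[?H, e]\<^sub>L = 0" "[?H, f]\<^sub>L = 0" using e f Ht c0 by (auto simp: weight_space_def)
  have comm: "[?H, [e, x]\<^sub>L]\<^sub>L = [e, [?H, x]\<^sub>L]\<^sub>L" "[?H, [f, x]\<^sub>L]\<^sub>L = [f, [?H, x]\<^sub>L]\<^sub>L" for x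
    using lie_bracket_bracket[of ?H e x] lie_bracket_bracket[of ?H f x] He by simp_all
  have EF: "[e, [f, x]\<^sub>L]\<^sub>L = [f, [e, x]\<^sub>L]\<^sub>L + [?H, x]\<^sub>L" for x
    by (simp add: lie_bracket_bracket)
  \<comment> \<open>For v killed by e, applying e to the j-fold f-translate gives j c times the
    previous one. As the third translate vanishes, so do the second, the first and v.\<close>
  have z: "v = 0" if v: "[?H, v]\<^sub>L = c *\<^sub>C v" "[e, v]\<^sub>L = 0" "c \<noteq> 0" for v c
  proof -
    have 1: "[e, [f, v]\<^sub>L]\<^sub>L = c *\<^sub>C v" using v by (simp add: EF)
    have 2: "[e, [f, [f, v]\<^sub>L]\<^sub>L]\<^sub>L = (2 * c) *\<^sub>C [f, v]\<^sub>L"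
      using v by (simp add: EF[of "[f, v]\<^sub>L"] 1 comm scaleC_add_left[symmetric])
    have 3: "[e, [f, [f, [f, v]\<^sub>L]\<^sub>L]\<^sub>L]\<^sub>L = (3 * c) *\<^sub>C [f, [f, v]\<^sub>L]\<^sub>L"
      using v by (simp add: EF[of "[f, [f, v]\<^sub>L]\<^sub>L"] 2 comm scaleC_add_left[symmetric])
    have "[f, [f, v]\<^sub>L]\<^sub>L = 0" using 3 ad_cube[of p_minus f v] f(2) v(3) by simp
    then have "[f, v]\<^sub>L = 0" using 2 v(3) by simp
    then show ?thesis using 1 v(3) by simp
  qed
  \<comment> \<open>The twofold e-translate of v is killed by e and keeps the eigenvalue c, so it is
    0; repeating this for the onefold translate and for v itself gives the claim.\<close>
  have "v = 0" if v: "[?H, v]\<^sub>L = c *\<^sub>C v" "c \<noteq> 0" for v c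
  proof -
    have "[?H, [e, v]\<^sub>L]\<^sub>L = c *\<^sub>C [e, v]\<^sub>L" "[?H, [e, [e, v]\<^sub>L]\<^sub>L]\<^sub>L = c *\<^sub>C [e, [e, v]\<^sub>L]\<^sub>L"
      by (simp_all add: comm v)
    then show ?thesis using z v ad_cube[of p_plus e v] e(2) by metis
  qed
  note 0 = this
  have "[?H, x]\<^sub>L = 0" if x: "x \<in> {x. \<exists>c. [?H, x]\<^sub>L = c *\<^sub>C x}" for x
  proof -
    obtain c where c: "[?H, x]\<^sub>L = c *\<^sub>C x" using x by blast
    show ?thesis
      by (cases "c = 0") (use c 0[OF c] in auto)
  qed
  moreover have "cspan {x. \<exists>c. [?H, x]\<^sub>L = c *\<^sub>C x} = UNIV"
    using cartan_subalgebra(1) Ht unfolding cartan_subalgebra_def by blast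
  ultimately have "[?H, x]\<^sub>L = 0" for x
    using clinear_vanishes_on_span[OF clinear_lie_bracket, of "{x. \<exists>c. [?H, x]\<^sub>L = c *\<^sub>C x}" ?H x] by blast
  then have "killing ?H y = 0" for y by (simp add: killing_def ctrace_def)
    (simp add: clinear_simps[OF clinear_crepresentation[OF cextend_basis_props]])
  then have "?H = 0" by (rule killing_nondegenerate)
  then have "\<alpha> h = 0" if "h \<in> t" for h
    using bracket_pairing(2)[OF e(1) f(1,3) that] ef by simp
  then have "\<forall>h\<in>t. [h, e]\<^sub>L = 0" using e(1) unfolding weight_space_def by simp
  then have "e \<in> t" unfolding in_t_iff .
  then have "e = 0" using kk_pnc t_kk plus_pnc e(2) by blast
  then show False using ef by simp
qed

text \<open>v = x - \<open>killing x f\<close> e is orthogonal to f, hence commutes with f. Applying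
  f to the first, second and third e-translates of v multiplies the previous one by -c, -3 c and -6
  c with c = \<alpha> [e, f] nonzero, and the third translate is 0, so v = 0. Since x is any vector
  of weight \<alpha>, a root cannot occur in k and p+ at once.\<close>

lemma root_space_one_dimensional:
  assumes e: "e \<in> gw \<alpha>" "e \<in> p_plus" and f: "f \<in> gw \<beta>" "f \<in> p_minus" "\<forall>h\<in>t. \<beta> h = - \<alpha> h"
    and ef: "killing e f = 1" and x: "x \<in> gw \<alpha>"
  shows "x = killing x f *\<^sub>C e"
proof -
  define v where "v = x - killing x f *\<^sub>C e"
  let ?H = "[e, f]\<^sub>L" and ?c = "\<alpha> [e, f]\<^sub>L"
  note c0 = coroot_nonzero[OF e f ef]
  note Ht = bracket_pairing(1)[OF e(1) f(1,3)]
  have v: "v \<in> gw \<alpha>" unfolding v_def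
    using subspace_gw e x by (intro complex_vector.subspace_diff complex_vector.subspace_scale) auto
  have "killing v f = 0" using ef by (simp add: v_def)
  then have "[v, f]\<^sub>L = 0" using bracket_pairing(3)[OF v f(1,3)] by blast
  then have fv: "[f, v]\<^sub>L = 0" using lie_bracket_anticommute[of f v] by simp
  have He: "[?H, e]\<^sub>L = ?c *\<^sub>C e" and Hv: "[?H, v]\<^sub>L = ?c *\<^sub>C v"
    using e v Ht by (auto simp: weight_space_def)
  have HE: "[?H, [e, y]\<^sub>L]\<^sub>L = ?c *\<^sub>C [e, y]\<^sub>L + [e, [?H, y]\<^sub>L]\<^sub>L" for y
    using lie_bracket_bracket[of ?H e y] He by simp
  have FE: "[f, [e, y]\<^sub>L]\<^sub>L = [e, [f, y]\<^sub>L]\<^sub>L - [?H, y]\<^sub>L" for y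
    by (simp add: lie_bracket_bracket)
  have H1: "[?H, [e, v]\<^sub>L]\<^sub>L = (2 * ?c) *\<^sub>C [e, v]\<^sub>L"
    by (simp add: HE Hv scaleC_add_left[symmetric])
  have H2: "[?H, [e, [e, v]\<^sub>L]\<^sub>L]\<^sub>L = (3 * ?c) *\<^sub>C [e, [e, v]\<^sub>L]\<^sub>L"
    by (simp add: HE[of "[e, v]\<^sub>L"] H1 scaleC_add_left[symmetric])
  have 1: "[f, [e, v]\<^sub>L]\<^sub>L = (- ?c) *\<^sub>C v" by (simp add: FE fv Hv complex_vector.scale_minus_left)
  have 2: "[f, [e, [e, v]\<^sub>L]\<^sub>L]\<^sub>L = (- 3 * ?c) *\<^sub>C [e, v]\<^sub>L"
    unfolding FE[of "[e, v]\<^sub>L"] 1 H1 lie_bracket_linear complex_vector.scale_left_diff_distrib[symmetric]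
    by (rule arg_cong2[of _ _ _ _ scaleC]) simp_all
  have 3: "[f, [e, [e, [e, v]\<^sub>L]\<^sub>L]\<^sub>L]\<^sub>L = (- 6 * ?c) *\<^sub>C [e, [e, v]\<^sub>L]\<^sub>L"
    unfolding FE[of "[e, [e, v]\<^sub>L]\<^sub>L"] 2 H2 lie_bracket_linear complex_vector.scale_left_diff_distrib[symmetric]
    by (rule arg_cong2[of _ _ _ _ scaleC]) simp_all
  have "[e, [e, v]\<^sub>L]\<^sub>L = 0" using 3 ad_cube[of p_plus e v] e(2) c0 by simp
  then have "[e, v]\<^sub>L = 0" using 2 c0 by simp
  then have "v = 0" using 1 c0 by simp
  then show ?thesis by (simp add: v_def)
qed

end

section \<open>Signs of the weights, conjugation of p+ and p-, and the character\<close>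

context hermitian_symmetric_pair
begin

lemma zero_weight: "x \<in> gw \<alpha> \<Longrightarrow> (\<And>h. h \<in> t \<Longrightarrow> \<alpha> h = 0) \<Longrightarrow> x \<in> t"
  by (rule in_t_iff[THEN iffD2]) (simp add: weight_space_def)

lemma root_memI:
  assumes "\<alpha> \<in> dual_space t" "y \<in> gw \<alpha>" "y \<in> pnc" "y \<noteq> 0"
  shows "\<alpha> \<in> roots UNIV t"
proof -
  have "\<alpha> \<noteq> (\<lambda>_. 0)"
    using zero_weight[OF assms(2)] kk_pnc[of y] t_kk assms(3,4) by auto
  then show ?thesis using assms by (auto simp: roots_def)
qed

lemma t_stable_plus: "h \<in> t \<Longrightarrow> x \<in> p_plus \<Longrightarrow> [h, x]\<^sub>L \<in> p_plus"
  and t_stable_minus: "h \<in> t \<Longrightarrow> x \<in> p_minus \<Longrightarrow> [h, x]\<^sub>L \<in> p_minus"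
  using k_stable t_kk by blast+

text \<open>Conjugation need not preserve t, but it maps t into k, and stability of W under k is
  enough.\<close>

lemma gconj_image_t_stable:
  assumes "\<And>x y. x \<in> kk \<Longrightarrow> y \<in> W \<Longrightarrow> [x, y]\<^sub>L \<in> W" "h \<in> t" "y \<in> gconj ` W"
  shows "[h, y]\<^sub>L \<in> gconj ` W"
proof -
  obtain z where z: "z \<in> W" "y = gconj z" using assms(3) by blast
  have "[gconj h, z]\<^sub>L \<in> W" using assms(1,2) z kk_conj t_kk by blast
  moreover have "[h, y]\<^sub>L = gconj [gconj h, z]\<^sub>L" by (simp add: gconj_bracket gconj_conj z)
  ultimately show ?thesis by blast
qed

lemma csubspace_conj: "csubspace W \<Longrightarrow> csubspace (gconj ` W)"
proof (rule complex_vector.subspaceI)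
  assume W: "csubspace W"
  show "0 \<in> gconj ` W" using complex_vector.subspace_0[OF W] gconj_0 by (metis image_eqI)
  show "x + y \<in> gconj ` W" if xy: "x \<in> gconj ` W" "y \<in> gconj ` W" for x y
  proof -
    obtain u v where "u \<in> W" "v \<in> W" "x = gconj u" "y = gconj v" using xy by blast
    then have "x + y = gconj (u + v)" "u + v \<in> W"
      using complex_vector.subspace_add[OF W] by (simp_all add: gconj_add)
    then show ?thesis by blast
  qed
  show "c *\<^sub>C x \<in> gconj ` W" if x: "x \<in> gconj ` W" for c x
  proof -
    obtain u where "u \<in> W" "x = gconj u" using x by blast
    then have "c *\<^sub>C x = gconj (cnj c *\<^sub>C u)" "cnj c *\<^sub>C u \<in> W"
      using complex_vector.subspace_scale[OF W] by (simp_all add: gconj_scale)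
    then show ?thesis by blast
  qed
qed

text \<open>A character of k is determined by its restriction to t: a vector r of weight \<alpha>
  with \<alpha> y nonzero is a multiple of the commutator [y, r], on which characters vanish, and
  vectors of weight 0 lie in t. So the description in \<open>character_of_weight\<close> has exactly
  one solution, the restriction of \<kappa>.\<close>

lemma character_eq:
  assumes add: "\<And>x y. \<kappa> (x + y) = \<kappa> x + \<kappa> y" and scale: "\<And>c x. \<kappa> (c *\<^sub>C x) = c * \<kappa> x"
    and br: "\<And>x y. x \<in> kk \<Longrightarrow> y \<in> kk \<Longrightarrow> \<kappa> [x, y]\<^sub>L = 0" and \<mu>: "\<And>x. x \<in> t \<Longrightarrow> \<kappa> x = \<mu> x"
    and x: "x \<in> kk"
  shows "character_of_weight kk t \<mu> x = \<kappa> x"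
proof -
  let ?P = "\<lambda>\<chi>. \<chi> \<in> dual_space kk \<and> (\<forall>x\<in>kk. \<forall>y\<in>kk. \<chi> [x, y]\<^sub>L = 0) \<and> (\<forall>x\<in>t. \<chi> x = \<mu> x)"
  define \<chi>0 where "\<chi>0 = (\<lambda>x. if x \<in> kk then \<kappa> x else 0)"
  have "?P \<chi>0"
    using br \<mu> t_kk brackets(1)
    by (auto simp: \<chi>0_def dual_space_def add scale complex_vector.subspace_add[OF subspace_kk]
        complex_vector.subspace_scale[OF subspace_kk])
  moreover have "\<chi> = \<chi>0" if \<chi>: "?P \<chi>" for \<chi>
  proof
    fix x
    show "\<chi> x = \<chi>0 x"
    proof (cases "x \<in> kk")
      case True
      have lin: "\<chi> (u + v) = \<chi> u + \<chi> v" "\<chi> (c *\<^sub>C u) = c * \<chi> u" if "u \<in> kk" "v \<in> kk" for u v c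
        using \<chi> that by (auto simp: dual_space_def)
      have lin0: "\<chi> 0 = 0" using lin(2)[of 0 0 0] complex_vector.subspace_0[OF subspace_kk] by simp
      obtain S r where S: "finite S" "\<And>\<alpha>. \<alpha> \<in> S \<Longrightarrow> r \<alpha> \<in> gw \<alpha> \<inter> kk" "x = (\<Sum>\<alpha>\<in>S. r \<alpha>)"
        using weight_decomposition[OF subspace_kk brackets(1)[OF t_kk] True] by blast
      have r: "\<chi> (r \<alpha>) = \<kappa> (r \<alpha>)" if \<alpha>: "\<alpha> \<in> S" for \<alpha>
      proof (cases "\<exists>y\<in>t. \<alpha> y \<noteq> 0")
        case True
        then obtain y where y: "y \<in> t" "\<alpha> y \<noteq> 0" by blast
        have "[y, r \<alpha>]\<^sub>L = \<alpha> y *\<^sub>C r \<alpha>" using S(2)[OF \<alpha>] y by (simp add: weight_space_def)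
        moreover have "\<chi> [y, r \<alpha>]\<^sub>L = 0" "\<kappa> [y, r \<alpha>]\<^sub>L = 0"
          using \<chi> br t_kk[OF y(1)] S(2)[OF \<alpha>] by auto
        ultimately show ?thesis
          using lin(2)[of "r \<alpha>" 0 "\<alpha> y"] scale[of "\<alpha> y" "r \<alpha>"] S(2)[OF \<alpha>] y(2)
            complex_vector.subspace_0[OF subspace_kk] by simp
      next
        case False
        then have "r \<alpha> \<in> t" using zero_weight S(2)[OF \<alpha>] by blast
        then show ?thesis using \<chi> \<mu> by simp
      qed
      have "\<chi> (\<Sum>\<alpha>\<in>S. r \<alpha>) = \<kappa> (\<Sum>\<alpha>\<in>S. r \<alpha>) \<and> (\<Sum>\<alpha>\<in>S. r \<alpha>) \<in> kk"
        using S(1,2) r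
      proof (induction S rule: finite_induct)
        case empty
        show ?case using lin0 scale[of 0 0] complex_vector.subspace_0[OF subspace_kk] by simp
      next
        case (insert \<alpha> S)
        then have "\<chi> (\<Sum>\<alpha>\<in>S. r \<alpha>) = \<kappa> (\<Sum>\<alpha>\<in>S. r \<alpha>) \<and> (\<Sum>\<alpha>\<in>S. r \<alpha>) \<in> kk" "r \<alpha> \<in> kk" "\<chi> (r \<alpha>) = \<kappa> (r \<alpha>)"
          by auto
        then show ?case
          using insert.hyps by (simp add: lin add complex_vector.subspace_add[OF subspace_kk])
      qed
      then show ?thesis using True S(3) by (simp add: \<chi>0_def)
    next
      case False
      then show ?thesis using \<chi> by (simp add: \<chi>0_def dual_space_def)
    qed
  qed
  ultimately have "character_of_weight kk t \<mu> = \<chi>0"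
    unfolding character_of_weight_def by (rule the_equality)
  then show ?thesis using x by (simp add: \<chi>0_def)
qed

context
  fixes P and h
  assumes regular: "h \<in> t" "\<And>\<alpha>. \<alpha> \<in> roots UNIV t \<Longrightarrow> Re (\<alpha> h) \<noteq> 0" "P = {\<alpha> \<in> roots UNIV t. Re (\<alpha> h) > 0}"
    and borel: "subspace_sum t (nilradical t P) \<subseteq> subspace_sum kk p_plus"
begin

text \<open>This is the inclusion of the Borel subalgebra in k + p+, read for a single root space;
  everything below about signs of weights starts from it.\<close>

lemma positive_root_space:
  assumes "\<alpha> \<in> P" "x \<in> gw \<alpha>"
  shows "\<exists>a\<in>kk. \<exists>b\<in>p_plus. x = a + b"
proof -
  have "x \<in> nilradical t P"
    unfolding nilradical_def using assms by (intro complex_vector.span_base) blast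
  then have "x \<in> subspace_sum t (nilradical t P)"
    unfolding subspace_sum_def using complex_vector.subspace_0[OF subspace_t] by force
  then show ?thesis using borel unfolding subspace_sum_def by blast
qed

text \<open>A positive weight would put y into k + p+, which meets p- only in 0.\<close>

lemma minus_weight_negative:
  assumes "\<alpha> \<in> dual_space t" "y \<in> gw \<alpha>" "y \<in> p_minus" "y \<noteq> 0"
  shows "Re (\<alpha> h) < 0"
proof (rule ccontr)
  assume "\<not> Re (\<alpha> h) < 0"
  moreover have root: "\<alpha> \<in> roots UNIV t" using root_memI assms minus_pnc by blast
  ultimately have "\<alpha> \<in> P" using regular(2)[OF root] regular(3) by simp
  then obtain a b where ab: "a \<in> kk" "b \<in> p_plus" "y = a + b"
    using positive_root_space assms(2) by blast
  have "a = y - b" using ab by simp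
  then have "a \<in> pnc" using complex_vector.subspace_diff[OF subspace_pnc] assms(3) ab(2) plus_pnc minus_pnc by blast
  then have "y = b" using kk_pnc ab by simp
  then show False using decomposition(2) ab(2) assms(3,4) by blast
qed

text \<open>The Killing form pairs p+ with p-, so the opposite weight occurs in p-, where the
  weights are negative.\<close>

lemma plus_weight_positive:
  assumes "\<alpha> \<in> dual_space t" "y \<in> gw \<alpha>" "y \<in> p_plus" "y \<noteq> 0"
  shows "Re (\<alpha> h) > 0"
proof -
  obtain z where "z \<in> p_minus" "killing y z \<noteq> 0" using dual(1) assms by blast
  then obtain \<beta> f where "\<beta> \<in> dual_space t" "f \<in> gw \<beta> \<inter> p_minus" "killing y f = 1" "\<forall>h\<in>t. \<beta> h = - \<alpha> h"
    using exists_paired_weight[OF subspace_minus t_stable_minus assms(2)] by blast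
  moreover have "f \<noteq> 0" using calculation by auto
  ultimately show ?thesis using minus_weight_negative[of \<beta> f] regular(1) by auto
qed

text \<open>The weights of \<open>gconj ` p_plus\<close> are opposite to those of \<open>p_plus\<close>, because \<open>killing y (gconj y) > 0\<close>;
  a positive and a negative weight space cannot meet.\<close>

lemma gconj_weight_component:
  assumes W: "csubspace W" "\<And>x y. x \<in> kk \<Longrightarrow> y \<in> W \<Longrightarrow> [x, y]\<^sub>L \<in> W" "W \<subseteq> pnc"
    and y: "\<alpha> \<in> dual_space t" "y \<in> gw \<alpha>" "y \<in> gconj ` W" "y \<noteq> 0"
  shows "\<exists>\<beta>\<in>dual_space t. \<exists>f\<in>gw \<beta> \<inter> W. f \<noteq> 0 \<and> \<beta> h = - \<alpha> h"
proof -
  have cy: "gconj y \<in> W" using y(3) gconj_conj by auto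
  then have "gconj (gconj y) \<in> pnc" using W(3) pnc_conj by blast
  then have "Re (killing y (gconj y)) > 0" using killing_conj_positive[of y] y(4) by (simp add: gconj_conj)
  then have "killing y (gconj y) \<noteq> 0" by auto
  from exists_paired_weight[OF W(1) _ y(2) cy this]
  obtain \<beta> f where "\<beta> \<in> dual_space t" "f \<in> gw \<beta> \<inter> W" "killing y f = 1" "\<forall>h\<in>t. \<beta> h = - \<alpha> h"
    using W(2) t_kk by blast
  moreover have "f \<noteq> 0" using calculation by auto
  ultimately show ?thesis using regular(1) by blast
qed

text \<open>A weight component of the conjugate of W has the sign opposite to that of W. Its part in
  W has the same weight, so it must vanish, and the component lies in W'. The factor s is 1 for p+
  and -1 for p-.\<close>

lemma gconj_subset:
  assumes W: "csubspace W" "\<And>x y. x \<in> kk \<Longrightarrow> y \<in> W \<Longrightarrow> [x, y]\<^sub>L \<in> W" "W \<subseteq> pnc"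
    and W': "csubspace W'" "\<And>x y. x \<in> kk \<Longrightarrow> y \<in> W' \<Longrightarrow> [x, y]\<^sub>L \<in> W'"
    and sum: "\<And>x. x \<in> pnc \<Longrightarrow> \<exists>a\<in>W. \<exists>b\<in>W'. x = a + b" and disj: "\<And>x. x \<in> W \<Longrightarrow> x \<in> W' \<Longrightarrow> x = 0"
    and s: "\<And>\<alpha> y. \<alpha> \<in> dual_space t \<Longrightarrow> y \<in> gw \<alpha> \<Longrightarrow> y \<in> W \<Longrightarrow> y \<noteq> 0 \<Longrightarrow> s * Re (\<alpha> h) > 0"
  shows "gconj ` W \<subseteq> W'"
proof
  fix y assume "y \<in> gconj ` W"
  from weight_decomposition[OF csubspace_conj[OF W(1)] gconj_image_t_stable[OF W(2)] this]
  obtain S r where S: "S \<subseteq> dual_space t" "\<And>\<alpha>. \<alpha> \<in> S \<Longrightarrow> r \<alpha> \<in> gw \<alpha> \<inter> gconj ` W" "y = (\<Sum>\<alpha>\<in>S. r \<alpha>)"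
    by blast
  have "r \<alpha> \<in> W'" if \<alpha>: "\<alpha> \<in> S" for \<alpha>
  proof (cases "r \<alpha> = 0")
    case True
    then show ?thesis using complex_vector.subspace_0[OF W'(1)] by simp
  next
    case False
    have r: "r \<alpha> \<in> gw \<alpha>" "r \<alpha> \<in> gconj ` W" "\<alpha> \<in> dual_space t" using S \<alpha> by auto
    obtain \<beta> f where \<beta>: "\<beta> \<in> dual_space t" "f \<in> gw \<beta> \<inter> W" "f \<noteq> 0" "\<beta> h = - \<alpha> h"
      using gconj_weight_component[OF W r(3) r(1,2) False] by blast
    have neg: "s * Re (\<alpha> h) < 0" using s[OF \<beta>(1), of f] \<beta> by auto
    obtain w where "w \<in> W" "r \<alpha> = gconj w" using r(2) by blast
    then have "r \<alpha> \<in> pnc" using pnc_conj[of w] W(3) by auto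
    then obtain a b where ab: "a \<in> W" "b \<in> W'" "r \<alpha> = a + b" using sum by blast
    \<comment> \<open>Comparing the two parts of the weight equation for a + b, the defect of a
      equals minus that of b, so it lies in both W and W'.\<close>
    have "[x, a]\<^sub>L - \<alpha> x *\<^sub>C a = 0" if x: "x \<in> t" for x
    proof (rule disj)
      show "[x, a]\<^sub>L - \<alpha> x *\<^sub>C a \<in> W"
        using W t_kk[OF x] ab(1) by (intro complex_vector.subspace_diff complex_vector.subspace_scale) auto
      have "[x, a]\<^sub>L + [x, b]\<^sub>L = \<alpha> x *\<^sub>C a + \<alpha> x *\<^sub>C b"
        using r(1) x ab(3) by (simp add: weight_space_def scaleC_add_right)
      then have "[x, a]\<^sub>L - \<alpha> x *\<^sub>C a = \<alpha> x *\<^sub>C b - [x, b]\<^sub>L" by (simp add: algebra_simps)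
      then show "[x, a]\<^sub>L - \<alpha> x *\<^sub>C a \<in> W'"
        using W' t_kk[OF x] ab(2) by (simp add: complex_vector.subspace_diff complex_vector.subspace_scale)
    qed
    then have "a \<in> gw \<alpha>" by (simp add: weight_space_def)
    then have "a = 0" using s[OF r(3) _ ab(1)] neg by fastforce
    then show ?thesis using ab by simp
  qed
  then show "y \<in> W'" unfolding S(3) by (rule complex_vector.subspace_sum[OF W'(1)])
qed

lemma pnc_decomposition: "x \<in> pnc \<Longrightarrow> \<exists>a\<in>p_plus. \<exists>b\<in>p_minus. x = a + b"
  unfolding decomposition(1)[symmetric] subspace_sum_def by blast

lemma gconj_plus: "gconj ` p_plus = p_minus"
proof
  show "gconj ` p_plus \<subseteq> p_minus"
    by (rule gconj_subset[where s = 1])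
      (use subspace_plus subspace_minus k_stable plus_pnc pnc_decomposition decomposition(2) plus_weight_positive in auto)
  have "gconj ` p_minus \<subseteq> p_plus"
  proof (rule gconj_subset[where s = "- 1"])
    show "\<exists>a\<in>p_minus. \<exists>b\<in>p_plus. x = a + b" if "x \<in> pnc" for x
      using pnc_decomposition[OF that] by (metis add.commute)
  qed (use subspace_plus subspace_minus k_stable minus_pnc decomposition(2) minus_weight_negative in auto)
  then have "gconj (gconj x) \<in> gconj ` p_plus" if "x \<in> p_minus" for x using that by blast
  then show "p_minus \<subseteq> gconj ` p_plus" by (auto simp: gconj_conj)
qed

lemma orthonormal_basis_plus:
  "\<exists>es. distinct es \<and> cspan (set es) = p_plus \<and> cspan (gconj ` set es) = p_minus
    \<and> (\<forall>x\<in>set es. \<forall>y\<in>set es. killing x (gconj y) = (if x = y then 1 else 0))"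
proof -
  obtain B where B: "finite B" "cspan B = p_plus"
    using finite_dim_subspace[OF finite_dim_UNIV subspace_plus] by (auto simp: finite_dim_def)
  have "B \<subseteq> p_plus" using B complex_vector.span_superset by blast
  have "\<exists>es. distinct es \<and> cspan (set es) = cspan B
      \<and> (\<forall>x\<in>set es. \<forall>y\<in>set es. killing x (gconj y) = (if x = y then 1 else 0))"
  proof (rule gram_schmidt[OF clinear_killing_left _ subspace_plus _ B(1) \<open>B \<subseteq> p_plus\<close>])
    show "killing y (gconj x) = cnj (killing x (gconj y))" for x y
      using killing_conj[of x "gconj y"] killing_commute[of "gconj x" y] by (simp add: gconj_conj)
    show "Re (killing x (gconj x)) > 0" if "x \<in> p_plus" "x \<noteq> 0" for x
      using killing_conj_positive that plus_pnc by blast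
  qed
  then obtain es where es: "distinct es" "cspan (set es) = p_plus"
    "\<forall>x\<in>set es. \<forall>y\<in>set es. killing x (gconj y) = (if x = y then 1 else 0)"
    using B(2) by blast
  have "cspan (gconj ` set es) = p_minus"
  proof
    have "set es \<subseteq> p_plus" using es(2) complex_vector.span_superset by blast
    then show "cspan (gconj ` set es) \<subseteq> p_minus"
      using gconj_plus by (intro complex_vector.span_minimal[OF _ subspace_minus]) blast
    show "p_minus \<subseteq> cspan (gconj ` set es)"
    proof
      fix y assume "y \<in> p_minus"
      then obtain x where x: "x \<in> cspan (set es)" "y = gconj x" using gconj_plus es(2) by blast
      from x(1) have "gconj x \<in> cspan (gconj ` set es)"
      proof (induction rule: complex_vector.span_induct_alt)
        case (step c x y)
        then show ?case
          by (simp add: gconj_add gconj_scale complex_vector.span_add complex_vector.span_scale complex_vector.span_base)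
      qed (simp add: gconj_0 complex_vector.span_zero)
      then show "y \<in> cspan (gconj ` set es)" using x by simp
    qed
  qed
  then show ?thesis using es by blast
qed

subsection \<open>The character \<open>\<rho> - \<rho>\<^sub>k\<close>\<close>

text \<open>Both parts of a positive root vector in k + p+ have weight \<alpha>. The part in k
  vanishes because \<alpha> is not a root of k, so the root vector lies in p+ and has a partner in
  p-.\<close>

lemma plus_root_vectors:
  assumes "\<alpha> \<in> P - roots kk t"
  shows "\<exists>e\<in>gw \<alpha> \<inter> p_plus. \<exists>\<beta>\<in>dual_space t. \<exists>f\<in>gw \<beta> \<inter> p_minus. killing e f = 1 \<and> (\<forall>h\<in>t. \<beta> h = - \<alpha> h)"
proof -
  have root: "\<alpha> \<in> roots UNIV t" "\<alpha> \<in> dual_space t" "\<alpha> \<noteq> (\<lambda>_. 0)"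
    using assms regular(3) by (auto simp: roots_def)
  moreover have "0 \<in> gw \<alpha>" by (simp add: weight_space_def)
  ultimately obtain x where x: "x \<in> gw \<alpha>" "x \<noteq> 0" by (auto simp: roots_def)
  obtain a b where ab: "a \<in> kk" "b \<in> p_plus" "x = a + b"
    using positive_root_space[of \<alpha> x] assms x(1) by blast
  have "[y, a]\<^sub>L - \<alpha> y *\<^sub>C a = 0" if y: "y \<in> t" for y
  proof (rule kk_pnc)
    show "[y, a]\<^sub>L - \<alpha> y *\<^sub>C a \<in> kk"
      using brackets(1) t_kk[OF y] ab(1) subspace_kk
      by (intro complex_vector.subspace_diff complex_vector.subspace_scale) auto
    have "[y, a]\<^sub>L + [y, b]\<^sub>L = \<alpha> y *\<^sub>C a + \<alpha> y *\<^sub>C b"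
      using x(1) y ab(3) by (simp add: weight_space_def scaleC_add_right)
    then have "[y, a]\<^sub>L - \<alpha> y *\<^sub>C a = \<alpha> y *\<^sub>C b - [y, b]\<^sub>L" by (simp add: algebra_simps)
    moreover have "b \<in> pnc" using ab(2) plus_pnc by blast
    ultimately show "[y, a]\<^sub>L - \<alpha> y *\<^sub>C a \<in> pnc"
      using brackets(2)[OF t_kk[OF y]] subspace_pnc
      by (simp add: complex_vector.subspace_diff complex_vector.subspace_scale)
  qed
  then have "a \<in> gw \<alpha> \<inter> kk" using ab by (simp add: weight_space_def)
  then have "a = 0" using assms root by (auto simp: roots_def)
  then have xp: "x \<in> p_plus" using ab by simp
  then obtain z where "z \<in> p_minus" "killing x z \<noteq> 0" using dual(1) x by blast
  from exists_paired_weight[OF subspace_minus t_stable_minus x(1) this]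
  show ?thesis using x(1) xp by blast
qed

text \<open>The converse of \<open>plus_root_vectors\<close>: if \<alpha> were also a root of k,
  one-dimensionality of its root space would make a root vector in k proportional to x in
  p+.\<close>

lemma plus_weights:
  assumes "\<alpha> \<in> dual_space t" "x \<in> gw \<alpha>" "x \<in> p_plus" "x \<noteq> 0"
  shows "\<alpha> \<in> P - roots kk t"
proof
  have "\<alpha> \<in> roots UNIV t" using root_memI assms plus_pnc by blast
  then show "\<alpha> \<in> P" using plus_weight_positive[OF assms] regular(3) by simp
  obtain z where "z \<in> p_minus" "killing x z \<noteq> 0" using dual(1) assms by blast
  then obtain \<beta> f where \<beta>: "f \<in> gw \<beta> \<inter> p_minus" "killing x f = 1" "\<forall>h\<in>t. \<beta> h = - \<alpha> h"
    using exists_paired_weight[OF subspace_minus t_stable_minus assms(2)] by blast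
  show "\<alpha> \<notin> roots kk t"
  proof
    assume "\<alpha> \<in> roots kk t"
    moreover have "0 \<in> gw \<alpha> \<inter> kk"
      using complex_vector.subspace_0[OF subspace_kk] by (simp add: weight_space_def)
    ultimately obtain y where y: "y \<in> gw \<alpha>" "y \<in> kk" "y \<noteq> 0" by (auto simp: roots_def)
    then have "y = killing y f *\<^sub>C x"
      using root_space_one_dimensional[OF assms(2,3) _ _ \<beta>(3,2)] \<beta>(1) by blast
    then have "y \<in> p_plus" using complex_vector.subspace_scale[OF subspace_plus assms(3)] by metis
    then show False using kk_pnc plus_pnc y by blast
  qed
qed

text \<open>Both sides are computed from the trace of ad h' on p+, once in the orthonormal basis and
  once in the root vectors e \<alpha> with dual vectors f \<alpha>. Every root in P outside k
  contributes once because its root space is one-dimensional.\<close>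

lemma plus_trace:
  assumes es: "cspan (set es) = p_plus" "\<And>v. v \<in> p_plus \<Longrightarrow> v = (\<Sum>e\<in>set es. killing v (gconj e) *\<^sub>C e)"
    and h': "h' \<in> t"
  shows "(\<Sum>e\<in>set es. killing [h', e]\<^sub>L (gconj e)) / 2 = half_sum P h' - half_sum (P \<inter> roots kk t) h'"
proof -
  let ?F = "P - roots kk t"
  have finP: "finite P"
    using finite_roots[OF cartan_subalgebra(1) finite_dim_UNIV] regular(3) by simp
  have "\<forall>\<alpha>\<in>?F. \<exists>e f. e \<in> gw \<alpha> \<inter> p_plus \<and> f \<in> p_minus \<and> killing e f = 1
      \<and> (\<exists>\<beta>. f \<in> gw \<beta> \<and> (\<forall>h\<in>t. \<beta> h = - \<alpha> h))"
    using plus_root_vectors by blast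
  then obtain e f where ef: "\<And>\<alpha>. \<alpha> \<in> ?F \<Longrightarrow> e \<alpha> \<in> gw \<alpha> \<and> e \<alpha> \<in> p_plus \<and> f \<alpha> \<in> p_minus
      \<and> killing (e \<alpha>) (f \<alpha>) = 1 \<and> (\<exists>\<beta>. f \<alpha> \<in> gw \<beta> \<and> (\<forall>h\<in>t. \<beta> h = - \<alpha> h))"
    by (metis Int_iff)
  have one: "x = killing x (f \<alpha>) *\<^sub>C e \<alpha>" if "\<alpha> \<in> ?F" "x \<in> gw \<alpha>" for \<alpha> x
    using ef[OF that(1)] root_space_one_dimensional[of "e \<alpha>" \<alpha> "f \<alpha>" _ x] that(2) by blast
  have orth: "killing x (f \<alpha>) = 0" if \<alpha>\<beta>: "\<alpha> \<in> ?F" "\<beta> \<in> ?F" "x \<in> gw \<beta>" "\<alpha> \<noteq> \<beta>" for \<alpha> \<beta> x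
  proof (rule ccontr)
    assume nz: "killing x (f \<alpha>) \<noteq> 0"
    obtain \<gamma> where \<gamma>: "f \<alpha> \<in> gw \<gamma>" "\<forall>h\<in>t. \<gamma> h = - \<alpha> h" using ef[OF \<alpha>\<beta>(1)] by blast
    have "\<alpha> h = \<beta> h" if "h \<in> t" for h
      using killing_weights[OF \<open>x \<in> gw \<beta>\<close> \<gamma>(1) nz that] \<gamma>(2) that by simp
    moreover have "\<alpha> \<in> dual_space t" "\<beta> \<in> dual_space t" using \<alpha>\<beta>(1,2) regular(3) by (auto simp: roots_def)
    ultimately show False using dual_space_distinct[of \<alpha> t \<beta>] \<alpha>\<beta>(4) by blast
  qed
  have expand: "x = (\<Sum>\<alpha>\<in>?F. killing x (f \<alpha>) *\<^sub>C e \<alpha>)" if x: "x \<in> p_plus" for x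
  proof (rule clinear_eq_on_span[OF clinear_id, of _ "\<Union>\<alpha>\<in>?F. gw \<alpha> \<inter> p_plus"])
    show "clinear (\<lambda>x. \<Sum>\<alpha>\<in>?F. killing x (f \<alpha>) *\<^sub>C e \<alpha>)"
      by (rule clinearI) (simp_all add: scaleC_add_left sum.distrib complex_vector.scale_sum_right scaleC_scaleC)
    obtain S r where S: "S \<subseteq> dual_space t" "\<And>\<alpha>. \<alpha> \<in> S \<Longrightarrow> r \<alpha> \<in> gw \<alpha> \<inter> p_plus" "x = (\<Sum>\<alpha>\<in>S. r \<alpha>)"
      using weight_decomposition[OF subspace_plus t_stable_plus x] by blast
    have "r \<alpha> \<in> cspan (\<Union>\<alpha>\<in>?F. gw \<alpha> \<inter> p_plus)" if "\<alpha> \<in> S" for \<alpha>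
    proof (cases "r \<alpha> = 0")
      case False
      then have "\<alpha> \<in> ?F" using plus_weights[of \<alpha> "r \<alpha>"] S that by blast
      then show ?thesis using S(2)[OF that] by (intro complex_vector.span_base) blast
    qed (simp add: complex_vector.span_zero)
    then show "x \<in> cspan (\<Union>\<alpha>\<in>?F. gw \<alpha> \<inter> p_plus)" unfolding S(3) by (rule complex_vector.span_sum)
    fix y assume "y \<in> (\<Union>\<alpha>\<in>?F. gw \<alpha> \<inter> p_plus)"
    then obtain \<beta> where \<beta>: "\<beta> \<in> ?F" "y \<in> gw \<beta>" by blast
    have "(\<Sum>\<alpha>\<in>?F. killing y (f \<alpha>) *\<^sub>C e \<alpha>) = (\<Sum>\<alpha>\<in>?F. if \<alpha> = \<beta> then y else 0)"
      using one[OF \<beta>] orth[OF _ \<beta>] by (intro sum.cong refl) auto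
    then show "y = (\<Sum>\<alpha>\<in>?F. killing y (f \<alpha>) *\<^sub>C e \<alpha>)" using \<beta>(1) finP by simp
  qed
  have esp: "x \<in> p_plus" if "x \<in> set es" for x
    using es(1) complex_vector.span_base[OF that] by simp
  have "(\<Sum>x\<in>set es. killing [h', x]\<^sub>L (gconj x))
      = (\<Sum>x\<in>set es. \<Sum>\<alpha>\<in>?F. \<alpha> h' * (killing x (f \<alpha>) * killing (e \<alpha>) (gconj x)))"
  proof (rule sum.cong[OF refl])
    fix x assume "x \<in> set es"
    then have "[h', x]\<^sub>L = [h', \<Sum>\<alpha>\<in>?F. killing x (f \<alpha>) *\<^sub>C e \<alpha>]\<^sub>L" using expand esp by metis
    also have "\<dots> = (\<Sum>\<alpha>\<in>?F. (\<alpha> h' * killing x (f \<alpha>)) *\<^sub>C e \<alpha>)"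
      using ef h' by (simp add: clinear_sum[OF clinear_lie_bracket] weight_space_def scaleC_scaleC mult.commute)
    finally show "killing [h', x]\<^sub>L (gconj x) = (\<Sum>\<alpha>\<in>?F. \<alpha> h' * (killing x (f \<alpha>) * killing (e \<alpha>) (gconj x)))"
      by (simp add: clinear_sum[OF clinear_killing_left] mult.assoc)
  qed
  \<comment> \<open>Exchanging the sums lets the orthonormal expansion of e \<alpha> collapse, and
    what remains is \<open>killing (e \<alpha>) (f \<alpha>)\<close>, which is 1.\<close>
  also have "\<dots> = (\<Sum>\<alpha>\<in>?F. \<alpha> h' * killing (\<Sum>x\<in>set es. killing (e \<alpha>) (gconj x) *\<^sub>C x) (f \<alpha>))"
    by (subst sum.swap) (simp add: clinear_sum[OF clinear_killing_left] sum_distrib_left mult.commute mult.left_commute)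
  also have "\<dots> = (\<Sum>\<alpha>\<in>?F. \<alpha> h')"
    using ef es(2) by (intro sum.cong refl) (metis mult.right_neutral)
  finally have tr: "(\<Sum>x\<in>set es. killing [h', x]\<^sub>L (gconj x)) = (\<Sum>\<alpha>\<in>?F. \<alpha> h')" .
  have "(\<Sum>\<alpha>\<in>P. \<alpha> h') = (\<Sum>\<alpha>\<in>P \<inter> roots kk t. \<alpha> h') + (\<Sum>\<alpha>\<in>?F. \<alpha> h')"
    by (rule sum.Int_Diff[OF finP])
  then show ?thesis by (simp add: tr half_sum_def diff_divide_distrib[symmetric])
qed

end

lemma eigenspaces_span: "h \<in> t \<Longrightarrow> cspan (\<Union>c. eigenspace (lie_bracket h) c) = UNIV"
proof -
  assume "h \<in> t"
  then have "cspan {x. \<exists>c. [h, x]\<^sub>L = c *\<^sub>C x} = UNIV"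
    using cartan_subalgebra(1) unfolding cartan_subalgebra_def by blast
  moreover have "{x. \<exists>c. [h, x]\<^sub>L = c *\<^sub>C x} = (\<Union>c. eigenspace (lie_bracket h) c)"
    by (auto simp: eigenspace_def)
  ultimately show ?thesis by simp
qed

text \<open>Elements of the real form act by skew operators; in z = x + i y the conjugate-linear
  second argument turns i into -i, so the adjoint of z is minus its conjugate.\<close>

lemma unitary_adjoint:
  assumes ip: "hermitian_inner_product ip" and inv: "\<And>x u v. x \<in> g\<^sub>0 \<Longrightarrow> ip (\<pi> x u) v + ip u (\<pi> x v) = 0"
    and lin: "\<And>v. clinear (\<lambda>x. \<pi> x v)"
  shows "ip (\<pi> z u) v = - ip u (\<pi> (gconj z) v)"
proof -
  note ip = hermitian_inner_productD[OF ip]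
  obtain x y where z: "x \<in> g\<^sub>0" "y \<in> g\<^sub>0" "z = x + \<i> *\<^sub>C y" using real_form_decomposition by blast
  have inv': "ip (\<pi> x u) v = - ip u (\<pi> x v)" "ip (\<pi> y u) v = - ip u (\<pi> y v)"
    using inv z by (simp_all add: eq_neg_iff_add_eq_0)
  have "gconj z = x + (- \<i>) *\<^sub>C y" using z gconj_eq by (simp add: complex_vector.scale_minus_left)
  then have "\<pi> (gconj z) v = \<pi> x v + (- \<i>) *\<^sub>C \<pi> y v" by (simp only: clinear_simps[OF lin])
  moreover have "\<pi> z u = \<pi> x u + \<i> *\<^sub>C \<pi> y u" by (simp only: z(3) clinear_simps[OF lin])
  ultimately show ?thesis by (simp only: ip(1,2,4,5) inv') simp
qed

end

theorem theorem5p2: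
  fixes \<theta> :: "'g::complex_lie_algebra \<Rightarrow> 'g"
    and g\<^sub>0 t p_plus p_minus k p Z :: "'g set"
    and P :: "('g \<Rightarrow> complex) set"
    and \<chi> :: "'g \<Rightarrow> complex"
    and \<pi> :: "'g \<Rightarrow> 'm::complex_vector \<Rightarrow> 'm"
  assumes "hermitian_symmetric_pair \<theta> g\<^sub>0 t p_plus p_minus"
    and "k = compact_part \<theta> g\<^sub>0"
    and "p = noncompact_part \<theta> g\<^sub>0"
    and "positive_system t P"
    and "subspace_sum t (nilradical t P) \<subseteq> subspace_sum k p_plus"
    and "\<chi> = character_of_weight k t (\<lambda>h. half_sum P h - half_sum (P \<inter> roots k t) h)"
    and "orthonormal_basis p Z"
    and "category_O t (nilradical t P) \<pi>"
    and "unitary g\<^sub>0 \<pi>"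
  shows "isomorphic_modules k
        (dirac_cohomology p p_plus p_minus Z \<pi>) (dirac_kernel p p_plus p_minus Z \<pi>)
      \<and> isomorphic_modules k
        (dirac_kernel p p_plus p_minus Z \<pi>) (twist (cohomology p_plus \<pi>) \<chi>)
      \<and> isomorphic_modules k
        (twist (cohomology p_plus \<pi>) \<chi>) (twist (homology p_minus \<pi>) \<chi>)"
proof -
  interpret H: hermitian_symmetric_pair \<theta> g\<^sub>0 t p_plus p_minus by (fact assms(1))
  obtain h where h: "h \<in> t" "\<And>\<alpha>. \<alpha> \<in> roots UNIV t \<Longrightarrow> \<alpha> h \<in> \<real> \<and> \<alpha> h \<noteq> 0" "P = {\<alpha> \<in> roots UNIV t. Re (\<alpha> h) > 0}"
    using assms(4) unfolding positive_system_def by blast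
  have h2: "Re (\<alpha> h) \<noteq> 0" if "\<alpha> \<in> roots UNIV t" for \<alpha>
    using h(2)[OF that] by (auto simp: complex_eq_iff complex_is_Real_iff)
  note borel = assms(5)[unfolded assms(2)]
  note rep = category_O_rep[OF assms(8)]
  obtain ip where ip: "hermitian_inner_product ip"
    and inv: "\<And>x u v. x \<in> g\<^sub>0 \<Longrightarrow> ip (\<pi> x u) v + ip u (\<pi> x v) = 0"
    using assms(9) unfolding unitary_def by blast
  obtain es where es: "distinct es" "cspan (set es) = p_plus" "cspan (H.gconj ` set es) = p_minus"
    "\<And>x y. x \<in> set es \<Longrightarrow> y \<in> set es \<Longrightarrow> killing x (H.gconj y) = (if x = y then 1 else 0)"
  proof -
    have "\<exists>es. distinct es \<and> cspan (set es) = p_plus \<and> cspan (H.gconj ` set es) = p_minus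
      \<and> (\<forall>x\<in>set es. \<forall>y\<in>set es. killing x (H.gconj y) = (if x = y then 1 else 0))"
      by (rule H.orthonormal_basis_plus[where h = h and P = P]) (fact h(1) h2 h(3) borel)+
    then show ?thesis using that by blast
  qed
  have es_in: "x \<in> p_plus" "H.gconj x \<in> p_minus" if "x \<in> set es" for x
    using es(2,3) that complex_vector.span_base by blast+
  interpret dirac_spin es H.gconj k \<pi> ip p Z
  proof unfold_locales
    show "[x, y]\<^sub>L = 0" if "x \<in> set es" "y \<in> set es" for x y
      using H.abelian(2) es_in(1) that unfolding abelian_def by blast
    show "[H.gconj x, H.gconj y]\<^sub>L = 0" if "x \<in> set es" "y \<in> set es" for x y
      using H.abelian(4) es_in(2) that unfolding abelian_def by blast
    show "ip (\<pi> e u) v = - ip u (\<pi> (H.gconj e) v)" for e u v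
      by (rule H.unitary_adjoint[OF ip inv rep(2)])
    show "killing x y = 0" if "x \<in> cspan (set es)" "y \<in> cspan (set es)" for x y
      using H.maximal_isotropic(1) that es(2) unfolding maximal_isotropic_def isotropic_def by blast
    show "killing x y = 0" if "x \<in> cspan (H.gconj ` set es)" "y \<in> cspan (H.gconj ` set es)" for x y
      using H.maximal_isotropic(2) that es(3) unfolding maximal_isotropic_def isotropic_def by blast
  qed (use assms(2,3,7) es rep ip H.subspace_kk H.brackets(1) H.k_stable H.decomposition in
      \<open>simp_all add: clinear_simps[OF rep(1)] clinear_simps[OF rep(2)]\<close>)
  \<comment> \<open>\<open>half_trace\<close> vanishes on brackets of k and agrees with \<rho> minus
    the half-sum for k on t, and a character of k is determined by its values on t.\<close>
  have \<chi>: "\<chi> x = half_trace x" if "x \<in> k" for x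
    unfolding assms(6) assms(2)
  proof (rule H.character_eq)
    fix y assume y: "y \<in> t"
    show "half_trace y = half_sum P y - half_sum (P \<inter> roots (compact_part \<theta> g\<^sub>0) t) y"
      unfolding half_trace_def
    proof (rule H.plus_trace[where h = h and P = P])
      show "v = (\<Sum>e\<in>set es. killing v (H.gconj e) *\<^sub>C e)" if "v \<in> p_plus" for v
        using plus_expansion[of v] that es(2) by simp
    qed (fact h(1) h2 h(3) borel es(2) y)+
  qed (use that assms(2) half_trace_linear half_trace_bracket in auto)
  \<comment> \<open>The element h that defines P is used throughout: it has finite-dimensional
    eigenspaces on M, and an eigenbasis of p- for ad h carries this over to M \<otimes> \<Lambda>
    p-.\<close>
  obtain Q where Q: "\<And>c. finite (Q c)" "\<And>c v. v \<in> Q c \<Longrightarrow> \<pi> h v = c *\<^sub>C v" "cspan (\<Union>c. Q c) = UNIV"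
  proof -
    have "\<exists>Q. (\<forall>c. finite (Q c)) \<and> (\<forall>c. \<forall>v\<in>Q c. \<pi> h v = c *\<^sub>C v) \<and> cspan (\<Union>c. Q c) = UNIV"
      by (rule category_O_finite_eigenspaces[where h = h and P = P])
        (fact H.cartan_subalgebra(1) H.finite_dim_UNIV h(1) h2 h(3) assms(8))+
    then show ?thesis using that by blast
  qed
  obtain B where B: "finite B" "\<And>b. b \<in> B \<Longrightarrow> \<exists>c. [h, b]\<^sub>L = c *\<^sub>C b" "cspan B = p_minus"
    using eigenvector_basis_in_invariant[OF clinear_lie_bracket H.subspace_minus H.t_stable_minus[OF h(1)]
        finite_dim_subspace[OF H.finite_dim_UNIV H.subspace_minus] H.eigenspaces_span[OF h(1)]] by auto
  obtain fs where fs: "set fs = B" using finite_list[OF B(1)] by blast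
  have hk: "h \<in> k" using H.t_kk[OF h(1)] assms(2) by simp
  have "isomorphic_modules k (dirac_cohomology p (cspan (set es)) (cspan (H.gconj ` set es)) Z \<pi>)
      (dirac_kernel p (cspan (set es)) (cspan (H.gconj ` set es)) Z \<pi>)
    \<and> isomorphic_modules k (dirac_kernel p (cspan (set es)) (cspan (H.gconj ` set es)) Z \<pi>)
      (twist (cohomology (cspan (set es)) \<pi>) \<chi>)
    \<and> isomorphic_modules k (twist (cohomology (cspan (set es)) \<pi>) \<chi>) (twist (homology (cspan (H.gconj ` set es)) \<pi>) \<chi>)"
  proof (rule dirac_isomorphisms[OF _ \<chi>])
    fix u assume "u \<in> TT"
    then show "\<exists>v\<in>TT. \<exists>y\<in>TT. D v = 0 \<and> u = v + D (D y)"
      by (intro hodge_decomposition[OF hk Q, of fs]) (use fs B es(3) in auto)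
  qed
  then show ?thesis unfolding es(2,3) .
qed

end
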